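(* Let $d\ge2$ be an integer, and let $1<\delta'<\delta<d$. If for all $k$, and for some computable function $f$, there exists an $f(k)\,n^{o(k^{1-1/\delta'})}$ time algorithm for finding $k$ pairwise non-intersecting open balls in a collection of $n$ unit balls in $\mathbb R^d$ with the centers having fractal dimension at most $\delta$, then the Exponential Time Hypothesis (ETH) fails.
   Context: Nets: for $P\subseteq\mathbb R^d$ and $\rho>0$, a $\rho$-net of $P$ is a set $N\subseteq P$ such that distinct points of $N$ are at Euclidean distance greater than $\rho$ and every point of $P$ is within distance $\rho$ of $N$. $\mathsf{ball}(x,r)$ is the Euclidean ball of center $x$ and radius $r$. Fractal dimension: the fractal dimension of a set $P\subseteq\mathbb R^d$ is the infimum of the $s$ such that for any $\rho>0$ and $r\ge 2\rho$, for any $\rho$-net $N$ of $P$, and for any $x\in\mathbb R^d$, one has $|N\cap\mathsf{ball}(x,r)|=O((r/\rho)^s)$. "The centers having fractal dimension at most $\delta$" means that the set of centers of the balls has fractal dimension at most $\delta$. Unit balls are open Euclidean balls of one common fixed size. ETH: there is a constant $\sigma>0$ such that no algorithm solves 3-SAT on $N$ variables in time $O(2^{\sigma N})$. *)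

theory Defs
  imports "HOL-Analysis.Analysis" "HOL-Library.Landau_Symbols"
begin

section \<open>Deterministic multi-tape Turing machines\<close>

text \<open>The running-time classes below (all exponents \<open>\<sigma>\<close> for 3-SAT, exponents up to little-o for
  the ball problem) are invariant under polynomial slow-down, so the alphabet may be fixed.\<close>

datatype sym = Blank | Zero | One | LPar | RPar

datatype move = MoveLeft | Stay | MoveRight

text \<open>The states are \<open>0, \<dots>, states M\<close>; state \<open>0\<close> is initial and state \<open>states M\<close> is the
  halting state.\<close>

record tm =
  tapes :: nat
  states :: nat
  trans_fun :: "nat \<Rightarrow> sym list \<Rightarrow> nat \<times> (sym \<times> move) list"

definition turing_machine :: "tm \<Rightarrow> bool" where
  "turing_machine M \<longleftrightarrow> 1 \<le> tapes M \<and>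
     (\<forall>q < states M. \<forall>ss. length ss = tapes M \<longrightarrow>
        fst (trans_fun M q ss) \<le> states M \<and> length (snd (trans_fun M q ss)) = tapes M)"

text \<open>A tape is two-way infinite and comes with its head position.\<close>

type_synonym tape = "(int \<Rightarrow> sym) \<times> int"

fun act :: "sym \<times> move \<Rightarrow> tape \<Rightarrow> tape" where
  "act (s, m) (u, p) =
     (u(p := s), case m of MoveLeft \<Rightarrow> p - 1 | Stay \<Rightarrow> p | MoveRight \<Rightarrow> p + 1)"

fun tm_step :: "tm \<Rightarrow> nat \<times> tape list \<Rightarrow> nat \<times> tape list" where
  "tm_step M (q, us) =
     (if q = states M then (q, us)
      else case trans_fun M q (map (\<lambda>(u, p). u p) us) of (q', as) \<Rightarrow> (q', map2 act as us))"

definition tape_of :: "sym list \<Rightarrow> int \<Rightarrow> sym" where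
  "tape_of w i = (if 0 \<le> i \<and> i < int (length w) then w ! nat i else Blank)"

definition tm_init :: "tm \<Rightarrow> sym list \<Rightarrow> nat \<times> tape list" where
  "tm_init M w = (0, (tape_of w, 0) # replicate (tapes M - 1) (tape_of [], 0))"

text \<open>The input is on the first tape, the output is read off the last one.\<close>

definition halts_with :: "tm \<Rightarrow> sym list \<Rightarrow> nat \<Rightarrow> sym list \<Rightarrow> bool" where
  "halts_with M w t y \<longleftrightarrow>
     (case (tm_step M ^^ t) (tm_init M w) of
        (q, us) \<Rightarrow> q = states M \<and> fst (last us) = tape_of y)"

section \<open>Encodings\<close>

fun binary :: "nat \<Rightarrow> sym list" where
  "binary n = (if n = 0 then [] else (if odd n then One else Zero) # binary (n div 2))"

declare binary.simps [simp del]

definition enc_list :: "('a \<Rightarrow> sym list) \<Rightarrow> 'a list \<Rightarrow> sym list" where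
  "enc_list e xs = LPar # concat (map e xs) @ [RPar]"

definition enc_nat :: "nat \<Rightarrow> sym list" where
  "enc_nat n = LPar # binary n @ [RPar]"

definition enc_int :: "int \<Rightarrow> sym list" where
  "enc_int z = LPar # (if z < 0 then One else Zero) # binary (nat \<bar>z\<bar>) @ [RPar]"

definition enc_rat :: "rat \<Rightarrow> sym list" where
  "enc_rat x = (case quotient_of x of (p, q) \<Rightarrow> enc_list enc_int [p, q])"

text \<open>\<open>from_nat_into UNIV\<close> enumerates the finite index type; permuting the coordinates is an
  isometry, so the choice of enumeration is immaterial.\<close>

definition enc_point :: "rat ^ 'd \<Rightarrow> sym list" where
  "enc_point c = enc_list enc_rat (map (\<lambda>i. c $ from_nat_into UNIV i) [0..<CARD('d)])"

definition computable :: "(nat \<Rightarrow> nat) \<Rightarrow> bool" where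
  "computable f \<longleftrightarrow>
     (\<exists>M. turing_machine M \<and> (\<forall>k. \<exists>t. halts_with M (enc_nat k) t (enc_nat (f k))))"

section \<open>3-SAT and the Exponential Time Hypothesis\<close>

text \<open>The literal \<open>(v, b)\<close> is satisfied if variable \<open>v\<close> has the truth value \<open>b\<close>.\<close>

type_synonym clause = "(nat \<times> bool) list"

text \<open>Clauses are not repeated, so that the length of a formula is polynomial in the number
  \<open>N\<close> of variables; otherwise no time bound in terms of \<open>N\<close> alone could hold.\<close>

definition three_cnf :: "nat \<Rightarrow> clause list \<Rightarrow> bool" where
  "three_cnf N \<phi> \<longleftrightarrow> distinct \<phi> \<and> (\<forall>C \<in> set \<phi>. length C \<le> 3 \<and> (\<forall>(v, b) \<in> set C. v < N))"

definition satisfiable :: "clause list \<Rightarrow> bool" where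
  "satisfiable \<phi> \<longleftrightarrow> (\<exists>\<alpha> :: nat \<Rightarrow> bool. \<forall>C \<in> set \<phi>. \<exists>(v, b) \<in> set C. \<alpha> v = b)"

definition enc_literal :: "nat \<times> bool \<Rightarrow> sym list" where
  "enc_literal l = LPar # (if snd l then One else Zero) # binary (fst l) @ [RPar]"

definition enc_cnf :: "clause list \<Rightarrow> sym list" where
  "enc_cnf = enc_list (enc_list enc_literal)"

definition solves_3sat :: "tm \<Rightarrow> (nat \<Rightarrow> nat) \<Rightarrow> bool" where
  "solves_3sat M T \<longleftrightarrow> turing_machine M \<and>
     (\<forall>N \<phi>. three_cnf N \<phi> \<longrightarrow>
        (\<exists>t \<le> T N. halts_with M (enc_cnf \<phi>) t [if satisfiable \<phi> then One else Zero]))"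

definition ETH :: bool where
  "ETH \<longleftrightarrow> (\<exists>\<sigma>::real. \<sigma> > 0 \<and>
     \<not> (\<exists>M T. (\<lambda>N. real (T N)) \<in> O(\<lambda>N. 2 powr (\<sigma> * real N)) \<and> solves_3sat M T))"

section \<open>Fractal dimension\<close>

definition is_net :: "real \<Rightarrow> (real ^ 'd) set \<Rightarrow> (real ^ 'd) set \<Rightarrow> bool" where
  "is_net \<rho> P N \<longleftrightarrow> N \<subseteq> P \<and> (\<forall>x \<in> N. \<forall>y \<in> N. x \<noteq> y \<longrightarrow> dist x y > \<rho>) \<and>
     (\<forall>p \<in> P. \<exists>q \<in> N. dist p q \<le> \<rho>)"

text \<open>The fractal dimension of a family of point sets: the constant \<open>K\<close> hidden in the O-notation
  is common to all members of the family. For a single set \<open>P\<close> this is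
  \<open>fractal_dim {P}\<close>; that value is at most \<open>0\<close> for every finite \<open>P\<close>, so a bound on the dimension
  of the finite inputs of an algorithm is only meaningful for the family of these inputs.\<close>

definition fractal_dim :: "(real ^ 'd) set set \<Rightarrow> ereal" where
  "fractal_dim \<P> = Inf {ereal s | s. \<exists>K::real. \<forall>P \<in> \<P>. \<forall>\<rho> > 0. \<forall>r \<ge> 2 * \<rho>. \<forall>N. is_net \<rho> P N \<longrightarrow>
     (\<forall>x. real (card (N \<inter> ball x r)) \<le> K * (r / \<rho>) powr s)}"

section \<open>Finding pairwise non-intersecting unit balls\<close>

definition real_point :: "rat ^ 'd \<Rightarrow> real ^ 'd" where
  "real_point c = (\<chi> i. real_of_rat (c $ i))"

text \<open>A collection of balls of radius 1 is given by the list of its centers, a solution by a list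
  of positions in that list.\<close>

definition nonintersecting_balls :: "nat \<Rightarrow> (rat ^ 'd) list \<Rightarrow> nat list \<Rightarrow> bool" where
  "nonintersecting_balls k cs js \<longleftrightarrow> length js = k \<and> distinct js \<and> set js \<subseteq> {..<length cs} \<and>
     disjoint_family_on (\<lambda>j. ball (real_point (cs ! j)) 1) (set js)"

text \<open>Correctness and the time bound are only required on nonempty collections whose set of
  centers belongs to \<open>\<P>\<close>. The time bound \<open>T\<close> depends on the number of balls and on the bit length
  of the input.\<close>

definition finds_balls ::
    "tm \<Rightarrow> nat \<Rightarrow> (real ^ 'd) set set \<Rightarrow> (nat \<Rightarrow> nat \<Rightarrow> real) \<Rightarrow> bool" where
  "finds_balls M k \<P> T \<longleftrightarrow> turing_machine M \<and>
     (\<forall>cs :: (rat ^ 'd) list. cs \<noteq> [] \<longrightarrow> distinct cs \<longrightarrow> real_point ` set cs \<in> \<P> \<longrightarrow>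
        (\<exists>t y. real t \<le> T (length cs) (length (enc_list enc_point cs)) \<and>
           halts_with M (enc_list enc_point cs) t y \<and>
           (if \<exists>js. nonintersecting_balls k cs js
            then \<exists>js. nonintersecting_balls k cs js \<and> y = enc_list enc_nat js
            else y = [Zero])))"

end

(* Sparsification: branching on large flowers (many clauses sharing a literal or a pair of literals)
   turns a 3-CNF formula with N variables into 2^(eps N) formulas in which every literal occurs
   boundedly often.

   Such a formula is laid out in the grid {1..M}^d. The variables are distributed over M^(d-1) homes and
   routed along axis-parallel lines to the nodes where their clauses are checked; every line carries
   B = O(N / M^(d-1)) bits, that is, one of n = 2^B values. A value is stored in a cell x as the tiny
   displacement of a unit ball from the lattice point 2x. Two balls in adjacent cells are disjoint iff
   the displacements are weakly monotone in the direction of adjacency, so a closed loop of cells forces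
   all its balls to carry the same value, and constraints between lines are imposed by admitting only the
   consistent displacements in the cells where lines meet. Hence the formula is satisfiable iff one can
   choose as many pairwise disjoint balls as there are cells.

   The grid coordinates are spread out along a Cantor set of dimension alpha. Then all centers lie on a
   cross-shaped set of fractal dimension at most s = 1 + (d-1) alpha, whereas the number k of cells is of
   the order M^(d-1+1/alpha), so M^(d-1) is of the order k^(1-1/s). With delta' < s < delta, an
   n^o(k^(1-1/delta')) algorithm for one large fixed k takes time 2^(eps N) on these instances. This
   algorithm is simulated with its transition table as a constant; as every other step is polynomial in
   the time available, each sigma > 0 is reached, which contradicts ETH. *)
theory Submission
  imports Defs "HOL-Real_Asymp.Real_Asymp"
begin

section \<open>A structured stack language compiled to Turing machines\<close>

text \<open>The n = 2^B values of a line must become n distinguishable displacements inside a Cantor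
  set. Powers of the reciprocal digit base do this, one exponent per value; the price is coordinates
  of bit length linear in n, which the factor \<open>len ^ c\<close> of the time bound absorbs. The
  exponents start above n + d, so that squared sideways displacements stay below the smallest gap.
  The O-constant of the dimension must be common to all instances; hence the family of all subsets
  of one unbounded self-similar cross, which hosts every grid size and every n. Numbers are coded in
  unary, and a padding number p of order 2^(N/qq) is part of the data. It is the clock of the
  simulation and the cut-off for all exponentially long lists, so that the whole procedure is
  polynomial-time in the ordinary sense. The degree of this polynomial is fixed first, since
  machine, grid and k are mere data; then qq, then the sparsification threshold \<theta>, finally
  the grid and with it k. Sparsification is analysed only along the branch of a model. All other
  branches are merely counted, through a budget on the alternatives that open a flower.\<close>

type_synonym store = "nat \<Rightarrow> sym list"

datatype com = Skip | Push nat sym | Pop nat | Seq com com (infixl ";;" 60)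
  | Cond nat "sym \<Rightarrow> bool" com com | While nat "sym \<Rightarrow> bool" com

definition top_of :: "sym list \<Rightarrow> sym" where
  "top_of xs = (case xs of [] \<Rightarrow> Blank | x # _ \<Rightarrow> x)"

lemma top_of_simps [simp]: "top_of [] = Blank" "top_of (x # xs) = x"
  by (auto simp: top_of_def)

text \<open>The time counts exactly the steps of the compiled machine.\<close>

inductive exec :: "com \<Rightarrow> store \<Rightarrow> nat \<Rightarrow> store \<Rightarrow> bool" where
  Skip: "exec Skip s 0 s"
| Push: "exec (Push r a) s 2 (s(r := a # s r))"
| Pop: "exec (Pop r) s 1 (s(r := tl (s r)))"
| Seq: "exec c s t s' \<Longrightarrow> exec d s' t' s'' \<Longrightarrow> exec (c ;; d) s (t + t') s''"
| CondT: "P (top_of (s r)) \<Longrightarrow> exec c s t s' \<Longrightarrow> exec (Cond r P c d) s (t + 2) s'"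
| CondF: "\<not> P (top_of (s r)) \<Longrightarrow> exec d s t s' \<Longrightarrow> exec (Cond r P c d) s (t + 1) s'"
| WhileF: "\<not> P (top_of (s r)) \<Longrightarrow> exec (While r P c) s 1 s"
| WhileT: "P (top_of (s r)) \<Longrightarrow> exec c s t s' \<Longrightarrow> exec (While r P c) s' t' s'' \<Longrightarrow>
    exec (While r P c) s (t + t' + 2) s''"

datatype ins = Act nat "sym option" move | Branch nat "sym \<Rightarrow> bool" nat | Jump nat

fun compile :: "nat \<Rightarrow> com \<Rightarrow> ins list" where
  "compile n Skip = []"
| "compile n (Push r a) = [Act r None MoveLeft, Act r (Some a) Stay]"
| "compile n (Pop r) = [Act r None MoveRight]"
| "compile n (c ;; d) = compile n c @ compile (n + length (compile n c)) d"
| "compile n (Cond r P c d) =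
     (let cc = compile (n + 1) c; dd = compile (n + length cc + 2) d
      in Branch r P (n + length cc + 2) # cc @ Jump (n + length cc + 2 + length dd) # dd)"
| "compile n (While r P c) =
     (let cc = compile (n + 1) c in Branch r P (n + length cc + 2) # cc @ [Jump n])"

fun regs_below :: "nat \<Rightarrow> com \<Rightarrow> bool" where
  "regs_below R Skip \<longleftrightarrow> True"
| "regs_below R (Push r a) \<longleftrightarrow> r < R"
| "regs_below R (Pop r) \<longleftrightarrow> r < R"
| "regs_below R (c ;; d) \<longleftrightarrow> regs_below R c \<and> regs_below R d"
| "regs_below R (Cond r P c d) \<longleftrightarrow> r < R \<and> regs_below R c \<and> regs_below R d"
| "regs_below R (While r P c) \<longleftrightarrow> r < R \<and> regs_below R c"

definition keep :: "sym list \<Rightarrow> (sym \<times> move) list" where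
  "keep ss = map (\<lambda>a. (a, Stay)) ss"

fun ins_fun :: "ins \<Rightarrow> nat \<Rightarrow> sym list \<Rightarrow> nat \<times> (sym \<times> move) list" where
  "ins_fun (Act r ao m) q ss =
     (q + 1, (keep ss)[r := (case ao of None \<Rightarrow> ss ! r | Some a \<Rightarrow> a, m)])"
| "ins_fun (Branch r P q') q ss = (if P (ss ! r) then q + 1 else q', keep ss)"
| "ins_fun (Jump q') q ss = (q', keep ss)"

text \<open>Registers are the first \<open>R\<close> tapes. After the code, the symbol on top of register \<open>1\<close> is copied
  to the otherwise unused last tape. The cut-off \<open>min\<close> makes the machine well-formed for arbitrary jump
  targets.\<close>

definition machine :: "nat \<Rightarrow> ins list \<Rightarrow> tm" where
  "machine R code = \<lparr>tapes = R + 1, states = length code + 1,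
     trans_fun = (\<lambda>q ss. if q < length code
       then (case ins_fun (code ! q) q ss of (q', as) \<Rightarrow> (min q' (length code + 1), as))
       else (length code + 1, (keep ss)[R := (ss ! 1, Stay)]))\<rparr>"

lemma machine_sel [simp]:
  "tapes (machine R code) = R + 1" "states (machine R code) = length code + 1"
  by (auto simp: machine_def)

lemma length_keep [simp]: "length (keep ss) = length ss"
  by (simp add: keep_def)

lemma turing_machine_machine: "turing_machine (machine R code)"
  unfolding turing_machine_def
proof (intro conjI allI impI)
  show "1 \<le> tapes (machine R code)" by simp
next
  fix q and ss :: "sym list" assume "q < states (machine R code)" "length ss = tapes (machine R code)"
  then show "fst (trans_fun (machine R code) q ss) \<le> states (machine R code)"
    by (auto simp: machine_def split: prod.splits)
next
  fix q and ss :: "sym list" assume *: "q < states (machine R code)" "length ss = tapes (machine R code)"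
  then show "length (snd (trans_fun (machine R code) q ss)) = tapes (machine R code)"
    by (cases "code ! q") (auto simp: machine_def split: prod.splits)
qed

text \<open>Only the tape from the head rightwards matters. What lies to the left is garbage left by
  earlier pops, so popping need not erase anything.\<close>

definition stk :: "sym list \<Rightarrow> tape \<Rightarrow> bool" where
  "stk xs up \<longleftrightarrow> (\<forall>i::nat. fst up (snd up + int i) = (if i < length xs then xs ! i else Blank))"

text \<open>The last tape has to stay untouched: \<open>halts_with\<close> compares its entire
  content with the output, so it cannot double as a register.\<close>

definition rep :: "nat \<Rightarrow> store \<Rightarrow> tape list \<Rightarrow> bool" where
  "rep R s us \<longleftrightarrow> length us = R + 1 \<and> (\<forall>r < R. stk (s r) (us ! r)) \<and> us ! R = (tape_of [], 0)"

lemma stk_top: "stk xs (u, p) \<Longrightarrow> u p = top_of xs"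
  by (cases xs) (force simp: stk_def dest: spec[of _ 0])+

lemma stk_pop: "stk xs (u, p) \<Longrightarrow> stk (tl xs) (u, p + 1)"
  unfolding stk_def
proof
  fix i assume "\<forall>i::nat. fst (u, p) (snd (u, p) + int i) = (if i < length xs then xs ! i else Blank)"
  from this[rule_format, of "Suc i"]
  show "fst (u, p + 1) (snd (u, p + 1) + int i) = (if i < length (tl xs) then tl xs ! i else Blank)"
    by (cases xs) (auto simp: algebra_simps)
qed

lemma stk_push: "stk xs (u, p) \<Longrightarrow> stk (a # xs) (u(p - 1 := a), p - 1)"
  unfolding stk_def
proof
  fix i assume *: "\<forall>i::nat. fst (u, p) (snd (u, p) + int i) = (if i < length xs then xs ! i else Blank)"
  show "fst (u(p - 1 := a), p - 1) (snd (u(p - 1 := a), p - 1) + int i) =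
    (if i < length (a # xs) then (a # xs) ! i else Blank)"
    using *[rule_format, of "i - 1"] by (cases i) (auto simp: algebra_simps)
qed

lemma map2_act_keep: "map2 act (keep (map (\<lambda>(u, p). u p) us)) us = us"
  by (rule nth_equalityI) (auto simp: keep_def split: prod.splits)

lemma map2_act_update:
  assumes "r < length us"
  shows "map2 act ((keep (map (\<lambda>(u, p). u p) us))[r := (a, m)]) us = us[r := act (a, m) (us ! r)]"
proof (rule nth_equalityI)
  fix i assume "i < length (map2 act ((keep (map (\<lambda>(u, p). u p) us))[r := (a, m)]) us)"
  then have "i < length us" by simp
  then show "map2 act ((keep (map (\<lambda>(u, p). u p) us))[r := (a, m)]) us ! i = us[r := act (a, m) (us ! r)] ! i"
    using assms by (cases "us ! i") (auto simp: keep_def nth_list_update)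
qed simp

lemma act_same: "act (fst up (snd up), m) up =
    (fst up, case m of MoveLeft \<Rightarrow> snd up - 1 | Stay \<Rightarrow> snd up | MoveRight \<Rightarrow> snd up + 1)"
  by (cases up) (auto split: move.split)

lemma step_act:
  assumes "q < length code" "code ! q = Act r ao m" "r < length us"
  shows "tm_step (machine R code) (q, us) =
    (q + 1, us[r := act (case ao of None \<Rightarrow> fst (us ! r) (snd (us ! r)) | Some a \<Rightarrow> a, m) (us ! r)])"
  using assms map2_act_update[OF assms(3)]
  by (auto simp: machine_def split: option.splits prod.splits)

lemma step_branch:
  assumes "q < length code" "code ! q = Branch r P q'" "r < length us" "q' \<le> length code"
  shows "tm_step (machine R code) (q, us) = (if P (fst (us ! r) (snd (us ! r))) then q + 1 else q', us)"
  using assms by (auto simp: machine_def map2_act_keep split: prod.splits)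

lemma step_jump:
  assumes "q < length code" "code ! q = Jump q'" "q' \<le> length code"
  shows "tm_step (machine R code) (q, us) = (q', us)"
  using assms by (auto simp: machine_def map2_act_keep)

lemma rep_update:
  assumes "rep R s us" "r < R" "stk xs up"
  shows "rep R (s(r := xs)) (us[r := up])"
  using assms by (auto simp: rep_def nth_list_update)

lemma rep_top: "rep R s us \<Longrightarrow> r < R \<Longrightarrow> fst (us ! r) (snd (us ! r)) = top_of (s r)"
  using stk_top[of "s r" "fst (us ! r)" "snd (us ! r)"] by (auto simp: rep_def)

lemma sandwich:
  assumes "f x = y" "(f ^^ t) y = z" "f z = w"
  shows "(f ^^ (t + 2)) x = w"
proof -
  have "(f ^^ (t + 2)) x = f ((f ^^ t) (f x))"
    by (metis add_2_eq_Suc' comp_apply funpow.simps(2) funpow_swap1)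
  then show ?thesis using assms by simp
qed

text \<open>Jump targets are absolute addresses, so the induction must range over all positions of
  the fragment inside a larger code.\<close>

lemma exec_simulated:
  assumes "exec c s t s'" "code = pre @ compile (length pre) c @ post" "regs_below R c" "rep R s us"
  shows "\<exists>us'. (tm_step (machine R code) ^^ t) (length pre, us) =
      (length pre + length (compile (length pre) c), us') \<and> rep R s' us'"
  using assms
proof (induction arbitrary: pre post us rule: exec.induct)
  case (Skip s)
  then show ?case by auto
next
  case (Push r a s)
  let ?u = "fst (us ! r)" and ?p = "snd (us ! r)"
  have r: "r < length us" "r < R" using Push.prems by (auto simp: rep_def)
  have s1: "tm_step (machine R code) (length pre, us) = (length pre + 1, us[r := (?u, ?p - 1)])"
    using step_act[of "length pre" code r None MoveLeft us R] Push.prems r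
    by (simp add: act_same nth_append del: tm_step.simps)
  have s2: "tm_step (machine R code) (length pre + 1, us[r := (?u, ?p - 1)]) =
      (length pre + 2, us[r := (?u(?p - 1 := a), ?p - 1)])"
    using step_act[of "length pre + 1" code r "Some a" Stay "us[r := (?u, ?p - 1)]" R] Push.prems r
    by (auto simp: nth_append simp del: tm_step.simps)
  have "stk (a # s r) (?u(?p - 1 := a), ?p - 1)"
    using Push.prems r by (intro stk_push) (auto simp: rep_def)
  then have "rep R (s(r := a # s r)) (us[r := (?u(?p - 1 := a), ?p - 1)])"
    using Push.prems r by (intro rep_update) auto
  moreover have "(tm_step (machine R code) ^^ 2) (length pre, us) =
      (length pre + 2, us[r := (?u(?p - 1 := a), ?p - 1)])"
    using s1 s2 by (simp add: numeral_2_eq_2 del: tm_step.simps)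
  ultimately show ?case by (intro exI[of _ "us[r := (?u(?p - 1 := a), ?p - 1)]"] conjI) (simp, assumption)
next
  case (Pop r s)
  let ?u = "fst (us ! r)" and ?p = "snd (us ! r)"
  have r: "r < length us" "r < R" using Pop.prems by (auto simp: rep_def)
  have s1: "tm_step (machine R code) (length pre, us) = (length pre + 1, us[r := (?u, ?p + 1)])"
    using step_act[of "length pre" code r None MoveRight us R] Pop.prems r
    by (simp add: act_same nth_append del: tm_step.simps)
  have "stk (tl (s r)) (?u, ?p + 1)"
    using Pop.prems r by (intro stk_pop) (auto simp: rep_def)
  then have "rep R (s(r := tl (s r))) (us[r := (?u, ?p + 1)])"
    using Pop.prems r by (intro rep_update) auto
  then show ?case using s1
    by (intro exI[of _ "us[r := (?u, ?p + 1)]"] conjI) (simp del: tm_step.simps, assumption)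
next
  case (Seq c s t s' d t' s'')
  let ?n = "length pre"
  let ?c = "compile ?n c"
  let ?d = "compile (?n + length ?c) d"
  have code: "code = pre @ ?c @ (?d @ post)" "code = (pre @ ?c) @ compile (length (pre @ ?c)) d @ post"
    and regs: "regs_below R c" "regs_below R d"
    using Seq.prems by auto
  obtain us1 where 1: "(tm_step (machine R code) ^^ t) (?n, us) = (?n + length ?c, us1)" "rep R s' us1"
    using Seq.IH(1)[OF code(1) regs(1) Seq.prems(3)] by blast
  obtain us2 where 2: "(tm_step (machine R code) ^^ t') (?n + length ?c, us1) =
     (?n + length ?c + length ?d, us2)" "rep R s'' us2"
    using Seq.IH(2)[OF code(2) regs(2) 1(2)] by auto
  have "(tm_step (machine R code) ^^ (t' + t)) (?n, us) = (?n + length ?c + length ?d, us2)"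
    unfolding funpow_add using 1 2 by simp
  then show ?case using 2 by (intro exI[of _ us2]) (simp add: add.commute[of t t'] add.assoc)
next
  case (CondT P s r c t s' d)
  let ?n = "length pre" let ?c = "compile (?n + 1) c" let ?d = "compile (?n + length ?c + 2) d"
  have code: "code = pre @ Branch r P (?n + length ?c + 2) # ?c @ Jump (?n + length ?c + 2 + length ?d) # ?d @ post"
    using CondT.prems by (simp add: Let_def)
  have r: "r < length us" "r < R" using CondT.prems by (auto simp: rep_def)
  have s1: "tm_step (machine R code) (?n, us) = (?n + 1, us)"
    using step_branch[of ?n code r P "?n + length ?c + 2" us R] code r CondT.hyps rep_top[OF CondT.prems(3) r(2)]
    by (auto simp: nth_append simp del: tm_step.simps)
  let ?pre = "pre @ [Branch r P (?n + length ?c + 2)]"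
  have "code = ?pre @ compile (length ?pre) c @ (Jump (?n + length ?c + 2 + length ?d) # ?d @ post)"
    and "regs_below R c"
    using code CondT.prems by auto
  from CondT.IH[OF this CondT.prems(3)]
  obtain us1 where 1: "(tm_step (machine R code) ^^ t) (?n + 1, us) = (?n + 1 + length ?c, us1)" "rep R s' us1"
    by auto
  have s2: "tm_step (machine R code) (?n + 1 + length ?c, us1) = (?n + length ?c + 2 + length ?d, us1)"
    using step_jump[of "?n + 1 + length ?c" code "?n + length ?c + 2 + length ?d" R us1] code
    by (auto simp: nth_append simp del: tm_step.simps)
  have "(tm_step (machine R code) ^^ (t + 2)) (?n, us) = (?n + length ?c + 2 + length ?d, us1)"
    using s1 1(1) s2 by (rule sandwich)
  then show ?case using 1 by (auto simp: Let_def simp del: tm_step.simps)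
next
  case (CondF P s r d t s' c)
  let ?n = "length pre" let ?c = "compile (?n + 1) c" let ?d = "compile (?n + length ?c + 2) d"
  have code: "code = pre @ Branch r P (?n + length ?c + 2) # ?c @ Jump (?n + length ?c + 2 + length ?d) # ?d @ post"
    using CondF.prems by (simp add: Let_def)
  have r: "r < length us" "r < R" using CondF.prems by (auto simp: rep_def)
  have s1: "tm_step (machine R code) (?n, us) = (?n + length ?c + 2, us)"
    using step_branch[of ?n code r P "?n + length ?c + 2" us R] code r CondF.hyps rep_top[OF CondF.prems(3) r(2)]
    by (auto simp: nth_append simp del: tm_step.simps)
  let ?pre = "pre @ Branch r P (?n + length ?c + 2) # ?c @ [Jump (?n + length ?c + 2 + length ?d)]"
  have l: "length ?pre = ?n + length ?c + 2" by simp
  have "code = ?pre @ compile (length ?pre) d @ post" and "regs_below R d"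
    unfolding l using code CondF.prems by auto
  from CondF.IH[OF this CondF.prems(3)] obtain us1 where
    1: "(tm_step (machine R code) ^^ t) (?n + length ?c + 2, us) =
      (?n + length ?c + 2 + length ?d, us1)" "rep R s' us1"
    unfolding l by blast
  have "(tm_step (machine R code) ^^ (t + 1)) (?n, us) = (?n + length ?c + 2 + length ?d, us1)"
    using s1 1 by (simp add: funpow_swap1 del: tm_step.simps)
  then show ?case using 1 by (auto simp: Let_def simp del: tm_step.simps)
next
  case (WhileF P s r c)
  let ?n = "length pre" let ?c = "compile (?n + 1) c"
  have code: "code = pre @ Branch r P (?n + length ?c + 2) # ?c @ Jump ?n # post"
    using WhileF.prems by (simp add: Let_def)
  have r: "r < length us" "r < R" using WhileF.prems by (auto simp: rep_def)
  have s1: "tm_step (machine R code) (?n, us) = (?n + length ?c + 2, us)"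
    using step_branch[of ?n code r P "?n + length ?c + 2" us R] code r WhileF.hyps rep_top[OF WhileF.prems(3) r(2)]
    by (auto simp: nth_append simp del: tm_step.simps)
  then show ?case using WhileF.prems by (auto simp: Let_def simp del: tm_step.simps)
next
  case (WhileT P s r c t s' t' s'')
  let ?n = "length pre" let ?c = "compile (?n + 1) c"
  have code: "code = pre @ Branch r P (?n + length ?c + 2) # ?c @ Jump ?n # post"
    using WhileT.prems by (simp add: Let_def)
  have r: "r < length us" "r < R" using WhileT.prems by (auto simp: rep_def)
  have s1: "tm_step (machine R code) (?n, us) = (?n + 1, us)"
    using step_branch[of ?n code r P "?n + length ?c + 2" us R] code r WhileT.hyps rep_top[OF WhileT.prems(3) r(2)]
    by (auto simp: nth_append simp del: tm_step.simps)
  let ?pre = "pre @ [Branch r P (?n + length ?c + 2)]"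
  have "code = ?pre @ compile (length ?pre) c @ (Jump ?n # post)" and "regs_below R c"
    using code WhileT.prems by auto
  from WhileT.IH(1)[OF this WhileT.prems(3)]
  obtain us1 where 1: "(tm_step (machine R code) ^^ t) (?n + 1, us) = (?n + 1 + length ?c, us1)" "rep R s' us1"
    by auto
  have s2: "tm_step (machine R code) (?n + 1 + length ?c, us1) = (?n, us1)"
    using step_jump[of "?n + 1 + length ?c" code "?n" R us1] code
    by (auto simp: nth_append simp del: tm_step.simps)
  from WhileT.IH(2)[OF WhileT.prems(1,2) 1(2)]
  obtain us2 where 2: "(tm_step (machine R code) ^^ t') (?n, us1) =
      (?n + length (compile ?n (While r P c)), us2)" "rep R s'' us2" by auto
  have "(tm_step (machine R code) ^^ (t + 2)) (?n, us) = (?n, us1)"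
    using s1 1(1) s2 by (rule sandwich)
  then have "(tm_step (machine R code) ^^ (t' + (t + 2))) (?n, us) = (?n + length (compile ?n (While r P c)), us2)"
    unfolding funpow_add using 2 by simp
  moreover have "t' + (t + 2) = t + t' + 2" by simp
  ultimately have "(tm_step (machine R code) ^^ (t + t' + 2)) (?n, us) =
      (?n + length (compile ?n (While r P c)), us2)" by metis
  then show ?case using 2(2) by blast
qed

text \<open>The input is register \<open>0\<close>; stacks grow to the left, so that the initial tape already represents it.\<close>

theorem exec_halts_with:
  assumes "exec c ((\<lambda>_. [])(0 := w)) t s'" "regs_below R c" "2 \<le> R"
  shows "halts_with (machine R (compile 0 c)) w (t + 1) [top_of (s' 1)]"
proof -
  let ?M = "machine R (compile 0 c)"
  have "rep R ((\<lambda>_. [])(0 := w)) (snd (tm_init ?M w))"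
    unfolding rep_def
  proof (intro conjI allI impI)
    show "length (snd (tm_init ?M w)) = R + 1" by (simp add: tm_init_def)
    fix r assume "r < R"
    then show "stk (((\<lambda>_. [])(0 := w)) r) (snd (tm_init ?M w) ! r)"
      by (cases r) (simp_all add: tm_init_def stk_def tape_of_def)
  next
    show "snd (tm_init ?M w) ! R = (tape_of [], 0)"
      using assms(3) by (simp add: tm_init_def nth_Cons')
  qed
  from exec_simulated[OF assms(1) _ assms(2) this, of "compile 0 c" "[]" "[]"]
  obtain us where us: "(tm_step ?M ^^ t) (tm_init ?M w) = (length (compile 0 c), us)" "rep R s' us"
    by (fastforce simp: tm_init_def simp del: compile.simps tm_step.simps)
  have len: "length us = R + 1" and "us \<noteq> []" and usR: "us ! R = (tape_of [], 0)"
    using us(2) by (auto simp: rep_def)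
  have r1: "fst (us ! 1) (snd (us ! 1)) = top_of (s' 1)" using rep_top[OF us(2)] assms(3) by auto
  have "tm_step ?M (length (compile 0 c), us) =
      (length (compile 0 c) + 1, us[R := act (top_of (s' 1), Stay) (us ! R)])"
    using map2_act_update[of R us "top_of (s' 1)" Stay] len r1 assms(3)
    by (auto simp: machine_def split: prod.splits)
  then have "(tm_step ?M ^^ (t + 1)) (tm_init ?M w) =
      (length (compile 0 c) + 1, us[R := act (top_of (s' 1), Stay) (us ! R)])"
    using us(1) by (simp del: tm_step.simps)
  moreover have "last (us[R := act (top_of (s' 1), Stay) (us ! R)]) = ((tape_of [])(0 := top_of (s' 1)), 0)"
    using len usR by (subst last_conv_nth) auto
  moreover have "(tape_of [])(0 := x) = tape_of [x]" for x
    by (auto simp: tape_of_def fun_eq_iff)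
  ultimately show ?thesis by (simp add: halts_with_def del: tm_step.simps)
qed

section \<open>Polynomial-time functions on coded data\<close>

datatype tree = Leaf | Node tree tree

text \<open>A prefix-free code: several values can lie on one stack without separators, and the
  topmost one can be parsed off.\<close>

fun tcode :: "tree \<Rightarrow> sym list" where
  "tcode Leaf = [Zero]"
| "tcode (Node l r) = One # tcode l @ tcode r"

fun tsize :: "tree \<Rightarrow> nat" where
  "tsize Leaf = 1"
| "tsize (Node l r) = 1 + tsize l + tsize r"

lemma length_tcode: "length (tcode t) = tsize t"
  by (induction t) auto

lemma set_tcode: "set (tcode t) \<subseteq> {Zero, One}"
  by (induction t) auto

lemma tcode_append_inj: "tcode t @ xs = tcode t' @ ys \<Longrightarrow> t = t' \<and> xs = ys"
proof (induction t arbitrary: t' xs ys)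
  case Leaf
  then show ?case by (cases t') auto
next
  case (Node l r)
  obtain l' r' where t': "t' = Node l' r'" using Node.prems by (cases t') auto
  then have "tcode l @ (tcode r @ xs) = tcode l' @ (tcode r' @ ys)" using Node.prems by simp
  from Node.IH(1)[OF this] have l: "l = l'" and "tcode r @ xs = tcode r' @ ys" by simp_all
  from Node.IH(2)[OF this(2)] l t' show ?case by simp
qed

lemma tcode_inj: "tcode t = tcode t' \<longleftrightarrow> t = t'"
proof
  assume "tcode t = tcode t'"
  then have "tcode t @ [] = tcode t' @ []" by simp
  then show "t = t'" using tcode_append_inj by blast
qed simp

lemma tsize_pos: "0 < tsize t" by (cases t) auto

text \<open>Register 0 is the input and 1 the stack of values; 2, 3 and 4 are scratch registers,
  empty before and after every program in the sense of \<open>computes\<close>.\<close>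

definition mk :: "sym list \<Rightarrow> sym list \<Rightarrow> sym list \<Rightarrow> sym list \<Rightarrow> sym list \<Rightarrow> store" where
  "mk i m a b c = (\<lambda>r. if r = 0 then i else if r = 1 then m else if r = 2 then a else if r = 3 then b
     else if r = 4 then c else [])"

lemma mk_sel [simp]:
  "mk i m a b c 0 = i" "mk i m a b c 1 = m" "mk i m a b c (Suc 0) = m" "mk i m a b c 2 = a"
  "mk i m a b c 3 = b" "mk i m a b c 4 = c"
  by (auto simp: mk_def)

lemma mk_upd [simp]:
  "(mk i m a b c)(0 := x) = mk x m a b c" "(mk i m a b c)(1 := x) = mk i x a b c"
  "(mk i m a b c)(Suc 0 := x) = mk i x a b c"
  "(mk i m a b c)(2 := x) = mk i m x b c" "(mk i m a b c)(3 := x) = mk i m a x c"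
  "(mk i m a b c)(4 := x) = mk i m a b x"
  by (auto simp: mk_def fun_eq_iff)

definition run :: "com \<Rightarrow> store \<Rightarrow> store \<Rightarrow> nat \<Rightarrow> bool" where
  "run c s s' n \<longleftrightarrow> (\<exists>t \<le> n. exec c s t s')"

lemma run_mono: "run c s s' n \<Longrightarrow> n \<le> n' \<Longrightarrow> run c s s' n'"
  by (auto simp: run_def intro: order_trans)

lemma run_Push: "s' = s(r := a # s r) \<Longrightarrow> 2 \<le> n \<Longrightarrow> run (Push r a) s s' n"
  unfolding run_def by (intro exI[of _ 2] conjI) (simp, simp only: exec.Push)

lemma run_Pop: "s' = s(r := tl (s r)) \<Longrightarrow> 1 \<le> n \<Longrightarrow> run (Pop r) s s' n"
  unfolding run_def by (intro exI[of _ 1] conjI) (simp, simp only: exec.Pop)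

lemma run_Seq: "run c s s' n \<Longrightarrow> run d s' s'' n' \<Longrightarrow> run (c ;; d) s s'' (n + n')"
  unfolding run_def by (meson add_mono exec.Seq)

lemma run_CondT: "P (top_of (s r)) \<Longrightarrow> run c s s' n \<Longrightarrow> run (Cond r P c d) s s' (n + 2)"
  unfolding run_def by (meson add_mono exec.CondT order_refl)

lemma run_CondF: "\<not> P (top_of (s r)) \<Longrightarrow> run d s s' n \<Longrightarrow> run (Cond r P c d) s s' (n + 2)"
  unfolding run_def using exec.CondF by (metis add_le_mono one_le_numeral)

lemma run_WhileF: "\<not> P (top_of (s r)) \<Longrightarrow> run (While r P c) s s 1"
  unfolding run_def by (meson exec.WhileF order_refl)

lemma run_WhileT: "P (top_of (s r)) \<Longrightarrow> run c s s' n \<Longrightarrow> run (While r P c) s' s'' n' \<Longrightarrow>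
    run (While r P c) s s'' (n + n' + 2)"
  unfolding run_def by (meson add_mono exec.WhileT order_refl)

subsection \<open>Moving values between stacks\<close>

definition move_loop :: "nat \<Rightarrow> com" where
  "move_loop r = While 4 (\<lambda>x. x = One)
     (Cond 1 (\<lambda>x. x = One) (Pop 1 ;; Push r One ;; Push 4 One) (Pop 1 ;; Push r Zero ;; Pop 4))"

text \<open>Register \<open>4\<close> counts in unary the subtrees still to be read.\<close>

lemma run_move_loop2:
  "run (move_loop 2) (mk i m (rev (tcode t) @ a) b c) s' n \<Longrightarrow>
   run (move_loop 2) (mk i (tcode t @ m) a b (One # c)) s' (n + 10 * tsize t)"
proof (induction t arbitrary: m a c n)
  case Leaf
  have "run (Cond 1 (\<lambda>x. x = One) (Pop 1 ;; Push 2 One ;; Push 4 One) (Pop 1 ;; Push 2 Zero ;; Pop 4))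
      (mk i (tcode Leaf @ m) a b (One # c)) (mk i m (Zero # a) b c) (1 + 2 + 1 + 2)"
    by (intro run_CondF run_Seq run_Pop run_Push) auto
  from run_WhileT[OF _ this Leaf[simplified, unfolded move_loop_def]] show ?case
    unfolding move_loop_def by (auto intro: run_mono)
next
  case (Node l r)
  have "run (Cond 1 (\<lambda>x. x = One) (Pop 1 ;; Push 2 One ;; Push 4 One) (Pop 1 ;; Push 2 Zero ;; Pop 4))
      (mk i (tcode (Node l r) @ m) a b (One # c)) (mk i (tcode l @ tcode r @ m) (One # a) b (One # One # c)) (1 + 2 + 2 + 2)"
    by (intro run_CondT run_Seq run_Pop run_Push) auto
  moreover have "run (move_loop 2) (mk i (tcode l @ tcode r @ m) (One # a) b (One # One # c)) s'
      (n + 10 * tsize r + 10 * tsize l)"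
    using Node.prems by (intro Node.IH) auto
  ultimately show ?case
    unfolding move_loop_def by (auto intro: run_mono[OF run_WhileT])
qed

lemma run_move_loop3:
  "run (move_loop 3) (mk i m a (rev (tcode t) @ b) c) s' n \<Longrightarrow>
   run (move_loop 3) (mk i (tcode t @ m) a b (One # c)) s' (n + 10 * tsize t)"
proof (induction t arbitrary: m b c n)
  case Leaf
  have "run (Cond 1 (\<lambda>x. x = One) (Pop 1 ;; Push 3 One ;; Push 4 One) (Pop 1 ;; Push 3 Zero ;; Pop 4))
      (mk i (tcode Leaf @ m) a b (One # c)) (mk i m a (Zero # b) c) (1 + 2 + 1 + 2)"
    by (intro run_CondF run_Seq run_Pop run_Push) auto
  from run_WhileT[OF _ this Leaf[simplified, unfolded move_loop_def]] show ?case
    unfolding move_loop_def by (auto intro: run_mono)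
next
  case (Node l r)
  have "run (Cond 1 (\<lambda>x. x = One) (Pop 1 ;; Push 3 One ;; Push 4 One) (Pop 1 ;; Push 3 Zero ;; Pop 4))
      (mk i (tcode (Node l r) @ m) a b (One # c)) (mk i (tcode l @ tcode r @ m) a (One # b) (One # One # c)) (1 + 2 + 2 + 2)"
    by (intro run_CondT run_Seq run_Pop run_Push) auto
  moreover have "run (move_loop 3) (mk i (tcode l @ tcode r @ m) a (One # b) (One # One # c)) s'
      (n + 10 * tsize r + 10 * tsize l)"
    using Node.prems by (intro Node.IH) auto
  ultimately show ?case
    unfolding move_loop_def by (auto intro: run_mono[OF run_WhileT])
qed

definition move :: "nat \<Rightarrow> com" where
  "move r = Push 4 One ;; move_loop r"

lemma run_move2: "run (move 2) (mk i (tcode t @ m) a b []) (mk i m (rev (tcode t) @ a) b []) (10 * tsize t + 3)"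
proof -
  have "run (move_loop 2) (mk i m (rev (tcode t) @ a) b []) (mk i m (rev (tcode t) @ a) b []) 1"
    unfolding move_loop_def by (rule run_WhileF) simp
  from run_move_loop2[OF this] have "run (move 2) (mk i (tcode t @ m) a b []) (mk i m (rev (tcode t) @ a) b [])
      (2 + (1 + 10 * tsize t))"
    unfolding move_def by (intro run_Seq[OF run_Push]) auto
  then show ?thesis by (rule run_mono) simp
qed

lemma run_move3: "run (move 3) (mk i (tcode t @ m) a b []) (mk i m a (rev (tcode t) @ b) []) (10 * tsize t + 3)"
proof -
  have "run (move_loop 3) (mk i m a (rev (tcode t) @ b) []) (mk i m a (rev (tcode t) @ b) []) 1"
    unfolding move_loop_def by (rule run_WhileF) simp
  from run_move_loop3[OF this] have "run (move 3) (mk i (tcode t @ m) a b []) (mk i m a (rev (tcode t) @ b) [])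
      (2 + (1 + 10 * tsize t))"
    unfolding move_def by (intro run_Seq[OF run_Push]) auto
  then show ?thesis by (rule run_mono) simp
qed

text \<open>Pouring one stack into another reverses it. \<open>move\<close> leaves a code reversed,
  and a \<open>transfer\<close> restores its order.\<close>

definition transfer :: "nat \<Rightarrow> (sym \<Rightarrow> com) \<Rightarrow> com" where
  "transfer r f = While r (\<lambda>x. x \<noteq> Blank) (Cond r (\<lambda>x. x = One) (Pop r ;; f One) (Pop r ;; f Zero))"

text \<open>The state is given as a function \<open>S\<close> of the content of the register that is being emptied.\<close>

lemma run_transfer:
  assumes "set xs \<subseteq> {Zero, One}"
    and S: "\<And>ys zs. S ys zs r = ys"
    and step: "\<And>y ys zs. run (f y) ((S (y # ys) zs)(r := ys)) (S ys (y # zs)) k"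
  shows "run (transfer r f) (S xs zs) (S [] (rev xs @ zs)) ((k + 5) * length xs + 1)"
  using assms(1)
proof (induction xs arbitrary: zs)
  case Nil
  have "run (transfer r f) (S [] zs) (S [] zs) 1"
    unfolding transfer_def by (rule run_WhileF) (simp add: S)
  then show ?case by simp
next
  case (Cons x xs)
  have "run (Pop r ;; f x) (S (x # xs) zs) (S xs (x # zs)) (1 + k)"
    by (intro run_Seq[OF run_Pop step]) (auto simp: S)
  note body = this
  have "run (Cond r (\<lambda>x. x = One) (Pop r ;; f One) (Pop r ;; f Zero)) (S (x # xs) zs) (S xs (x # zs)) (1 + k + 2)"
  proof (cases "x = One")
    case True
    then show ?thesis using run_CondT[of "\<lambda>x. x = One" "S (x # xs) zs" r "Pop r ;; f One", of "S xs (x # zs)" "1 + k"]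
      body by (simp add: S)
  next
    case False
    then have x: "x = Zero" using Cons.prems by auto
    then show ?thesis using run_CondF[of "\<lambda>x. x = One" "S (x # xs) zs" r "Pop r ;; f Zero", of "S xs (x # zs)" "1 + k"]
      body by (simp add: S)
  qed
  moreover have "run (transfer r f) (S xs (x # zs)) (S [] (rev xs @ x # zs)) ((k + 5) * length xs + 1)"
    using Cons by auto
  ultimately have "run (transfer r f) (S (x # xs) zs) (S [] (rev xs @ x # zs)) ((1 + k + 2) + ((k + 5) * length xs + 1) + 2)"
    unfolding transfer_def using Cons.prems by (intro run_WhileT) (auto simp: S)
  then show ?case by (auto intro: run_mono)
qed

lemma run_push1: "run (Push (Suc 0) y) (mk i m a b c) (mk i (y # m) a b c) 2"
  by (rule run_Push) auto

lemma run_push2: "run (Push 2 y) (mk i m a b c) (mk i m (y # a) b c) 2"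
  by (rule run_Push) auto

lemma run_push13: "run (Push (Suc 0) y ;; Push 3 y) (mk i m a b c) (mk i (y # m) a (y # b) c) 4"
  by (rule run_mono[OF run_Seq[OF run_push1 run_Push[where n = 2]]]) auto

lemma run_Skip: "run Skip s s 0"
  by (auto simp: run_def intro: exec.intros)

text \<open>Emptying the reversed copy yields correctly ordered copies on registers 1 and 3; the
  second has to pass once more through register 2 to end up on top of the first in the right
  order.\<close>

definition dup :: com where
  "dup = move 2 ;; transfer 2 (\<lambda>x. Push 1 x ;; Push 3 x) ;; transfer 3 (\<lambda>x. Push 2 x) ;; transfer 2 (\<lambda>x. Push 1 x)"

lemma run_dup: "run dup (mk i (tcode t @ m) [] [] []) (mk i (tcode t @ tcode t @ m) [] [] []) (40 * tsize t + 10)"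
proof -
  let ?c = "tcode t"
  have 1: "run (move 2) (mk i (?c @ m) [] [] []) (mk i m (rev ?c) [] []) (10 * tsize t + 3)"
    using run_move2[of i t m "[]" "[]"] by simp
  have 2: "run (transfer 2 (\<lambda>x. Push 1 x ;; Push 3 x)) (mk i m (rev ?c) [] []) (mk i (?c @ m) [] ?c [])
      ((4 + 5) * length (rev ?c) + 1)"
    using run_transfer[where S = "\<lambda>xs zs. mk i (zs @ m) xs zs []" and xs = "rev ?c" and zs = "[]" and k = 4
        and r = 2 and f = "\<lambda>x. Push 1 x ;; Push 3 x"]
      run_push13 set_tcode[of t] by auto
  have 3: "run (transfer 3 (\<lambda>x. Push 2 x)) (mk i (?c @ m) [] ?c []) (mk i (?c @ m) (rev ?c) [] [])
      ((2 + 5) * length ?c + 1)"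
    using run_transfer[where S = "\<lambda>xs zs. mk i (?c @ m) zs xs []" and xs = "?c" and zs = "[]" and k = 2
        and r = 3 and f = "\<lambda>x. Push 2 x"]
      run_push1 run_push2 set_tcode[of t] by auto
  have 4: "run (transfer 2 (\<lambda>x. Push 1 x)) (mk i (?c @ m) (rev ?c) [] []) (mk i (?c @ ?c @ m) [] [] [])
      ((2 + 5) * length (rev ?c) + 1)"
    using run_transfer[where S = "\<lambda>xs zs. mk i (zs @ ?c @ m) xs [] []" and xs = "rev ?c" and zs = "[]" and k = 2
        and r = 2 and f = "\<lambda>x. Push 1 x"]
      run_push1 run_push2 set_tcode[of t] by auto
  show ?thesis unfolding dup_def
    by (rule run_mono[OF run_Seq[OF run_Seq[OF run_Seq[OF 1 2] 3] 4]]) (simp add: length_tcode)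
qed

definition swap :: com where
  "swap = move 2 ;; move 3 ;; transfer 2 (\<lambda>x. Push 1 x) ;; transfer 3 (\<lambda>x. Push 1 x)"

lemma run_swap: "run swap (mk i (tcode t @ tcode u @ m) [] [] []) (mk i (tcode u @ tcode t @ m) [] [] [])
    (20 * (tsize t + tsize u) + 10)"
proof -
  let ?c = "tcode t" and ?d = "tcode u"
  have 1: "run (move 2) (mk i (?c @ ?d @ m) [] [] []) (mk i (?d @ m) (rev ?c) [] []) (10 * tsize t + 3)"
    using run_move2[of i t "?d @ m" "[]" "[]"] by simp
  have 2: "run (move 3) (mk i (?d @ m) (rev ?c) [] []) (mk i m (rev ?c) (rev ?d) []) (10 * tsize u + 3)"
    using run_move3[of i u m "rev ?c" "[]"] by simp
  have 3: "run (transfer 2 (\<lambda>x. Push 1 x)) (mk i m (rev ?c) (rev ?d) []) (mk i (?c @ m) [] (rev ?d) [])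
      ((2 + 5) * length (rev ?c) + 1)"
    using run_transfer[where S = "\<lambda>xs zs. mk i (zs @ m) xs (rev ?d) []" and xs = "rev ?c" and zs = "[]" and k = 2
        and r = 2 and f = "\<lambda>x. Push 1 x"]
      run_push1 run_push2 set_tcode[of t] by auto
  have 4: "run (transfer 3 (\<lambda>x. Push 1 x)) (mk i (?c @ m) [] (rev ?d) []) (mk i (?d @ ?c @ m) [] [] [])
      ((2 + 5) * length (rev ?d) + 1)"
    using run_transfer[where S = "\<lambda>xs zs. mk i (zs @ ?c @ m) [] xs []" and xs = "rev ?d" and zs = "[]" and k = 2
        and r = 3 and f = "\<lambda>x. Push 1 x"]
      run_push1 run_push2 set_tcode[of u] by auto
  show ?thesis unfolding swap_def
    by (rule run_mono[OF run_Seq[OF run_Seq[OF run_Seq[OF 1 2] 3] 4]]) (simp add: length_tcode)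
qed

definition drop_value :: com where
  "drop_value = move 2 ;; transfer 2 (\<lambda>x. Skip)"

lemma run_drop: "run drop_value (mk i (tcode t @ m) [] [] []) (mk i m [] [] []) (15 * tsize t + 10)"
proof -
  let ?c = "tcode t"
  have 1: "run (move 2) (mk i (?c @ m) [] [] []) (mk i m (rev ?c) [] []) (10 * tsize t + 3)"
    using run_move2[of i t m "[]" "[]"] by simp
  have 2: "run (transfer 2 (\<lambda>x. Skip)) (mk i m (rev ?c) [] []) (mk i m [] [] [])
      ((0 + 5) * length (rev ?c) + 1)"
    using run_transfer[where S = "\<lambda>xs zs. mk i m xs [] []" and xs = "rev ?c" and zs = "[]" and k = 0
        and r = 2 and f = "\<lambda>x. Skip"]
      run_Skip set_tcode[of t] by auto
  show ?thesis unfolding drop_value_def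
    by (rule run_mono[OF run_Seq[OF 1 2]]) (simp add: length_tcode)
qed

lemmas prog_defs = dup_def swap_def drop_value_def move_def move_loop_def transfer_def

lemma regs_progs [simp]: "regs_below 5 dup" "regs_below 5 swap" "regs_below 5 drop_value"
  "regs_below 5 (move 2)" "regs_below 5 (move 3)"
  by (auto simp: prog_defs)

definition push_all :: "sym list \<Rightarrow> com" where
  "push_all w = foldr (\<lambda>x c. c ;; Push 1 x) w Skip"

lemma run_push_all: "run (push_all w) (mk i m [] [] []) (mk i (w @ m) [] [] []) (2 * length w)"
proof (induction w)
  case Nil
  then show ?case by (auto simp: push_all_def intro: run_Skip)
next
  case (Cons x w)
  have "run (push_all w ;; Push 1 x) (mk i m [] [] []) (mk i ((x # w) @ m) [] [] []) (2 * length w + 2)"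
    by (rule run_Seq[OF Cons run_Push]) auto
  then show ?case by (simp add: push_all_def)
qed

lemma regs_push_all [simp]: "regs_below 5 (push_all w)"
  by (induction w) (auto simp: push_all_def)

subsection \<open>Coded types\<close>

class coded =
  fixes code :: "'a \<Rightarrow> tree"
  assumes code_eq_iff: "code x = code y \<longleftrightarrow> x = y"

abbreviation sz :: "'a::coded \<Rightarrow> nat" where
  "sz x \<equiv> tsize (code x)"

abbreviation cc :: "'a::coded \<Rightarrow> sym list" where
  "cc x \<equiv> tcode (code x)"

instantiation unit :: coded begin
definition code_unit :: "unit \<Rightarrow> tree" where "code_unit x = Leaf"
instance by standard (auto simp: code_unit_def)
end

instantiation bool :: coded begin
definition code_bool :: "bool \<Rightarrow> tree" where "code_bool b = (if b then Node Leaf Leaf else Leaf)"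
instance by standard (auto simp: code_bool_def)
end

text \<open>Unary coding: polynomial time below means polynomial in the values of numbers. This is
  what turns a large padding number into a time allowance.\<close>

fun code_nat' :: "nat \<Rightarrow> tree" where
  "code_nat' 0 = Leaf" | "code_nat' (Suc n) = Node Leaf (code_nat' n)"

instantiation nat :: coded begin
definition code_nat :: "nat \<Rightarrow> tree" where "code_nat = code_nat'"
instance
proof
  fix x y :: nat show "code x = code y \<longleftrightarrow> x = y"
    unfolding code_nat_def
  proof (induction x arbitrary: y)
    case 0 then show ?case by (cases y) auto
  next
    case (Suc x) then show ?case by (cases y) auto
  qed
qed
end

instantiation prod :: (coded, coded) coded begin
definition code_prod :: "'a \<times> 'b \<Rightarrow> tree" where "code_prod p = Node (code (fst p)) (code (snd p))"
instance by standard (auto simp: code_prod_def code_eq_iff prod_eq_iff)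
end

text \<open>A nonempty list has the same code as the pair of its head and tail, so passing between
  the two costs nothing.\<close>

fun code_list' :: "'a::coded list \<Rightarrow> tree" where
  "code_list' [] = Leaf" | "code_list' (x # xs) = Node (code x) (code_list' xs)"

instantiation list :: (coded) coded begin
definition code_list :: "'a list \<Rightarrow> tree" where "code_list = code_list'"
instance
proof
  fix x y :: "'a list" show "code x = code y \<longleftrightarrow> x = y"
    unfolding code_list_def
  proof (induction x arbitrary: y)
    case Nil then show ?case by (cases y) auto
  next
    case (Cons a x) then show ?case by (cases y) (auto simp: code_eq_iff)
  qed
qed
end

fun sym_nat :: "sym \<Rightarrow> nat" where
  "sym_nat Blank = 0" | "sym_nat Zero = 1" | "sym_nat One = 2" | "sym_nat LPar = 3" | "sym_nat RPar = 4"

instantiation sym :: coded begin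
definition code_sym :: "sym \<Rightarrow> tree" where "code_sym s = code (sym_nat s)"
instance
proof
  fix x y :: sym show "code x = code y \<longleftrightarrow> x = y"
    by (cases x; cases y) (auto simp: code_sym_def code_eq_iff)
qed
end

fun move_nat :: "move \<Rightarrow> nat" where
  "move_nat MoveLeft = 0" | "move_nat Stay = 1" | "move_nat MoveRight = 2"

instantiation move :: coded begin
definition code_move :: "move \<Rightarrow> tree" where "code_move s = code (move_nat s)"
instance
proof
  fix x y :: move show "code x = code y \<longleftrightarrow> x = y"
    by (cases x; cases y) (auto simp: code_move_def code_eq_iff)
qed
end

lemma code_simps [simp]:
  "code (a, b) = Node (code a) (code b)" "code (0::nat) = Leaf" "code (Suc n) = Node Leaf (code n)"
  "code ([] :: 'a::coded list) = Leaf" "code (x # xs) = Node (code x) (code (xs :: 'a list))"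
  "code True = Node Leaf Leaf" "code False = Leaf" "code () = Leaf"
  by (auto simp: code_prod_def code_nat_def code_list_def code_bool_def code_unit_def)

lemma sz_nat [simp]: "sz (n::nat) = 2 * n + 1"
  by (induction n) auto

lemma sz_bool_le: "sz (b::bool) \<le> 3"
  by (cases b) auto

lemma sz_sym_le: "sz (s::sym) \<le> 9"
  by (cases s) (auto simp: code_sym_def)

lemma sz_list: "sz (xs :: 'a::coded list) = 1 + (\<Sum>x\<leftarrow>xs. sz x + 1)"
  by (induction xs) auto

lemma length_le_sz: "2 * length (xs :: 'a::coded list) + 1 \<le> sz xs"
proof (induction xs)
  case (Cons x xs) then show ?case using tsize_pos[of "code x"] by simp
qed simp

lemma sz_append: "sz (xs @ ys) + 1 = sz xs + sz (ys :: 'a::coded list)"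
  by (simp add: sz_list)

lemma sz_rev: "sz (rev xs) = sz (xs :: 'a::coded list)"
proof (induction xs)
  case (Cons x xs)
  then show ?case using sz_append[of "rev xs" "[x]"] by simp
qed simp

lemma sz_mem: "x \<in> set xs \<Longrightarrow> sz x + 2 \<le> sz (xs :: 'a::coded list)"
  by (induction xs) (auto simp: Suc_le_eq tsize_pos)

lemma sz_list_le: "(\<And>x. x \<in> set xs \<Longrightarrow> sz x \<le> k) \<Longrightarrow> sz (xs :: 'a::coded list) \<le> 1 + length xs * (k + 1)"
proof (induction xs)
  case (Cons x xs)
  have "sz x \<le> k" "sz xs \<le> 1 + length xs * (k + 1)" using Cons by auto
  then show ?case by simp
qed simp

section \<open>Polynomial bounds and the class of polynomial-time functions\<close>

text \<open>The base n + 2 is at least 2 even for n = 0, so constants, sums and products are all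
  absorbed by a larger exponent.\<close>

definition pbd :: "(nat \<Rightarrow> nat) \<Rightarrow> bool" where
  "pbd F \<longleftrightarrow> (\<exists>a. \<forall>n. F n \<le> (n + 2) ^ a)"

lemma pbd_mono: "pbd G \<Longrightarrow> (\<And>n. F n \<le> G n) \<Longrightarrow> pbd F"
  unfolding pbd_def using order_trans by blast

lemma pbd_const: "pbd (\<lambda>n. c)"
  unfolding pbd_def
proof (intro exI[of _ c] allI)
  fix n :: nat
  have "c \<le> 2 ^ c" using less_exp[of c] by simp
  also have "\<dots> \<le> (n + 2) ^ c" by (intro power_mono) auto
  finally show "c \<le> (n + 2) ^ c" .
qed

lemma pbd_id: "pbd (\<lambda>n. n)"
  unfolding pbd_def by (intro exI[of _ 1]) auto

lemma pbd_mult: "pbd F \<Longrightarrow> pbd G \<Longrightarrow> pbd (\<lambda>n. F n * G n)"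
  unfolding pbd_def
proof -
  assume "\<exists>a. \<forall>n. F n \<le> (n + 2) ^ a" "\<exists>a. \<forall>n. G n \<le> (n + 2) ^ a"
  then obtain a b where "\<forall>n. F n \<le> (n + 2) ^ a" "\<forall>n. G n \<le> (n + 2) ^ b" by auto
  then have "\<forall>n. F n * G n \<le> (n + 2) ^ (a + b)"
    by (auto simp: power_add intro!: mult_le_mono)
  then show "\<exists>a. \<forall>n. F n * G n \<le> (n + 2) ^ a" ..
qed

lemma pbd_add: "pbd F \<Longrightarrow> pbd G \<Longrightarrow> pbd (\<lambda>n. F n + G n)"
proof -
  assume "pbd F" "pbd G"
  then have "pbd (\<lambda>n. (F n + 1) * (G n + 1))" if "pbd (\<lambda>n. F n + 1)" "pbd (\<lambda>n. G n + 1)"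
    using that by (rule_tac pbd_mult)
  moreover have "pbd (\<lambda>n. H n + 1)" if H: "pbd H" for H
  proof -
    obtain a where a: "\<forall>n. H n \<le> (n + 2) ^ a" using H by (auto simp: pbd_def)
    have "H n + 1 \<le> (n + 2) ^ (a + 1)" for n
    proof -
      have "H n + 1 \<le> (n + 2) ^ a + (n + 2) ^ a"
        using a by (intro add_mono) auto
      also have "\<dots> \<le> (n + 2) ^ (a + 1)" by (simp add: algebra_simps)
      finally show ?thesis .
    qed
    then show ?thesis unfolding pbd_def by (intro exI[of _ "a + 1"] allI)
  qed
  ultimately have "pbd (\<lambda>n. (F n + 1) * (G n + 1))" using \<open>pbd F\<close> \<open>pbd G\<close> by blast
  then show ?thesis by (rule pbd_mono) auto
qed

lemma pbd_power: "pbd F \<Longrightarrow> pbd (\<lambda>n. F n ^ k)"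
proof (induction k)
  case 0
  then show ?case using pbd_const[of 1] by simp
next
  case (Suc k)
  then show ?case using pbd_mult by simp
qed

lemma pbd_Suc: "pbd F \<Longrightarrow> pbd (\<lambda>n. Suc (F n))"
  using pbd_add[OF _ pbd_const[of 1]] by simp

lemmas pbd_intros = pbd_const pbd_id pbd_add pbd_mult pbd_power pbd_Suc

text \<open>The rest \<open>m\<close> of the stack is arbitrary, which makes programs composable.
  Time and output size share one bound because composition needs both.\<close>

definition computes :: "com \<Rightarrow> ('a::coded \<Rightarrow> 'b::coded) \<Rightarrow> (nat \<Rightarrow> nat) \<Rightarrow> bool" where
  "computes c f F \<longleftrightarrow> regs_below 5 c \<and>
     (\<forall>x i m. run c (mk i (cc x @ m) [] [] []) (mk i (cc (f x) @ m) [] [] []) (F (sz x)) \<and> sz (f x) \<le> F (sz x))"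

definition FP :: "('a::coded \<Rightarrow> 'b::coded) \<Rightarrow> bool" where
  "FP f \<longleftrightarrow> (\<exists>c a. computes c f (\<lambda>n. (n + 2) ^ a))"

lemma FPI:
  assumes "regs_below 5 c"
    and "\<And>x i m. run c (mk i (cc x @ m) [] [] []) (mk i (cc (f x) @ m) [] [] []) (F (sz x))"
    and "\<And>x. sz (f x) \<le> G (sz x)" and "pbd F" "pbd G"
  shows "FP f"
proof -
  have "pbd (\<lambda>n. F n + G n)" using assms by (intro pbd_intros)
  then obtain a where a: "\<And>n. F n + G n \<le> (n + 2) ^ a" by (auto simp: pbd_def)
  have a': "F n \<le> (n + 2) ^ a" "G n \<le> (n + 2) ^ a" for n using a[of n] by linarith+
  have "computes c f (\<lambda>n. (n + 2) ^ a)"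
    unfolding computes_def
    using assms(1) run_mono[OF assms(2) a'(1)] order_trans[OF assms(3) a'(2)] by blast
  then show ?thesis unfolding FP_def by blast
qed

lemma FPE:
  assumes "FP f"
  shows "\<exists>c a. regs_below 5 c \<and>
    (\<forall>x i m. run c (mk i (cc x @ m) [] [] []) (mk i (cc (f x) @ m) [] [] []) ((sz x + 2) ^ a)) \<and>
    (\<forall>x. sz (f x) \<le> (sz x + 2) ^ a)"
  using assms unfolding FP_def computes_def by blast

lemma FP_size: "FP f \<Longrightarrow> \<exists>a. \<forall>x. sz (f x) \<le> (sz x + 2) ^ a"
  using FPE by blast

lemma FP_id: "FP (\<lambda>x. x)"
  by (rule FPI[of Skip _ "\<lambda>n. 0" "\<lambda>n. n"]) (auto intro: run_Skip pbd_intros)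

text \<open>The empty program does it; a change of type that preserves the code is free.\<close>

lemma FP_recode: "(\<And>x. code (f x) = code x) \<Longrightarrow> FP f"
  by (rule FPI[of Skip _ "\<lambda>n. 0" "\<lambda>n. n"]) (auto intro: run_Skip pbd_intros)

lemma FP_const: "FP (\<lambda>x. k)"
proof (rule FPI[of "drop_value ;; push_all (cc k)"])
  fix x :: 'a and i m
  show "run (drop_value ;; push_all (cc k)) (mk i (cc x @ m) [] [] []) (mk i (cc k @ m) [] [] [])
    ((\<lambda>n. (15 * n + 10) + 2 * length (cc k)) (sz x))"
    by (intro run_Seq[OF run_drop run_push_all])
  show "sz k \<le> (\<lambda>n. sz k) (sz x)" by simp
qed (auto intro!: pbd_intros)

lemma FP_comp:
  assumes "FP f" "FP g"
  shows "FP (\<lambda>x. g (f x))"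
proof -
  obtain c a where c: "regs_below 5 c"
    "\<And>x i m. run c (mk i (cc x @ m) [] [] []) (mk i (cc (f x) @ m) [] [] []) ((sz x + 2) ^ a)"
    "\<And>x. sz (f x) \<le> (sz x + 2) ^ a" using FPE[OF assms(1)] by blast
  obtain d b where d: "regs_below 5 d"
    "\<And>x i m. run d (mk i (cc x @ m) [] [] []) (mk i (cc (g x) @ m) [] [] []) ((sz x + 2) ^ b)"
    "\<And>x. sz (g x) \<le> (sz x + 2) ^ b" using FPE[OF assms(2)] by blast
  have b: "(sz (f x) + 2) ^ b \<le> ((sz x + 2) ^ a + 2) ^ b" for x
    using c(3)[of x] by (intro power_mono) auto
  show ?thesis
  proof (rule FPI[of "c ;; d"])
    fix x :: 'a and i m
    show "run (c ;; d) (mk i (cc x @ m) [] [] []) (mk i (cc (g (f x)) @ m) [] [] [])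
      ((\<lambda>n. (n + 2) ^ a + ((n + 2) ^ a + 2) ^ b) (sz x))"
      using run_mono[OF run_Seq[OF c(2) d(2)] add_left_mono[OF b]] by simp
    show "sz (g (f x)) \<le> (\<lambda>n. ((n + 2) ^ a + 2) ^ b) (sz x)"
      using order_trans[OF d(3) b] by simp
  qed (auto intro!: pbd_intros c d)
qed

lemma FP_Pair:
  assumes "FP f" "FP g"
  shows "FP (\<lambda>x. (f x, g x))"
proof -
  obtain c a where c: "regs_below 5 c"
    "\<And>x i m. run c (mk i (cc x @ m) [] [] []) (mk i (cc (f x) @ m) [] [] []) ((sz x + 2) ^ a)"
    "\<And>x. sz (f x) \<le> (sz x + 2) ^ a" using FPE[OF assms(1)] by blast
  obtain d b where d: "regs_below 5 d"
    "\<And>x i m. run d (mk i (cc x @ m) [] [] []) (mk i (cc (g x) @ m) [] [] []) ((sz x + 2) ^ b)"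
    "\<And>x. sz (g x) \<le> (sz x + 2) ^ b" using FPE[OF assms(2)] by blast
  let ?F = "\<lambda>n. (40 * n + 10) + (n + 2) ^ a + (20 * ((n + 2) ^ a + n) + 10) + (n + 2) ^ b
      + (20 * ((n + 2) ^ b + (n + 2) ^ a) + 10) + 2"
  show ?thesis
  proof (rule FPI[of "dup ;; c ;; swap ;; d ;; swap ;; Push 1 One" _ ?F "\<lambda>n. 1 + (n + 2) ^ a + (n + 2) ^ b"])
    fix x :: 'a and i m
    have "run (dup ;; c ;; swap ;; d ;; swap ;; Push 1 One) (mk i (cc x @ m) [] [] [])
      (mk i (cc (f x, g x) @ m) [] [] [])
      ((40 * sz x + 10) + (sz x + 2) ^ a + (20 * (sz (f x) + sz x) + 10) + (sz x + 2) ^ b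
      + (20 * (sz (g x) + sz (f x)) + 10) + 2)"
      by (rule run_Seq run_dup c(2) run_swap d(2) run_Push)+ (auto)
    then show "run (dup ;; c ;; swap ;; d ;; swap ;; Push 1 One) (mk i (cc x @ m) [] [] [])
      (mk i (cc (f x, g x) @ m) [] [] []) (?F (sz x))"
      using c(3)[of x] d(3)[of x] by (elim run_mono) (simp add: algebra_simps)
    show "sz (f x, g x) \<le> (\<lambda>n. 1 + (n + 2) ^ a + (n + 2) ^ b) (sz x)" using c(3)[of x] d(3)[of x] by simp
  qed (auto intro!: pbd_intros c d)
qed

lemma FP_fst': "FP (\<lambda>p. fst p)"
proof (rule FPI[of "Pop 1 ;; swap ;; drop_value" _ "\<lambda>n. 1 + (20 * n + 10) + (15 * n + 10)" "\<lambda>n. n"])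
  fix p :: "'a \<times> 'b" and i m
  obtain x y where p: "p = (x, y)" by force
  have 1: "run (Pop 1) (mk i (cc p @ m) [] [] []) (mk i (cc x @ cc y @ m) [] [] []) 1"
    by (rule run_Pop) (auto simp: p)
  have "run (Pop 1 ;; swap ;; drop_value) (mk i (cc p @ m) [] [] []) (mk i (cc (fst p) @ m) [] [] [])
      (1 + (20 * (sz x + sz y) + 10) + (15 * sz y + 10))"
    using run_Seq[OF run_Seq[OF 1 run_swap] run_drop] by (simp add: p)
  then show "run (Pop 1 ;; swap ;; drop_value) (mk i (cc p @ m) [] [] []) (mk i (cc (fst p) @ m) [] [] [])
      ((\<lambda>n. 1 + (20 * n + 10) + (15 * n + 10)) (sz p))"
    by (elim run_mono) (simp add: p)
qed (auto intro!: pbd_intros)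

lemma FP_snd': "FP (\<lambda>p. snd p)"
proof (rule FPI[of "Pop 1 ;; drop_value" _ "\<lambda>n. 1 + (15 * n + 10)" "\<lambda>n. n"])
  fix p :: "'a \<times> 'b" and i m
  obtain x y where p: "p = (x, y)" by force
  have 1: "run (Pop 1) (mk i (cc p @ m) [] [] []) (mk i (cc x @ cc y @ m) [] [] []) 1"
    by (rule run_Pop) (auto simp: p)
  have "run (Pop 1 ;; drop_value) (mk i (cc p @ m) [] [] []) (mk i (cc (snd p) @ m) [] [] [])
      (1 + (15 * sz x + 10))"
    using run_Seq[OF 1 run_drop] by (simp add: p)
  then show "run (Pop 1 ;; drop_value) (mk i (cc p @ m) [] [] []) (mk i (cc (snd p) @ m) [] [] [])
      ((\<lambda>n. 1 + (15 * n + 10)) (sz p))"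
    by (elim run_mono) (simp add: p)
qed (auto intro!: pbd_intros)

lemma FP_if:
  assumes "FP p" "FP f" "FP g"
  shows "FP (\<lambda>x. if p x then f x else g x)"
proof -
  obtain e l where e: "regs_below 5 e"
    "\<And>x i m. run e (mk i (cc x @ m) [] [] []) (mk i (cc (p x) @ m) [] [] []) ((sz x + 2) ^ l)"
    "\<And>x. sz (p x) \<le> (sz x + 2) ^ l" using FPE[OF assms(1)] by blast
  obtain c a where c: "regs_below 5 c"
    "\<And>x i m. run c (mk i (cc x @ m) [] [] []) (mk i (cc (f x) @ m) [] [] []) ((sz x + 2) ^ a)"
    "\<And>x. sz (f x) \<le> (sz x + 2) ^ a" using FPE[OF assms(2)] by blast
  obtain d b where d: "regs_below 5 d"
    "\<And>x i m. run d (mk i (cc x @ m) [] [] []) (mk i (cc (g x) @ m) [] [] []) ((sz x + 2) ^ b)"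
    "\<And>x. sz (g x) \<le> (sz x + 2) ^ b" using FPE[OF assms(3)] by blast
  \<comment> \<open>\<open>True\<close> occupies three symbols and \<open>False\<close> one, hence
    three pops in one branch and a single pop in the other.\<close>
  let ?c = "dup ;; e ;; Cond 1 (\<lambda>x. x = One) (Pop 1 ;; Pop 1 ;; Pop 1 ;; c) (Pop 1 ;; d)"
  let ?F = "\<lambda>n. (40 * n + 10) + (n + 2) ^ l + (1 + 1 + 1 + (n + 2) ^ a + (n + 2) ^ b + 2)"
  show ?thesis
  proof (rule FPI[of ?c _ ?F "\<lambda>n. (n + 2) ^ a + (n + 2) ^ b"])
    fix x :: 'a and i m
    have 1: "run (dup ;; e) (mk i (cc x @ m) [] [] []) (mk i (cc (p x) @ cc x @ m) [] [] [])
        ((40 * sz x + 10) + (sz x + 2) ^ l)"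
      by (rule run_Seq run_dup e(2))+
    have 2: "run (Cond 1 (\<lambda>x. x = One) (Pop 1 ;; Pop 1 ;; Pop 1 ;; c) (Pop 1 ;; d))
        (mk i (cc (p x) @ cc x @ m) [] [] []) (mk i (cc (if p x then f x else g x) @ m) [] [] [])
        (1 + 1 + 1 + (sz x + 2) ^ a + (sz x + 2) ^ b + 2)"
    proof (cases "p x")
      case True
      have "run (Pop 1 ;; Pop 1 ;; Pop 1 ;; c) (mk i (cc (p x) @ cc x @ m) [] [] [])
          (mk i (cc (if p x then f x else g x) @ m) [] [] []) (1 + 1 + 1 + (sz x + 2) ^ a)"
        unfolding if_P[OF True]
        by (intro run_Seq[OF run_Seq[OF run_Seq[OF run_Pop run_Pop] run_Pop] c(2)]) (auto simp: True)
      from run_CondT[OF _ this] show ?thesis by (rule run_mono) (simp_all add: True)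
    next
      case False
      have "run (Pop 1 ;; d) (mk i (cc (p x) @ cc x @ m) [] [] [])
          (mk i (cc (if p x then f x else g x) @ m) [] [] []) (1 + (sz x + 2) ^ b)"
        unfolding if_not_P[OF False] by (intro run_Seq[OF run_Pop d(2)]) (auto simp: False)
      from run_CondF[OF _ this] show ?thesis by (rule run_mono) (simp_all add: False)
    qed
    from run_Seq[OF 1 2] show "run ?c (mk i (cc x @ m) [] [] []) (mk i (cc (if p x then f x else g x) @ m) [] [] []) (?F (sz x))"
      by simp
    show "sz (if p x then f x else g x) \<le> (\<lambda>n. (n + 2) ^ a + (n + 2) ^ b) (sz x)"
      using c(3)[of x] d(3)[of x] by simp
  qed (auto intro!: pbd_intros c d e)
qed

text \<open>Once \<open>l x\<close> lies on top of a saved copy of x, a swap and one pushed symbol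
  produce the code of (x, (y, ys)), because a nonempty list is coded like the pair of its head and
  tail.\<close>

lemma FP_case_list:
  assumes "FP l" "FP n" "FP (\<lambda>p. c (fst p) (fst (snd p)) (snd (snd p)))"
  shows "FP (\<lambda>x. case l x of [] \<Rightarrow> n x | y # ys \<Rightarrow> c x y ys)"
proof -
  obtain e w where e: "regs_below 5 e"
    "\<And>x i m. run e (mk i (cc x @ m) [] [] []) (mk i (cc (l x) @ m) [] [] []) ((sz x + 2) ^ w)"
    "\<And>x. sz (l x) \<le> (sz x + 2) ^ w" using FPE[OF assms(1)] by blast
  obtain nc b where d: "regs_below 5 nc"
    "\<And>x i m. run nc (mk i (cc x @ m) [] [] []) (mk i (cc (n x) @ m) [] [] []) ((sz x + 2) ^ b)"
    "\<And>x. sz (n x) \<le> (sz x + 2) ^ b" using FPE[OF assms(2)] by blast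
  let ?f = "\<lambda>p. c (fst p) (fst (snd p)) (snd (snd p))"
  obtain cp a where c: "regs_below 5 cp"
    "\<And>x i m. run cp (mk i (cc x @ m) [] [] []) (mk i (cc (?f x) @ m) [] [] []) ((sz x + 2) ^ a)"
    "\<And>x. sz (?f x) \<le> (sz x + 2) ^ a" using FPE[OF assms(3)] by blast
  let ?c = "dup ;; e ;; Cond 1 (\<lambda>x. x = One) (swap ;; Push 1 One ;; cp) (Pop 1 ;; nc)"
  let ?F = "\<lambda>n. (40 * n + 10) + (n + 2) ^ w +
     (20 * ((n + 2) ^ w + n) + 10 + 2 + ((n + 2) ^ w + n + 1 + 2) ^ a + 1 + (n + 2) ^ b + 2)"
  let ?r = "\<lambda>x. case l x of [] \<Rightarrow> n x | y # ys \<Rightarrow> c x y ys"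
  show ?thesis
  proof (rule FPI[of ?c _ ?F "\<lambda>n. ((n + 2) ^ w + n + 1 + 2) ^ a + (n + 2) ^ b"])
    fix x :: 'a and i m
    have 1: "run (dup ;; e) (mk i (cc x @ m) [] [] []) (mk i (cc (l x) @ cc x @ m) [] [] [])
        ((40 * sz x + 10) + (sz x + 2) ^ w)"
      by (rule run_Seq run_dup e(2))+
    have 2: "run (Cond 1 (\<lambda>x. x = One) (swap ;; Push 1 One ;; cp) (Pop 1 ;; nc))
        (mk i (cc (l x) @ cc x @ m) [] [] []) (mk i (cc (?r x) @ m) [] [] [])
        (20 * ((sz x + 2) ^ w + sz x) + 10 + 2 + ((sz x + 2) ^ w + sz x + 1 + 2) ^ a + 1 + (sz x + 2) ^ b + 2)"
    proof (cases "l x")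
      case Nil
      have "run (Pop 1 ;; nc) (mk i (cc (l x) @ cc x @ m) [] [] []) (mk i (cc (n x) @ m) [] [] []) (1 + (sz x + 2) ^ b)"
        unfolding Nil by (intro run_Seq[OF run_Pop d(2)]) auto
      moreover have "?r x = n x" by (simp add: Nil)
      ultimately show ?thesis
        by (simp only:) (rule run_mono[OF run_CondF[where n = "1 + (sz x + 2) ^ b"]], simp add: Nil, assumption, linarith)
    next
      case (Cons y ys)
      have "run (swap ;; Push 1 One ;; cp) (mk i (cc (l x) @ cc x @ m) [] [] [])
          (mk i (cc (?f (x, (y, ys))) @ m) [] [] []) ((20 * (sz (l x) + sz x) + 10) + 2 + (sz (x, l x) + 2) ^ a)"
        using c(2)[of i "(x, (y, ys))" m] unfolding Cons
        by (intro run_Seq[OF run_Seq[OF run_swap run_Push]]) auto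
      from run_CondT[OF _ this] have "run (Cond 1 (\<lambda>x. x = One) (swap ;; Push 1 One ;; cp) (Pop 1 ;; nc))
        (mk i (cc (l x) @ cc x @ m) [] [] []) (mk i (cc (?r x) @ m) [] [] [])
        ((20 * (sz (l x) + sz x) + 10) + 2 + (sz (x, l x) + 2) ^ a + 2)" by (simp add: Cons)
      moreover have "(sz (x, l x) + 2) ^ a \<le> ((sz x + 2) ^ w + sz x + 1 + 2) ^ a"
        using e(3)[of x] by (intro power_mono) auto
      moreover have "A \<le> A' \<Longrightarrow> L \<le> W \<Longrightarrow> 20 * (L + s) + 10 + 2 + A + 2 \<le> 20 * (W + s) + 10 + 2 + A' + 1 + B + 2"
        for A A' L W s B :: nat by simp
      ultimately show ?thesis
        using e(3)[of x] by (elim run_mono) blast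
    qed
    from run_Seq[OF 1 2] show "run ?c (mk i (cc x @ m) [] [] []) (mk i (cc (?r x) @ m) [] [] []) (?F (sz x))"
      by simp
    have "sz (c x y ys) \<le> ((sz x + 2) ^ w + sz x + 1 + 2) ^ a" if "l x = y # ys" for y ys
    proof -
      have "sz (c x y ys) \<le> (sz (x, l x) + 2) ^ a" using c(3)[of "(x, (y, ys))"] that by simp
      also have "\<dots> \<le> ((sz x + 2) ^ w + sz x + 1 + 2) ^ a"
        using e(3)[of x] by (intro power_mono) auto
      finally show ?thesis .
    qed
    then show "sz (?r x) \<le> (\<lambda>n. ((n + 2) ^ w + n + 1 + 2) ^ a + (n + 2) ^ b) (sz x)"
      using d(3)[of x] by (auto split: list.split intro: trans_le_add1 trans_le_add2)
  qed (auto intro!: pbd_intros c d e)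
qed

text \<open>Replacing each symbol of the code by the two symbols of one successor yields the length
  in unary.\<close>

lemma FP_size_of': "FP (\<lambda>x. sz x)"
proof -
  let ?t = "transfer 2 (\<lambda>x. Push 1 Zero ;; Push 1 One)"
  let ?c = "move 2 ;; Push 1 Zero ;; ?t"
  have st: "run (Push (Suc 0) Zero ;; Push (Suc 0) One) (mk i m a b c) (mk i (One # Zero # m) a b c) 4" for i m a b c
    by (rule run_mono[OF run_Seq[OF run_push1 run_push1]]) simp
  have "cc (length zs) @ m = concat (map (\<lambda>_. [One, Zero]) zs) @ Zero # m" for zs m :: "sym list"
    by (induction zs) auto
  note len = this[symmetric]
  show ?thesis
  proof (rule FPI[of ?c _ "\<lambda>n. (10 * n + 3) + 2 + ((4 + 5) * n + 1)" "\<lambda>n. 2 * n + 1"])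
    fix x :: 'a and i m
    let ?c = "cc x"
    have 1: "run (move 2) (mk i (?c @ m) [] [] []) (mk i m (rev ?c) [] []) (10 * sz x + 3)"
      using run_move2[of i "code x" m "[]" "[]"] by simp
    have "run ?t (mk i (Zero # m) (rev ?c) [] []) (mk i (concat (map (\<lambda>_. [One, Zero]) ?c) @ Zero # m) [] [] [])
      ((4 + 5) * length (rev ?c) + 1)"
      using run_transfer[where S = "\<lambda>xs zs. mk i (concat (map (\<lambda>_. [One, Zero]) zs) @ Zero # m) xs [] []"
          and xs = "rev ?c" and zs = "[]" and k = 4 and r = 2 and f = "\<lambda>x. Push 1 Zero ;; Push 1 One"]
        st set_tcode[of "code x"] by auto
    then have 2: "run ?t (mk i (Zero # m) (rev ?c) [] []) (mk i (cc (sz x) @ m) [] [] []) ((4 + 5) * sz x + 1)"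
      using len[of ?c m] by (simp add: length_tcode)
    have "run (Push 1 Zero) (mk i m (rev ?c) [] []) (mk i (Zero # m) (rev ?c) [] []) 2"
      using run_push1 by simp
    from run_Seq[OF run_Seq[OF 1 this] 2]
    show "run (move 2 ;; Push 1 Zero ;; ?t) (mk i (?c @ m) [] [] []) (mk i (cc (sz x) @ m) [] [] [])
      ((\<lambda>n. (10 * n + 3) + 2 + ((4 + 5) * n + 1)) (sz x))" by simp
  qed (auto intro!: pbd_intros simp: transfer_def)
qed

text \<open>Register 4 holds the verdict so far. The loop never stops early, so register 2 is empty
  afterwards in any case.\<close>

definition compare_loop :: com where
  "compare_loop = While 2 (\<lambda>x. x \<noteq> Blank)
     (Cond 2 (\<lambda>x. x = One)
       (Pop 2 ;; Cond 3 (\<lambda>x. x = One) (Pop 3) (Pop 3 ;; Pop 4 ;; Push 4 Zero))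
       (Pop 2 ;; Cond 3 (\<lambda>x. x = Zero) (Pop 3) (Pop 3 ;; Pop 4 ;; Push 4 Zero)))"

lemma run_compare_loop:
  assumes "set as \<subseteq> {Zero, One}" "v = One \<or> v = Zero"
  shows "run compare_loop (mk i m as bs [v])
    (mk i m [] (drop (length as) bs) [if v = One \<and> take (length as) bs = as then One else Zero])
    (15 * length as + 1)"
  using assms
proof (induction as arbitrary: bs v)
  case Nil
  have "run compare_loop (mk i m [] bs [v]) (mk i m [] bs [v]) 1"
    unfolding compare_loop_def by (rule run_WhileF) simp
  then show ?case using Nil by auto
next
  case (Cons x as)
  let ?v = "if v = One \<and> top_of bs = x then One else Zero"
  have inner: "run (Pop 2 ;; Cond 3 (\<lambda>y. y = x) (Pop 3) (Pop 3 ;; Pop 4 ;; Push 4 Zero))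
      (mk i m (x # as) bs [v]) (mk i m as (tl bs) [?v]) (1 + (1 + 1 + 2 + 2))"
  proof (rule run_Seq[OF run_Pop])
    show "run (Cond 3 (\<lambda>y. y = x) (Pop 3) (Pop 3 ;; Pop 4 ;; Push 4 Zero))
      (mk i m as bs [v]) (mk i m as (tl bs) [?v]) (1 + 1 + 2 + 2)"
    proof (cases "top_of bs = x")
      case True
      have "run (Pop 3) (mk i m as bs [v]) (mk i m as (tl bs) [?v]) 1"
        using True Cons.prems(2) by (intro run_Pop) auto
      then show ?thesis by (intro run_mono[OF run_CondT[where n = 1]]) (use True in simp_all)
    next
      case False
      have "run (Pop 3 ;; Pop 4 ;; Push 4 Zero) (mk i m as bs [v]) (mk i m as (tl bs) [?v]) (1 + 1 + 2)"
        using False by (intro run_Seq[OF run_Seq[OF run_Pop run_Pop] run_Push]) auto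
      then show ?thesis by (intro run_mono[OF run_CondF[where n = "1 + 1 + 2"]]) (use False in simp_all)
    qed
  qed auto
  have body: "run (Cond 2 (\<lambda>x. x = One)
       (Pop 2 ;; Cond 3 (\<lambda>x. x = One) (Pop 3) (Pop 3 ;; Pop 4 ;; Push 4 Zero))
       (Pop 2 ;; Cond 3 (\<lambda>x. x = Zero) (Pop 3) (Pop 3 ;; Pop 4 ;; Push 4 Zero)))
      (mk i m (x # as) bs [v]) (mk i m as (tl bs) [?v]) (1 + (1 + 1 + 2 + 2) + 2)"
  proof (cases "x = One")
    case True
    show ?thesis by (rule run_CondT) (use inner True in simp_all)
  next
    case False
    then have "x = Zero" using Cons.prems by auto
    then show ?thesis by - (rule run_CondF, use inner in simp_all)
  qed
  have IH: "run compare_loop (mk i m as (tl bs) [?v])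
    (mk i m [] (drop (length as) (tl bs)) [if ?v = One \<and> take (length as) (tl bs) = as then One else Zero])
    (15 * length as + 1)"
    using Cons.prems by (intro Cons.IH) auto
  have fin: "drop (length as) (tl bs) = drop (length (x # as)) bs"
    "(if ?v = One \<and> take (length as) (tl bs) = as then One else Zero) =
     (if v = One \<and> take (length (x # as)) bs = x # as then One else Zero)"
    using Cons.prems by (cases bs; auto)+
  show ?case unfolding compare_loop_def
    by (rule run_mono[OF run_WhileT[OF _ body IH[unfolded compare_loop_def fin]]]) (use Cons.prems in auto)
qed

definition compare_values :: com where
  "compare_values = Pop 1 ;; move 2 ;; move 3 ;; Push 4 One ;; compare_loop ;;
     transfer 3 (\<lambda>x. Pop 4 ;; Push 4 Zero) ;;
     Cond 4 (\<lambda>x. x = One) (Pop 4 ;; Push 1 Zero ;; Push 1 Zero ;; Push 1 One) (Pop 4 ;; Push 1 Zero)"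

text \<open>The reversed codes are compared symbol by symbol. A remainder of the second word also
  means inequality; clearing it and recording this happen in the same pass.\<close>

lemma FP_eq': "FP (\<lambda>p. fst p = snd p)"
proof (rule FPI[of compare_values _ "\<lambda>n. 1 + (10 * n + 3) + (10 * n + 3) + 2 + (15 * n + 1) + ((3 + 5) * n + 1)
    + (1 + 2 + 2 + 2 + 2)" "\<lambda>n. 3"])
  fix p :: "'a \<times> 'a" and i m
  obtain x y where p: "p = (x, y)" by force
  let ?a = "rev (cc x)" and ?b = "rev (cc y)"
  let ?v = "if take (length ?a) ?b = ?a then One else Zero"
  let ?w = "if x = y then One else Zero"
  have w: "(if drop (length ?a) ?b = [] then ?v else Zero) = ?w"
  proof -
    have "drop (length ?a) ?b = [] \<and> take (length ?a) ?b = ?a \<longleftrightarrow> x = y"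
    proof
      assume *: "drop (length ?a) ?b = [] \<and> take (length ?a) ?b = ?a"
      then have "?b = ?a" by (metis append_Nil2 append_take_drop_id)
      then show "x = y" by (simp add: tcode_inj code_eq_iff)
    qed simp
    then show ?thesis by auto
  qed
  have 1: "run (Pop 1) (mk i (cc p @ m) [] [] []) (mk i (cc x @ cc y @ m) [] [] []) 1"
    by (rule run_Pop) (auto simp: p)
  have 2: "run (move 2) (mk i (cc x @ cc y @ m) [] [] []) (mk i (cc y @ m) ?a [] []) (10 * sz x + 3)"
    using run_move2[of i "code x" "cc y @ m" "[]" "[]"] by simp
  have 3: "run (move 3) (mk i (cc y @ m) ?a [] []) (mk i m ?a ?b []) (10 * sz y + 3)"
    using run_move3[of i "code y" m ?a "[]"] by simp
  have 4: "run (Push 4 One) (mk i m ?a ?b []) (mk i m ?a ?b [One]) 2"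
    by (rule run_Push) auto
  have 5: "run compare_loop (mk i m ?a ?b [One]) (mk i m [] (drop (length ?a) ?b) [?v]) (15 * sz x + 1)"
    using run_compare_loop[of ?a One i m ?b] set_tcode[of "code x"] by (simp add: length_tcode)
  have st: "run (Pop 4 ;; Push 4 Zero) (mk i m a b [v]) (mk i m a b [Zero]) 3" for i m a b v
    by (rule run_mono[OF run_Seq[OF run_Pop[where n = 1] run_Push[where n = 2]]]) auto
  have "set (drop (length ?a) ?b) \<subseteq> {Zero, One}"
    using set_tcode[of "code y"] set_drop_subset[of "length ?a" ?b] by auto
  then have "run (transfer 3 (\<lambda>x. Pop 4 ;; Push 4 Zero)) (mk i m [] (drop (length ?a) ?b) [?v])
    (mk i m [] [] [if drop (length ?a) ?b = [] then ?v else Zero]) ((3 + 5) * length (drop (length ?a) ?b) + 1)"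
    using run_transfer[where S = "\<lambda>xs zs. mk i m [] xs [if zs = [] then ?v else Zero]"
        and xs = "drop (length ?a) ?b" and zs = "[]" and k = 3 and r = 3 and f = "\<lambda>x. Pop 4 ;; Push 4 Zero"]
      st by auto
  then have 6: "run (transfer 3 (\<lambda>x. Pop 4 ;; Push 4 Zero)) (mk i m [] (drop (length ?a) ?b) [?v])
    (mk i m [] [] [?w]) ((3 + 5) * sz y + 1)"
    unfolding w by (rule run_mono) (simp add: length_tcode)
  have 7: "run (Cond 4 (\<lambda>x. x = One) (Pop 4 ;; Push 1 Zero ;; Push 1 Zero ;; Push 1 One) (Pop 4 ;; Push 1 Zero))
    (mk i m [] [] [?w]) (mk i (cc (x = y) @ m) [] [] []) (1 + 2 + 2 + 2 + 2)"
  proof (cases "x = y")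
    case True
    have "run (Pop 4 ;; Push 1 Zero ;; Push 1 Zero ;; Push 1 One) (mk i m [] [] [?w])
       (mk i (One # Zero # Zero # m) [] [] []) (1 + 2 + 2 + 2)"
      by (intro run_Seq[OF run_Seq[OF run_Seq[OF run_Pop run_Push] run_Push] run_Push]) auto
    then show ?thesis by (intro run_mono[OF run_CondT[where n = "1 + 2 + 2 + 2"]]) (use True in simp_all)
  next
    case False
    have "run (Pop 4 ;; Push 1 Zero) (mk i m [] [] [?w]) (mk i (Zero # m) [] [] []) (1 + 2)"
      by (intro run_Seq[OF run_Pop run_Push]) auto
    then show ?thesis by (intro run_mono[OF run_CondF[where n = "1 + 2"]]) (use False in simp_all)
  qed
  show "run compare_values (mk i (cc p @ m) [] [] []) (mk i (cc (fst p = snd p) @ m) [] [] [])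
    ((\<lambda>n. 1 + (10 * n + 3) + (10 * n + 3) + 2 + (15 * n + 1) + ((3 + 5) * n + 1) + (1 + 2 + 2 + 2 + 2)) (sz p))"
    using run_Seq[OF run_Seq[OF run_Seq[OF run_Seq[OF run_Seq[OF run_Seq[OF 1 2] 3] 4] 5] 6] 7]
    unfolding compare_values_def p fst_conv snd_conv by (rule run_mono) simp
  show "sz (fst p = snd p) \<le> (\<lambda>n. 3) (sz p)" using sz_bool_le by simp
qed (auto intro!: pbd_intros simp: compare_values_def compare_loop_def transfer_def)

subsection \<open>Closure under bounded iteration\<close>

named_theorems fp

lemma FP_comp2:
  assumes "FP f" "FP g" "FP (\<lambda>p. h (fst p) (snd p))"
  shows "FP (\<lambda>x. h (f x) (g x))"
  using FP_comp[OF FP_Pair[OF assms(1,2)] assms(3)] by simp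

lemmas FP_fst [fp] = FP_comp[OF _ FP_fst']
lemmas FP_snd [fp] = FP_comp[OF _ FP_snd']
lemmas FP_eq [fp] = FP_comp2[OF _ _ FP_eq']
lemmas FP_size_of [fp] = FP_comp[OF _ FP_size_of']
lemmas [fp] = FP_id FP_const FP_Pair FP_if FP_case_list

lemma FP_Cons [fp]:
  assumes "FP f" "FP g"
  shows "FP (\<lambda>x. f x # g x)"
proof -
  have "FP (\<lambda>p :: 'b \<times> 'b list. fst p # snd p)"
    by (rule FP_recode) auto
  from FP_comp2[OF assms, of "\<lambda>x y. x # y"] this show ?thesis by simp
qed

lemma FP_Let [fp]: "FP f \<Longrightarrow> FP (\<lambda>p. g (fst p) (snd p)) \<Longrightarrow> FP (\<lambda>x. let y = f x in g x y)"
  using FP_comp2[OF FP_id, of f g] by simp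

lemma FP_case_prod [fp]: "FP (\<lambda>x. g x (fst (f x)) (snd (f x))) \<Longrightarrow> FP (\<lambda>x. case f x of (a, b) \<Rightarrow> g x a b)"
  by (simp add: split_beta)

lemma FP_conj [fp]: "FP f \<Longrightarrow> FP g \<Longrightarrow> FP (\<lambda>x. f x \<and> g x)"
proof -
  assume "FP f" "FP g"
  then have "FP (\<lambda>x. if f x then g x else False)" by (intro fp)
  then show ?thesis by (rule back_subst[of FP]) auto
qed

lemma FP_disj [fp]: "FP f \<Longrightarrow> FP g \<Longrightarrow> FP (\<lambda>x. f x \<or> g x)"
proof -
  assume "FP f" "FP g"
  then have "FP (\<lambda>x. if f x then True else g x)" by (intro fp)
  then show ?thesis by (rule back_subst[of FP]) auto
qed

lemma FP_not [fp]: "FP f \<Longrightarrow> FP (\<lambda>x. \<not> f x)"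
proof -
  assume "FP f"
  then have "FP (\<lambda>x. if f x then False else True)" by (intro fp)
  then show ?thesis by (rule back_subst[of FP]) auto
qed

lemma FP_imp [fp]: "FP f \<Longrightarrow> FP g \<Longrightarrow> FP (\<lambda>x. f x \<longrightarrow> g x)"
proof -
  assume "FP f" "FP g"
  then have "FP (\<lambda>x. if f x then g x else True)" by (intro fp)
  then show ?thesis by (rule back_subst[of FP]) auto
qed

text \<open>The list lies on top of the accumulator. Pushing \<open>One\<close> fuses the two codes
  into that of a pair for the body, popping it separates them again; an empty list shows
  \<open>Zero\<close> and ends the loop.\<close>

definition loop :: "com \<Rightarrow> com" where
  "loop c = While 1 (\<lambda>x. x = One) (Push 1 One ;; c ;; Pop 1)"

lemma run_loop:
  assumes c: "\<And>x i m. run c (mk i (cc x @ m) [] [] [])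
      (mk i (cc (case fst x of [] \<Rightarrow> x | y # ys \<Rightarrow> (ys, G y (snd x))) @ m) [] [] []) ((sz x + 2) ^ a)"
    and "\<And>us vs. l = us @ vs \<Longrightarrow> sz (vs, fold G us z) \<le> S"
  shows "run (loop c) (mk i (cc l @ cc z @ m) [] [] []) (mk i (Zero # cc (fold G l z) @ m) [] [] [])
    (length l * ((S + 2) ^ a + 5) + 1)"
  using assms(2)
proof (induction l arbitrary: z)
  case Nil
  show ?case unfolding loop_def by (simp, rule run_WhileF[THEN run_mono]) auto
next
  case (Cons y l)
  have 1: "run (Push 1 One) (mk i (cc (y # l) @ cc z @ m) [] [] []) (mk i (cc (y # l, z) @ m) [] [] []) 2"
    by (rule run_Push) auto
  have 2: "run c (mk i (cc (y # l, z) @ m) [] [] []) (mk i (cc (l, G y z) @ m) [] [] []) ((sz (y # l, z) + 2) ^ a)"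
    using c[of i "(y # l, z)" m] by simp
  have 3: "run (Pop 1) (mk i (cc (l, G y z) @ m) [] [] []) (mk i (cc l @ cc (G y z) @ m) [] [] []) 1"
    by (rule run_Pop) auto
  have le: "(sz (y # l, z) + 2) ^ a \<le> (S + 2) ^ a"
    using Cons.prems[of "[]" "y # l"] by (intro power_mono) auto
  have body: "run (Push 1 One ;; c ;; Pop 1) (mk i (cc (y # l) @ cc z @ m) [] [] [])
      (mk i (cc l @ cc (G y z) @ m) [] [] []) (2 + (S + 2) ^ a + 1)"
    by (rule run_mono[OF run_Seq[OF run_Seq[OF 1 2] 3]]) (use le in simp)
  have IH: "run (loop c) (mk i (cc l @ cc (G y z) @ m) [] [] []) (mk i (Zero # cc (fold G l (G y z)) @ m) [] [] [])
    (length l * ((S + 2) ^ a + 5) + 1)"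
  proof (rule Cons.IH)
    fix us vs assume "l = us @ vs"
    then show "sz (vs, fold G us (G y z)) \<le> S" using Cons.prems[of "y # us" vs] by simp
  qed
  have "run (loop c) (mk i (cc (y # l) @ cc z @ m) [] [] []) (mk i (Zero # cc (fold G l (G y z)) @ m) [] [] [])
    (2 + (S + 2) ^ a + 1 + (length l * ((S + 2) ^ a + 5) + 1) + 2)"
    using IH body unfolding loop_def by (intro run_WhileT) auto
  moreover have "fold G (y # l) z = fold G l (G y z)" by simp
  ultimately show ?case by (simp only:) (erule run_mono, simp)
qed

text \<open>The accumulator may grow, so iteration preserves polynomial time only if the values
  after all prefixes of the list obey one polynomial bound.\<close>

lemma FP_fold_gen:
  assumes "FP (\<lambda>p. G (fst p) (snd p))" "FP l" "FP z"
    and bound: "\<And>x us vs. l x = us @ vs \<Longrightarrow> sz (fold G us (z x)) \<le> (sz x + k) ^ b"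
  shows "FP (\<lambda>x. fold G (l x) (z x))"
proof -
  have "FP (\<lambda>x. case fst x of [] \<Rightarrow> x | y # ys \<Rightarrow> (ys, G y (snd x)))"
    by (intro fp FP_comp2[OF _ _ assms(1)])
  from FPE[OF this] obtain c a where c: "regs_below 5 c"
    "\<And>x i m. run c (mk i (cc x @ m) [] [] [])
      (mk i (cc (case fst x of [] \<Rightarrow> x | y # ys \<Rightarrow> (ys, G y (snd x))) @ m) [] [] []) ((sz x + 2) ^ a)"
    by blast
  from FPE[OF FP_Pair[OF assms(2,3)]] obtain d e where d: "regs_below 5 d"
    "\<And>x i m. run d (mk i (cc x @ m) [] [] []) (mk i (cc (l x, z x) @ m) [] [] []) ((sz x + 2) ^ e)"
    "\<And>x. sz (l x, z x) \<le> (sz x + 2) ^ e" by blast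
  define S where "S = (\<lambda>n. (n + 2) ^ e + 1 + (n + k) ^ b)"
  have lz: "sz (l x) \<le> (sz x + 2) ^ e" for x using d(3)[of x] by simp
  show ?thesis
  proof (rule FPI[of "d ;; Pop 1 ;; loop c ;; Pop 1" _
        "\<lambda>n. (n + 2) ^ e + 1 + ((n + 2) ^ e * ((S n + 2) ^ a + 5) + 1) + 1" "\<lambda>n. (n + k) ^ b"])
    fix x i m
    have 1: "run (Pop 1) (mk i (cc (l x, z x) @ m) [] [] []) (mk i (cc (l x) @ cc (z x) @ m) [] [] []) 1"
      by (rule run_Pop) auto
    have 2: "run (loop c) (mk i (cc (l x) @ cc (z x) @ m) [] [] []) (mk i (Zero # cc (fold G (l x) (z x)) @ m) [] [] [])
      (length (l x) * ((S (sz x) + 2) ^ a + 5) + 1)"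
    proof (rule run_loop[OF c(2)])
      fix us vs assume *: "l x = us @ vs"
      then have "sz vs \<le> sz (l x)" using sz_append[of us vs] tsize_pos[of "code us"] by simp
      then show "sz (vs, fold G us (z x)) \<le> S (sz x)"
        using bound[OF *] lz[of x] by (simp add: S_def)
    qed
    have 3: "run (Pop 1) (mk i (Zero # cc (fold G (l x) (z x)) @ m) [] [] []) (mk i (cc (fold G (l x) (z x)) @ m) [] [] []) 1"
      by (rule run_Pop) auto
    have "length (l x) \<le> (sz x + 2) ^ e" using length_le_sz[of "l x"] lz[of x] by linarith
    then have len: "length (l x) * ((S (sz x) + 2) ^ a + 5) \<le> (sz x + 2) ^ e * ((S (sz x) + 2) ^ a + 5)"
      by (rule mult_right_mono) simp
    show "run (d ;; Pop 1 ;; loop c ;; Pop 1) (mk i (cc x @ m) [] [] []) (mk i (cc (fold G (l x) (z x)) @ m) [] [] [])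
      ((\<lambda>n. (n + 2) ^ e + 1 + ((n + 2) ^ e * ((S n + 2) ^ a + 5) + 1) + 1) (sz x))"
      by (rule run_mono[OF run_Seq[OF run_Seq[OF run_Seq[OF d(2) 1] 2] 3]]) (use len in simp)
    show "sz (fold G (l x) (z x)) \<le> (\<lambda>n. (n + k) ^ b) (sz x)" using bound[of x "l x" "[]"] by simp
  qed (auto intro!: pbd_intros simp: c d loop_def S_def)
qed

lemma fold_with_context: "fold (\<lambda>y p. (g (snd p) y (fst p), snd p)) ys (z, x) = (fold (g x) ys z, x)"
  by (induction ys arbitrary: z) auto

text \<open>The step may use the argument x of the whole computation, because x travels along inside
  the accumulator.\<close>

lemma FP_fold:
  assumes g: "FP (\<lambda>p. g (fst p) (fst (snd p)) (snd (snd p)))" and l: "FP l" and z: "FP z"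
    and bound: "\<And>x us vs. l x = us @ vs \<Longrightarrow> sz (fold (g x) us (z x)) \<le> (sz x + k) ^ b"
  shows "FP (\<lambda>x. fold (g x) (l x) (z x))"
proof -
  let ?G = "\<lambda>y p. (g (snd p) y (fst p), snd p)"
  have "FP (\<lambda>x. fold ?G (l x) (z x, x))"
  proof (rule FP_fold_gen[where k = "k + 2" and b = "b + 1"])
    have "FP (\<lambda>p. (snd (snd p), (fst p, fst (snd p))) :: 'a \<times> 'b \<times> 'c)" by (intro fp)
    from FP_comp[OF this g] show "FP (\<lambda>p. (g (snd (snd p)) (fst p) (fst (snd p)), snd (snd p)))"
      by (intro fp) simp
    show "FP (\<lambda>x. (z x, x))" by (intro fp z)
    fix x us vs assume *: "l x = us @ vs"
    have "sz (fold ?G us (z x, x)) = 1 + sz (fold (g x) us (z x)) + sz x"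
      by (simp add: fold_with_context)
    also have "\<dots> \<le> 1 + (sz x + k + 2) ^ b + sz x"
      using order_trans[OF bound[OF *] power_mono[of "sz x + k" "sz x + k + 2" b]] by simp
    also have "\<dots> \<le> (sz x + k + 2) ^ b + (sz x + 1) * (sz x + k + 2) ^ b"
    proof -
      have "1 \<le> (sz x + k + 2) ^ b" by simp
      then have "(sz x + 1) * 1 \<le> (sz x + 1) * (sz x + k + 2) ^ b" by (intro mult_left_mono) auto
      then show ?thesis by simp
    qed
    also have "\<dots> = (sz x + 2) * (sz x + k + 2) ^ b" by simp
    also have "\<dots> \<le> (sz x + k + 2) * (sz x + k + 2) ^ b" by (intro mult_right_mono) auto
    finally show "sz (fold ?G us (z x, x)) \<le> (sz x + (k + 2)) ^ (b + 1)" by (simp add: add.assoc)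
  qed (rule l)
  from FP_fst[OF this] show ?thesis by (simp add: fold_with_context)
qed

text \<open>The form of the rule that covers almost all uses: each step adds to the size an amount that does
  not depend on the accumulated value.\<close>

lemma FP_fold_inc:
  assumes g: "FP (\<lambda>p. g (fst p) (fst (snd p)) (snd (snd p)))" and l: "FP l" and z: "FP z"
    and inc: "\<And>x y acc. sz (g x y acc) \<le> sz acc + (sz x + sz y + k) ^ b"
  shows "FP (\<lambda>x. fold (g x) (l x) (z x))"
proof -
  obtain al where al: "\<And>x. sz (l x) \<le> (sz x + 2) ^ al" using FP_size[OF l] by blast
  obtain az where az: "\<And>x. sz (z x) \<le> (sz x + 2) ^ az" using FP_size[OF z] by blast
  have "pbd (\<lambda>n. (n + 2) ^ az + (n + 2) ^ al * (n + (n + 2) ^ al + k) ^ b)"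
    by (intro pbd_intros)
  then obtain c where c: "\<And>n. (n + 2) ^ az + (n + 2) ^ al * (n + (n + 2) ^ al + k) ^ b \<le> (n + 2) ^ c"
    by (auto simp: pbd_def)
  show ?thesis
  proof (rule FP_fold[OF g l z, where k = 2 and b = c])
    fix x us vs assume *: "l x = us @ vs"
    let ?Q = "(sz x + sz (l x) + k) ^ b"
    have "set us' \<subseteq> set (l x) \<Longrightarrow> sz (fold (g x) us' a) \<le> sz a + length us' * ?Q" for us' a
    proof (induction us' arbitrary: a)
      case (Cons y us')
      have "sz y \<le> sz (l x)" using Cons.prems sz_mem[of y "l x"] by simp
      then have "(sz x + sz y + k) ^ b \<le> ?Q" by (intro power_mono) auto
      then have "sz (g x y a) \<le> sz a + ?Q" using inc[of x y a] by linarith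
      moreover have "sz (fold (g x) us' (g x y a)) \<le> sz (g x y a) + length us' * ?Q"
        using Cons by simp
      ultimately show ?case by simp
    qed simp
    from this[of us "z x"] * have "sz (fold (g x) us (z x)) \<le> sz (z x) + length us * ?Q" by simp
    also have "\<dots> \<le> (sz x + 2) ^ az + (sz x + 2) ^ al * (sz x + (sz x + 2) ^ al + k) ^ b"
    proof (intro add_mono mult_mono az power_mono)
      have "length us \<le> length (l x)" using * by simp
      also have "\<dots> \<le> sz (l x)" using length_le_sz[of "l x"] by linarith
      also have "\<dots> \<le> (sz x + 2) ^ al" by (rule al)
      finally show "length us \<le> (sz x + 2) ^ al" .
    qed (use al in auto)
    also have "\<dots> \<le> (sz x + 2) ^ c" by (rule c)
    finally show "sz (fold (g x) us (z x)) \<le> (sz x + 2) ^ c" .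
  qed
qed

text \<open>Iteration cut off at values of size above \<open>N\<close>; it is polynomial-time without any assumption on the
  growth of the iterates.\<close>

definition tfold :: "nat \<Rightarrow> 'b \<Rightarrow> ('a \<Rightarrow> 'b \<Rightarrow> 'b::coded) \<Rightarrow> 'a list \<Rightarrow> 'b \<Rightarrow> 'b" where
  "tfold N d g = fold (\<lambda>y acc. let a = g y acc in if N < sz a then d else a)"

text \<open>For a large enough threshold the cut-off never takes effect; the exponential padding
  will supply that threshold.\<close>

lemma tfold_eq_fold:
  assumes "\<And>us vs. l = us @ vs \<Longrightarrow> sz (fold g us z) \<le> N"
  shows "tfold N d g l z = fold g l z"
  using assms
proof (induction l arbitrary: z)
  case (Cons y l)
  have "sz (g y z) \<le> N" using Cons.prems[of "[y]" l] by simp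
  moreover have "tfold N d g l (g y z) = fold g l (g y z)"
  proof (rule Cons.IH)
    fix us vs assume "l = us @ vs"
    then show "sz (fold g us (g y z)) \<le> N" using Cons.prems[of "y # us" vs] by simp
  qed
  ultimately show ?case by (simp add: tfold_def)
qed (simp add: tfold_def)

subsection \<open>Natural numbers and lists\<close>

lemma code_replicate_unit: "code (replicate n ()) = code n"
  by (induction n) auto

text \<open>A number and a list of that many units have equal codes, so arithmetic is inherited from
  list processing.\<close>

lemma FP_units: "FP (f :: 'a::coded \<Rightarrow> nat) \<Longrightarrow> FP (\<lambda>x. replicate (f x) ())"
  using FP_comp[OF _ FP_recode, of f "\<lambda>n. replicate n ()"] code_replicate_unit by blast

lemma code_length_unit: "code (length (xs :: unit list)) = code xs"
  by (induction xs) auto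

lemma FP_length_unit: "FP f \<Longrightarrow> FP (\<lambda>x. length (f x :: unit list))"
  using FP_comp[OF _ FP_recode, of f length] code_length_unit by blast

lemma FP_Suc [fp]: "FP f \<Longrightarrow> FP (\<lambda>x. Suc (f x))"
proof -
  assume "FP f"
  then have "FP (\<lambda>x. length (() # replicate (f x) ()))"
    by (intro FP_length_unit fp FP_units)
  then show ?thesis by simp
qed

lemma FP_pred:
  fixes f :: "'a::coded \<Rightarrow> nat"
  assumes "FP f"
  shows "FP (\<lambda>x. f x - 1)"
proof -
  have "FP (\<lambda>x. length (case replicate (f x) () of [] \<Rightarrow> [] | y # ys \<Rightarrow> ys))"
    by (intro FP_length_unit fp FP_units assms)
  moreover have "length (case replicate n () of [] \<Rightarrow> [] | y # ys \<Rightarrow> ys) = n - 1" for n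
    by (cases n) auto
  ultimately show ?thesis by simp
qed

lemma fold_replicate: "fold (\<lambda>y. f) (replicate n u) z = (f ^^ n) z"
  by (induction n arbitrary: z) (auto simp: funpow_swap1)

lemma FP_iter_inc:
  fixes g :: "'a::coded \<Rightarrow> 'b::coded \<Rightarrow> 'b"
  assumes "FP (\<lambda>p. g (fst p) (snd p))" "FP n" "FP z"
    and "\<And>x acc. sz (g x acc) \<le> sz acc + (sz x + k) ^ b"
  shows "FP (\<lambda>x. (g x ^^ n x) (z x))"
proof -
  have "FP (\<lambda>x. fold (\<lambda>y. g x) (replicate (n x) ()) (z x))"
  proof (rule FP_fold_inc[where k = k and b = b])
    show "FP (\<lambda>p. g (fst p) (snd (snd p)))" by (intro fp FP_comp2[OF _ _ assms(1)])
    fix x :: 'a and acc :: 'b and y :: unit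
    have "(sz x + k) ^ b \<le> (sz x + sz y + k) ^ b" by (intro power_mono) auto
    then show "sz (g x acc) \<le> sz acc + (sz x + sz y + k) ^ b" using assms(4)[of x acc] by linarith
  qed (intro FP_units assms)+
  then show ?thesis by (simp add: fold_replicate)
qed

lemma FP_plus [fp]: "FP f \<Longrightarrow> FP g \<Longrightarrow> FP (\<lambda>x. f x + g x :: nat)"
proof -
  assume fg: "FP f" "FP g"
  have "FP (\<lambda>x. (Suc ^^ f x) (g x))"
    by (rule FP_iter_inc[where k = 2 and b = 1]) ((intro fp fg; fail) | simp)+
  then show ?thesis by (simp add: add.commute)
qed

lemma funpow_pred: "((\<lambda>n. n - 1) ^^ k) n = n - (k::nat)"
  by (induction k) auto

lemma FP_minus [fp]: "FP f \<Longrightarrow> FP g \<Longrightarrow> FP (\<lambda>x. f x - g x :: nat)"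
proof -
  assume fg: "FP f" "FP g"
  have "FP (\<lambda>x. ((\<lambda>n. n - 1) ^^ g x) (f x))"
    by (rule FP_iter_inc[where k = 2 and b = 1]) ((intro fp fg FP_pred; fail) | simp)+
  then show ?thesis by (simp only: funpow_pred)
qed

lemma FP_le [fp]: "FP f \<Longrightarrow> FP g \<Longrightarrow> FP (\<lambda>x. f x \<le> (g x :: nat))"
proof -
  assume fg: "FP f" "FP g"
  have "FP (\<lambda>x. f x - g x = 0)" by (intro fp fg)
  then show ?thesis by simp
qed

lemma FP_less [fp]: "FP f \<Longrightarrow> FP g \<Longrightarrow> FP (\<lambda>x. f x < (g x :: nat))"
proof -
  assume fg: "FP f" "FP g"
  have "FP (\<lambda>x. Suc (f x) \<le> g x)" by (intro fp fg)
  then show ?thesis by (simp add: Suc_le_eq)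
qed

text \<open>Every value after the first is either of size at most N or equal to d, so the growth
  condition for folding holds whatever the step does.\<close>

lemma FP_tfold [fp]:
  assumes N: "FP N" and d: "FP d" and g: "FP (\<lambda>p. g (fst p) (fst (snd p)) (snd (snd p)))"
    and l: "FP l" and z: "FP z"
  shows "FP (\<lambda>x. tfold (N x) (d x) (g x) (l x) (z x))"
proof -
  obtain aN where aN: "\<And>x. sz (N x) \<le> (sz x + 2) ^ aN" using FP_size[OF N] by blast
  obtain ad where ad: "\<And>x. sz (d x) \<le> (sz x + 2) ^ ad" using FP_size[OF d] by blast
  obtain az where az: "\<And>x. sz (z x) \<le> (sz x + 2) ^ az" using FP_size[OF z] by blast
  have "pbd (\<lambda>n. (n + 2) ^ aN + (n + 2) ^ ad + (n + 2) ^ az)"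
    by (intro pbd_intros)
  then obtain c where c: "\<And>n :: nat. (n + 2) ^ aN + (n + 2) ^ ad + (n + 2) ^ az \<le> (n + 2) ^ c"
    by (auto simp: pbd_def)
  show ?thesis unfolding tfold_def
  proof (rule FP_fold[OF _ l z, where k = 2 and b = c])
    show "FP (\<lambda>p. let a = g (fst p) (fst (snd p)) (snd (snd p)) in if N (fst p) < sz a then d (fst p) else a)"
      by (intro fp N d FP_comp[OF _ N] FP_comp[OF _ d] g)
    fix x us vs
    show "sz (fold (\<lambda>y acc. let a = g x y acc in if N x < sz a then d x else a) us (z x)) \<le> (sz x + 2) ^ c"
    proof (cases us rule: rev_cases)
      case Nil
      then show ?thesis using az[of x] c[of "sz x"] by simp
    next
      case (snoc us' y)
      then show ?thesis using aN[of x] ad[of x] c[of "sz x"] by (auto simp: Let_def)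
    qed
  qed
qed

lemma FP_times [fp]: "FP f \<Longrightarrow> FP g \<Longrightarrow> FP (\<lambda>x. f x * g x :: nat)"
proof -
  assume fg: "FP f" "FP g"
  obtain a where a: "\<And>x. sz (g x) \<le> (sz x + 2) ^ a" using FP_size[OF fg(2)] by blast
  have "FP (\<lambda>x. (((\<lambda>n. n + g x) ^^ f x) 0))"
  proof (rule FP_iter_inc[where k = 2 and b = a])
    show "FP (\<lambda>p. snd p + g (fst p))" by (intro fp FP_comp[OF _ fg(2)])
    show "sz (acc + g x) \<le> sz acc + (sz x + 2) ^ a" for x and acc :: nat using a[of x] by simp
  qed (intro fp fg)+
  moreover have "((\<lambda>n. n + b) ^^ k) 0 = k * (b::nat)" for b k by (induction k) auto
  ultimately show ?thesis by simp
qed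

text \<open>A counter with carry. For n = 0 a carry never occurs, in accordance with division by
  zero.\<close>

definition divmod_step :: "nat \<Rightarrow> nat \<times> nat \<Rightarrow> nat \<times> nat" where
  "divmod_step n p = (if Suc (snd p) = n then (Suc (fst p), 0) else (fst p, Suc (snd p)))"

lemma divmod_step_iter: "(divmod_step n ^^ m) (0, 0) = (m div n, m mod n)"
proof (induction m)
  case (Suc m)
  show ?case
  proof (cases "n = 0")
    case True then show ?thesis using Suc by (simp add: divmod_step_def)
  next
    case False
    then have "m mod n < n" by simp
    show ?thesis
    proof (cases "Suc (m mod n) = n")
      case True
      then show ?thesis using Suc by (simp add: divmod_step_def div_Suc mod_Suc)
    next
      case False
      then show ?thesis using Suc by (simp add: divmod_step_def div_Suc mod_Suc)
    qed
  qed
qed simp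

lemma FP_divmod: "FP f \<Longrightarrow> FP g \<Longrightarrow> FP (\<lambda>x. (f x div g x, f x mod (g x :: nat)))"
proof -
  assume fg: "FP f" "FP g"
  have "FP (\<lambda>x. (divmod_step (g x) ^^ f x) (0, 0))"
  proof (rule FP_iter_inc[where k = 2 and b = 1])
    show "FP (\<lambda>p. divmod_step (g (fst p)) (snd p))" unfolding divmod_step_def
      by (intro fp FP_comp[OF _ fg(2)])
    show "sz (divmod_step (g x) acc) \<le> sz acc + (sz x + 2) ^ 1" for x acc
      by (cases acc) (simp add: divmod_step_def)
  qed (intro fp fg)+
  then show ?thesis by (simp add: divmod_step_iter)
qed

lemma FP_div [fp]: "FP f \<Longrightarrow> FP g \<Longrightarrow> FP (\<lambda>x. f x div (g x :: nat))"
  using FP_fst[OF FP_divmod] by simp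

lemma FP_mod [fp]: "FP f \<Longrightarrow> FP g \<Longrightarrow> FP (\<lambda>x. f x mod (g x :: nat))"
  using FP_snd[OF FP_divmod] by simp

lemma pow_slack: "1 + (n + 3) ^ a \<le> (n + 3) ^ Suc (a :: nat)" for n :: nat
proof -
  have "1 \<le> (n + 3) ^ a" by simp
  then have "1 + (n + 3) ^ a \<le> 2 * (n + 3) ^ a" by linarith
  also have "\<dots> \<le> (n + 3) * (n + 3) ^ a" by (intro mult_right_mono) auto
  finally show ?thesis by simp
qed

lemma FP_rev [fp]: "FP l \<Longrightarrow> FP (\<lambda>x. rev (l x))"
proof -
  assume l: "FP l"
  have "FP (\<lambda>x. fold (\<lambda>y acc. y # acc) (l x) [])"
    by (rule FP_fold_inc[where k = 1 and b = 1]) ((intro fp l; fail) | simp)+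
  then show ?thesis by (simp add: fold_Cons_rev)
qed

lemma FP_append [fp]: "FP l \<Longrightarrow> FP l' \<Longrightarrow> FP (\<lambda>x. l x @ l' x)"
proof -
  assume l: "FP l" "FP l'"
  have "FP (\<lambda>x. fold (\<lambda>y acc. y # acc) (rev (l x)) (l' x))"
    by (rule FP_fold_inc[where k = 1 and b = 1]) ((intro fp l; fail) | simp)+
  then show ?thesis by (simp add: fold_Cons_rev)
qed

lemma FP_map [fp]:
  assumes g: "FP (\<lambda>p. g (fst p) (snd p))" and l: "FP l"
  shows "FP (\<lambda>x. map (g x) (l x))"
proof -
  obtain a where a: "\<And>p. sz (g (fst p) (snd p)) \<le> (sz p + 2) ^ a" using FP_size[OF g] by blast
  have "FP (\<lambda>x. fold (\<lambda>y acc. g x y # acc) (l x) [])"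
  proof (rule FP_fold_inc[where k = 3 and b = "Suc a"])
    show "FP (\<lambda>p. g (fst p) (fst (snd p)) # snd (snd p))" by (intro fp FP_comp2[OF _ _ g])
    fix x y acc
    show "sz (g x y # acc) \<le> sz acc + (sz x + sz y + 3) ^ Suc a"
      using a[of "(x, y)"] pow_slack[of "sz x + sz y" a] by (simp add: numeral_3_eq_3)
  qed (intro fp l)+
  then have "FP (\<lambda>x. rev (fold (\<lambda>y acc. g x y # acc) (l x) []))" by (intro fp)
  moreover have "rev (fold (\<lambda>y acc. g x y # acc) ys zs) = rev zs @ map (g x) ys" for x ys zs
    by (induction ys arbitrary: zs) auto
  ultimately show ?thesis by simp
qed

lemma FP_filter [fp]:
  assumes g: "FP (\<lambda>p. P (fst p) (snd p))" and l: "FP l"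
  shows "FP (\<lambda>x. filter (P x) (l x))"
proof -
  have "FP (\<lambda>x. fold (\<lambda>y acc. if P x y then y # acc else acc) (l x) [])"
    by (rule FP_fold_inc[where k = 1 and b = "1"]) ((intro fp l FP_comp2[OF _ _ g]; fail) | simp)+
  then have "FP (\<lambda>x. rev (fold (\<lambda>y acc. if P x y then y # acc else acc) (l x) []))" by (intro fp)
  moreover have "rev (fold (\<lambda>y acc. if P x y then y # acc else acc) ys zs) = rev zs @ filter (P x) ys" for x ys zs
    by (induction ys arbitrary: zs) auto
  ultimately show ?thesis by simp
qed

lemma FP_concat [fp]:
  assumes l: "FP l"
  shows "FP (\<lambda>x. concat (l x))"
proof -
  have "FP (\<lambda>x. fold (\<lambda>y acc. rev y @ acc) (l x) [])"
  proof (rule FP_fold_inc[where k = 1 and b = "1"])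
    show "sz (rev y @ acc) \<le> sz acc + (sz x + sz y + 1) ^ 1" for x :: 'a and y acc :: "'b list"
      using sz_append[of "rev y" acc] by (simp add: sz_rev)
  qed (intro fp l)+
  then have "FP (\<lambda>x. rev (fold (\<lambda>y acc. rev y @ acc) (l x) []))" by (intro fp)
  moreover have "rev (fold (\<lambda>y acc. rev y @ acc) ys zs) = rev zs @ concat ys" for ys and zs :: "'b list"
    by (induction ys arbitrary: zs) auto
  ultimately show ?thesis by simp
qed

lemma FP_length [fp]: "FP l \<Longrightarrow> FP (\<lambda>x. length (l x))"
proof -
  assume l: "FP l"
  have "FP (\<lambda>x. length (map (\<lambda>y. ()) (l x)))"
    by (intro FP_length_unit fp l)
  then show ?thesis by simp
qed

lemma FP_list_ex [fp]:
  assumes g: "FP (\<lambda>p. P (fst p) (snd p))" and l: "FP l"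
  shows "FP (\<lambda>x. list_ex (P x) (l x))"
proof -
  have "FP (\<lambda>x. filter (P x) (l x) \<noteq> [])" by (intro fp g l)
  then show ?thesis by (simp add: list_ex_iff filter_empty_conv)
qed

lemma FP_list_all [fp]:
  assumes g: "FP (\<lambda>p. P (fst p) (snd p))" and l: "FP l"
  shows "FP (\<lambda>x. list_all (P x) (l x))"
proof -
  have "FP (\<lambda>x. filter (\<lambda>y. \<not> P x y) (l x) = [])" by (intro fp g l)
  then show ?thesis by (simp add: list_all_iff filter_empty_conv)
qed

lemma FP_member [fp]:
  assumes "FP f" "FP l"
  shows "FP (\<lambda>x. f x \<in> set (l x))"
proof -
  have "FP (\<lambda>x. list_ex (\<lambda>y. f x = y) (l x))" by (intro fp assms FP_comp[OF _ assms(1)])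
  then show ?thesis by (simp add: list_ex_iff)
qed

lemma FP_drop [fp]:
  assumes "FP f" "FP l"
  shows "FP (\<lambda>x. drop (f x) (l x))"
proof -
  have "FP (\<lambda>x. ((\<lambda>ys. case ys of [] \<Rightarrow> [] | y # ys \<Rightarrow> ys) ^^ f x) (l x))"
    by (rule FP_iter_inc[where k = 1 and b = "1"]) ((intro fp assms; fail) | (simp split: list.split))+
  moreover have "((\<lambda>ys. case ys of [] \<Rightarrow> [] | y # ys \<Rightarrow> ys) ^^ k) ys = drop k ys" for k and ys :: "'b list"
    by (induction k arbitrary: ys) (auto simp: funpow_Suc_right simp del: funpow.simps(2) split: list.split)
  ultimately show ?thesis by simp
qed

definition nthd :: "'a \<Rightarrow> 'a list \<Rightarrow> nat \<Rightarrow> 'a" where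
  "nthd d xs i = (case drop i xs of [] \<Rightarrow> d | y # ys \<Rightarrow> y)"

lemma nthd_nth: "i < length xs \<Longrightarrow> nthd d xs i = xs ! i"
  by (simp add: nthd_def Cons_nth_drop_Suc[symmetric])

lemma FP_nthd [fp]: "FP d \<Longrightarrow> FP l \<Longrightarrow> FP f \<Longrightarrow> FP (\<lambda>x. nthd (d x) (l x) (f x))"
  unfolding nthd_def by (intro fp) 

lemma FP_replicate [fp]: "FP f \<Longrightarrow> FP g \<Longrightarrow> FP (\<lambda>x. replicate (f x) (g x))"
proof -
  assume fg: "FP f" "FP g"
  have "FP (\<lambda>x. map (\<lambda>y. g x) (replicate (f x) ()))" by (intro fp FP_units fg FP_comp[OF _ fg(2)])
  then show ?thesis by (simp add: map_replicate_const)
qed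

lemma FP_upt [fp]: "FP f \<Longrightarrow> FP (\<lambda>x. [0..<f x])"
proof -
  assume f: "FP f"
  let ?g = "\<lambda>(y::unit) (acc :: nat list). length acc # acc"
  have r: "fold ?g ys [] = rev [0..<length ys]" for ys
    by (induction ys rule: rev_induct) auto
  obtain a where a: "\<And>x. sz (f x) \<le> (sz x + 2) ^ a" using FP_size[OF f] by blast
  have "FP (\<lambda>x. fold ?g (replicate (f x) ()) [])"
  proof (rule FP_fold)
    fix x us vs assume "replicate (f x) () = us @ vs"
    then have "f x = length us + length vs" by (metis length_append length_replicate)
    then have us: "length us \<le> f x" by simp
    have "sz [0..<length us] \<le> 1 + length us * (sz (f x) + 1)"
      using us by (intro order_trans[OF sz_list_le[where k = "sz (f x)"]]) auto
    also have "\<dots> \<le> 1 + sz (f x) * (sz (f x) + 1)"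
      using us by (intro add_mono mult_mono) auto
    also have "\<dots> \<le> 3 * sz (f x) * sz (f x)" by (simp add: algebra_simps)
    also have "\<dots> \<le> (sz x + 3) * (sz x + 3) ^ a * (sz x + 3) ^ a"
      using order_trans[OF a power_mono[of "sz x + 2" "sz x + 3" a]] by (intro mult_mono) auto
    finally show "sz (fold ?g us []) \<le> (sz x + 3) ^ (1 + a + a)"
      unfolding r sz_rev by (simp add: power_add mult.assoc)
  qed (intro fp FP_units f)+
  then have "FP (\<lambda>x. rev (fold ?g (replicate (f x) ()) []))" by (intro fp)
  then show ?thesis by (simp only: r rev_rev_ident length_replicate)
qed

lemma FP_zip [fp]:
  assumes "FP l" "FP l'"
  shows "FP (\<lambda>x. zip (l x) (l' x))"
proof -
  let ?g = "\<lambda>a p. case fst p of [] \<Rightarrow> p | b # bs \<Rightarrow> (bs, (a, b) # snd p)"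
  have "FP (\<lambda>x. fold ?g (l x) (l' x, []))"
  proof (rule FP_fold_inc[where k = 3 and b = 1])
    show "sz (?g y acc) \<le> sz acc + (sz x + sz y + 3) ^ 1" for x :: 'a and y :: 'b and acc :: "'c list \<times> ('b \<times> 'c) list"
      by (cases acc) (auto split: list.split)
  qed (intro fp assms)+
  then have "FP (\<lambda>x. rev (snd (fold ?g (l x) (l' x, []))))" by (intro fp)
  moreover have "rev (snd (fold ?g as (bs, cs))) = rev cs @ zip as bs" for as :: "'b list" and bs :: "'c list" and cs
  proof (induction as arbitrary: bs cs)
    case (Cons a as)
    show ?case
    proof (cases bs)
      case Nil
      have "fold ?g as ([], cs) = ([], cs)" for as by (induction as) auto
      then show ?thesis by (simp add: Nil)
    next
      case (Cons b bs')
      then show ?thesis using Cons.IH by simp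
    qed
  qed simp
  ultimately show ?thesis by simp
qed

subsection \<open>Machines with exponential padding\<close>

definition dispatch :: "nat \<Rightarrow> (sym \<Rightarrow> com) \<Rightarrow> com" where
  "dispatch r f = While r (\<lambda>x. x \<noteq> Blank)
     (Cond r (\<lambda>x. x = Zero) (Pop r ;; f Zero) (Cond r (\<lambda>x. x = One) (Pop r ;; f One)
       (Cond r (\<lambda>x. x = LPar) (Pop r ;; f LPar) (Pop r ;; f RPar))))"

lemma run_dispatch:
  assumes "Blank \<notin> set xs"
    and S: "\<And>ys zs. S ys zs r = ys"
    and step: "\<And>y ys zs. run (f y) ((S (y # ys) zs)(r := ys)) (S ys (y # zs)) k"
  shows "run (dispatch r f) (S xs zs) (S [] (rev xs @ zs)) ((k + 10) * length xs + 1)"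
  using assms(1)
proof (induction xs arbitrary: zs)
  case Nil
  have "run (dispatch r f) (S [] zs) (S [] zs) 1"
    unfolding dispatch_def by (rule run_WhileF) (simp add: S)
  then show ?case by simp
next
  case (Cons x xs)
  have b: "run (Pop r ;; f x) (S (x # xs) zs) (S xs (x # zs)) (1 + k)"
    by (intro run_Seq[OF run_Pop step]) (auto simp: S)
  have t: "top_of (S (x # xs) zs r) = x" by (simp add: S)
  have "run (Cond r (\<lambda>x. x = Zero) (Pop r ;; f Zero) (Cond r (\<lambda>x. x = One) (Pop r ;; f One)
       (Cond r (\<lambda>x. x = LPar) (Pop r ;; f LPar) (Pop r ;; f RPar)))) (S (x # xs) zs) (S xs (x # zs)) (1 + k + 2 + 2 + 2)"
  proof (cases x)
    case Blank
    then show ?thesis using Cons.prems by simp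
  next
    case Zero
    show ?thesis
      by (rule run_mono[OF run_CondT[where n = "1 + k"]]) (use b t Zero in simp_all)
  next
    case One
    show ?thesis
      by (rule run_mono[OF run_CondF[OF _ run_CondT[where n = "1 + k"]]]) (use b t One in simp_all)
  next
    case LPar
    show ?thesis
      by (rule run_mono[OF run_CondF[OF _ run_CondF[OF _ run_CondT[where n = "1 + k"]]]]) (use b t LPar in simp_all)
  next
    case RPar
    show ?thesis
      by (rule run_mono[OF run_CondF[OF _ run_CondF[OF _ run_CondF[where n = "1 + k"]]]]) (use b t RPar in simp_all)
  qed
  moreover have "run (dispatch r f) (S xs (x # zs)) (S [] (rev xs @ x # zs)) ((k + 10) * length xs + 1)"
    using Cons by auto
  ultimately have "run (dispatch r f) (S (x # xs) zs) (S [] (rev xs @ x # zs))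
      ((1 + k + 2 + 2 + 2) + ((k + 10) * length xs + 1) + 2)"
    unfolding dispatch_def using Cons.prems by (intro run_WhileT) (auto simp: S)
  then show ?case by (auto intro: run_mono)
qed

text \<open>Lists are built from their end, hence the first pass, which reverses the input.\<close>

definition load_input :: com where
  "load_input = dispatch 0 (\<lambda>x. Push 2 x) ;; Push 1 Zero ;; dispatch 2 (\<lambda>x. push_all (One # cc x))"

lemma run_push_all': "run (push_all w) (mk i m a b c) (mk i (w @ m) a b c) (2 * length w)"
proof (induction w)
  case Nil
  then show ?case by (auto simp: push_all_def intro: run_Skip)
next
  case (Cons x w)
  have "run (push_all w ;; Push 1 x) (mk i m a b c) (mk i ((x # w) @ m) a b c) (2 * length w + 2)"
    by (rule run_Seq[OF Cons run_Push]) auto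
  then show ?case by (simp add: push_all_def)
qed

lemma run_load_input:
  assumes "Blank \<notin> set w"
  shows "run load_input (mk w [] [] [] []) (mk [] (cc w) [] [] []) (42 * length w + 4)"
proof -
  have 1: "run (dispatch 0 (\<lambda>x. Push 2 x)) (mk w [] [] [] []) (mk [] [] (rev w) [] []) ((2 + 10) * length w + 1)"
    using run_dispatch[where S = "\<lambda>xs zs. mk xs [] zs [] []" and r = 0 and f = "\<lambda>x. Push 2 x" and k = 2
        and zs = "[]", OF assms] run_push2 by simp
  have "run (Push 1 Zero) (mk [] [] (rev w) [] []) (mk [] [Zero] (rev w) [] []) 2"
    by (rule run_Push) auto
  note 1 = run_Seq[OF 1 this]
  have st: "run (push_all (One # cc x)) (mk i m a b c) (mk i (One # cc x @ m) a b c) 20" for x :: sym and i m a b c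
    using run_mono[OF run_push_all'[of "One # cc x" i m a b c], of 20] sz_sym_le[of x] by (simp add: length_tcode)
  have "run (dispatch 2 (\<lambda>x. push_all (One # cc x))) (mk [] [Zero] (rev w) [] []) (mk [] (cc w) [] [] [])
      ((20 + 10) * length (rev w) + 1)"
    using run_dispatch[where S = "\<lambda>xs zs. mk [] (cc zs) xs [] []" and r = 2 and xs = "rev w"
        and f = "\<lambda>x. push_all (One # cc x)" and k = 20 and zs = "[]"] st assms by simp
  from run_Seq[OF 1 this] show ?thesis unfolding load_input_def by (rule run_mono) simp
qed

lemma sz_word_le: "sz (w :: sym list) \<le> 10 * length w + 1"
  using sz_list_le[of w 9] sz_sym_le by simp

lemma fold_double: "fold (\<lambda>y p. (fst p + fst p, snd p)) us (c, w) = (c * 2 ^ length us, w :: 'a)" for c :: nat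
  by (induction us arbitrary: c) (auto simp: algebra_simps)

lemma le_two_power: "(n::nat) \<le> 2 ^ n"
  using less_exp[of n] by simp

text \<open>The exponent E depends on D alone; \<open>prm\<close> and \<open>c\<close> are wired
  into the program and, like \<open>h\<close>, affect only K. This order of quantifiers later
  permits an \<open>h\<close> that is small compared with 1/E.\<close>

theorem padded_machine:
  fixes D :: "'p::coded \<times> nat \<times> sym list \<Rightarrow> bool"
  assumes "FP D"
  shows "\<exists>E. \<forall>prm c h. FP h \<longrightarrow> (\<exists>M K. turing_machine M \<and> (\<forall>w. Blank \<notin> set w \<longrightarrow>
    (\<exists>t \<le> K * (length w + 2) ^ K * 2 ^ (h w * E).
       halts_with M w t [if D (prm, c * 2 ^ h w, w) then One else Zero])))"
proof -
  from FPE[OF assms] obtain cD e where cD: "regs_below 5 cD"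
    "\<And>x i m. run cD (mk i (cc x @ m) [] [] []) (mk i (cc (D x) @ m) [] [] []) ((sz x + 2) ^ e)" by blast
  \<comment> \<open>The padding arises from c by doubling, once for each unit in a list of length
    \<open>h w\<close>.\<close>
  let ?G = "\<lambda>(y::unit) (p::nat \<times> sym list). (fst p + fst p, snd p)"
  have "FP (\<lambda>x. case fst x of [] \<Rightarrow> x | y # ys \<Rightarrow> (ys, ?G y (snd x)))"
    by (intro fp)
  from FPE[OF this] obtain cG a where cG: "regs_below 5 cG"
    "\<And>x i m. run cG (mk i (cc x @ m) [] [] [])
      (mk i (cc (case fst x of [] \<Rightarrow> x | y # ys \<Rightarrow> (ys, ?G y (snd x))) @ m) [] [] []) ((sz x + 2) ^ a)"
    by blast
  show ?thesis
  \<comment> \<open>With X = 2^(h w), the doubling loop has at most X rounds of degree a in X, and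
    the procedure itself has degree e.\<close>
  proof (intro exI[of _ "a + 1 + e"] allI impI)
    fix prm :: 'p and c :: nat and h :: "sym list \<Rightarrow> nat"
    assume h: "FP h"
    have "FP (\<lambda>w. (replicate (h w) (), (c, w)))" by (intro fp FP_units h)
    from FPE[OF this] obtain cf b where cf: "regs_below 5 cf"
      "\<And>x i m. run cf (mk i (cc x @ m) [] [] []) (mk i (cc (replicate (h x) (), (c, x)) @ m) [] [] []) ((sz x + 2) ^ b)"
      by blast
    define prog where "prog = load_input ;; cf ;; Pop 1 ;; loop cG ;; Pop 1 ;; push_all (One # cc prm) ;; cD"
    have regs: "regs_below 5 prog"
      using cf(1) cD(1) cG(1) by (simp add: prog_def load_input_def dispatch_def loop_def)
    define k where "k = 2 * c + 40 + sz prm"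
    define K where "K = 50 + 10 ^ b + 7 * k ^ a + 2 * k + k ^ e + b + a + e + 1"
    have main: "\<exists>t \<le> K * (length w + 2) ^ K * 2 ^ (h w * (a + 1 + e)).
       halts_with (machine 5 (compile 0 prog)) w t [if D (prm, c * 2 ^ h w, w) then One else Zero]"
      if w: "Blank \<notin> set w" for w
    proof -
      define L X where "L = length w + 2" and "X = (2::nat) ^ h w"
      have X1: "1 \<le> X" "h w \<le> X" using le_two_power by (auto simp: X_def)
      have L2: "2 \<le> L" by (simp add: L_def)
      have LX: "L \<le> L * X" "X \<le> L * X" using X1 L2 by auto
      let ?p = "c * 2 ^ h w"
      have 1: "run load_input (mk w [] [] [] []) (mk [] (cc w) [] [] []) (42 * length w + 4)"
        by (rule run_load_input[OF w])
      have 2: "run cf (mk [] (cc w) [] [] []) (mk [] (cc (replicate (h w) (), (c, w))) [] [] []) ((sz w + 2) ^ b)"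
        using cf(2)[of "[]" w "[]"] by simp
      have 3: "run (Pop 1) (mk [] (cc (replicate (h w) (), (c, w))) [] [] [])
          (mk [] (cc (replicate (h w) ()) @ cc (c, w) @ []) [] [] []) 1"
        by (rule run_Pop) auto
      have szb: "sz (vs, fold ?G us (c, w)) + 2 \<le> k * L * X" if "replicate (h w) () = us @ vs" for us vs
      proof -
        have hl: "h w = length us + length vs" using that by (metis length_append length_replicate)
        have "sz (vs, fold ?G us (c, w)) = 2 * length vs + 2 * (c * 2 ^ length us) + sz w + 4"
          using sz_nat[of "length vs"] code_length_unit[of vs] by (simp add: fold_double)
        also have "\<dots> \<le> 2 * X + 2 * (c * X) + (10 * length w + 1) + 4"
        proof -
          have "length vs \<le> X" using hl X1 by simp
          moreover have "(2::nat) ^ length us \<le> X" unfolding X_def by (rule power_increasing) (use hl in auto)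
          ultimately show ?thesis using sz_word_le[of w] by (intro add_mono mult_le_mono) auto
        qed
        also have "\<dots> + 2 \<le> 2 * (L * X) + 2 * c * (L * X) + 10 * (L * X) + 7 * (L * X)"
        proof -
          have "c * X \<le> c * (L * X)" using LX by (intro mult_left_mono) auto
          moreover have "length w \<le> L * X" using LX(1) by (simp add: L_def)
          moreover have "1 \<le> L * X" using LX L2 by linarith
          ultimately show ?thesis using LX by linarith
        qed
        also have "\<dots> \<le> k * L * X" by (simp add: k_def algebra_simps)
        finally show ?thesis by simp
      qed
      have kLX: "0 < k * L * X" using X1 L2 by (simp add: k_def)
      have 4: "run (loop cG) (mk [] (cc (replicate (h w) ()) @ cc (c, w) @ []) [] [] [])
        (mk [] (Zero # cc (fold ?G (replicate (h w) ()) (c, w)) @ []) [] [] [])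
        (length (replicate (h w) ()) * ((k * L * X) ^ a + 5) + 1)"
      proof -
        have bnd: "sz (vs, fold ?G us (c, w)) \<le> k * L * X - 2" if "replicate (h w) () = us @ vs" for us vs
          using szb[OF that] by linarith
        have S: "k * L * X - 2 + 2 = k * L * X"
          using szb[of "[]" "replicate (h w) ()"] by (simp del: code_simps)
        show ?thesis
          using run_loop[where l = "replicate (h w) ()" and z = "(c, w)" and G = ?G and S = "k * L * X - 2"
              and m = "[]" and i = "[]", OF cG(2) bnd] unfolding S .
      qed
      have 4: "run (loop cG) (mk [] (cc (replicate (h w) ()) @ cc (c, w) @ []) [] [] [])
        (mk [] (Zero # cc (?p, w)) [] [] []) (X * ((k * L * X) ^ a + 5) + 1)"
      proof -
        have le: "length (replicate (h w) ()) * ((k * L * X) ^ a + 5) \<le> X * ((k * L * X) ^ a + 5)"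
          using X1(2) by (intro mult_right_mono) auto
        have eq: "cc (fold ?G (replicate (h w) ()) (c, w)) @ [] = cc (?p, w)"
          unfolding fold_double by simp
        show ?thesis using run_mono[OF 4[unfolded eq] add_right_mono[OF le]] .
      qed
      have 5: "run (Pop 1) (mk [] (Zero # cc (?p, w)) [] [] []) (mk [] (cc (?p, w)) [] [] []) 1"
        by (rule run_Pop) auto
      have 6: "run (push_all (One # cc prm)) (mk [] (cc (?p, w)) [] [] []) (mk [] (cc (prm, ?p, w)) [] [] [])
        (2 * length (One # cc prm))"
        using run_push_all[of "One # cc prm" "[]" "cc (?p, w)"] by simp
      have szD: "sz (prm, ?p, w) + 2 \<le> k * L * X"
      proof -
        have "sz (prm, ?p, w) + 2 = sz prm + 2 * (c * X) + sz w + 5" by (simp add: X_def)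
        also have "\<dots> \<le> sz prm * (L * X) + 2 * c * (L * X) + 10 * (L * X) + 6 * (L * X)"
        proof -
          have "c * X \<le> c * (L * X)" using LX by (intro mult_left_mono) auto
          moreover have "length w \<le> L * X" using LX(1) by (simp add: L_def)
          moreover have 1: "1 \<le> L * X" using LX L2 by linarith
          moreover have "sz prm * 1 \<le> sz prm * (L * X)" using 1 by (intro mult_left_mono) auto
          ultimately show ?thesis using LX sz_word_le[of w] by linarith
        qed
        also have "\<dots> \<le> k * L * X" by (simp add: k_def algebra_simps)
        finally show ?thesis .
      qed
      have 7: "run cD (mk [] (cc (prm, ?p, w)) [] [] []) (mk [] (cc (D (prm, ?p, w))) [] [] []) ((k * L * X) ^ e)"
        using run_mono[OF cD(2)[of "[]" "(prm, ?p, w)" "[]"] power_mono[OF szD]] by simp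
      let ?time = "42 * length w + 4 + (sz w + 2) ^ b + 1 + (X * ((k * L * X) ^ a + 5) + 1) + 1
          + 2 * length (One # cc prm) + (k * L * X) ^ e"
      have "run prog (mk w [] [] [] []) (mk [] (cc (D (prm, ?p, w))) [] [] []) ?time"
        unfolding prog_def by (rule run_Seq[OF run_Seq[OF run_Seq[OF run_Seq[OF run_Seq[OF run_Seq[OF 1 2] 3] 4] 5] 6] 7])
      then obtain t where t: "t \<le> ?time" "exec prog (mk w [] [] [] []) t (mk [] (cc (D (prm, ?p, w))) [] [] [])"
        by (auto simp: run_def)
      have mkw: "mk w [] [] [] [] = (\<lambda>_. [])(0 := w)" by (auto simp: mk_def fun_eq_iff)
      have "halts_with (machine 5 (compile 0 prog)) w (t + 1) [if D (prm, ?p, w) then One else Zero]"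
        using exec_halts_with[OF t(2)[unfolded mkw] regs] by (auto split: if_splits)
      moreover have "t + 1 \<le> K * L ^ K * X ^ (a + 1 + e)"
      proof -
        let ?Z = "L ^ K * X ^ (a + 1 + e)"
        have Z: "x ^ i \<le> L ^ K" if "x \<le> L" "i \<le> K" for x i
          using order_trans[OF power_mono[OF that(1)] power_increasing[OF that(2)]] L2 by simp
        have XZ: "X ^ i \<le> X ^ (a + 1 + e)" if "i \<le> a + 1 + e" for i
          using X1 that by (intro power_increasing) auto
        have Z1: "1 \<le> ?Z" using L2 X1 by simp
        have LZ: "L \<le> ?Z"
        proof -
          have "L * 1 \<le> ?Z" using Z[of L 1] X1 by (intro mult_le_mono) (auto simp: K_def)
          then show ?thesis by simp
        qed
        have "sz w + 2 \<le> 10 * L" using sz_word_le[of w] by (simp add: L_def)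
        then have "(sz w + 2) ^ b \<le> (10 * L) ^ b" by (rule power_mono) simp
        also have "\<dots> = 10 ^ b * (L ^ b * 1)" by (simp add: power_mult_distrib)
        also have "\<dots> \<le> 10 ^ b * ?Z" using Z[of L b] X1 by (intro mult_le_mono) (auto simp: K_def)
        finally have t2: "(sz w + 2) ^ b \<le> 10 ^ b * ?Z" .
        have p1: "1 \<le> (k * L * X) ^ a" using kLX by simp
        have "X * ((k * L * X) ^ a + 5) + 1 \<le> X * ((k * L * X) ^ a + 5 * (k * L * X) ^ a) + X * (k * L * X) ^ a"
          using p1 X1 by (intro add_mono mult_le_mono) (auto intro: order_trans[OF _ mult_le_mono[OF X1(1) p1]])
        also have "\<dots> = 7 * k ^ a * (L ^ a * X ^ (a + 1))" by (simp add: power_mult_distrib algebra_simps)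
        also have "\<dots> \<le> 7 * k ^ a * ?Z"
          using Z[of L a] XZ[of "a + 1"] by (intro mult_le_mono) (auto simp: K_def)
        finally have t4: "X * ((k * L * X) ^ a + 5) + 1 \<le> 7 * k ^ a * ?Z" .
        have "(k * L * X) ^ e = k ^ e * (L ^ e * X ^ e)" by (simp add: power_mult_distrib algebra_simps)
        also have "\<dots> \<le> k ^ e * ?Z"
          using Z[of L e] XZ[of "e"] by (intro mult_le_mono) (auto simp: K_def)
        finally have t7: "(k * L * X) ^ e \<le> k ^ e * ?Z" .
        have "2 * length (One # cc prm) \<le> 2 * k * 1" by (simp add: k_def length_tcode)
        also have "\<dots> \<le> 2 * k * ?Z" using Z1 by (intro mult_le_mono) auto
        finally have t6: "2 * length (One # cc prm) \<le> 2 * k * ?Z" .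
        have "t + 1 \<le> 50 * ?Z + 10 ^ b * ?Z + 7 * k ^ a * ?Z + 2 * k * ?Z + k ^ e * ?Z"
          using t(1) t2 t4 t6 t7 LZ Z1 by (simp add: L_def)
        also have "\<dots> = (50 + 10 ^ b + 7 * k ^ a + 2 * k + k ^ e) * ?Z" by (simp add: algebra_simps)
        also have "\<dots> \<le> K * ?Z" by (intro mult_right_mono) (auto simp: K_def)
        finally show ?thesis by (simp add: mult.assoc)
      qed
      ultimately show ?thesis unfolding L_def X_def power_mult[symmetric] by blast
    qed
    show "\<exists>M K. turing_machine M \<and> (\<forall>w. Blank \<notin> set w \<longrightarrow>
      (\<exists>t \<le> K * (length w + 2) ^ K * 2 ^ (h w * (a + 1 + e)).
       halts_with M w t [if D (prm, c * 2 ^ h w, w) then One else Zero]))"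
      using main turing_machine_machine by blast
  qed
qed

section \<open>Networks of loops in the grid\<close>

text \<open>For every axis-parallel line \<open>(i, t)\<close> of \<open>{1..M}\<^sup>d\<close> the cells contain a closed loop: a forward
  strand in direction \<open>i\<close>, a parallel backward strand at distance one in direction \<open>nx i\<close>, and the two
  adjacencies at the ends. Values grow weakly along the loop, hence are constant on it.\<close>

locale network =
  fixes pos :: "nat \<Rightarrow> nat" and M E :: nat and nx :: "'d::finite \<Rightarrow> 'd"
  assumes pos_gap: "\<And>p q. p < q \<Longrightarrow> pos p + 3 \<le> pos q"
    and pos_1: "2 \<le> pos 1" and pos_M: "pos M + 1 < E" and M1: "1 \<le> M"
    and nx: "\<And>i. nx i \<noteq> i"
begin

text \<open>The coordinate in the direction of the line is free; fixing it to 0 gives each line a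
  unique representation.\<close>

definition Lines :: "('d \<times> ('d \<Rightarrow> nat)) set" where
  "Lines = {l. snd l (fst l) = 0 \<and> (\<forall>j. j \<noteq> fst l \<longrightarrow> snd l j \<in> {1..M})}"

definition fwd :: "'d \<times> ('d \<Rightarrow> nat) \<Rightarrow> nat \<Rightarrow> 'd \<Rightarrow> nat" where
  "fwd l z = (\<lambda>j. if j = fst l then z else pos (snd l j))"

definition bwd :: "'d \<times> ('d \<Rightarrow> nat) \<Rightarrow> nat \<Rightarrow> 'd \<Rightarrow> nat" where
  "bwd l z = (fwd l z)(nx (fst l) := pos (snd l (nx (fst l))) + 1)"

definition Cells :: "('d \<Rightarrow> nat) set" where
  "Cells = (\<Union>l \<in> Lines. fwd l ` {1..E} \<union> bwd l ` {1..E})"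

text \<open>A line describes direction i of a cell if its strand runs in that direction, or if the
  cell is one of its four end cells and i is the direction joining the two strands. The flag marks
  the parts of the loop that are traversed against the coordinate direction.\<close>

definition D :: "('d \<Rightarrow> nat) \<Rightarrow> 'd \<Rightarrow> ('d \<times> ('d \<Rightarrow> nat)) \<times> bool \<Rightarrow> bool" where
  "D x i e = (case e of (l, fl) \<Rightarrow> l \<in> Lines \<and>
     (if fl then fst l = i \<and> x \<in> bwd l ` {1..E} \<or> nx (fst l) = i \<and> x \<in> {fwd l 1, bwd l 1}
      else fst l = i \<and> x \<in> fwd l ` {1..E} \<or> nx (fst l) = i \<and> x \<in> {fwd l E, bwd l E}))"

definition desc :: "('d \<Rightarrow> nat) \<Rightarrow> 'd \<Rightarrow> (('d \<times> ('d \<Rightarrow> nat)) \<times> bool) option" where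
  "desc x i = (if \<exists>e. D x i e then Some (THE e. D x i e) else None)"

text \<open>Coordinates where strands of other directions may run. The end coordinates 1 and
  \<open>E\<close> are not among them, so an end cell never lies on a line of another
  direction.\<close>

definition occ :: "nat \<Rightarrow> bool" where
  "occ z \<longleftrightarrow> (\<exists>p \<in> {1..M}. z = pos p \<or> z = pos p + 1)"

lemma nx_neq [simp]: "nx i \<noteq> i" "i \<noteq> nx i"
  using nx[of i] by auto

lemma strand_simps [simp]:
  "fwd l z (fst l) = z" "j \<noteq> fst l \<Longrightarrow> fwd l z j = pos (snd l j)"
  "bwd l z (fst l) = z" "bwd l z (nx (fst l)) = Suc (pos (snd l (nx (fst l))))"
  "j \<noteq> fst l \<Longrightarrow> j \<noteq> nx (fst l) \<Longrightarrow> bwd l z j = pos (snd l j)"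
  by (auto simp: fwd_def bwd_def)

lemma pos_mono: "p \<le> q \<Longrightarrow> pos p \<le> pos q"
  using pos_gap[of p q] by (cases "p = q") auto

lemma pos_inj: "pos p = pos q \<longleftrightarrow> p = q"
  using pos_gap[of p q] pos_gap[of q p] by (cases p q rule: linorder_cases) auto

lemma pos_neq1: "pos p \<noteq> Suc (pos q)"
  using pos_gap[of p q] pos_gap[of q p] by (cases p q rule: linorder_cases) auto

lemma pos_neq2: "pos p \<noteq> Suc (Suc (pos q))"
  using pos_gap[of p q] pos_gap[of q p] by (cases p q rule: linorder_cases) auto

lemma occ_bounds: "occ z \<Longrightarrow> 1 < z \<and> z < E"
proof -
  assume "occ z"
  then obtain p where p: "1 \<le> p" "p \<le> M" "z = pos p \<or> z = pos p + 1" by (auto simp: occ_def)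
  then show ?thesis using pos_mono[OF p(1)] pos_mono[OF p(2)] pos_1 pos_M by linarith
qed

lemma E2: "2 < E"
  using pos_mono[OF M1] pos_1 pos_M by linarith

lemma strand_coord:
  assumes "x \<in> fwd l ` {1..E} \<union> bwd l ` {1..E}" "j \<noteq> fst l"
  shows "x j = pos (snd l j) \<or> x j = Suc (pos (snd l j))"
proof -
  obtain z where "x = fwd l z \<or> x = bwd l z" using assms(1) by blast
  then show ?thesis
    using assms(2) by (cases "j = nx (fst l)") auto
qed

lemma strand_occ:
  assumes "l \<in> Lines" "x \<in> fwd l ` {1..E} \<union> bwd l ` {1..E}" "j \<noteq> fst l"
  shows "occ (x j)"
proof -
  have "snd l j \<in> {1..M}" using assms by (auto simp: Lines_def)
  then show ?thesis using strand_coord[OF assms(2,3)] by (auto simp: occ_def)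
qed

lemma Cells_iff: "x \<in> Cells \<longleftrightarrow> (\<exists>l \<in> Lines. x \<in> fwd l ` {1..E} \<union> bwd l ` {1..E})"
  by (auto simp: Cells_def)

lemma Cells_bounds: "x \<in> Cells \<Longrightarrow> x i \<in> {1..E}"
proof -
  assume "x \<in> Cells"
  then obtain l where l: "l \<in> Lines" "x \<in> fwd l ` {1..E} \<union> bwd l ` {1..E}" by (auto simp: Cells_iff)
  show ?thesis
  proof (cases "i = fst l")
    case True
    then show ?thesis using l(2) by auto
  next
    case False
    from occ_bounds[OF strand_occ[OF l False]] show ?thesis by simp
  qed
qed

lemma strand_unique:
  assumes "l \<in> Lines" "x \<in> fwd l ` {1..E} \<union> bwd l ` {1..E}"
    and "l' \<in> Lines" "x \<in> fwd l' ` {1..E} \<union> bwd l' ` {1..E}" and "fst l = fst l'"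
  shows "l = l'"
proof -
  have "snd l j = snd l' j" for j
  proof (cases "j = fst l")
    case True then show ?thesis using assms by (auto simp: Lines_def)
  next
    case False
    have "x j = pos (snd l j) \<or> x j = Suc (pos (snd l j))" "x j = pos (snd l' j) \<or> x j = Suc (pos (snd l' j))"
      using strand_coord[OF assms(2), of j] strand_coord[OF assms(4), of j] False assms(5) by auto
    then show ?thesis using pos_inj[of "snd l j" "snd l' j"] pos_neq1[of "snd l j" "snd l' j"]
        pos_neq1[of "snd l' j" "snd l j"] by auto
  qed
  then show ?thesis using assms(5) by (simp add: prod_eq_iff fun_eq_iff)
qed

lemma fwd_bwd_disjoint: "fwd l z \<noteq> bwd l z'"
proof
  assume "fwd l z = bwd l z'"
  from fun_cong[OF this, of "nx (fst l)"] show False by simp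
qed

lemma D_strand: "D x i (l, fl) \<Longrightarrow> l \<in> Lines \<and> x \<in> fwd l ` {1..E} \<union> bwd l ` {1..E}"
  using E2 by (force simp: D_def split: if_splits)

lemma D_cap: "D x i (l, fl) \<Longrightarrow> fst l \<noteq> i \<Longrightarrow> nx (fst l) = i \<and> x (fst l) = (if fl then 1 else E)"
  by (auto simp: D_def split: if_splits)

lemma D_own: "D x i (l, fl) \<Longrightarrow> fst l = i \<Longrightarrow> x \<in> (if fl then bwd l else fwd l) ` {1..E}"
  using nx_neq(1)[of i] unfolding D_def by (auto split: if_splits)

lemma not_occ: "\<not> occ 1" "\<not> occ E"
  using occ_bounds by blast+

text \<open>Of two lines with different directions describing the same direction of x, one does so
  only at its end cell; its coordinate there is 1 or \<open>E\<close>, yet the other line would make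
  this coordinate occupied. Lines of equal direction through one cell coincide by the gaps.\<close>

lemma D_unique: "D x i e \<Longrightarrow> D x i e' \<Longrightarrow> e = e'"
proof -
  assume a: "D x i e" "D x i e'"
  obtain l fl where "e = (l, fl)" by (cases e)
  moreover obtain l' fl' where "e' = (l', fl')" by (cases e')
  ultimately have e: "e = (l, fl)" "e' = (l', fl')" by auto
  have s: "l \<in> Lines" "x \<in> fwd l ` {1..E} \<union> bwd l ` {1..E}" "l' \<in> Lines" "x \<in> fwd l' ` {1..E} \<union> bwd l' ` {1..E}"
    using a D_strand unfolding e by blast+
  have "fst l = fst l'"
  proof (rule ccontr)
    assume ne: "fst l \<noteq> fst l'"
    then consider "fst l \<noteq> i" | "fst l' \<noteq> i" by (cases "fst l = i") auto
    then show False
    proof cases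
      case 1
      then have "x (fst l) = 1 \<or> x (fst l) = E" using D_cap[of x i l fl] a(1) e by (auto split: if_splits)
      moreover have "occ (x (fst l))" using strand_occ[OF s(3,4)] ne by blast
      ultimately show False using not_occ by auto
    next
      case 2
      then have "x (fst l') = 1 \<or> x (fst l') = E" using D_cap[of x i l' fl'] a(2) e by (auto split: if_splits)
      moreover have "occ (x (fst l'))" using strand_occ[OF s(1,2)] ne by metis
      ultimately show False using not_occ by auto
    qed
  qed
  then have l: "l = l'" using strand_unique[OF s] by blast
  have "fl = fl'"
  proof (cases "fst l = i")
    case True
    have "x \<in> (if fl then bwd l else fwd l) ` {1..E}" "x \<in> (if fl' then bwd l else fwd l) ` {1..E}"
      using D_own[of x i l fl] D_own[of x i l fl'] a True unfolding e l by auto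
    then obtain z z' where z: "x = (if fl then bwd l else fwd l) z" "x = (if fl' then bwd l else fwd l) z'" by blast
    have "(if fl then bwd l else fwd l) z = (if fl' then bwd l else fwd l) z'" using z(1) z(2) by (rule trans[OF sym])
    note eq = this
    show ?thesis
    proof (cases fl)
      case True
      then have "bwd l z = (if fl' then bwd l else fwd l) z'" using eq by simp
      then show ?thesis using fwd_bwd_disjoint[of l z' z] True by (cases fl') simp_all
    next
      case False
      then have "fwd l z = (if fl' then bwd l else fwd l) z'" using eq by simp
      then show ?thesis using fwd_bwd_disjoint[of l z z'] False by (cases fl') simp_all
    qed
  next
    case False
    have "D x i (l, fl)" "D x i (l, fl')" using a unfolding e l by simp_all
    then have "(if fl then 1 else E) = (if fl' then 1 else E)"
      using D_cap[of x i l fl] D_cap[of x i l fl'] False by simp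
    then show ?thesis using E2 by (cases fl; cases fl') simp_all
  qed
  then show ?thesis using l e by simp
qed

lemma desc_iff: "desc x i = Some e \<longleftrightarrow> D x i e"
proof
  assume "desc x i = Some e"
  then have "\<exists>e. D x i e" and e: "e = (THE e. D x i e)" unfolding desc_def by (metis option.distinct(1), metis option.distinct(1) option.inject)
  then obtain e' where e': "D x i e'" by blast
  have "(THE e. D x i e) = e'" by (rule the_equality[of "D x i", OF e'(1)]) (rule D_unique[OF _ e'(1)])
  with e e' show "D x i e" by metis
next
  assume d: "D x i e"
  have "(THE e. D x i e) = e" by (rule the_equality[of "D x i", OF d]) (rule D_unique[OF _ d])
  moreover have "\<exists>e. D x i e" using d by blast
  ultimately show "desc x i = Some e" unfolding desc_def by simp
qed

lemma cap_only:
  assumes "x \<in> Cells" "\<not> occ (x i')" "i \<noteq> i'"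
  shows "occ (x i)"
proof -
  obtain l where l: "l \<in> Lines" "x \<in> fwd l ` {1..E} \<union> bwd l ` {1..E}" using assms(1) by (auto simp: Cells_iff)
  have "fst l = i'" using strand_occ[OF l] assms(2) by metis
  then show ?thesis using strand_occ[OF l] assms(3) by metis
qed

lemma pos_occ_gap: "p \<in> {1..M} \<Longrightarrow> \<not> occ (pos p + 2)" "p \<in> {1..M} \<Longrightarrow> \<not> occ (pos p - 1)"
proof -
  show "\<not> occ (pos p + 2)"
  proof
    assume "occ (pos p + 2)"
    then obtain q where "pos p + 2 = pos q \<or> pos p + 2 = pos q + 1" by (auto simp: occ_def)
    then show False using pos_neq2[of q p] pos_neq1[of q p] by auto
  qed
  assume p: "p \<in> {1..M}"
  then have "2 \<le> pos p" using pos_1 pos_mono[of 1 p] by auto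
  show "\<not> occ (pos p - 1)"
  proof
    assume "occ (pos p - 1)"
    then obtain q where "pos p - 1 = pos q \<or> pos p - 1 = pos q + 1" by (auto simp: occ_def)
    then have "pos p = pos q + 1 \<or> pos p = pos q + 2" using \<open>2 \<le> pos p\<close> by linarith
    then show False using pos_neq2[of p q] pos_neq1[of p q] by auto
  qed
qed

text \<open>Gaps of at least 3 exclude accidental neighbours: cells adjacent in direction i are
  consecutive on a strand, or form the end of a loop, or are both undescribed in that direction. So
  monotonicity never relates two different lines.\<close>

lemma D_adjacent:
  assumes x: "x \<in> Cells" and y: "y \<in> Cells" and xy: "y = x(i := x i + 1)"
  shows "D x i e \<longleftrightarrow> D y i e"
proof -
  obtain l fl where e: "e = (l, fl)" by (cases e)
  have yi: "y i = x i + 1" and yj: "j \<noteq> i \<Longrightarrow> y j = x j" for j using xy by auto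
  have xy': "x = y(i := y i - 1)" using xy by auto
  show ?thesis
  proof (cases "l \<in> Lines")
    case False then show ?thesis by (auto simp: e D_def)
  next
    case L: True
    show ?thesis
    proof (cases "fst l = i")
      case True
      have f: "(fwd l z)(i := z') = fwd l z'" "(bwd l z)(i := z') = bwd l z'" "fwd l z i = z" "bwd l z i = z" for z z'
        using True nx[of i] by (auto simp: fwd_def bwd_def fun_eq_iff)
      have xb: "x i \<in> {1..E}" and yb: "y i \<in> {1..E}" using Cells_bounds x y by auto
      have "x \<in> fwd l ` {1..E} \<longleftrightarrow> y \<in> fwd l ` {1..E}"
      proof
        assume "x \<in> fwd l ` {1..E}"
        then obtain z where "x = fwd l z" by auto
        then have "y = fwd l (y i)" using xy f by simp
        then show "y \<in> fwd l ` {1..E}" using yb by blast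
      next
        assume "y \<in> fwd l ` {1..E}"
        then obtain z where "y = fwd l z" by auto
        then have "x = fwd l (x i)" using xy' f by (metis fun_upd_same)
        then show "x \<in> fwd l ` {1..E}" using xb by blast
      qed
      moreover have "x \<in> bwd l ` {1..E} \<longleftrightarrow> y \<in> bwd l ` {1..E}"
      proof
        assume "x \<in> bwd l ` {1..E}"
        then obtain z where "x = bwd l z" by auto
        then have "y = bwd l (y i)" using xy f by simp
        then show "y \<in> bwd l ` {1..E}" using yb by blast
      next
        assume "y \<in> bwd l ` {1..E}"
        then obtain z where "y = bwd l z" by auto
        then have "x = bwd l (x i)" using xy' f by (metis fun_upd_same)
        then show "x \<in> bwd l ` {1..E}" using xb by blast
      qed
      ultimately show ?thesis using True nx[of i] by (auto simp: e D_def)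
    next
      case ne: False
      show ?thesis
      proof (cases "nx (fst l) = i")
        case False then show ?thesis using ne by (auto simp: e D_def)
      next
        case nxi: True
        have p: "snd l i \<in> {1..M}" using L ne by (auto simp: Lines_def)
        have xs: "x (fst l) = y (fst l)" using yj[of "fst l"] ne by simp
        have bf: "bwd l z = (fwd l z)(i := pos (snd l i) + 1)" "fwd l z i = pos (snd l i)"
          "fwd l z = (bwd l z)(i := pos (snd l i))" "bwd l z i = pos (snd l i) + 1"
          "fwd l z (fst l) = z" "bwd l z (fst l) = z" for z
          using nxi ne by (auto simp: bwd_def fwd_def fun_eq_iff)
        \<comment> \<open>Both ends at once: at an unoccupied z, a step beyond the pair
          \<open>pos p\<close>, \<open>pos p + 1\<close> would leave the set of cells.\<close>
        have key: "x \<in> {fwd l z, bwd l z} \<longleftrightarrow> y \<in> {fwd l z, bwd l z}" if z: "\<not> occ z" for z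
        proof
          assume "x \<in> {fwd l z, bwd l z}"
          then consider "x = fwd l z" | "x = bwd l z" by blast
          then show "y \<in> {fwd l z, bwd l z}"
          proof cases
            case 1
            then have "y = (fwd l z)(i := fwd l z i + 1)" using xy by simp
            then have "y = bwd l z" unfolding bf(1)[of z] bf(2)[of z] .
            then show ?thesis by simp
          next
            case 2
            then have "y i = pos (snd l i) + 2" using yi bf(4)[of z] by simp
            moreover have "y (fst l) = z" using xs 2 bf(6)[of z] by simp
            then have "occ (y i)" using cap_only[OF y, of "fst l" i] z ne by metis
            ultimately show ?thesis using pos_occ_gap(1)[OF p] by simp
          qed
        next
          assume "y \<in> {fwd l z, bwd l z}"
          then consider "y = bwd l z" | "y = fwd l z" by blast
          then show "x \<in> {fwd l z, bwd l z}"
          proof cases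
            case 1
            then have "x = (bwd l z)(i := bwd l z i - 1)" using xy' by simp
            then have "x = fwd l z" unfolding bf(3)[of z] bf(4)[of z] by simp
            then show ?thesis by simp
          next
            case 2
            then have "x i = pos (snd l i) - 1" using yi bf(2)[of z] by simp
            moreover have "x (fst l) = z" using xs 2 bf(5)[of z] by simp
            then have "occ (x i)" using cap_only[OF x, of "fst l" i] z ne by metis
            ultimately show ?thesis using pos_occ_gap(2)[OF p] by simp
          qed
        qed
        show ?thesis using key[OF not_occ(1)] key[OF not_occ(2)] nxi ne L by (auto simp: e D_def)
      qed
    qed
  qed
qed

lemma desc_adjacent:
  assumes "x \<in> Cells" "y \<in> Cells" "y = x(i := x i + 1)"
  shows "desc x i = desc y i"
proof (cases "desc x i")
  case None
  then show ?thesis using desc_iff D_adjacent[OF assms] by (metis not_Some_eq)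
next
  case (Some e)
  then show ?thesis using desc_iff D_adjacent[OF assms] by metis
qed

text \<open>The value shown in direction \<open>i\<close>; on backward strands and bottom caps it is reversed.\<close>

definition dval :: "nat \<Rightarrow> (('d \<Rightarrow> nat) \<Rightarrow> 'd \<Rightarrow> nat) \<Rightarrow> ('d \<Rightarrow> nat) \<Rightarrow> 'd \<Rightarrow> nat" where
  "dval n \<tau> x i = (case desc x i of Some (l, True) \<Rightarrow> n - 1 - \<tau> x i | _ \<Rightarrow> \<tau> x i)"

definition solution :: "nat \<Rightarrow> ('d \<times> ('d \<Rightarrow> nat) \<Rightarrow> nat \<Rightarrow> 'd \<times> ('d \<Rightarrow> nat) \<Rightarrow> nat \<Rightarrow> bool) \<Rightarrow>
    (('d \<Rightarrow> nat) \<Rightarrow> 'd \<Rightarrow> nat) \<Rightarrow> bool" where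
  "solution n cons \<tau> \<longleftrightarrow>
     (\<forall>x \<in> Cells. \<forall>i. \<tau> x i < n \<and> (desc x i = None \<longrightarrow> \<tau> x i = 0)) \<and>
     (\<forall>x \<in> Cells. \<forall>i j l fl l' fl'. desc x i = Some (l, fl) \<longrightarrow> desc x j = Some (l', fl') \<longrightarrow>
        cons l (\<tau> x i) l' (\<tau> x j)) \<and>
     (\<forall>x \<in> Cells. \<forall>y \<in> Cells. \<forall>i. y = x(i := x i + 1) \<longrightarrow> dval n \<tau> x i \<le> dval n \<tau> y i)"

lemma strand_cells: "l \<in> Lines \<Longrightarrow> z \<in> {1..E} \<Longrightarrow> fwd l z \<in> Cells \<and> bwd l z \<in> Cells"
  unfolding Cells_def by blast

lemma strand_next: "fwd l (Suc z) = (fwd l z)(fst l := fwd l z (fst l) + 1)"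
  "bwd l (Suc z) = (bwd l z)(fst l := bwd l z (fst l) + 1)"
  "bwd l z = (fwd l z)(nx (fst l) := fwd l z (nx (fst l)) + 1)"
  by (auto simp: fwd_def bwd_def fun_eq_iff)

lemma desc_strand:
  assumes "l \<in> Lines" "z \<in> {1..E}"
  shows "desc (fwd l z) (fst l) = Some (l, False)" "desc (bwd l z) (fst l) = Some (l, True)"
  using assms by (auto simp: desc_iff D_def)

lemma desc_cap:
  assumes "l \<in> Lines"
  shows "desc (fwd l 1) (nx (fst l)) = Some (l, True)" "desc (bwd l 1) (nx (fst l)) = Some (l, True)"
    "desc (fwd l E) (nx (fst l)) = Some (l, False)" "desc (bwd l E) (nx (fst l)) = Some (l, False)"
  using assms by (auto simp: desc_iff D_def)

text \<open>With f on the forward and g on the backward strand, f 1 \<le> ... \<le> f E \<le> g E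
  \<le> ... \<le> g 1 \<le> f 1. At the corners, \<open>cons\<close> makes the two directions of a
  cell that belong to the same line show the same value.\<close>

lemma loop_constant:
  assumes sol: "solution n cons \<tau>" and cons: "\<And>l v v'. cons l v l v' \<Longrightarrow> v = v'"
    and l: "l \<in> Lines" and x: "x \<in> Cells" and d: "desc x i = Some (l, fl)"
  shows "\<tau> x i = \<tau> (fwd l 1) (fst l)"
proof -
  let ?i = "fst l" and ?j = "nx (fst l)"
  have E: "1 \<in> {1..E}" "E \<in> {1..E}" using E2 by auto
  note C = strand_cells[OF l]
  have lt: "\<tau> y j < n" if "y \<in> Cells" for y j using sol that by (auto simp: solution_def)
  have adj: "dval n \<tau> y j \<le> dval n \<tau> z j" if "y \<in> Cells" "z \<in> Cells" "z = y(j := y j + 1)" for y z j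
    using sol that by (auto simp: solution_def)
  have same: "\<tau> y j = \<tau> y j'" if "y \<in> Cells" "desc y j = Some (l, fl)" "desc y j' = Some (l, fl')" for y j j' fl fl'
    using sol that cons unfolding solution_def by blast
  define f g where "f z = \<tau> (fwd l z) ?i" and "g z = \<tau> (bwd l z) ?i" for z
  have f: "f z \<le> f (Suc z)" if "z \<in> {1..<E}" for z
    using adj[of "fwd l z" "fwd l (Suc z)" ?i] C[of z] C[of "Suc z"] that strand_next[of l z]
      desc_strand[OF l, of z] desc_strand[OF l, of "Suc z"] by (auto simp: f_def dval_def)
  have g: "g (Suc z) \<le> g z" if "z \<in> {1..<E}" for z
  proof -
    have "n - 1 - g z \<le> n - 1 - g (Suc z)"
      using adj[of "bwd l z" "bwd l (Suc z)" ?i] C[of z] C[of "Suc z"] that strand_next[of l z]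
      desc_strand[OF l, of z] desc_strand[OF l, of "Suc z"] by (auto simp: g_def dval_def)
    moreover have "g z < n" "g (Suc z) < n" using lt C[of z] C[of "Suc z"] that by (auto simp: g_def)
    ultimately show ?thesis by linarith
  qed
  have top: "f E \<le> g E"
  proof -
    have "\<tau> (fwd l E) ?j \<le> \<tau> (bwd l E) ?j"
      using adj[of "fwd l E" "bwd l E" ?j] C[OF E(2)] strand_next(3)[of l E] desc_cap[OF l] by (auto simp: dval_def)
    moreover have "\<tau> (fwd l E) ?j = f E" "\<tau> (bwd l E) ?j = g E"
      unfolding f_def g_def using same C[OF E(2)] desc_cap[OF l] desc_strand[OF l E(2)] by metis+
    ultimately show ?thesis by simp
  qed
  have bot: "g 1 \<le> f 1"
  proof -
    have "n - 1 - \<tau> (fwd l 1) ?j \<le> n - 1 - \<tau> (bwd l 1) ?j"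
      using adj[of "fwd l 1" "bwd l 1" ?j] C[OF E(1)] strand_next(3)[of l 1] desc_cap[OF l] by (auto simp: dval_def)
    moreover have "\<tau> (fwd l 1) ?j = f 1" "\<tau> (bwd l 1) ?j = g 1"
      unfolding f_def g_def using same C[OF E(1)] desc_cap[OF l] desc_strand[OF l E(1)] by metis+
    moreover have "f 1 < n" "g 1 < n" using lt C[OF E(1)] by (auto simp: f_def g_def)
    ultimately show ?thesis by linarith
  qed
  have f1: "z \<le> E \<Longrightarrow> f 1 \<le> f z" if "1 \<le> z" for z
    using that by (induction z rule: dec_induct) (use f order_trans in fastforce)+
  have fE: "z \<le> E \<Longrightarrow> 1 \<le> z \<Longrightarrow> f z \<le> f E" for z
    by (induction z rule: inc_induct) (use f order_trans in fastforce)+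
  have g1: "z \<le> E \<Longrightarrow> g z \<le> g 1" if "1 \<le> z" for z
    using that by (induction z rule: dec_induct) (use g order_trans in fastforce)+
  have gE: "z \<le> E \<Longrightarrow> 1 \<le> z \<Longrightarrow> g E \<le> g z" for z
    by (induction z rule: inc_induct) (use g order_trans in fastforce)+
  have eq: "f z = f 1" "g z = f 1" if "z \<in> {1..E}" for z
    using f1[of z] fE[of z] g1[of z] gE[of z] f1[of E] gE[of 1] top bot that E by auto
  have "D x i (l, fl)" using d desc_iff by blast
  then have "x \<in> fwd l ` {1..E} \<union> bwd l ` {1..E}" using D_strand by blast
  then obtain z where z: "z \<in> {1..E}" "x = fwd l z \<or> x = bwd l z" by blast
  then obtain fl' where "desc x ?i = Some (l, fl')" using desc_strand[OF l z(1)] by blast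
  then have "\<tau> x i = \<tau> x ?i" using same[OF x d] by blast
  then show ?thesis using z eq[OF z(1)] by (auto simp: f_def g_def)
qed

text \<open>One value per line remains of a solution because of the loops. Conversely, values that
  are constant on lines meet every monotonicity condition, since neighbours have equal
  descriptions.\<close>

theorem solution_iff:
  assumes cons: "\<And>l v v'. cons l v l v' \<Longrightarrow> v = v'" and n: "0 < n"
  shows "(\<exists>\<tau>. solution n cons \<tau>) \<longleftrightarrow>
    (\<exists>val. (\<forall>l \<in> Lines. val l < n) \<and> (\<forall>x \<in> Cells. \<forall>i j l fl l' fl'. desc x i = Some (l, fl) \<longrightarrow>
       desc x j = Some (l', fl') \<longrightarrow> cons l (val l) l' (val l')))"
proof
  assume "\<exists>\<tau>. solution n cons \<tau>"
  then obtain \<tau> where sol: "solution n cons \<tau>" ..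
  define val where "val l = \<tau> (fwd l 1) (fst l)" for l
  have E: "1 \<in> {1..E}" using E2 by auto
  have "\<forall>l \<in> Lines. val l < n" using sol strand_cells[OF _ E] by (auto simp: val_def solution_def)
  moreover have "cons l (val l) l' (val l')"
    if "x \<in> Cells" "desc x i = Some (l, fl)" "desc x j = Some (l', fl')" for x i j l fl l' fl'
  proof -
    have "l \<in> Lines" "l' \<in> Lines" using that desc_iff D_strand by blast+
    then have "\<tau> x i = val l" "\<tau> x j = val l'"
      using loop_constant[OF sol cons _ that(1)] that by (auto simp: val_def)
    moreover have "cons l (\<tau> x i) l' (\<tau> x j)" using sol that unfolding solution_def by blast
    ultimately show ?thesis by simp
  qed
  ultimately show "\<exists>val. (\<forall>l \<in> Lines. val l < n) \<and> (\<forall>x \<in> Cells. \<forall>i j l fl l' fl'. desc x i = Some (l, fl) \<longrightarrow>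
       desc x j = Some (l', fl') \<longrightarrow> cons l (val l) l' (val l'))" by blast
next
  assume "\<exists>val. (\<forall>l \<in> Lines. val l < n) \<and> (\<forall>x \<in> Cells. \<forall>i j l fl l' fl'. desc x i = Some (l, fl) \<longrightarrow>
       desc x j = Some (l', fl') \<longrightarrow> cons l (val l) l' (val l'))"
  then obtain val where v: "\<forall>l \<in> Lines. val l < n"
    and c: "\<And>x i j l fl l' fl'. x \<in> Cells \<Longrightarrow> desc x i = Some (l, fl) \<Longrightarrow>
       desc x j = Some (l', fl') \<Longrightarrow> cons l (val l) l' (val l')" by blast
  define \<tau> where "\<tau> x i = (case desc x i of None \<Rightarrow> 0 | Some (l, fl) \<Rightarrow> val l)" for x i
  have "solution n cons \<tau>"
    unfolding solution_def
  proof (intro conjI ballI allI impI)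
    fix x i assume "x \<in> Cells"
    show "\<tau> x i < n"
    proof (cases "desc x i")
      case None then show ?thesis using n by (simp add: \<tau>_def)
    next
      case (Some e)
      obtain l fl where e: "e = (l, fl)" by (cases e)
      then have "l \<in> Lines" using Some desc_iff D_strand by metis
      then show ?thesis using v Some e by (simp add: \<tau>_def)
    qed
  next
    fix x i assume "desc x i = None" then show "\<tau> x i = 0" by (simp add: \<tau>_def)
  next
    fix x i j l fl l' fl' assume "x \<in> Cells" "desc x i = Some (l, fl)" "desc x j = Some (l', fl')"
    then show "cons l (\<tau> x i) l' (\<tau> x j)" using c by (simp add: \<tau>_def)
  next
    fix x y i assume "x \<in> Cells" "y \<in> Cells" "y = x(i := x i + 1)"
    from desc_adjacent[OF this] show "dval n \<tau> x i \<le> dval n \<tau> y i"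
      by (cases "desc y i") (auto simp: dval_def \<tau>_def)
  qed
  then show "\<exists>\<tau>. solution n cons \<tau>" by blast
qed

text \<open>At a node every direction carries a line, so its cell can compare the values of all of
  them.\<close>

lemma node_cell:
  assumes "\<And>j. p j \<in> {1..M}"
  shows "(\<lambda>j. pos (p j)) \<in> Cells" "desc (\<lambda>j. pos (p j)) i = Some ((i, p(i := 0)), False)"
proof -
  have l: "(i, p(i := 0)) \<in> Lines" using assms by (auto simp: Lines_def)
  have "occ (pos (p i))" using assms by (auto simp: occ_def)
  then have z: "pos (p i) \<in> {1..E}" using occ_bounds[of "pos (p i)"] by simp
  have e: "(\<lambda>j. pos (p j)) = fwd (i, p(i := 0)) (pos (p i))" by (auto simp: fwd_def)
  show "(\<lambda>j. pos (p j)) \<in> Cells" unfolding e using strand_cells[OF l z] by blast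
  show "desc (\<lambda>j. pos (p j)) i = Some ((i, p(i := 0)), False)"
    unfolding e using desc_strand(1)[OF l z] by simp
qed

lemma finite_Lines: "finite Lines"
proof (rule finite_subset)
  show "Lines \<subseteq> UNIV \<times> (PiE UNIV (\<lambda>_. {0..M}))" by (force simp: Lines_def)
qed (auto intro!: finite_PiE)

lemma finite_Cells: "finite Cells"
  unfolding Cells_def using finite_Lines by auto

lemma card_Lines: "card Lines \<le> CARD('d) * M ^ (CARD('d) - 1)"
proof -
  have "Lines \<subseteq> (\<Union>i. {i} \<times> (PiE UNIV (\<lambda>j. if j = i then {0} else {1..M})))"
  proof
    fix l assume "l \<in> Lines"
    then show "l \<in> (\<Union>i. {i} \<times> (PiE UNIV (\<lambda>j. if j = i then {0} else {1..M})))"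
      by (intro UN_I[of "fst l"]) (auto simp: Lines_def mem_Times_iff PiE_iff)
  qed
  then have "card Lines \<le> card (\<Union>i::'d. {i} \<times> (PiE UNIV (\<lambda>j. if j = i then {0} else {1..M})))"
    by (intro card_mono) (auto intro!: finite_PiE)
  also have "\<dots> \<le> (\<Sum>i\<in>UNIV. card ({i::'d} \<times> (PiE UNIV (\<lambda>j. if j = i then {0} else {1..M}))))"
    by (rule card_UN_le) simp
  also have "\<dots> = (\<Sum>i\<in>(UNIV::'d set). M ^ (CARD('d) - 1))"
  proof (rule sum.cong[OF refl])
    fix i :: 'd
    have "(\<Prod>j\<in>UNIV. card (if j = i then {0} else {1..M})) = (\<Prod>j\<in>UNIV - {i}. M)"
      by (subst prod.remove[of UNIV i]) (auto intro!: prod.cong)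
    then show "card ({i} \<times> (PiE UNIV (\<lambda>j. if j = i then {0} else {1..M}))) = M ^ (CARD('d) - 1)"
      by (simp add: card_PiE card_cartesian_product)
  qed
  finally show ?thesis by simp
qed

lemma card_Cells: "card Cells \<le> 2 * CARD('d) * M ^ (CARD('d) - 1) * E"
proof -
  have "card Cells \<le> (\<Sum>l\<in>Lines. card (fwd l ` {1..E} \<union> bwd l ` {1..E}))"
    unfolding Cells_def by (rule card_UN_le[OF finite_Lines])
  also have "\<dots> \<le> (\<Sum>l\<in>Lines. 2 * E)"
  proof (rule sum_mono)
    fix l
    have "card (fwd l ` {1..E} \<union> bwd l ` {1..E}) \<le> card (fwd l ` {1..E}) + card (bwd l ` {1..E})"
      by (rule card_Un_le)
    also have "\<dots> \<le> 2 * E"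
      using card_image_le[of "{1..E}" "fwd l"] card_image_le[of "{1..E}" "bwd l"] by simp
    finally show "card (fwd l ` {1..E} \<union> bwd l ` {1..E}) \<le> 2 * E" .
  qed
  also have "\<dots> \<le> CARD('d) * M ^ (CARD('d) - 1) * (2 * E)"
    using card_Lines by simp
  finally show ?thesis by (simp add: algebra_simps)
qed

end

section \<open>Unit balls realising a network\<close>

lemma dist_vec_sq: "(dist a b)\<^sup>2 = (\<Sum>i\<in>UNIV. (a $ i - b $ i)\<^sup>2)" for a b :: "real ^ 'n"
  by (simp add: dist_vec_def L2_set_def dist_real_def sum_nonneg)

lemma coord_le_dist: "\<bar>a $ i - b $ i\<bar> \<le> dist a b" for a b :: "real ^ 'n"
  using component_le_norm_cart[of "a - b" i] by (simp add: dist_norm)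

lemma unit_balls_disjoint: "ball a 1 \<inter> ball b 1 = {} \<longleftrightarrow> 2 \<le> dist a b" for a b :: "real ^ 'n"
proof
  assume d: "ball a 1 \<inter> ball b 1 = {}"
  show "2 \<le> dist a b"
  proof (rule ccontr)
    assume "\<not> 2 \<le> dist a b"
    then have "midpoint a b \<in> ball a 1 \<inter> ball b 1" by (auto simp: dist_midpoint)
    then show False using d by blast
  qed
next
  assume "2 \<le> dist a b"
  then show "ball a 1 \<inter> ball b 1 = {}" by (intro disjoint_ballI) simp
qed

text \<open>With 2^q as the base of the Cantor digits, the displacement is a single additional digit
  1, which keeps the center in the Cantor set.\<close>

definition center :: "nat \<Rightarrow> ('d::finite \<Rightarrow> nat) \<Rightarrow> ('d \<Rightarrow> nat) \<Rightarrow> rat ^ 'd" where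
  "center q x u = (\<chi> i. 2 * (of_nat (x i) + 1 / 2 ^ (q * u i)))"

definition eps :: "nat \<Rightarrow> nat \<Rightarrow> real" where
  "eps q u = 1 / 2 ^ (q * u)"

lemma real_point_center: "real_point (center q x u) $ i = 2 * (real (x i) + eps q (u i))"
  by (simp add: real_point_def center_def eps_def of_rat_add of_rat_mult of_rat_divide of_rat_power)

lemma eps_pos: "0 < eps q u" by (simp add: eps_def)

lemma eps_antimono: "u \<le> v \<Longrightarrow> eps q v \<le> eps q u"
  unfolding eps_def by (intro divide_left_mono power_increasing mult_left_mono) auto

lemma eps_half: "u < v \<Longrightarrow> 1 \<le> q \<Longrightarrow> 2 * eps q v \<le> eps q u"
proof -
  assume "u < v" "1 \<le> q"
  then have "q * (u + 1) \<le> q * v" by (intro mult_left_mono) auto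
  then have "q * u + 1 \<le> q * v" using \<open>1 \<le> q\<close> by simp
  then have "(2::real) ^ (q * u + 1) \<le> 2 ^ (q * v)" by (intro power_increasing) auto
  then show ?thesis by (simp add: eps_def field_simps)
qed

lemma eps_inj: "1 \<le> q \<Longrightarrow> eps q u = eps q v \<longleftrightarrow> u = v"
  using eps_half[of u v q] eps_half[of v u q] eps_pos[of q u] eps_pos[of q v]
  by (cases u v rule: linorder_cases) auto

lemma center_inj:
  assumes "1 \<le> q" "\<And>i. 1 \<le> u i" "\<And>i. 1 \<le> v i" "center q x u = center q y v"
  shows "x = y \<and> u = v"
proof -
  have "x i = y i \<and> u i = v i" for i
  proof -
    have e: "2 * (real (x i) + eps q (u i)) = 2 * (real (y i) + eps q (v i))"
      using assms(4) real_point_center by metis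
    have b: "0 < eps q w" "eps q w \<le> 1 / 2" if "1 \<le> w" for w
      using eps_half[of 0 w q] that assms(1) eps_pos[of q w] by (simp_all add: eps_def[of q 0])
    have "2 * (X + E) = 2 * (Z + F) \<Longrightarrow> 0 < E \<Longrightarrow> E \<le> 1 / 2 \<Longrightarrow> 0 < F \<Longrightarrow> F \<le> 1 / 2 \<Longrightarrow> X < Z + 1 \<and> Z < X + 1"
      for X Z E F :: real by simp
    from this[OF e b[OF assms(2)[of i]] b[OF assms(3)[of i]]]
    have "real (x i) < real (y i) + 1" "real (y i) < real (x i) + 1" by blast+
    then have "x i = y i" by linarith
    then show ?thesis using e eps_inj[OF assms(1)] by simp
  qed
  then show ?thesis by auto
qed

text \<open>The exponents in use are Y + 1, ..., Y + n. Here 2 (Y + 1) exceeds Y + n by d + 2, so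
  that a sum of d squared displacements is at most the smallest displacement.\<close>

locale ball_scale =
  fixes q n Y :: nat and d :: nat
  assumes q: "1 \<le> q" and n: "1 \<le> n" and Y: "Y = n + d" and d: "2 \<le> d"
begin

definition exps :: "('d \<Rightarrow> nat) \<Rightarrow> bool" where
  "exps u \<longleftrightarrow> (\<forall>i. Y + 1 \<le> u i \<and> u i \<le> Y + n)"

lemma eps_small:
  assumes "Y + 1 \<le> u"
  shows "eps q u \<le> 1 / 4" "real d * (eps q u)\<^sup>2 < 1" "real d * (eps q u)\<^sup>2 \<le> eps q (Y + n)"
proof -
  have "eps q u \<le> eps q (Y + 1)" using assms by (rule eps_antimono)
  have "Y + 1 \<le> q * (Y + 1)" using mult_right_mono[OF q, of "Y + 1"] by simp
  then have "(2::real) ^ (Y + 1) \<le> 2 ^ (q * (Y + 1))" by (intro power_increasing) auto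
  then have e1: "eps q (Y + 1) \<le> 1 / 2 ^ (Y + 1)" unfolding eps_def by (intro divide_left_mono) auto
  have "(4::real) \<le> 2 ^ (Y + 1)" using power_increasing[of 2 "Y + 1" "2::real"] Y d by simp
  then have "1 / 2 ^ (Y + 1) \<le> (1 / 4::real)" by (intro divide_left_mono) auto
  then show 4: "eps q u \<le> 1 / 4" using e1 \<open>eps q u \<le> eps q (Y + 1)\<close> by linarith
  have "real d \<le> 2 ^ d" using less_exp[of d] by (metis less_imp_le of_nat_le_iff of_nat_numeral of_nat_power)
  also have "\<dots> \<le> 2 ^ (q * (Y + 2 - n))"
  proof (rule power_increasing)
    have "d \<le> 1 * (Y + 2 - n)" using Y by simp
    also have "\<dots> \<le> q * (Y + 2 - n)" using q by (intro mult_right_mono) auto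
    finally show "d \<le> q * (Y + 2 - n)" .
  qed simp
  finally have d2: "real d \<le> 2 ^ (q * (Y + 2 - n))" .
  have "2 * (q * (Y + 1)) = q * (Y + 2 - n) + q * (Y + n)" using Y by (simp add: algebra_simps)
  then have "(2::real) ^ (2 * (q * (Y + 1))) = 2 ^ (q * (Y + 2 - n)) * 2 ^ (q * (Y + n))"
    by (simp add: power_add)
  then have sq: "(eps q (Y + 1))\<^sup>2 = 1 / (2 ^ (q * (Y + 2 - n)) * 2 ^ (q * (Y + n)))"
    unfolding eps_def power_divide power_mult[symmetric] by (simp only: mult.commute[of _ 2] power_one)
  have "real d * (eps q u)\<^sup>2 \<le> 2 ^ (q * (Y + 2 - n)) * (eps q (Y + 1))\<^sup>2"
    using d2 \<open>eps q u \<le> eps q (Y + 1)\<close> eps_pos[of q u] by (intro mult_mono power_mono) auto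
  also have "\<dots> = eps q (Y + n)" unfolding sq by (simp add: eps_def)
  finally show le: "real d * (eps q u)\<^sup>2 \<le> eps q (Y + n)" .
  have "eps q (Y + n) \<le> eps q (Y + 1)" using n by (intro eps_antimono) simp
  also have "\<dots> < 1" using e1 \<open>1 / 2 ^ (Y + 1) \<le> (1 / 4::real)\<close> by linarith
  finally show "real d * (eps q u)\<^sup>2 < 1" using le by linarith
qed

lemma eps_diff_sq:
  assumes "Y + 1 \<le> u" "Y + 1 \<le> v"
  shows "(eps q u - eps q v)\<^sup>2 \<le> (eps q (Y + 1))\<^sup>2"
proof -
  have "\<bar>eps q u - eps q v\<bar> \<le> \<bar>eps q (Y + 1)\<bar>"
    using eps_antimono[OF assms(1), of q] eps_antimono[OF assms(2), of q] eps_pos[of q u] eps_pos[of q v] by linarith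
  then show ?thesis using abs_le_square_iff by blast
qed

lemma same_cell_dist:
  fixes x :: "'d::finite \<Rightarrow> nat"
  assumes "CARD('d) = d" "exps u" "exps v"
  shows "dist (real_point (center q x u)) (real_point (center q x v)) < 2"
proof -
  have "(dist (real_point (center q x u)) (real_point (center q x v)))\<^sup>2
      = (\<Sum>i\<in>UNIV. 4 * (eps q (u i) - eps q (v i))\<^sup>2)"
    unfolding dist_vec_sq real_point_center by (intro sum.cong) (auto simp: power2_eq_square algebra_simps)
  also have "\<dots> \<le> (\<Sum>i\<in>(UNIV::'d set). 4 * (eps q (Y + 1))\<^sup>2)"
    using assms by (intro sum_mono mult_left_mono eps_diff_sq) (auto simp: exps_def)
  also have "\<dots> = 4 * (real d * (eps q (Y + 1))\<^sup>2)" using assms(1) by simp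
  also have "\<dots> < 2\<^sup>2" using eps_small(2)[of "Y + 1"] by simp
  finally show ?thesis by (rule power_less_imp_less_base) simp
qed

text \<open>The difference in direction i is 2 (1 + eps v - eps u). If the far ball is displaced at
  least as much, this alone reaches 2. Otherwise at least twice the smallest displacement is
  missing, and the sideways contributions, being quadratic, cannot make up for it.\<close>

lemma adjacent_dist:
  fixes x y :: "'d::finite \<Rightarrow> nat"
  assumes c: "CARD('d) = d" and u: "exps u" and v: "exps v" and y: "y = x(i := x i + 1)"
  shows "2 \<le> dist (real_point (center q x u)) (real_point (center q y v)) \<longleftrightarrow> v i \<le> u i"
proof
  assume "v i \<le> u i"
  then have "2 \<le> \<bar>real_point (center q x u) $ i - real_point (center q y v) $ i\<bar>"
    using eps_antimono[of "v i" "u i" q] unfolding real_point_center y by simp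
  also have "\<dots> \<le> dist (real_point (center q x u)) (real_point (center q y v))" by (rule coord_le_dist)
  finally show "2 \<le> dist (real_point (center q x u)) (real_point (center q y v))" .
next
  assume far: "2 \<le> dist (real_point (center q x u)) (real_point (center q y v))"
  show "v i \<le> u i"
  proof (rule ccontr)
    assume "\<not> v i \<le> u i"
    then have lt: "u i < v i" by simp
    let ?g = "eps q (Y + n)"
    have vi: "Y + 1 \<le> v i" "v i \<le> Y + n" "Y + 1 \<le> u i" using u v by (auto simp: exps_def)
    \<comment> \<open>Different displacements differ at least by a factor 2, so their difference is
      at least the smaller of the two.\<close>
    have g: "?g \<le> eps q (u i) - eps q (v i)"
      using eps_half[OF lt q] eps_antimono[OF vi(2), of q] by linarith
    have small: "0 < 1 + eps q (v i) - eps q (u i)" using eps_small(1)[OF vi(3)] eps_pos[of q "v i"] by linarith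
    have "(dist (real_point (center q x u)) (real_point (center q y v)))\<^sup>2
        = (\<Sum>j\<in>UNIV. 4 * (real (x j) + eps q (u j) - real (y j) - eps q (v j))\<^sup>2)"
      unfolding dist_vec_sq real_point_center by (intro sum.cong) (auto simp: power2_eq_square algebra_simps)
    also have "\<dots> = 4 * (1 + eps q (v i) - eps q (u i))\<^sup>2 + (\<Sum>j\<in>UNIV - {i}. 4 * (eps q (u j) - eps q (v j))\<^sup>2)"
      by (subst sum.remove[of UNIV i]) (auto simp: y power2_eq_square algebra_simps intro!: sum.cong)
    also have "\<dots> \<le> 4 * (1 - ?g)\<^sup>2 + (\<Sum>j\<in>UNIV - {i}. 4 * (eps q (Y + 1))\<^sup>2)"
      using u v small g by (intro add_mono sum_mono mult_left_mono eps_diff_sq power_mono) (auto simp: exps_def)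
    also have "\<dots> = 4 * (1 - ?g)\<^sup>2 + 4 * (real (d - 1) * (eps q (Y + 1))\<^sup>2)"
      using c by simp
    also have "\<dots> < 4 * (1 - ?g)\<^sup>2 + 4 * ?g"
    proof -
      have "real (d - 1) * (eps q (Y + 1))\<^sup>2 < real d * (eps q (Y + 1))\<^sup>2"
        using d eps_pos[of q "Y + 1"] by (intro mult_strict_right_mono) auto
      then show ?thesis using eps_small(3)[of "Y + 1"] by simp
    qed
    also have "\<dots> \<le> 4"
    proof -
      have "?g \<le> 1" using eps_small(1)[of "Y + n"] n by simp
      then have "?g * ?g \<le> ?g * 1" using eps_pos[of q "Y + n"] by (intro mult_left_mono) auto
      then show ?thesis by (simp add: power2_eq_square algebra_simps)
    qed
    finally have "(dist (real_point (center q x u)) (real_point (center q y v)))\<^sup>2 < 2\<^sup>2" by simp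
    then have "dist (real_point (center q x u)) (real_point (center q y v)) < 2"
      by (rule power_less_imp_less_base) simp
    then show False using far by simp
  qed
qed

text \<open>A coordinate in which the cells differ by 2 or more suffices. Otherwise at least two
  coordinates differ, each contributing at least 3/2 to the centers, and 2 (3/2)^2 > 4.\<close>

lemma far_dist:
  fixes x y :: "'d::finite \<Rightarrow> nat"
  assumes u: "exps u" and v: "exps v" and xy: "x \<noteq> y"
    and "\<And>i. y \<noteq> x(i := x i + 1)" "\<And>i. x \<noteq> y(i := y i + 1)"
  shows "2 \<le> dist (real_point (center q x u)) (real_point (center q y v))"
proof -
  let ?a = "real_point (center q x u)" and ?b = "real_point (center q y v)"
  have e: "0 < eps q (u i)" "eps q (u i) \<le> 1 / 4" "0 < eps q (v i)" "eps q (v i) \<le> 1 / 4" for i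
    using eps_pos eps_small(1) u v by (auto simp: exps_def)
  have co: "3 / 2 \<le> \<bar>?a $ i - ?b $ i\<bar>" if "x i \<noteq> y i" for i
  proof -
    have "real (x i) + 1 \<le> real (y i) \<or> real (y i) + 1 \<le> real (x i)" using that by linarith
    moreover have "X + 1 \<le> Z \<or> Z + 1 \<le> X \<Longrightarrow> 0 < E \<Longrightarrow> E \<le> 1 / 4 \<Longrightarrow> 0 < F \<Longrightarrow> F \<le> 1 / 4 \<Longrightarrow>
      3 / 2 \<le> \<bar>2 * (X + E) - 2 * (Z + F)\<bar>" for X Z E F :: real by (auto simp: abs_if)
    ultimately show ?thesis unfolding real_point_center using e[of i] by blast
  qed
  show ?thesis
  proof (cases "\<exists>i. x i + 2 \<le> y i \<or> y i + 2 \<le> x i")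
    case True
    then obtain i where "x i + 2 \<le> y i \<or> y i + 2 \<le> x i" by blast
    then have "real (x i) + 2 \<le> real (y i) \<or> real (y i) + 2 \<le> real (x i)" by linarith
    moreover have "X + 2 \<le> Z \<or> Z + 2 \<le> X \<Longrightarrow> 0 < E \<Longrightarrow> E \<le> 1 / 4 \<Longrightarrow> 0 < F \<Longrightarrow> F \<le> 1 / 4 \<Longrightarrow>
      2 \<le> \<bar>2 * (X + E) - 2 * (Z + F)\<bar>" for X Z E F :: real by (auto simp: abs_if)
    ultimately have "2 \<le> \<bar>?a $ i - ?b $ i\<bar>" unfolding real_point_center using e[of i] by blast
    then show ?thesis using coord_le_dist[of ?a i ?b] by linarith
  next
    case False
    obtain i where i: "x i \<noteq> y i" using xy by auto
    have "\<exists>j. j \<noteq> i \<and> x j \<noteq> y j"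
    proof (rule ccontr)
      assume "\<nexists>j. j \<noteq> i \<and> x j \<noteq> y j"
      then have eq: "\<And>j. j \<noteq> i \<Longrightarrow> x j = y j" by blast
      have "\<not> x i + 2 \<le> y i" "\<not> y i + 2 \<le> x i" using False by auto
      then have "y i = x i + 1 \<or> x i = y i + 1" using i by linarith
      then show False
      proof
        assume "y i = x i + 1"
        then have "y = x(i := x i + 1)" using eq by auto
        then show False using assms(4) by blast
      next
        assume "x i = y i + 1"
        then have "x = y(i := y i + 1)" using eq by auto
        then show False using assms(5) by blast
      qed
    qed
    then obtain j where j: "j \<noteq> i" "x j \<noteq> y j" by blast
    have sq: "9 / 4 \<le> (?a $ l - ?b $ l)\<^sup>2" if "x l \<noteq> y l" for l
    proof -
      have "(3 / 2)\<^sup>2 \<le> \<bar>?a $ l - ?b $ l\<bar>\<^sup>2" using co[OF that] by (intro power_mono) auto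
      then show ?thesis by (simp add: power2_eq_square)
    qed
    have "4 \<le> (\<Sum>l\<in>{i, j}. (?a $ l - ?b $ l)\<^sup>2)" using sq[OF i] sq[OF j(2)] j(1) by simp
    also have "\<dots> \<le> (\<Sum>l\<in>UNIV. (?a $ l - ?b $ l)\<^sup>2)" by (rule sum_mono2) auto
    finally have "2\<^sup>2 \<le> (dist ?a ?b)\<^sup>2" unfolding dist_vec_sq by simp
    then show ?thesis by (rule power2_le_imp_le) simp
  qed
qed

end

section \<open>Disjoint balls, one per cell, versus solutions of a network\<close>

context network
begin

text \<open>The condition of \<open>solution\<close> on a single cell; it selects the balls that are
  placed in that cell.\<close>

definition valid :: "nat \<Rightarrow> ('d \<times> ('d \<Rightarrow> nat) \<Rightarrow> nat \<Rightarrow> 'd \<times> ('d \<Rightarrow> nat) \<Rightarrow> nat \<Rightarrow> bool) \<Rightarrow>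
    ('d \<Rightarrow> nat) \<Rightarrow> ('d \<Rightarrow> nat) \<Rightarrow> bool" where
  "valid n cons x t \<longleftrightarrow> (\<forall>i. t i < n \<and> (desc x i = None \<longrightarrow> t i = 0)) \<and>
     (\<forall>i j l fl l' fl'. desc x i = Some (l, fl) \<longrightarrow> desc x j = Some (l', fl') \<longrightarrow> cons l (t i) l' (t j))"

definition shown :: "nat \<Rightarrow> ('d \<Rightarrow> nat) \<Rightarrow> ('d \<Rightarrow> nat) \<Rightarrow> 'd \<Rightarrow> nat" where
  "shown n x t i = (case desc x i of Some (l, True) \<Rightarrow> n - 1 - t i | _ \<Rightarrow> t i)"

lemma solution_alt:
  "solution n cons \<tau> \<longleftrightarrow> (\<forall>x \<in> Cells. valid n cons x (\<tau> x)) \<and>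
     (\<forall>x \<in> Cells. \<forall>y \<in> Cells. \<forall>i. y = x(i := x i + 1) \<longrightarrow> shown n x (\<tau> x) i \<le> shown n y (\<tau> y) i)"
  unfolding solution_def valid_def dval_def shown_def by blast

text \<open>Larger values give smaller exponents and hence larger displacements, so that disjoint
  neighbours correspond to weakly increasing shown values.\<close>

definition expo :: "nat \<Rightarrow> nat \<Rightarrow> ('d \<Rightarrow> nat) \<Rightarrow> ('d \<Rightarrow> nat) \<Rightarrow> 'd \<Rightarrow> nat" where
  "expo Y n x t i = Y + n - shown n x t i"

lemma shown_less: "valid n cons x t \<Longrightarrow> shown n x t i < n"
proof -
  assume "valid n cons x t"
  then have "t i < n" by (auto simp: valid_def)
  then show ?thesis by (auto simp: shown_def split: option.split prod.split bool.split)
qed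

lemma shown_inj: "valid n cons x t \<Longrightarrow> valid n cons x t' \<Longrightarrow> (\<And>i. shown n x t i = shown n x t' i) \<Longrightarrow> t = t'"
proof
  fix i
  assume v: "valid n cons x t" "valid n cons x t'" and s: "\<And>i. shown n x t i = shown n x t' i"
  have "t i < n" "t' i < n" using v by (auto simp: valid_def)
  then show "t i = t' i" using s[of i] by (auto simp: shown_def split: option.splits prod.splits bool.splits)
qed

definition ball_center :: "nat \<Rightarrow> nat \<Rightarrow> nat \<Rightarrow> ('d \<Rightarrow> nat) \<Rightarrow> ('d \<Rightarrow> nat) \<Rightarrow> rat ^ 'd" where
  "ball_center q Y n x t = center q x (expo Y n x t)"

text \<open>Two balls of the same cell always intersect, so \<open>card Cells\<close> disjoint balls
  occupy every cell exactly once. Cells that are not neighbours impose no condition.\<close>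

theorem balls_iff_solution:
  assumes sc: "ball_scale q n Y CARD('d)"
    and cs: "set cs = {ball_center q Y n x t | x t. x \<in> Cells \<and> valid n cons x t}"
  shows "(\<exists>js. nonintersecting_balls (card Cells) cs js) \<longleftrightarrow> (\<exists>\<tau>. solution n cons \<tau>)"
proof -
  interpret ball_scale q n Y "CARD('d)" by (rule sc)
  have ex: "exps (expo Y n x t)" if "valid n cons x t" for x t
  proof -
    have "Y + 1 \<le> Y + n - shown n x t i \<and> Y + n - shown n x t i \<le> Y + n" for i
      using shown_less[OF that, of i] by linarith
    then show ?thesis by (auto simp: exps_def expo_def)
  qed
  let ?pt = "\<lambda>x t. real_point (ball_center q Y n x t)"
  have same: "dist (?pt x t) (?pt x t') < 2" if "valid n cons x t" "valid n cons x t'" for x t t'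
    unfolding ball_center_def using same_cell_dist[OF refl ex[OF that(1)] ex[OF that(2)]] .
  have adj: "2 \<le> dist (?pt x t) (?pt y t') \<longleftrightarrow> shown n x t i \<le> shown n y t' i"
    if "valid n cons x t" "valid n cons y t'" "y = x(i := x i + 1)" for x y t t' i
  proof -
    have "2 \<le> dist (?pt x t) (?pt y t') \<longleftrightarrow> expo Y n y t' i \<le> expo Y n x t i"
      unfolding ball_center_def by (rule adjacent_dist[OF refl ex[OF that(1)] ex[OF that(2)] that(3)])
    then show ?thesis using shown_less[OF that(1), of i] shown_less[OF that(2), of i] unfolding expo_def by linarith
  qed
  have far: "2 \<le> dist (?pt x t) (?pt y t')"
    if "valid n cons x t" "valid n cons y t'" "x \<noteq> y" "\<And>i. y \<noteq> x(i := x i + 1)" "\<And>i. x \<noteq> y(i := y i + 1)" for x y t t'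
    unfolding ball_center_def using far_dist[OF ex[OF that(1)] ex[OF that(2)] that(3-5)] .
  show ?thesis
  proof
    assume "\<exists>js. nonintersecting_balls (card Cells) cs js"
    then obtain js where js: "length js = card Cells" "distinct js" "set js \<subseteq> {..<length cs}"
      "disjoint_family_on (\<lambda>j. ball (real_point (cs ! j)) 1) (set js)" by (auto simp: nonintersecting_balls_def)
    have "\<forall>j \<in> set js. \<exists>x t. cs ! j = ball_center q Y n x t \<and> x \<in> Cells \<and> valid n cons x t"
    proof
      fix j assume "j \<in> set js"
      then have "cs ! j \<in> set cs" using js(3) by auto
      then show "\<exists>x t. cs ! j = ball_center q Y n x t \<and> x \<in> Cells \<and> valid n cons x t" unfolding cs by blast
    qed
    then obtain X T where XT: "\<And>j. j \<in> set js \<Longrightarrow> cs ! j = ball_center q Y n (X j) (T j) \<and> X j \<in> Cells \<and> valid n cons (X j) (T j)"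
      by metis
    have apart: "2 \<le> dist (?pt (X j) (T j)) (?pt (X j') (T j'))" if "j \<in> set js" "j' \<in> set js" "j \<noteq> j'" for j j'
      using js(4) that XT[OF that(1)] XT[OF that(2)] unfolding disjoint_family_on_def
      by (metis unit_balls_disjoint)
    have inj: "inj_on X (set js)"
    proof (rule inj_onI, rule ccontr)
      fix j j' assume *: "j \<in> set js" "j' \<in> set js" "X j = X j'" "j \<noteq> j'"
      from apart[OF *(1,2,4)] same[of "X j" "T j" "T j'"] XT[OF *(1)] XT[OF *(2)] show False
        unfolding *(3) by linarith
    qed
    have "X ` set js = Cells"
    proof (rule card_subset_eq[OF finite_Cells])
      show "X ` set js \<subseteq> Cells" using XT by blast
      show "card (X ` set js) = card Cells" using card_image[OF inj] js(1,2) distinct_card by metis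
    qed
    define J where "J = inv_into (set js) X"
    have J: "J x \<in> set js" "X (J x) = x" if "x \<in> Cells" for x
      using that \<open>X ` set js = Cells\<close> unfolding J_def by (auto simp: inv_into_into f_inv_into_f)
    have "solution n cons (\<lambda>x. T (J x))"
      unfolding solution_alt
    proof (intro conjI ballI allI impI)
      fix x assume "x \<in> Cells"
      then show "valid n cons x (T (J x))" using XT[OF J(1)] J(2) by metis
    next
      fix x y i assume *: "x \<in> Cells" "y \<in> Cells" "y = x(i := x i + 1)"
      have v: "valid n cons x (T (J x))" "valid n cons y (T (J y))" using XT[OF J(1)] J(2) * by metis+
      have "x \<noteq> y" using *(3) by (metis add_eq_self_zero fun_upd_same zero_neq_one)
      then have "J x \<noteq> J y" using J(2) *(1,2) by metis
      from apart[OF J(1)[OF *(1)] J(1)[OF *(2)] this]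
      have "2 \<le> dist (?pt x (T (J x))) (?pt y (T (J y)))" unfolding J(2)[OF *(1)] J(2)[OF *(2)] .
      then show "shown n x (T (J x)) i \<le> shown n y (T (J y)) i" using adj[OF v *(3)] by blast
    qed
    then show "\<exists>\<tau>. solution n cons \<tau>" by blast
  next
    assume "\<exists>\<tau>. solution n cons \<tau>"
    then obtain \<tau> where sol: "\<And>x. x \<in> Cells \<Longrightarrow> valid n cons x (\<tau> x)"
      "\<And>x y i. x \<in> Cells \<Longrightarrow> y \<in> Cells \<Longrightarrow> y = x(i := x i + 1) \<Longrightarrow> shown n x (\<tau> x) i \<le> shown n y (\<tau> y) i"
      unfolding solution_alt by blast
    have "\<exists>j. j < length cs \<and> cs ! j = ball_center q Y n x (\<tau> x)" if "x \<in> Cells" for x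
    proof -
      have "ball_center q Y n x (\<tau> x) \<in> set cs" unfolding cs using sol(1)[OF that] that by blast
      then show ?thesis by (simp add: in_set_conv_nth)
    qed
    then obtain J where J: "\<And>x. x \<in> Cells \<Longrightarrow> J x < length cs \<and> cs ! J x = ball_center q Y n x (\<tau> x)" by metis
    have apart: "2 \<le> dist (?pt x (\<tau> x)) (?pt y (\<tau> y))" if "x \<in> Cells" "y \<in> Cells" "x \<noteq> y" for x y
    proof -
      consider i where "y = x(i := x i + 1)" | i where "x = y(i := y i + 1)"
        | "\<And>i. y \<noteq> x(i := x i + 1)" "\<And>i. x \<noteq> y(i := y i + 1)" by blast
      then show ?thesis
      proof cases
        case 1
        then show ?thesis using adj[OF sol(1)[OF that(1)] sol(1)[OF that(2)] 1] sol(2)[OF that(1,2) 1] by blast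
      next
        case 2
        then show ?thesis using adj[OF sol(1)[OF that(2)] sol(1)[OF that(1)] 2] sol(2)[OF that(2,1) 2]
          by (metis dist_commute)
      next
        case 3
        then show ?thesis using far[OF sol(1)[OF that(1)] sol(1)[OF that(2)] that(3)] by blast
      qed
    qed
    have inj: "inj_on J Cells"
    proof (rule inj_onI, rule ccontr)
      fix x y assume *: "x \<in> Cells" "y \<in> Cells" "J x = J y" "x \<noteq> y"
      have "ball_center q Y n x (\<tau> x) = ball_center q Y n y (\<tau> y)" using J[OF *(1)] J[OF *(2)] *(3) by simp
      then show False using apart[OF *(1,2,4)] by simp
    qed
    obtain xs where xs: "set xs = Cells" "distinct xs" using finite_distinct_list[OF finite_Cells] by blast
    have "nonintersecting_balls (card Cells) cs (map J xs)"
      unfolding nonintersecting_balls_def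
    proof (intro conjI)
      show "length (map J xs) = card Cells" using xs distinct_card[of xs] by simp
      show "distinct (map J xs)" using xs inj by (simp add: distinct_map)
      show "set (map J xs) \<subseteq> {..<length cs}" using J xs by auto
      show "disjoint_family_on (\<lambda>j. ball (real_point (cs ! j)) 1) (set (map J xs))"
        unfolding disjoint_family_on_def
      proof (intro ballI impI)
        fix j j' assume "j \<in> set (map J xs)" "j' \<in> set (map J xs)" "j \<noteq> j'"
        then obtain x y where xy: "x \<in> Cells" "y \<in> Cells" "x \<noteq> y" "j = J x" "j' = J y" using xs by auto
        then show "ball (real_point (cs ! j)) 1 \<inter> ball (real_point (cs ! j')) 1 = {}"
          unfolding unit_balls_disjoint using apart J by simp
      qed
    qed
    then show "\<exists>js. nonintersecting_balls (card Cells) cs js" by blast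
  qed
qed

lemma ball_center_inj:
  assumes sc: "ball_scale q n Y CARD('d)" and v: "valid n cons x t" "valid n cons y t'"
    and eq: "ball_center q Y n x t = ball_center q Y n y t'"
  shows "x = y \<and> t = t'"
proof -
  interpret ball_scale q n Y "CARD('d)" by (rule sc)
  have s: "shown n x t i < n" "shown n y t' i < n" for i using shown_less v by blast+
  have "1 \<le> expo Y n x t i" "1 \<le> expo Y n y t' i" for i
    using s[of i] unfolding expo_def by linarith+
  from center_inj[OF q this eq[unfolded ball_center_def]]
  have xy: "x = y" and e: "expo Y n x t = expo Y n y t'" by auto
  have "shown n x t i = shown n x t' i" for i
    using fun_cong[OF e, of i] s[of i] unfolding expo_def xy by linarith
  then show ?thesis using shown_inj v xy by blast
qed

end

section \<open>A Cantor grid of prescribed fractal dimension\<close>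

text \<open>In base 2^q only the 2^p smallest digits are allowed. Powers of two keep all centers
  dyadic and still realise every rational dimension p/q between 0 and 1.\<close>

locale cantor =
  fixes p q :: nat
  assumes p1: "1 \<le> p" and pq: "p < q"
begin

definition A :: nat where "A = 2 ^ p"
definition B :: nat where "B = 2 ^ q"

lemma A2: "2 \<le> A"
  using power_increasing[of 1 p "2::nat"] p1 by (simp add: A_def)

lemma AB: "A < B"
  unfolding A_def B_def using pq by (intro power_strict_increasing) auto

lemma B4: "4 \<le> B"
  using power_increasing[of 2 q "2::nat"] p1 pq by (simp add: B_def)

inductive_set digs :: "nat set" where
  zero: "0 \<in> digs"
| step: "z \<in> digs \<Longrightarrow> y < A \<Longrightarrow> B * z + y \<in> digs"

lemma digs_div_mod: "z \<in> digs \<Longrightarrow> z div B \<in> digs \<and> z mod B < A"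
proof (induction rule: digs.induct)
  case zero
  then show ?case using digs.zero A2 by auto
next
  case (step z y)
  then have "y < B" using AB by simp
  then show ?case using step by simp
qed

lemma digs_mult: "z \<in> digs \<Longrightarrow> B ^ m * z \<in> digs"
proof (induction m)
  case (Suc m)
  then show ?case using digs.step[of "B ^ m * z" 0] A2 by (simp add: mult.assoc)
qed simp

lemma digs_div: "z \<in> digs \<Longrightarrow> z div B ^ m \<in> digs"
proof (induction m arbitrary: z)
  case (Suc m)
  have "z div B ^ Suc m = z div B div B ^ m" by (simp add: div_mult2_eq)
  then show ?case using Suc digs_div_mod by simp
qed simp

lemma digs_mod: "z \<in> digs \<Longrightarrow> z mod B ^ m \<in> digs"
proof (induction m arbitrary: z)
  case 0
  then show ?case using digs.zero by simp
next
  case (Suc m)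
  have "z mod B ^ Suc m = B * (z div B mod B ^ m) + z mod B" by (simp add: mod_mult2_eq)
  then show ?case using Suc digs_div_mod digs.step by metis
qed

lemma card_digs_less: "finite {z \<in> digs. z < B ^ s} \<and> card {z \<in> digs. z < B ^ s} \<le> A ^ s"
proof (induction s)
  case 0
  have "{z \<in> digs. z < B ^ 0} \<subseteq> {0}" by auto
  from card_mono[OF _ this] show ?case by simp
next
  case (Suc s)
  let ?S = "{z \<in> digs. z < B ^ s}"
  have sub: "{z \<in> digs. z < B ^ Suc s} \<subseteq> (\<lambda>(w, y). B * w + y) ` (?S \<times> {..<A})"
  proof
    fix z assume "z \<in> {z \<in> digs. z < B ^ Suc s}"
    then have z: "z div B \<in> digs" "z mod B < A" "z div B < B ^ s"
      using digs_div_mod[of z] less_mult_imp_div_less[of z "B ^ s" B] by (auto simp: mult.commute)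
    have "z = (\<lambda>(w, y). B * w + y) (z div B, z mod B)" by simp
    then show "z \<in> (\<lambda>(w, y). B * w + y) ` (?S \<times> {..<A})" using z by blast
  qed
  have fin: "finite (?S \<times> {..<A})" using Suc by simp
  have "card {z \<in> digs. z < B ^ Suc s} \<le> card (?S \<times> {..<A})"
    using card_mono[OF finite_imageI[OF fin] sub] card_image_le[OF fin] by (rule order_trans)
  also have "\<dots> \<le> A ^ s * A" using Suc by (simp add: card_cartesian_product)
  finally show ?case using finite_subset[OF sub finite_imageI[OF fin]] by (simp add: mult.commute)
qed

text \<open>A window of length at most B^s meets at most two aligned blocks of B^s integers, and
  inside a block a member is determined by its last s digits.\<close>

lemma card_digs_window:
  fixes u :: int
  assumes "L \<le> B ^ s"
  shows "finite (int ` digs \<inter> {u..<u + int L}) \<and> card (int ` digs \<inter> {u..<u + int L}) \<le> 2 * A ^ s"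
proof -
  let ?W = "int ` digs \<inter> {u..<u + int L}" and ?b = "int (B ^ s)" and ?S = "int ` {z \<in> digs. z < B ^ s}"
  have b: "0 < ?b" using B4 by simp
  have sub: "?W \<subseteq> (\<lambda>(k, m). k * ?b + m) ` ({u div ?b, u div ?b + 1} \<times> ?S)"
  proof
    fix w assume w: "w \<in> ?W"
    then obtain z where z: "z \<in> digs" "w = int z" by auto
    have "w mod ?b = int (z mod B ^ s)" unfolding z by (simp add: zmod_int)
    then have m: "w mod ?b \<in> ?S" using digs_mod[OF z(1), of s] B4 by simp
    have lo: "u div ?b \<le> w div ?b" using w b by (intro zdiv_mono1) auto
    have "int L \<le> ?b" using assms by (simp only: of_nat_le_iff)
    moreover have "w < u + int L" using w by simp
    ultimately have "w \<le> u + ?b" by linarith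
    then have "w div ?b \<le> (u + ?b) div ?b" using b by (intro zdiv_mono1)
    moreover have "(u + ?b) div ?b = u div ?b + 1" using b by simp
    ultimately have "w div ?b \<in> {u div ?b, u div ?b + 1}" using lo by auto
    then show "w \<in> (\<lambda>(k, m). k * ?b + m) ` ({u div ?b, u div ?b + 1} \<times> ?S)"
      using m by (intro image_eqI[of _ _ "(w div ?b, w mod ?b)"]) (simp_all only: case_prod_conv div_mult_mod_eq mem_Sigma_iff simp_thms)
  qed
  have fin: "finite ({u div ?b, u div ?b + 1} \<times> ?S)" using card_digs_less[of s] by simp
  have "card ?W \<le> card ({u div ?b, u div ?b + 1} \<times> ?S)"
    using card_mono[OF finite_imageI[OF fin] sub] card_image_le[OF fin] by (rule order_trans)
  also have "\<dots> \<le> 2 * card ?S" by (simp add: card_cartesian_product card_insert_if)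
  also have "\<dots> \<le> 2 * A ^ s"
    using card_digs_less[of s] card_image_le[of "{z \<in> digs. z < B ^ s}" int] by simp
  finally show ?thesis using finite_subset[OF sub finite_imageI[OF fin]] by simp
qed

text \<open>The similarity dimension log A / log B of the Cantor set.\<close>

definition alpha :: real where "alpha = real p / real q"

lemma A_powr: "real (A ^ s) = real (B ^ s) powr alpha"
proof -
  have "real (B ^ s) powr alpha = 2 powr (real (q * s) * alpha)"
    by (simp add: B_def power_mult[symmetric] powr_powr powr_realpow[symmetric])
  also have "real (q * s) * alpha = real (p * s)" using pq by (simp add: alpha_def)
  also have "2 powr real (p * s) = 2 ^ (p * s)" by (rule powr_realpow) simp
  also have "\<dots> = real (A ^ s)" by (simp add: A_def power_mult)
  finally show ?thesis by simp
qed

lemma alpha_bounds: "0 < alpha" "alpha < 1"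
  using p1 pq by (auto simp: alpha_def)

lemma card_digs_window_real:
  fixes u :: int and R :: real
  assumes R: "1 \<le> R" and L: "real L \<le> 4 * R"
  shows "finite (int ` digs \<inter> {u..<u + int L}) \<and>
    real (card (int ` digs \<inter> {u..<u + int L})) \<le> 2 * real A * (4 * R) powr alpha"
proof -
  \<comment> \<open>The least scale that covers the window; by minimality only a factor
    \<open>A\<close> is lost.\<close>
  define s where "s = (LEAST s. L \<le> B ^ s)"
  have "L \<le> B ^ L"
    using less_exp[of L] power_mono[of 2 B L] B4 by linarith
  then have s: "L \<le> B ^ s" unfolding s_def by (rule LeastI)
  have "real (A ^ s) \<le> real A * (4 * R) powr alpha"
  proof (cases s)
    case 0
    have "1 * 1 \<le> real A * (4 * R) powr alpha"
      using A2 R alpha_bounds by (intro mult_mono ge_one_powr_ge_zero) auto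
    then show ?thesis using 0 by simp
  next
    case (Suc s')
    then have "\<not> L \<le> B ^ s'" using not_less_Least[of s' "\<lambda>s. L \<le> B ^ s"] s_def by simp
    then have "real (B ^ s') \<le> 4 * R" using L by linarith
    then have "real (A ^ s') \<le> (4 * R) powr alpha"
      unfolding A_powr using alpha_bounds by (intro powr_mono2) auto
    then have "real A * real (A ^ s') \<le> real A * (4 * R) powr alpha" by (intro mult_left_mono) auto
    then show ?thesis by (simp add: Suc)
  qed
  moreover have "real (card (int ` digs \<inter> {u..<u + int L})) \<le> real (2 * A ^ s)"
    using card_digs_window[OF s, of u] by (simp only: of_nat_le_iff)
  ultimately show ?thesis using card_digs_window[OF s, of u] by simp
qed

text \<open>Closed under multiplication and division by B, hence self-similar at all small and all
  large scales, as counting for arbitrary \<rho> and r requires.\<close>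

definition dust :: "real set" where
  "dust = {real u / real B ^ m | u m. u \<in> digs}"

text \<open>Dividing by a power of B shifts the digits, and the floor cuts off the fractional
  ones.\<close>

lemma floor_dust: "z \<in> dust \<Longrightarrow> \<lfloor>z / real B powi j\<rfloor> \<in> int ` digs"
proof -
  assume "z \<in> dust"
  then obtain u m where u: "u \<in> digs" and z: "z = real u / real B ^ m" by (auto simp: dust_def)
  have B0: "real B \<noteq> 0" using B4 by simp
  have e: "z / real B powi j = real u / real B powi (int m + j)"
    unfolding z using B0 by (simp add: power_int_add)
  show ?thesis
  proof (cases "0 \<le> int m + j")
    case True
    then obtain k where k: "int m + j = int k" using nonneg_int_cases by blast
    have "\<lfloor>real u / real (B ^ k)\<rfloor> = int (u div B ^ k)"
      by (simp only: floor_divide_of_nat_eq)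
    then show ?thesis unfolding e k using digs_div[OF u, of k] by simp
  next
    case False
    then obtain k where k: "int m + j = - int k" by (metis int_cases2 minus_minus nat_le_iff nle_le of_nat_0_le_iff)
    have "real u / real B powi (int m + j) = real (B ^ k * u)" unfolding k by (simp add: power_int_minus field_simps)
    then show ?thesis unfolding e using digs_mult[OF u, of k] by (metis floor_of_nat image_eqI)
  qed
qed

text \<open>The free coordinate i is the direction of the line on which a center sits. Halving
  undoes the factor 2 in \<open>center\<close>.\<close>

definition cross :: "(real ^ 'd::finite) set" where
  "cross = {x. \<exists>i. \<forall>j. j \<noteq> i \<longrightarrow> x $ j / 2 \<in> dust}"

lemma floor_window:
  fixes y c r h :: real
  assumes "\<bar>y - c\<bar> < r" "0 < h" "1 \<le> r / h" "real L = of_int \<lceil>2 * (r / h)\<rceil> + 1"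
  shows "\<lfloor>y / h\<rfloor> \<in> {\<lfloor>(c - r) / h\<rfloor>..<\<lfloor>(c - r) / h\<rfloor> + int L}"
proof -
  have "(c - r) / h \<le> y / h" using assms by (intro divide_right_mono) auto
  then have 1: "\<lfloor>(c - r) / h\<rfloor> \<le> \<lfloor>y / h\<rfloor>" by (rule floor_mono)
  have "y / h \<le> (c - r + 2 * r) / h" using assms by (intro divide_right_mono) auto
  also have "\<dots> = (c - r) / h + 2 * (r / h)" by (simp add: add_divide_distrib diff_divide_distrib)
  finally have "y / h \<le> (c - r) / h + 2 * (r / h)" .
  then have "of_int \<lfloor>y / h\<rfloor> < of_int \<lfloor>(c - r) / h\<rfloor> + 1 + (of_int \<lceil>2 * (r / h)\<rceil> :: real)"
    by linarith
  then have "of_int \<lfloor>y / h\<rfloor> < (of_int (\<lfloor>(c - r) / h\<rfloor> + int L) :: real)"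
    using assms(4) by simp
  then have "\<lfloor>y / h\<rfloor> < \<lfloor>(c - r) / h\<rfloor> + int L" by (simp only: of_int_less_iff)
  then show ?thesis using 1 by simp
qed

text \<open>Net points are separated by boxes of side h, small enough that points in one box are at
  most \<rho> apart. Within the ball, each dust direction offers O((r/h)^alpha) box coordinates and
  the free direction O(r/h).\<close>

lemma cross_count:
  fixes N :: "(real ^ 'd::finite) set" and x0 :: "real ^ 'd"
  assumes N: "N \<subseteq> cross" and sep: "\<And>x y. x \<in> N \<Longrightarrow> y \<in> N \<Longrightarrow> x \<noteq> y \<Longrightarrow> \<rho> < dist x y"
    and \<rho>: "0 < \<rho>" and r: "2 * \<rho> \<le> r"
  shows "real (card (N \<inter> ball x0 r)) \<le>
    real CARD('d) * (2 * real A) ^ (CARD('d) - 1) * (8 * real B * real CARD('d)) powr (1 + real (CARD('d) - 1) * alpha)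
      * (r / \<rho>) powr (1 + real (CARD('d) - 1) * alpha)"
proof -
  let ?d = "real CARD('d)" and ?e = "1 + real (CARD('d) - 1) * alpha"
  have d1: "1 \<le> ?d" by (simp add: Suc_le_eq)
  have B0: "1 < real B" using B4 by simp
  \<comment> \<open>The largest j for which boxes of side 2 B^j, times the dimension, stay within
    \<rho>; rounding to a power of B costs at most a factor \<open>B\<close>.\<close>
  define j where "j = \<lfloor>log (real B) (\<rho> / (2 * ?d))\<rfloor>"
  define h where "h = 2 * real B powi j"
  have hpos: "0 < h" using B0 by (simp add: h_def)
  have pw: "real B powi j = real B powr of_int j" using B0 by (simp add: powr_real_of_int')
  have q0: "0 < \<rho> / (2 * ?d)" using \<rho> d1 by simp
  have "real B powr of_int j \<le> real B powr (log (real B) (\<rho> / (2 * ?d)))"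
    using B0 unfolding j_def by (intro powr_mono) auto
  then have h1: "real B powi j \<le> \<rho> / (2 * ?d)" unfolding pw using B0 q0 by simp
  have "real B powr (log (real B) (\<rho> / (2 * ?d))) \<le> real B powr (of_int j + 1)"
    using B0 unfolding j_def by (intro powr_mono) linarith+
  then have h2: "\<rho> / (2 * ?d) \<le> real B * real B powi j" unfolding pw using B0 q0 by (simp add: powr_add mult.commute)
  have hd: "h * ?d \<le> \<rho>" using h1 d1 by (simp add: h_def field_simps)
  define R where "R = r / h"
  have "\<rho> / h \<le> R" unfolding R_def using r \<rho> hpos by (intro divide_right_mono) auto
  moreover have "1 \<le> \<rho> / h"
  proof -
    have "h * 1 \<le> h * ?d" using d1 hpos by (intro mult_left_mono) auto
    then have "h \<le> \<rho>" using hd by linarith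
    then show ?thesis using hpos by simp
  qed
  ultimately have R1: "1 \<le> R" by linarith
  have R2: "R \<le> 2 * real B * ?d * (r / \<rho>)"
  proof -
    have "\<rho> \<le> 2 * real B * ?d * h"
    proof -
      have "\<rho> \<le> real B * ?d * h" using h2 d1 by (simp add: h_def field_simps)
      moreover have "0 \<le> real B * ?d * h" using hpos by simp
      ultimately show ?thesis by linarith
    qed
    then have "r * \<rho> \<le> r * (2 * real B * ?d * h)" using r \<rho> by (intro mult_left_mono) auto
    then show ?thesis unfolding R_def using hpos \<rho> by (simp add: field_simps)
  qed
  obtain L :: nat where L: "int L = \<lceil>2 * R\<rceil> + 1" using R1 by (metis add_increasing ceiling_mono
      ceiling_zero mult_nonneg_nonneg nonneg_int_cases order_trans zero_le_numeral zero_le_one)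
  have L': "real L = of_int \<lceil>2 * R\<rceil> + 1" using L by (metis of_int_1 of_int_add of_int_of_nat_eq)
  have L4: "real L \<le> 4 * R" using L' R1 by linarith
  define k where "k x = (\<lambda>i. \<lfloor>x $ i / h\<rfloor>)" for x :: "real ^ 'd"
  define win where "win i = {\<lfloor>(x0 $ i - r) / h\<rfloor>..<\<lfloor>(x0 $ i - r) / h\<rfloor> + int L}" for i
  define box where "box i = PiE UNIV (\<lambda>j. if j = i then win j else int ` digs \<inter> win j)" for i
  have inj: "inj_on k N"
  proof (rule inj_onI, rule ccontr)
    fix x y assume *: "x \<in> N" "y \<in> N" "k x = k y" "x \<noteq> y"
    have "\<bar>x $ i - y $ i\<bar> < h" for i
    proof -
      have "\<lfloor>x $ i / h\<rfloor> = \<lfloor>y $ i / h\<rfloor>" using fun_cong[OF *(3), of i] by (simp add: k_def)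
      then have "\<bar>x $ i / h - y $ i / h\<bar> < 1" by linarith
      then have "\<bar>(x $ i - y $ i) / h\<bar> < 1" by (simp add: diff_divide_distrib)
      then show ?thesis using hpos by (simp add: abs_divide)
    qed
    then have "(\<Sum>i\<in>UNIV. \<bar>(x - y) $ i\<bar>) \<le> (\<Sum>i\<in>(UNIV::'d set). h)"
      by (intro sum_mono) (simp add: less_imp_le)
    then have "dist x y \<le> h * ?d"
      using norm_le_l1_cart[of "x - y"] by (simp add: dist_norm mult.commute)
    then show False using sep[OF *(1,2,4)] hd by linarith
  qed
  have img: "k ` (N \<inter> ball x0 r) \<subseteq> (\<Union>i. box i)"
  proof
    fix w assume "w \<in> k ` (N \<inter> ball x0 r)"
    then obtain x where x: "x \<in> N" "dist x0 x < r" "w = k x" by auto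
    have win: "k x j \<in> win j" for j
    proof -
      have "\<bar>x $ j - x0 $ j\<bar> < r" using coord_le_dist[of x0 j x] x(2) by linarith
      then show ?thesis unfolding k_def win_def
        using hpos R1 L' unfolding R_def by (intro floor_window) auto
    qed
    obtain i where i: "\<And>j. j \<noteq> i \<Longrightarrow> x $ j / 2 \<in> dust" using N x(1) by (auto simp: cross_def)
    have "k x j \<in> int ` digs" if "j \<noteq> i" for j
      using floor_dust[OF i[OF that], of "\<lfloor>log (real B) (\<rho> / (2 * ?d))\<rfloor>"]
      by (simp add: k_def h_def j_def)
    then have "k x \<in> box i" using win by (auto simp: box_def)
    then show "w \<in> (\<Union>i. box i)" using x(3) by blast
  qed
  have fd: "finite (int ` digs \<inter> win j)" "real (card (int ` digs \<inter> win j)) \<le> 2 * real A * (4 * R) powr alpha" for j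
    using card_digs_window_real[OF R1 L4] unfolding win_def by blast+
  have finbox: "finite (box i)" for i
    unfolding box_def using fd(1) by (intro finite_PiE) (auto simp: win_def)
  have cardbox: "real (card (box i)) \<le> (2 * real A) ^ (CARD('d) - 1) * (4 * R) powr ?e" for i
  proof -
    have "card (box i) = (\<Prod>j\<in>UNIV. card (if j = i then win j else int ` digs \<inter> win j))"
      unfolding box_def by (rule card_PiE) simp
    also have "\<dots> = card (win i) * (\<Prod>j\<in>UNIV - {i}. card (int ` digs \<inter> win j))"
      by (subst prod.remove[of UNIV i]) (auto intro!: prod.cong)
    finally have "real (card (box i)) = real L * (\<Prod>j\<in>UNIV - {i}. real (card (int ` digs \<inter> win j)))"
      by (simp add: win_def)
    also have "\<dots> \<le> (4 * R) * (\<Prod>j\<in>UNIV - {i}. 2 * real A * (4 * R) powr alpha)"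
      using L4 R1 fd(2) by (intro mult_mono prod_mono) (auto intro!: prod_nonneg)
    also have "\<dots> = (4 * R) * (2 * real A * (4 * R) powr alpha) ^ (CARD('d) - 1)" by simp
    also have "\<dots> = (2 * real A) ^ (CARD('d) - 1) * ((4 * R) powr 1 * (4 * R) powr (real (CARD('d) - 1) * alpha))"
      using R1 by (simp add: power_mult_distrib powr_power mult.commute mult.left_commute)
    finally show ?thesis by (simp only: powr_add)
  qed
  have "card (N \<inter> ball x0 r) = card (k ` (N \<inter> ball x0 r))"
    using inj by (intro card_image[symmetric]) (auto intro: inj_on_subset)
  also have "\<dots> \<le> card (\<Union>i. box i)" using finbox by (intro card_mono[OF _ img]) auto
  also have "\<dots> \<le> (\<Sum>i\<in>UNIV. card (box i))" by (rule card_UN_le) simp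
  finally have "real (card (N \<inter> ball x0 r)) \<le> (\<Sum>i\<in>UNIV. real (card (box i)))"
    by (metis of_nat_le_iff of_nat_sum)
  also have "\<dots> \<le> (\<Sum>i\<in>(UNIV::'d set). (2 * real A) ^ (CARD('d) - 1) * (4 * R) powr ?e)"
    by (intro sum_mono cardbox)
  also have "\<dots> = ?d * (2 * real A) ^ (CARD('d) - 1) * (4 * R) powr ?e" by simp
  also have "\<dots> \<le> ?d * (2 * real A) ^ (CARD('d) - 1) * ((8 * real B * ?d) * (r / \<rho>)) powr ?e"
    using R1 R2 alpha_bounds by (intro mult_left_mono powr_mono2) auto
  also have "\<dots> = ?d * (2 * real A) ^ (CARD('d) - 1) * ((8 * real B * ?d) powr ?e * (r / \<rho>) powr ?e)"
    using r \<rho> by (subst powr_mult) auto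
  finally show ?thesis by (simp add: mult.assoc)
qed

text \<open>The counting constant does not depend on the subset, so it serves the whole family. The
  exponent is 1 for the free direction and alpha for each of the others.\<close>

theorem fractal_dim_cross:
  "fractal_dim (Pow (cross :: (real ^ 'd::finite) set)) \<le> ereal (1 + real (CARD('d) - 1) * alpha)"
  unfolding fractal_dim_def
proof (rule Inf_lower, clarify, intro exI conjI)
  let ?e = "1 + real (CARD('d) - 1) * alpha"
  show "ereal ?e = ereal ?e" ..
  show "\<forall>P\<in>Pow cross. \<forall>\<rho>>0. \<forall>r\<ge>2 * \<rho>. \<forall>N. is_net \<rho> P N \<longrightarrow> (\<forall>x::real ^ 'd. real (card (N \<inter> ball x r)) \<le>
    (real CARD('d) * (2 * real A) ^ (CARD('d) - 1) * (8 * real B * real CARD('d)) powr ?e) * (r / \<rho>) powr ?e)"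
  proof (intro ballI allI impI)
    fix P N :: "(real ^ 'd) set" and \<rho> r and x :: "real ^ 'd"
    assume "P \<in> Pow cross" "0 < \<rho>" "2 * \<rho> \<le> r" "is_net \<rho> P N"
    then show "real (card (N \<inter> ball x r)) \<le>
      (real CARD('d) * (2 * real A) ^ (CARD('d) - 1) * (8 * real B * real CARD('d)) powr ?e) * (r / \<rho>) powr ?e"
      by (intro cross_count) (auto simp: is_net_def)
  qed
qed

section \<open>Grid positions on the Cantor set\<close>

text \<open>Reads the base-\<open>A\<close> digits of x in base \<open>B\<close>, an increasing map
  into \<open>digs\<close>.\<close>

function cant :: "nat \<Rightarrow> nat" where
  "cant x = (if x = 0 then 0 else B * cant (x div A) + x mod A)"
  by pat_completeness auto
termination
  using A2 by (relation "Wellfounded.measure id") auto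

declare cant.simps [simp del]

lemma cant_digs: "cant x \<in> digs"
proof (induction x rule: less_induct)
  case (less x)
  show ?case
  proof (cases "x = 0")
    case True
    then show ?thesis using digs.zero by (simp add: cant.simps)
  next
    case False
    then have "cant (x div A) \<in> digs" using less A2 by simp
    then show ?thesis using False A2 digs.step[of "cant (x div A)" "x mod A"] by (subst cant.simps) simp
  qed
qed

lemma cant_rec: "cant x = B * cant (x div A) + x mod A"
  by (cases "x = 0") (simp_all add: cant.simps)

lemma cant_mono: "x < y \<Longrightarrow> cant x < cant y"
proof (induction y arbitrary: x rule: less_induct)
  case (less y)
  have mod: "x mod A < B" using A2 AB mod_less_divisor[of A x] by linarith
  show ?case
  proof (cases "x div A = y div A")
    case True
    have "x = A * (x div A) + x mod A" by simp
    moreover have "y = A * (x div A) + y mod A" unfolding True by simp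
    ultimately have "x mod A < y mod A" using less.prems by linarith
    then show ?thesis using cant_rec[of x] cant_rec[of y] True by simp
  next
    case False
    moreover have "x div A \<le> y div A" using less.prems by (intro div_le_mono) simp
    ultimately have lt: "x div A < y div A" by simp
    have "y div A < y" using less.prems A2 by simp
    from less.IH[OF this lt] have "cant (x div A) + 1 \<le> cant (y div A)" by simp
    then have "B * (cant (x div A) + 1) \<le> B * cant (y div A)" by (rule mult_left_mono) simp
    then show ?thesis using cant_rec[of x] cant_rec[of y] mod by simp
  qed
qed

lemma cant_power: "cant (A ^ m) = B ^ m"
proof (induction m)
  case 0
  then show ?case using A2 by (simp add: cant.simps)
next
  case (Suc m)
  then show ?case using A2 cant_rec[of "A ^ Suc m"] by simp
qed

text \<open>The factor \<open>B\<close> makes the last digit 0. So the next integer, where backward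
  strands run, has admissible digits too, and positions are at least 4 apart.\<close>

definition grid_pos :: "nat \<Rightarrow> nat" where "grid_pos x = B * cant x"

lemma grid_pos_digs: "grid_pos x \<in> digs" "grid_pos x + 1 \<in> digs"
  using digs.step[OF cant_digs, of 0 x] digs.step[OF cant_digs, of 1 x] A2 by (auto simp: grid_pos_def)

lemma grid_pos_gap: "x < y \<Longrightarrow> grid_pos x + 3 \<le> grid_pos y"
proof -
  assume "x < y"
  then have "cant x + 1 \<le> cant y" using cant_mono by (simp add: Suc_le_eq)
  then have "B * (cant x + 1) \<le> B * cant y" by (rule mult_left_mono) simp
  then show ?thesis using B4 by (simp add: grid_pos_def)
qed

lemma grid_pos_1: "2 \<le> grid_pos 1"
  using grid_pos_gap[of 0 1] by linarith

text \<open>The displacement puts a digit 1 behind the radix point, and w \<ge> 1 keeps it clear of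
  the digits of u.\<close>

lemma digs_dust:
  assumes u: "u \<in> digs" and "1 \<le> w"
  shows "real u + 1 / real B ^ w \<in> dust"
proof -
  obtain w' where w: "w = Suc w'" using assms(2) by (cases w) auto
  have "B * (B ^ w' * u) + 1 \<in> digs" using digs.step[OF digs_mult[OF u, of w'], of 1] A2 by simp
  moreover have "real u + 1 / real B ^ w = real (B * (B ^ w' * u) + 1) / real B ^ w"
    using B4 by (simp add: w field_simps)
  ultimately show ?thesis unfolding dust_def by blast
qed

end

section \<open>Sparsification of 3-CNF formulas\<close>

definition sub :: "'a list \<Rightarrow> 'a list \<Rightarrow> bool" where
  "sub C C' \<longleftrightarrow> list_all (\<lambda>l. l \<in> set C') C"

lemma sub_iff: "sub C C' \<longleftrightarrow> set C \<subseteq> set C'"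
  by (auto simp: sub_def list_all_iff)

text \<open>Clauses are never deleted; subsumed ones merely become inactive. Thus the clauses only
  grow along a branch, and a model of a leaf is a model of the original formula.\<close>

definition active :: "'a list list \<Rightarrow> 'a list \<Rightarrow> bool" where
  "active K C \<longleftrightarrow> \<not> list_ex (\<lambda>C'. sub C' C \<and> \<not> sub C C') K"

definition petals :: "'a list list \<Rightarrow> 'a list \<Rightarrow> nat \<Rightarrow> 'a list list" where
  "petals K H j = filter (\<lambda>C. active K C \<and> length C = j \<and> sub H C) K"

text \<open>Heart, size of the petals, and the number of petals that counts as large. The order
  matters because the first large flower is used: a flower of the last kind is treated only when no
  literal lies in \<theta> active 2-clauses and no pair in \<theta> active 3-clauses.\<close>

definition flowers :: "nat \<Rightarrow> 'a list list \<Rightarrow> ('a list \<times> nat \<times> nat) list" where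
  "flowers \<theta> K = map (\<lambda>l. ([l], 2, \<theta>)) (concat K) @
     concat (map (\<lambda>C. concat (map (\<lambda>a. map (\<lambda>b. ([a, b], 3, \<theta>)) (filter (\<lambda>b. b \<noteq> a) C)) C)) K) @
     map (\<lambda>l. ([l], 3, 4 * \<theta> * \<theta>)) (concat K)"

definition large_flowers :: "nat \<Rightarrow> 'a list list \<Rightarrow> ('a list \<times> nat \<times> nat) list" where
  "large_flowers \<theta> K = filter (\<lambda>x. snd (snd x) \<le> length (petals K (fst x) (fst (snd x)))) (flowers \<theta> K)"

definition open_petals :: "'a list list \<Rightarrow> 'a list \<Rightarrow> nat \<Rightarrow> 'a list list" where
  "open_petals K H j = map (\<lambda>C. filter (\<lambda>l. l \<notin> set H) C) (petals K H j)"

text \<open>Either the heart of a large flower is added as a clause or all its petals are; the second alternative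
  consumes one unit of the budget \<open>r\<close>.\<close>

definition branch :: "nat \<Rightarrow> 'a list list \<times> nat \<Rightarrow> ('a list list \<times> nat) list" where
  "branch \<theta> s = (case large_flowers \<theta> (fst s) of [] \<Rightarrow> [s]
     | x # xs \<Rightarrow> (fst x # fst s, snd s) #
         (if snd s = 0 then [] else [(open_petals (fst s) (fst x) (fst (snd x)) @ fst s, snd s - 1)]))"

definition spread :: "nat \<Rightarrow> ('a list list \<times> nat) list \<Rightarrow> ('a list list \<times> nat) list" where
  "spread \<theta> ss = concat (map (branch \<theta>) ss)"

lemma set_spread: "set (spread \<theta> ss) = (\<Union>s \<in> set ss. set (branch \<theta> s))"
  by (simp add: spread_def)

abbreviation csets :: "'a list list \<Rightarrow> 'a set set" where
  "csets K \<equiv> set ` set K"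

definition minimal :: "'a set set \<Rightarrow> 'a set \<Rightarrow> bool" where
  "minimal S c \<longleftrightarrow> (\<forall>c' \<in> S. \<not> c' \<subset> c)"

lemma active_iff: "active K C \<longleftrightarrow> minimal (csets K) (set C)"
  by (auto simp: active_def list_ex_iff sub_iff minimal_def)

definition well :: "'a set \<Rightarrow> 'a list list \<Rightarrow> bool" where
  "well V K \<longleftrightarrow> distinct (map set K) \<and> (\<forall>C \<in> set K. distinct C \<and> length C \<le> 3 \<and> set C \<subseteq> V)"

lemma petals_iff: "C \<in> set (petals K H j) \<longleftrightarrow> C \<in> set K \<and> minimal (csets K) (set C) \<and> length C = j \<and> set H \<subseteq> set C"
  by (auto simp: petals_def active_iff sub_iff)

lemma well_inj: "well V K \<Longrightarrow> inj_on set (set K)"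
  by (auto simp: well_def distinct_map)

lemma well_card: "well V K \<Longrightarrow> C \<in> set K \<Longrightarrow> card (set C) = length C"
  by (auto simp: well_def distinct_card)

lemma petals_length: "well V K \<Longrightarrow> length (petals K H j) = card {c \<in> csets K. minimal (csets K) c \<and> card c = j \<and> set H \<subseteq> c}"
proof -
  assume w: "well V K"
  have "distinct K" using w by (auto simp: well_def distinct_map)
  then have "distinct (petals K H j)" by (simp add: petals_def)
  then have "length (petals K H j) = card (set (petals K H j))" by (simp add: distinct_card)
  also have "\<dots> = card (set ` set (petals K H j))"
    using well_inj[OF w] by (intro card_image[symmetric]) (auto simp: petals_def intro: inj_on_subset)
  also have "set ` set (petals K H j) = {c \<in> csets K. minimal (csets K) c \<and> card c = j \<and> set H \<subseteq> c}"
    using well_card[OF w] by (auto simp: petals_iff)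
  finally show ?thesis .
qed

lemma large_flowersD:
  assumes "large_flowers \<theta> K = (H, j, t) # xs"
  shows "t \<le> length (petals K H j)"
    "(\<exists>l. H = [l] \<and> j = 2 \<and> t = \<theta>) \<or>
     (\<exists>a b. H = [a, b] \<and> a \<noteq> b \<and> j = 3 \<and> t = \<theta>) \<or> (\<exists>l. H = [l] \<and> j = 3 \<and> t = 4 * \<theta> * \<theta>)"
proof -
  have "(H, j, t) \<in> set (large_flowers \<theta> K)" by (simp add: assms)
  then show "t \<le> length (petals K H j)"
    "(\<exists>l. H = [l] \<and> j = 2 \<and> t = \<theta>) \<or>
     (\<exists>a b. H = [a, b] \<and> a \<noteq> b \<and> j = 3 \<and> t = \<theta>) \<or> (\<exists>l. H = [l] \<and> j = 3 \<and> t = 4 * \<theta> * \<theta>)"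
    by (auto simp: large_flowers_def flowers_def)
qed

lemma petals_nonempty_heart:
  assumes "C \<in> set (petals K [l] j)"
  shows "l \<in> set (concat K)"
  using assms by (auto simp: petals_iff)

lemma no_first_kind:
  assumes e: "large_flowers \<theta> K = xs" and no: "\<And>l. ([l], 2, \<theta>) \<notin> set xs" and \<theta>: "1 \<le> \<theta>"
  shows "length (petals K [l] 2) < \<theta>"
proof (rule ccontr)
  assume "\<not> length (petals K [l] 2) < \<theta>"
  then have le: "\<theta> \<le> length (petals K [l] 2)" by simp
  then have "petals K [l] 2 \<noteq> []" using \<theta> by auto
  then obtain C where "C \<in> set (petals K [l] 2)" by (meson last_in_set)
  then have "l \<in> set (concat K)" by (rule petals_nonempty_heart)
  then have "([l], 2, \<theta>) \<in> set (large_flowers \<theta> K)" using le by (auto simp: large_flowers_def flowers_def)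
  then show False using e no by auto
qed

lemma filter_app_head:
  assumes "filter P (xs @ ys) = x # zs" "x \<notin> set xs"
  shows "filter P xs = []"
proof (cases "filter P xs")
  case (Cons y ys')
  then have "y = x" using assms(1) by simp
  moreover have "y \<in> set (filter P xs)" by (simp add: Cons)
  ultimately show ?thesis using assms(2) by simp
qed

lemma head_third_kind:
  assumes e: "large_flowers \<theta> K = (H, j, t) # xs" and j: "j = 3" and \<theta>: "1 \<le> \<theta>"
  shows "length (petals K [l] 2) < \<theta>"
proof (rule ccontr)
  assume "\<not> length (petals K [l] 2) < \<theta>"
  then have le: "\<theta> \<le> length (petals K [l] 2)" by simp
  then have "petals K [l] 2 \<noteq> []" using \<theta> by auto
  then obtain C where "C \<in> set (petals K [l] 2)" by (meson last_in_set)
  then have l: "l \<in> set (concat K)" by (rule petals_nonempty_heart)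
  let ?P = "\<lambda>x. snd (snd x) \<le> length (petals K (fst x) (fst (snd x)))"
  have "filter ?P (map (\<lambda>l. ([l], 2, \<theta>)) (concat K)) = []"
    using e unfolding large_flowers_def flowers_def
    by (rule filter_app_head) (auto simp: j)
  then show False using l le by (auto simp: filter_empty_conv)
qed

lemma head_pair_kind:
  assumes e: "large_flowers \<theta> K = ([c], 3, t) # xs" and \<theta>: "1 \<le> \<theta>" and ab: "a \<noteq> b"
  shows "length (petals K [a, b] 3) < \<theta>"
proof (rule ccontr)
  assume "\<not> length (petals K [a, b] 3) < \<theta>"
  then have le: "\<theta> \<le> length (petals K [a, b] 3)" by simp
  then have "petals K [a, b] 3 \<noteq> []" using \<theta> by auto
  then obtain C where "C \<in> set (petals K [a, b] 3)" by (meson last_in_set)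
  then have C: "C \<in> set K" "a \<in> set C" "b \<in> set C" by (auto simp: petals_iff)
  let ?P = "\<lambda>x. snd (snd x) \<le> length (petals K (fst x) (fst (snd x)))"
  let ?ys = "map (\<lambda>l. ([l], 2, \<theta>)) (concat K) @
     concat (map (\<lambda>C. concat (map (\<lambda>a. map (\<lambda>b. ([a, b], 3, \<theta>)) (filter (\<lambda>b. b \<noteq> a) C)) C)) K)"
  have "filter ?P ?ys = []"
    using e unfolding large_flowers_def flowers_def append_assoc[symmetric]
    by (rule filter_app_head) auto
  moreover have "([a, b], 3, \<theta>) \<in> set ?ys" using C ab by fastforce
  ultimately show False using le by (auto simp: filter_empty_conv)
qed

subsection \<open>The potential along the branch of a satisfying assignment\<close>

definition units :: "'a set set \<Rightarrow> 'a set" where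
  "units S = {l. {l} \<in> S}"

text \<open>Minimal 2-clauses created by the branching; together with the unit clauses they measure
  progress.\<close>

definition new_pairs :: "'a set set \<Rightarrow> 'a set set \<Rightarrow> 'a set set" where
  "new_pairs S0 S = {c \<in> S - S0. card c = 2 \<and> minimal S c}"

lemma finite_units: "finite S \<Longrightarrow> finite (units S)"
proof -
  assume "finite S"
  have "(\<lambda>l. {l}) ` units S \<subseteq> S" by (auto simp: units_def)
  then show ?thesis using \<open>finite S\<close> by (rule_tac finite_imageD[of "\<lambda>l. {l}"]) (auto intro: finite_subset)
qed

text \<open>A unit clause on l deprives only the 2-clauses containing l of their minimality, at most
  k of them. This is why a unit is given the weight 2 \<theta> in the potential.\<close>

lemma unit_step:
  assumes S: "finite S" and L: "finite L" "L \<inter> units S = {}"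
    and deg: "\<And>l. card {c \<in> new_pairs S0 S. l \<in> c} \<le> k"
  defines "S' \<equiv> S \<union> (\<lambda>l. {l}) ` L"
  shows "units S' = units S \<union> L" "card (units S') = card (units S) + card L"
    "new_pairs S0 S' \<subseteq> new_pairs S0 S" "card (new_pairs S0 S) \<le> card (new_pairs S0 S') + k * card L"
proof -
  show u: "units S' = units S \<union> L" by (auto simp: units_def S'_def)
  show "card (units S') = card (units S) + card L"
    unfolding u using L finite_units[OF S] by (intro card_Un_disjoint) auto
  have c1: "card c \<noteq> 2" if "c \<in> (\<lambda>l. {l}) ` L" for c using that by auto
  show sub: "new_pairs S0 S' \<subseteq> new_pairs S0 S"
    using c1 by (auto simp: new_pairs_def S'_def minimal_def)
  have "new_pairs S0 S \<subseteq> new_pairs S0 S' \<union> (\<Union>l\<in>L. {c \<in> new_pairs S0 S. l \<in> c})"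
  proof
    fix c assume c: "c \<in> new_pairs S0 S"
    show "c \<in> new_pairs S0 S' \<union> (\<Union>l\<in>L. {c \<in> new_pairs S0 S. l \<in> c})"
    proof (cases "\<exists>l\<in>L. l \<in> c")
      case True
      then show ?thesis using c by blast
    next
      case False
      then have "minimal S' c" using c by (auto simp: new_pairs_def minimal_def S'_def)
      then show ?thesis using c by (auto simp: new_pairs_def S'_def)
    qed
  qed
  moreover have fin: "finite (new_pairs S0 S)" using S by (auto simp: new_pairs_def)
  ultimately have "card (new_pairs S0 S) \<le> card (new_pairs S0 S' \<union> (\<Union>l\<in>L. {c \<in> new_pairs S0 S. l \<in> c}))"
    using sub L by (intro card_mono) (auto intro: finite_subset)
  also have "\<dots> \<le> card (new_pairs S0 S') + card (\<Union>l\<in>L. {c \<in> new_pairs S0 S. l \<in> c})" by (rule card_Un_le)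
  also have "card (\<Union>l\<in>L. {c \<in> new_pairs S0 S. l \<in> c}) \<le> (\<Sum>l\<in>L. card {c \<in> new_pairs S0 S. l \<in> c})"
    using L by (intro card_UN_le)
  also have "\<dots> \<le> (\<Sum>l\<in>L. k)" by (intro sum_mono deg)
  finally show "card (new_pairs S0 S) \<le> card (new_pairs S0 S') + k * card L" by (simp add: mult.commute)
qed

text \<open>A 2-clause cannot properly contain another one, so added pairs leave all earlier pairs
  minimal.\<close>

lemma pair_step:
  assumes S: "finite S" "S0 \<subseteq> S" and X: "finite X" "X \<inter> S = {}" "\<And>c. c \<in> X \<Longrightarrow> card c = 2 \<and> minimal S c"
  shows "units (S \<union> X) = units S" "new_pairs S0 (S \<union> X) = new_pairs S0 S \<union> X"
    "card (new_pairs S0 (S \<union> X)) = card (new_pairs S0 S) + card X"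
proof -
  show "units (S \<union> X) = units S" using X(3) by (fastforce simp: units_def)
  have noX: "\<not> c' \<subset> c" if "c' \<in> X" "card c = 2" for c c'
  proof
    assume "c' \<subset> c"
    moreover have "finite c" using that(2) by (metis card.infinite zero_neq_numeral)
    ultimately show False using psubset_card_mono[of c c'] X(3)[OF that(1)] that(2) by simp
  qed
  show e: "new_pairs S0 (S \<union> X) = new_pairs S0 S \<union> X"
  proof (intro set_eqI iffI)
    fix c assume "c \<in> new_pairs S0 (S \<union> X)"
    then show "c \<in> new_pairs S0 S \<union> X" by (auto simp: new_pairs_def minimal_def)
  next
    fix c assume c: "c \<in> new_pairs S0 S \<union> X"
    then have "card c = 2" "minimal S c" "c \<in> S \<union> X" using X(3) by (auto simp: new_pairs_def)
    moreover have "c \<notin> S0" using c X(2) S(2) by (auto simp: new_pairs_def)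
    ultimately show "c \<in> new_pairs S0 (S \<union> X)" using noX by (auto simp: new_pairs_def minimal_def)
  qed
  show "card (new_pairs S0 (S \<union> X)) = card (new_pairs S0 S) + card X"
    unfolding e using S X by (intro card_Un_disjoint) (auto simp: new_pairs_def)
qed

type_synonym lit = "nat \<times> bool"

definition lit_true :: "(nat \<Rightarrow> bool) \<Rightarrow> lit \<Rightarrow> bool" where
  "lit_true \<alpha> l \<longleftrightarrow> \<alpha> (fst l) = snd l"

definition models :: "(nat \<Rightarrow> bool) \<Rightarrow> lit list list \<Rightarrow> bool" where
  "models \<alpha> K \<longleftrightarrow> (\<forall>C \<in> set K. \<exists>l \<in> set C. lit_true \<alpha> l)"

lemma satisfiable_models: "satisfiable K \<longleftrightarrow> (\<exists>\<alpha>. models \<alpha> K)"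
  unfolding satisfiable_def models_def lit_true_def by (simp add: case_prod_beta)

definition vlits :: "nat \<Rightarrow> lit set" where
  "vlits N = {l. fst l < N}"

text \<open>State of the branch of a model after i steps, \<rho> of which opened a flower. With U
  units and P new pairs, P + 2\<theta>U never decreases. Every step raises U + (P + 2\<theta>U) by
  at least 1, and every opening raises 4\<theta>U + (P + 2\<theta>U) by at least 4\<theta>^2, since
  it creates \<theta> units or 4\<theta>^2 pairs.\<close>

definition inv :: "nat \<Rightarrow> nat \<Rightarrow> (nat \<Rightarrow> bool) \<Rightarrow> lit set set \<Rightarrow> lit list list \<Rightarrow> nat \<Rightarrow> nat \<Rightarrow> bool" where
  "inv N \<theta> \<alpha> S0 K i \<rho> \<longleftrightarrow> well (vlits N) K \<and> models \<alpha> K \<and> S0 \<subseteq> csets K \<and>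
     (\<forall>l. card {c \<in> new_pairs S0 (csets K). l \<in> c} \<le> 2 * \<theta>) \<and>
     i \<le> card (units (csets K)) + (card (new_pairs S0 (csets K)) + 2 * \<theta> * card (units (csets K))) \<and>
     \<rho> * (4 * \<theta> * \<theta>) \<le> 4 * \<theta> * card (units (csets K)) +
       (card (new_pairs S0 (csets K)) + 2 * \<theta> * card (units (csets K)))"

text \<open>The model satisfies all clauses: each unit is one of the N true literals, and each new
  pair contains one of them, which lies in at most 2\<theta> new pairs.\<close>

lemma inv_bounds:
  assumes "inv N \<theta> \<alpha> S0 K i \<rho>"
  shows "card (units (csets K)) \<le> N" "card (new_pairs S0 (csets K)) \<le> 2 * \<theta> * N"
proof -
  let ?T = "(\<lambda>v. (v, \<alpha> v)) ` {..<N}"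
  have true_in: "l \<in> ?T" if "lit_true \<alpha> l" "l \<in> vlits N" for l
    using that by (cases l) (auto simp: lit_true_def vlits_def)
  have w: "well (vlits N) K" and m: "models \<alpha> K" using assms by (auto simp: inv_def)
  have "units (csets K) \<subseteq> ?T"
  proof
    fix l assume "l \<in> units (csets K)"
    then obtain C where C: "C \<in> set K" "set C = {l}" by (auto simp: units_def)
    then have "lit_true \<alpha> l" "l \<in> vlits N" using w m by (auto simp: models_def well_def)
    then show "l \<in> ?T" by (rule true_in)
  qed
  then have "card (units (csets K)) \<le> card ?T" by (intro card_mono) auto
  also have "\<dots> \<le> N" using card_image_le[of "{..<N}" "\<lambda>v. (v, \<alpha> v)"] by simp
  finally show "card (units (csets K)) \<le> N" .
  have "new_pairs S0 (csets K) \<subseteq> (\<Union>l\<in>?T. {c \<in> new_pairs S0 (csets K). l \<in> c})"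
  proof
    fix c assume c: "c \<in> new_pairs S0 (csets K)"
    then obtain C where C: "C \<in> set K" "set C = c" by (auto simp: new_pairs_def)
    then obtain l where "l \<in> c" "lit_true \<alpha> l" "l \<in> vlits N" using w m by (fastforce simp: models_def well_def)
    then show "c \<in> (\<Union>l\<in>?T. {c \<in> new_pairs S0 (csets K). l \<in> c})" using c true_in by blast
  qed
  then have "card (new_pairs S0 (csets K)) \<le> card (\<Union>l\<in>?T. {c \<in> new_pairs S0 (csets K). l \<in> c})"
    by (intro card_mono) (auto simp: new_pairs_def)
  also have "\<dots> \<le> (\<Sum>l\<in>?T. card {c \<in> new_pairs S0 (csets K). l \<in> c})" by (rule card_UN_le) simp
  also have "\<dots> \<le> (\<Sum>l\<in>?T. 2 * \<theta>)" using assms by (intro sum_mono) (auto simp: inv_def)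
  also have "\<dots> \<le> 2 * \<theta> * N"
    using card_image_le[of "{..<N}" "\<lambda>v. (v, \<alpha> v)"] by (simp add: mult.commute)
  finally show "card (new_pairs S0 (csets K)) \<le> 2 * \<theta> * N" .
qed

text \<open>These limits determine the number of rounds and the initial budget in
  \<open>leaves\<close>.\<close>

lemma inv_limits:
  assumes "inv N \<theta> \<alpha> S0 K i \<rho>" "1 \<le> \<theta>"
  shows "i \<le> N * (4 * \<theta> + 1)" "\<rho> \<le> 2 * N div \<theta>"
proof -
  note b = inv_bounds[OF assms(1)]
  have 1: "2 * \<theta> * card (units (csets K)) \<le> 2 * \<theta> * N" using b(1) by (intro mult_left_mono) auto
  have "i \<le> card (units (csets K)) + (card (new_pairs S0 (csets K)) + 2 * \<theta> * card (units (csets K)))"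
    using assms(1) unfolding inv_def by blast
  also have "\<dots> \<le> N + (2 * \<theta> * N + 2 * \<theta> * N)" using b 1 by (intro add_mono)
  finally show "i \<le> N * (4 * \<theta> + 1)" by (simp add: algebra_simps)
  have 2: "4 * \<theta> * card (units (csets K)) \<le> 4 * \<theta> * N" using b(1) by (intro mult_left_mono) auto
  have "\<rho> * (4 * \<theta> * \<theta>) \<le> 4 * \<theta> * card (units (csets K)) +
       (card (new_pairs S0 (csets K)) + 2 * \<theta> * card (units (csets K)))"
    using assms(1) unfolding inv_def by blast
  also have "\<dots> \<le> 4 * \<theta> * N + (2 * \<theta> * N + 2 * \<theta> * N)" using b 1 2 by (intro add_mono)
  finally have "(4 * \<theta>) * (\<rho> * \<theta>) \<le> (4 * \<theta>) * (2 * N)" by (simp add: algebra_simps)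
  then have "\<rho> * \<theta> \<le> 2 * N" using assms(2) by simp
  then show "\<rho> \<le> 2 * N div \<theta>" using assms(2) by (simp add: less_eq_div_iff_mult_less_eq)
qed

lemma finite_csets [simp]: "finite (csets K)" by simp

lemma inv_unit_step:
  assumes inv: "inv N \<theta> \<alpha> S0 K i \<rho>" and K': "well (vlits N) K'" "models \<alpha> K'"
    and e: "csets K' = csets K \<union> (\<lambda>l. {l}) ` L" and L: "finite L" "L \<inter> units (csets K) = {}" "1 \<le> card L"
    and b: "b = 0 \<or> b = 1 \<and> \<theta> \<le> card L"
  shows "inv N \<theta> \<alpha> S0 K' (i + 1) (\<rho> + b)"
proof -
  let ?U = "card (units (csets K))" and ?P = "card (new_pairs S0 (csets K))"
  let ?U' = "card (units (csets K'))" and ?P' = "card (new_pairs S0 (csets K'))"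
  have deg: "card {c \<in> new_pairs S0 (csets K). l \<in> c} \<le> 2 * \<theta>" for l using inv unfolding inv_def by blast
  have i: "i \<le> ?U + (?P + 2 * \<theta> * ?U)" "\<rho> * (4 * \<theta> * \<theta>) \<le> 4 * \<theta> * ?U + (?P + 2 * \<theta> * ?U)"
    using inv unfolding inv_def by blast+
  note u = unit_step[OF finite_csets L(1,2) deg, folded e]
  have U': "?U' = ?U + card L" by (rule u(2))
  have P': "?P \<le> ?P' + 2 * \<theta> * card L" by (rule u(4))
  have phi: "?P + 2 * \<theta> * ?U \<le> ?P' + 2 * \<theta> * ?U'" using P' by (simp add: U' algebra_simps)
  have "card {c \<in> new_pairs S0 (csets K'). l \<in> c} \<le> 2 * \<theta>" for l
    using u(3) by (intro order_trans[OF card_mono deg[of l]]) (auto simp: new_pairs_def)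
  moreover have "i + 1 \<le> ?U' + (?P' + 2 * \<theta> * ?U')" using i(1) phi U' L(3) by linarith
  moreover have "(\<rho> + b) * (4 * \<theta> * \<theta>) \<le> 4 * \<theta> * ?U' + (?P' + 2 * \<theta> * ?U')"
  proof -
    have "b * (4 * \<theta> * \<theta>) \<le> 4 * \<theta> * card L"
      using b mult_left_mono[of \<theta> "card L" "4 * \<theta>"] by auto
    then have "(\<rho> + b) * (4 * \<theta> * \<theta>) \<le> 4 * \<theta> * card L + (4 * \<theta> * ?U + (?P + 2 * \<theta> * ?U))"
      using i(2) unfolding add_mult_distrib by linarith
    also have "\<dots> = 4 * \<theta> * ?U' + (?P + 2 * \<theta> * ?U)" by (simp add: U' algebra_simps)
    finally show ?thesis using phi by linarith
  qed
  moreover have "S0 \<subseteq> csets K'" using inv e unfolding inv_def by blast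
  ultimately show ?thesis using K' unfolding inv_def by blast
qed

lemma inv_pair_step:
  assumes inv: "inv N \<theta> \<alpha> S0 K i \<rho>" and K': "well (vlits N) K'" "models \<alpha> K'"
    and e: "csets K' = csets K \<union> X" and X: "finite X" "X \<inter> csets K = {}" "\<And>c. c \<in> X \<Longrightarrow> card c = 2 \<and> minimal (csets K) c"
    and X1: "1 \<le> card X" and b: "b = 0 \<or> b = 1 \<and> 4 * \<theta> * \<theta> \<le> card X"
    and deg: "\<And>l. card {c \<in> new_pairs S0 (csets K). l \<in> c} + card {c \<in> X. l \<in> c} \<le> 2 * \<theta>"
  shows "inv N \<theta> \<alpha> S0 K' (i + 1) (\<rho> + b)"
proof -
  let ?U = "card (units (csets K))" and ?P = "card (new_pairs S0 (csets K))"
  have S0: "S0 \<subseteq> csets K" using inv unfolding inv_def by blast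
  have i: "i \<le> ?U + (?P + 2 * \<theta> * ?U)" "\<rho> * (4 * \<theta> * \<theta>) \<le> 4 * \<theta> * ?U + (?P + 2 * \<theta> * ?U)"
    using inv unfolding inv_def by blast+
  have u1: "units (csets K') = units (csets K)"
    and u2: "new_pairs S0 (csets K') = new_pairs S0 (csets K) \<union> X"
    and u3: "card (new_pairs S0 (csets K')) = ?P + card X"
    unfolding e using pair_step[OF finite_csets S0 X] by blast+
  have "card {c \<in> new_pairs S0 (csets K'). l \<in> c} \<le> 2 * \<theta>" for l
  proof -
    have "{c \<in> new_pairs S0 (csets K'). l \<in> c} = {c \<in> new_pairs S0 (csets K). l \<in> c} \<union> {c \<in> X. l \<in> c}"
      by (auto simp: u2)
    then show ?thesis using deg[of l] card_Un_le[of "{c \<in> new_pairs S0 (csets K). l \<in> c}" "{c \<in> X. l \<in> c}"] by simp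
  qed
  moreover have "i + 1 \<le> ?U + ((?P + card X) + 2 * \<theta> * ?U)" using i(1) X1 by linarith
  moreover have "(\<rho> + b) * (4 * \<theta> * \<theta>) \<le> 4 * \<theta> * ?U + ((?P + card X) + 2 * \<theta> * ?U)"
    using i(2) b by (auto simp: add_mult_distrib)
  moreover have "S0 \<subseteq> csets K'" using S0 e by blast
  ultimately show ?thesis using K' u1 u3 unfolding inv_def by simp
qed

lemma heart_new:
  assumes w: "well V K" and C: "C \<in> set (petals K H j)" and lt: "length H < j" and dH: "distinct H"
  shows "set H \<subset> set C" "set H \<notin> csets K" "\<And>c. c \<subseteq> set H \<Longrightarrow> c \<notin> csets K" "minimal (csets K) (set H)"
proof -
  have C': "C \<in> set K" "minimal (csets K) (set C)" "length C = j" "set H \<subseteq> set C" using C by (auto simp: petals_iff)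
  have "card (set H) < card (set C)" using well_card[OF w C'(1)] C'(3) lt dH by (simp add: distinct_card)
  then show ps: "set H \<subset> set C" using C'(4) by (intro psubsetI) auto
  show none: "c \<notin> csets K" if "c \<subseteq> set H" for c
    using C'(2) ps that unfolding minimal_def by blast
  then show "set H \<notin> csets K" by blast
  show "minimal (csets K) (set H)" unfolding minimal_def using none by blast
qed

lemma well_heart:
  assumes w: "well V K" and C: "C \<in> set (petals K H j)" and lt: "length H < j" and dH: "distinct H" and j: "j \<le> 3"
  shows "well V (H # K)"
proof -
  have "set H \<subseteq> V" using C w by (auto simp: petals_iff well_def)
  then show ?thesis using heart_new(2)[OF w C lt dH] w dH lt j by (auto simp: well_def)
qed

lemma open_petals_sets: "csets (open_petals K H j) = (\<lambda>C. set C - set H) ` set (petals K H j)"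
  by (auto simp: open_petals_def image_image)

lemma open_petals_facts:
  assumes w: "well V K" and H: "H \<noteq> []" "distinct H"
  shows "inj_on (\<lambda>C. set C - set H) (set (petals K H j))"
    "(\<lambda>C. set C - set H) ` set (petals K H j) \<inter> csets K = {}"
    "\<And>C. C \<in> set (petals K H j) \<Longrightarrow> card (set C - set H) = j - length H \<and> minimal (csets K) (set C - set H)"
    "card ((\<lambda>C. set C - set H) ` set (petals K H j)) = length (petals K H j)"
proof -
  show inj: "inj_on (\<lambda>C. set C - set H) (set (petals K H j))"
  proof (rule inj_onI)
    fix C C' assume *: "C \<in> set (petals K H j)" "C' \<in> set (petals K H j)" "set C - set H = set C' - set H"
    then have "set C = set C'" by (auto simp: petals_iff)
    then show "C = C'" using * well_inj[OF w] by (auto simp: petals_iff inj_on_def)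
  qed
  have ps: "set C - set H \<subset> set C" "minimal (csets K) (set C)" if "C \<in> set (petals K H j)" for C
    using that H(1) by (auto simp: petals_iff neq_Nil_conv)
  then show "(\<lambda>C. set C - set H) ` set (petals K H j) \<inter> csets K = {}"
    by (auto simp: minimal_def) blast
  show "card (set C - set H) = j - length H \<and> minimal (csets K) (set C - set H)" if "C \<in> set (petals K H j)" for C
  proof
    show "minimal (csets K) (set C - set H)" using ps[OF that] unfolding minimal_def by blast
    show "card (set C - set H) = j - length H"
      using that well_card[OF w, of C] H(2) by (subst card_Diff_subset) (auto simp: petals_iff distinct_card)
  qed
  have "distinct (petals K H j)" using w by (auto simp: petals_def well_def distinct_map)
  then show "card ((\<lambda>C. set C - set H) ` set (petals K H j)) = length (petals K H j)"
    using card_image[OF inj] by (simp add: distinct_card)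
qed

lemma well_open_petals:
  assumes w: "well V K" and H: "H \<noteq> []" "distinct H"
  shows "well V (open_petals K H j @ K)"
proof -
  have dp: "distinct (petals K H j)" using w by (auto simp: petals_def well_def distinct_map)
  have m: "map set (open_petals K H j) = map (\<lambda>C. set C - set H) (petals K H j)"
    by (auto simp: open_petals_def)
  have "distinct (map set (open_petals K H j))"
    unfolding m using dp open_petals_facts(1)[OF w H] by (simp add: distinct_map)
  moreover have "csets (open_petals K H j) \<inter> csets K = {}"
    unfolding open_petals_sets by (rule open_petals_facts(2)[OF w H])
  moreover have "distinct C \<and> length C \<le> 3 \<and> set C \<subseteq> V" if C: "C \<in> set (open_petals K H j)" for C
  proof -
    obtain C' where C': "C' \<in> set K" "C = filter (\<lambda>l. l \<notin> set H) C'"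
      using C by (auto simp: open_petals_def petals_iff)
    have 1: "distinct C'" "length C' \<le> 3" "set C' \<subseteq> V" using w C'(1) unfolding well_def by blast+
    have "length C \<le> length C'" unfolding C'(2) by (rule length_filter_le)
    then have "length C \<le> 3" using 1(2) by linarith
    moreover have "distinct C" "set C \<subseteq> V" unfolding C'(2) using 1 by auto
    ultimately show ?thesis by blast
  qed
  ultimately show ?thesis using w by (auto simp: well_def)
qed

lemma models_open_petals:
  assumes "models \<alpha> K" "\<And>l. l \<in> set H \<Longrightarrow> \<not> lit_true \<alpha> l"
  shows "models \<alpha> (open_petals K H j @ K)"
  using assms unfolding models_def open_petals_def by (fastforce simp: petals_iff)

lemma new_pairs_degree:
  assumes "well V K"
  shows "card {c \<in> new_pairs S0 (csets K). l \<in> c} \<le> length (petals K [l] 2)"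
  unfolding petals_length[OF assms] by (intro card_mono) (auto simp: new_pairs_def)

text \<open>The model dictates the alternative: add the heart if it contains a true literal;
  otherwise each petal is satisfied outside the heart, and all petals are opened. Degrees of new
  pairs stay at most 2\<theta> because fewer than \<theta> old pairs contain a literal whenever
  pairs are added, and at most \<theta> are added.\<close>

lemma branch_step:
  assumes inv: "inv N \<theta> \<alpha> S0 K i \<rho>" and \<theta>: "1 \<le> \<theta>" and lf: "large_flowers \<theta> K = x # xs" and r: "\<rho> + r = 2 * N div \<theta>"
  shows "\<exists>K' \<rho>' r'. (K', r') \<in> set (branch \<theta> (K, r)) \<and> inv N \<theta> \<alpha> S0 K' (i + 1) \<rho>' \<and> \<rho>' + r' = 2 * N div \<theta>"
proof -
  obtain H j t where x: "x = (H, j, t)" by (cases x)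
  note lf = lf[unfolded x]
  note kinds = large_flowersD[OF lf]
  have w: "well (vlits N) K" and m: "models \<alpha> K" using inv unfolding inv_def by blast+
  have t1: "1 \<le> t" using kinds(2) \<theta> by auto
  then have "petals K H j \<noteq> []" using kinds(1) by auto
  then obtain C where C: "C \<in> set (petals K H j)" by (meson last_in_set)
  have H: "H \<noteq> []" "distinct H" "length H < j" "j \<le> 3" using kinds(2) by auto
  have br: "branch \<theta> (K, r) = (H # K, r) # (if r = 0 then [] else [(open_petals K H j @ K, r - 1)])"
    by (simp add: branch_def lf)
  show ?thesis
  proof (cases "\<exists>l \<in> set H. lit_true \<alpha> l")
    case True
    have w': "well (vlits N) (H # K)" by (rule well_heart[OF w C H(3,2,4)])
    have m': "models \<alpha> (H # K)" using True m by (auto simp: models_def)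
    have "inv N \<theta> \<alpha> S0 (H # K) (i + 1) (\<rho> + 0)"
    proof (cases "length H = 1")
      case True
      then obtain l where l: "H = [l]" by (auto simp: length_Suc_conv)
      have "{l} \<notin> csets K" using heart_new(2)[OF w C H(3,2)] l by simp
      then show ?thesis
        by (intro inv_unit_step[OF inv w' m', of "{l}"]) (auto simp: l units_def)
    next
      case False
      then obtain a b where ab: "H = [a, b]" "a \<noteq> b" "j = 3" "t = \<theta>" using kinds(2) by auto
      have "inv N \<theta> \<alpha> S0 (H # K) (i + 1) (\<rho> + 0)"
      proof (rule inv_pair_step[OF inv w' m', of "{set H}"])
        show "csets (H # K) = csets K \<union> {set H}" by auto
        show "{set H} \<inter> csets K = {}" using heart_new(2)[OF w C H(3,2)] by simp
        show "card c = 2 \<and> minimal (csets K) c" if "c \<in> {set H}" for c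
          using that ab heart_new(4)[OF w C H(3,2)] by auto
        fix l
        have "card {c \<in> new_pairs S0 (csets K). l \<in> c} < \<theta>"
          using new_pairs_degree[OF w, of S0 l] head_third_kind[OF lf ab(3) \<theta>, of l] by linarith
        moreover have "card {c \<in> {set H}. l \<in> c} \<le> 1" using card_mono[of "{set H}" "{c \<in> {set H}. l \<in> c}"] by auto
        ultimately show "card {c \<in> new_pairs S0 (csets K). l \<in> c} + card {c \<in> {set H}. l \<in> c} \<le> 2 * \<theta>" by linarith
      qed auto
      then show ?thesis by simp
    qed
    then show ?thesis using r br by (intro exI[of _ "H # K"] exI[of _ \<rho>] exI[of _ r]) simp
  next
    case False
    let ?K = "open_petals K H j @ K"
    let ?X = "(\<lambda>C. set C - set H) ` set (petals K H j)"
    have w': "well (vlits N) ?K" by (rule well_open_petals[OF w H(1,2)])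
    have m': "models \<alpha> ?K" using False by (intro models_open_petals[OF m]) blast
    note pf = open_petals_facts[OF w H(1,2), where j = j]
    have e: "csets ?K = csets K \<union> ?X"
      unfolding set_append image_Un open_petals_sets by (rule Un_commute)
    have Xt: "t \<le> card ?X" using kinds(1) pf(4) by simp
    have "inv N \<theta> \<alpha> S0 ?K (i + 1) (\<rho> + 1)"
    proof (cases "length H = 1 \<and> j = 3")
      case False
      then have j1: "j - length H = 1" and t: "t = \<theta>" using kinds(2) by auto
      define L where "L = {l. {l} \<in> ?X}"
      have "c \<in> (\<lambda>l. {l}) ` L" if "c \<in> ?X" for c
      proof -
        have "card c = 1" using that pf(3) j1 by auto
        then obtain l where "c = {l}" by (rule card_1_singletonE)
        then show ?thesis using that by (auto simp: L_def)
      qed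
      then have XL: "?X = (\<lambda>l. {l}) ` L" by (auto simp: L_def)
      have inj: "inj_on (\<lambda>l. {l}) L" by auto
      have fin: "finite L" using finite_imageD[OF _ inj] XL[symmetric] by simp
      have cL: "card L = card ?X" unfolding XL using card_image[OF inj] by simp
      show ?thesis
      proof (rule inv_unit_step[OF inv w' m' e[unfolded XL] fin])
        show "L \<inter> units (csets K) = {}" using pf(2) by (auto simp: L_def units_def)
        show "1 \<le> card L" "1 = 0 \<or> 1 = 1 \<and> \<theta> \<le> card L" using cL Xt t1 t by auto
      qed
    next
      case True
      then obtain l where l: "H = [l]" "j = 3" "t = 4 * \<theta> * \<theta>" using kinds(2) by auto
      show ?thesis
      proof (rule inv_pair_step[OF inv w' m' e])
        show "?X \<inter> csets K = {}" by (rule pf(2))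
        show "card c = 2 \<and> minimal (csets K) c" if "c \<in> ?X" for c using that pf(3) l by auto
        show "1 \<le> card ?X" using Xt t1 by linarith
        show "1 = 0 \<or> 1 = 1 \<and> 4 * \<theta> * \<theta> \<le> card ?X" using Xt unfolding l(3) by blast
        fix l'
        have 1: "card {c \<in> new_pairs S0 (csets K). l' \<in> c} < \<theta>"
          using new_pairs_degree[OF w, of S0 l'] head_third_kind[OF lf l(2) \<theta>, of l'] by linarith
        \<comment> \<open>An opened petal through l' stems from a 3-clause containing both l and l',
          and flowers on pairs are small at this stage.\<close>
        have 2: "card {c \<in> ?X. l' \<in> c} < \<theta>"
        proof (cases "l' = l")
          case True
          then have "{c \<in> ?X. l' \<in> c} = {}" using l by auto
          then show ?thesis using \<theta> by (simp only: card.empty)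
        next
          case False
          have "{c \<in> ?X. l' \<in> c} \<subseteq> (\<lambda>C. set C - set H) ` set (petals K [l, l'] 3)"
            using l by (auto simp: petals_iff)
          then have "card {c \<in> ?X. l' \<in> c} \<le> card ((\<lambda>C. set C - set H) ` set (petals K [l, l'] 3))"
            by (intro card_mono) auto
          also have "\<dots> \<le> length (petals K [l, l'] 3)"
            using card_image_le[of "set (petals K [l, l'] 3)" "\<lambda>C. set C - set H"] card_length[of "petals K [l, l'] 3"] by simp
          also have "\<dots> < \<theta>" using head_pair_kind[OF lf[unfolded l(1,2)] \<theta>, of l l'] False by blast
          finally show ?thesis .
        qed
        show "card {c \<in> new_pairs S0 (csets K). l' \<in> c} + card {c \<in> ?X. l' \<in> c} \<le> 2 * \<theta>" using 1 2 by linarith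
      qed simp
    qed
    \<comment> \<open>An exhausted budget would mean more openings than the potential
      permits.\<close>
    moreover from inv_limits(2)[OF this \<theta>] have "r \<noteq> 0" using r by linarith
    ultimately show ?thesis using r br
      by (intro exI[of _ ?K] exI[of _ "\<rho> + 1"] exI[of _ "r - 1"]) simp
  qed
qed

section \<open>Completeness and size of the branching tree\<close>

text \<open>One round more than \<open>inv\<close> can survive, so the branch of a model has no
  large flower left.\<close>

definition leaves :: "nat \<Rightarrow> nat \<Rightarrow> lit list list \<Rightarrow> (lit list list \<times> nat) list" where
  "leaves \<theta> N K = (spread \<theta> ^^ (N * (4 * \<theta> + 1) + 1)) [(K, 2 * N div \<theta>)]"

lemma branch_leaf: "large_flowers \<theta> K = [] \<Longrightarrow> branch \<theta> (K, r) = [(K, r)]"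
  by (simp add: branch_def)

text \<open>Nothing is claimed about other branches: they may still have large flowers after the
  last round, and such leaves will be rejected.\<close>

lemma leaves_complete:
  assumes w: "well (vlits N) K" and m: "models \<alpha> K" and \<theta>: "1 \<le> \<theta>"
  shows "\<exists>K' r'. (K', r') \<in> set (leaves \<theta> N K) \<and> models \<alpha> K' \<and> large_flowers \<theta> K' = []"
proof -
  have "new_pairs (csets K) (csets K) = {}" by (auto simp: new_pairs_def)
  then have inv0: "inv N \<theta> \<alpha> (csets K) K 0 0" using w m by (auto simp: inv_def)
  have "\<exists>K' r' \<rho>. (K', r') \<in> set ((spread \<theta> ^^ i) [(K, 2 * N div \<theta>)]) \<and> \<rho> + r' = 2 * N div \<theta> \<and>
     (inv N \<theta> \<alpha> (csets K) K' i \<rho> \<or> models \<alpha> K' \<and> large_flowers \<theta> K' = [])" for i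
  proof (induction i)
    case 0
    then show ?case using inv0 by auto
  next
    case (Suc i)
    then obtain K' r' \<rho> where IH: "(K', r') \<in> set ((spread \<theta> ^^ i) [(K, 2 * N div \<theta>)])" "\<rho> + r' = 2 * N div \<theta>"
      "inv N \<theta> \<alpha> (csets K) K' i \<rho> \<or> models \<alpha> K' \<and> large_flowers \<theta> K' = []" by blast
    have sp: "y \<in> set ((spread \<theta> ^^ Suc i) [(K, 2 * N div \<theta>)])" if "y \<in> set (branch \<theta> (K', r'))" for y
      using that IH(1) by (auto simp: set_spread)
    show ?case
    proof (cases "large_flowers \<theta> K'")
      case Nil
      have "models \<alpha> K'" using IH(3) unfolding inv_def by blast
      then show ?thesis using sp[of "(K', r')"] branch_leaf[OF Nil] Nil IH(2) by auto
    next
      case (Cons x xs)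
      then have "inv N \<theta> \<alpha> (csets K) K' i \<rho>" using IH(3) by auto
      from branch_step[OF this \<theta> Cons IH(2)] show ?thesis using sp by (metis Suc_eq_plus1)
    qed
  qed
  from this[of "N * (4 * \<theta> + 1) + 1"] obtain K' r' \<rho> where
    K': "(K', r') \<in> set (leaves \<theta> N K)"
      "inv N \<theta> \<alpha> (csets K) K' (N * (4 * \<theta> + 1) + 1) \<rho> \<or> models \<alpha> K' \<and> large_flowers \<theta> K' = []"
    unfolding leaves_def by blast
  moreover have "\<not> inv N \<theta> \<alpha> (csets K) K' (N * (4 * \<theta> + 1) + 1) \<rho>"
    using inv_limits(1)[of N \<theta> \<alpha> "csets K" K' "N * (4 * \<theta> + 1) + 1" \<rho>] \<theta> by auto
  ultimately show ?thesis by blast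
qed

lemma branch_well:
  assumes "well V (fst s)" "1 \<le> \<theta>" "s' \<in> set (branch \<theta> s)"
  shows "well V (fst s') \<and> set (fst s) \<subseteq> set (fst s') \<and> snd s' \<le> snd s"
proof (cases "large_flowers \<theta> (fst s)")
  case Nil
  then show ?thesis using assms by (simp add: branch_def)
next
  case (Cons x xs)
  obtain H j t where x: "x = (H, j, t)" by (cases x)
  note lf = Cons[unfolded x]
  note kinds = large_flowersD[OF lf]
  have t1: "1 \<le> t" using kinds(2) assms(2) by auto
  then have "petals (fst s) H j \<noteq> []" using kinds(1) by auto
  then obtain C where C: "C \<in> set (petals (fst s) H j)" by (meson last_in_set)
  have H: "H \<noteq> []" "distinct H" "length H < j" "j \<le> 3" using kinds(2) by auto
  show ?thesis
    using assms(3) well_heart[OF assms(1) C H(3,2,4)] well_open_petals[OF assms(1) H(1,2)]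
    by (auto simp: branch_def lf split: if_splits)
qed

lemma spread_iter_well:
  assumes "well V K" "1 \<le> \<theta>" "s \<in> set ((spread \<theta> ^^ i) [(K, r)])"
  shows "well V (fst s) \<and> set K \<subseteq> set (fst s) \<and> snd s \<le> r"
  using assms(3)
proof (induction i arbitrary: s)
  case 0
  then show ?case using assms(1) by simp
next
  case (Suc i)
  from Suc.prems have "\<exists>s' \<in> set ((spread \<theta> ^^ i) [(K, r)]). s \<in> set (branch \<theta> s')" by (simp add: set_spread)
  then obtain s' where s': "s' \<in> set ((spread \<theta> ^^ i) [(K, r)])" "s \<in> set (branch \<theta> s')" by blast
  show ?case using Suc.IH[OF s'(1)] branch_well[OF _ assms(2) s'(2)] by (metis order_trans)
qed

lemma sum_list_concat': "(\<Sum>y\<leftarrow>concat (map f xs). g y :: real) = (\<Sum>x\<leftarrow>xs. \<Sum>y\<leftarrow>f x. g y)"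
  by (induction xs) auto

text \<open>Each remaining unit of the budget is weighted by \<open>1 / x\<close>; then a step increases the total weight at most by
  the factor \<open>1 + x\<close>.\<close>

lemma spread_iter_length:
  fixes x :: real
  assumes x: "0 < x" "x \<le> 1"
  shows "(\<Sum>s\<leftarrow>(spread \<theta> ^^ i) ss. (1 / x) ^ snd s) \<le> (1 + x) ^ i * (\<Sum>s\<leftarrow>ss. (1 / x) ^ snd s)"
proof (induction i)
  case (Suc i)
  have b: "(\<Sum>s'\<leftarrow>branch \<theta> s. (1 / x) ^ snd s') \<le> (1 + x) * (1 / x) ^ snd s" for s
  proof -
    have "(1 / x) ^ snd s + (1 / x) ^ (snd s - 1) \<le> (1 + x) * (1 / x) ^ snd s" if "snd s \<noteq> 0"
      using x that by (cases "snd s") (auto simp: field_simps)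
    moreover have "(1 / x) ^ snd s \<le> (1 + x) * (1 / x) ^ snd s" using x by (simp add: algebra_simps)
    ultimately show ?thesis by (auto simp: branch_def split: list.split)
  qed
  have "(\<Sum>s\<leftarrow>(spread \<theta> ^^ Suc i) ss. (1 / x) ^ snd s) =
      (\<Sum>s\<leftarrow>(spread \<theta> ^^ i) ss. \<Sum>s'\<leftarrow>branch \<theta> s. (1 / x) ^ snd s')"
    by (simp add: spread_def[of \<theta> "(spread \<theta> ^^ i) ss"] sum_list_concat')
  also have "\<dots> \<le> (\<Sum>s\<leftarrow>(spread \<theta> ^^ i) ss. (1 + x) * (1 / x) ^ snd s)"
    by (intro sum_list_mono b)
  also have "\<dots> = (1 + x) * (\<Sum>s\<leftarrow>(spread \<theta> ^^ i) ss. (1 / x) ^ snd s)"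
    by (simp add: sum_list_const_mult)
  also have "\<dots> \<le> (1 + x) * ((1 + x) ^ i * (\<Sum>s\<leftarrow>ss. (1 / x) ^ snd s))"
    using Suc x by (intro mult_left_mono) auto
  finally show ?case by (simp add: mult.assoc)
qed simp

lemma spread_iter_count:
  fixes x :: real
  assumes x: "0 < x" "x \<le> 1"
  shows "real (length ((spread \<theta> ^^ i) [(K, r)])) \<le> (1 + x) ^ i * (1 / x) ^ r"
proof -
  have "real (length ss) \<le> (\<Sum>s\<leftarrow>ss. (1 / x) ^ snd s)" for ss :: "('a list list \<times> nat) list"
    using x by (induction ss) (auto intro: add_mono one_le_power)
  then show ?thesis using spread_iter_length[OF x, where \<theta> = \<theta> and i = i and ss = "[(K, r)]"]
    by (auto intro: order_trans)
qed

lemma leaf_degree: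
  assumes w: "well V K" and lf: "large_flowers \<theta> K = []" and \<theta>: "1 \<le> \<theta>"
  shows "card {C \<in> set K. active K C \<and> length C = 2 \<and> l \<in> set C} < \<theta>"
    "card {C \<in> set K. active K C \<and> length C = 3 \<and> l \<in> set C} < 4 * \<theta> * \<theta>"
proof -
  have e: "card {C \<in> set K. active K C \<and> length C = j \<and> l \<in> set C} = length (petals K [l] j)" for j
  proof -
    have "distinct (petals K [l] j)" using w by (auto simp: petals_def well_def distinct_map)
    then have "length (petals K [l] j) = card (set (petals K [l] j))" by (simp add: distinct_card)
    also have "set (petals K [l] j) = {C \<in> set K. active K C \<and> length C = j \<and> l \<in> set C}"
      by (auto simp: petals_def sub_iff)
    finally show ?thesis by simp
  qed
  have none: "x \<notin> set (large_flowers \<theta> K)" for x by (simp add: lf)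
  show "card {C \<in> set K. active K C \<and> length C = 2 \<and> l \<in> set C} < \<theta>"
    unfolding e by (rule no_first_kind[OF lf _ \<theta>]) simp
  show "card {C \<in> set K. active K C \<and> length C = 3 \<and> l \<in> set C} < 4 * \<theta> * \<theta>"
  proof (rule ccontr)
    assume "\<not> ?thesis"
    then have le: "4 * \<theta> * \<theta> \<le> length (petals K [l] 3)" unfolding e by simp
    then have "petals K [l] 3 \<noteq> []" using \<theta> by (metis list.size(3) mult_eq_0_iff not_one_le_zero zero_neq_numeral le_zero_eq)
    then obtain C where "C \<in> set (petals K [l] 3)" by (meson last_in_set)
    then have "l \<in> set (concat K)" by (rule petals_nonempty_heart)
    then have "([l], 3, 4 * \<theta> * \<theta>) \<in> set (large_flowers \<theta> K)" using le by (auto simp: large_flowers_def flowers_def)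
    then show False using none by blast
  qed
qed

text \<open>Every clause contains a minimal one, and satisfying the smaller clause satisfies the
  larger.\<close>

lemma models_active:
  assumes "models \<alpha> (filter (active K) K)"
  shows "models \<alpha> K"
proof -
  have "\<exists>c' \<in> csets K. c' \<subseteq> c \<and> minimal (csets K) c'" if "c \<in> csets K" for c
  proof -
    let ?F = "{c' \<in> csets K. c' \<subseteq> c}"
    have "finite ?F" "?F \<noteq> {}" using that by auto
    from finite_has_minimal[OF this]
    obtain c' where c': "c' \<in> ?F" "\<forall>b \<in> ?F. b \<le> c' \<longrightarrow> c' = b" by blast
    have "minimal (csets K) c'" unfolding minimal_def
    proof (intro ballI notI)
      fix b assume b: "b \<in> csets K" "b \<subset> c'"
      then have "b \<in> ?F" "b \<le> c'" using c'(1) by auto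
      then show False using c'(2) b(2) by blast
    qed
    then show ?thesis using c'(1) by blast
  qed
  note below = this
  show ?thesis unfolding models_def
  proof
    fix C assume "C \<in> set K"
    then obtain c' where c': "c' \<in> csets K" "c' \<subseteq> set C" "minimal (csets K) c'" using below by blast
    then obtain C' where C': "C' \<in> set K" "set C' = c'" by auto
    then have "C' \<in> set (filter (active K) K)" using c'(3) by (simp add: active_iff)
    then show "\<exists>l \<in> set C. lit_true \<alpha> l" using assms C'(2) c'(2) unfolding models_def by blast
  qed
qed

section \<open>Routing a sparse formula through a network\<close>

definition ctype :: "nat \<Rightarrow> lit list \<Rightarrow> nat list" where
  "ctype W C = map (\<lambda>l. fst l mod W) C"

text \<open>The rank counts the earlier clauses of the same type; reduced modulo the number of
  nodes, it deals the clauses of a type out in turn.\<close>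

definition ranked :: "nat \<Rightarrow> lit list list \<Rightarrow> (lit list \<times> nat) list" where
  "ranked W F = fold (\<lambda>C acc. (C, length (filter (\<lambda>x. ctype W (fst x) = ctype W C) acc)) # acc) F []"

text \<open>Clauses of one type, i.e. with the same homes of the variables, are spread evenly over the \<open>Q\<close> nodes.\<close>

definition placed :: "nat \<Rightarrow> nat \<Rightarrow> lit list list \<Rightarrow> (lit list \<times> nat) list" where
  "placed W Q F = map (\<lambda>x. (fst x, snd x mod Q)) (ranked W F)"

definition through :: "nat list list list \<Rightarrow> nat \<Rightarrow> nat \<Rightarrow> nat \<Rightarrow> nat list" where
  "through PT W v q = nthd [] (nthd [] PT (v mod W)) q"

text \<open>A variable is carried by line l if it reaches the node of one of its clauses through l.
  It is listed once, however many paths share the line.\<close>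

definition lvars :: "nat list list list \<Rightarrow> nat \<Rightarrow> nat \<Rightarrow> (lit list \<times> nat) list \<Rightarrow> nat \<Rightarrow> nat list" where
  "lvars PT W N R l = filter (\<lambda>v. list_ex (\<lambda>x. list_ex (\<lambda>y. fst y = v) (fst x) \<and> l \<in> set (through PT W v (snd x))) R) [0..<N]"

definition truths :: "nat list \<Rightarrow> bool list \<Rightarrow> nat list" where
  "truths S a = map fst (filter snd (zip S a))"

text \<open>A clause can be checked only where all its variables are present; the final line of the
  paths to its node is such a place.\<close>

definition okline :: "(lit list \<times> nat) list \<Rightarrow> nat list \<Rightarrow> bool list \<Rightarrow> bool" where
  "okline R S a = list_all (\<lambda>x. list_all (\<lambda>y. fst y \<in> set S) (fst x) \<longrightarrow>
     list_ex (\<lambda>y. (fst y \<in> set (truths S a)) = snd y) (fst x)) R"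

definition agree :: "nat list \<Rightarrow> bool list \<Rightarrow> nat list \<Rightarrow> bool list \<Rightarrow> bool" where
  "agree S a S' a' = list_all (\<lambda>v. v \<in> set S' \<longrightarrow> (v \<in> set (truths S a)) = (v \<in> set (truths S' a'))) S"

lemma ranked_snoc: "ranked W (F @ [C]) = (C, length (filter (\<lambda>x. ctype W (fst x) = ctype W C) (ranked W F))) # ranked W F"
  by (simp add: ranked_def)

lemma map_fst_ranked: "map fst (ranked W F) = rev F"
  by (induction F rule: rev_induct) (simp_all add: ranked_snoc, simp add: ranked_def)

lemma ranked_rank:
  "map snd (filter (\<lambda>x. ctype W (fst x) = \<tau>) (ranked W F)) = rev [0..<length (filter (\<lambda>C. ctype W C = \<tau>) F)]"
proof (induction F rule: rev_induct)
  case Nil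
  then show ?case by (simp add: ranked_def)
next
  case (snoc C F)
  show ?case
  proof (cases "ctype W C = \<tau>")
    case True
    have "length (filter (\<lambda>x. ctype W (fst x) = \<tau>) (ranked W F)) = length (filter (\<lambda>C. ctype W C = \<tau>) F)"
      using arg_cong[OF snoc, of length] by simp
    then show ?thesis using True snoc by (simp add: ranked_snoc)
  next
    case False
    then show ?thesis using snoc by (simp add: ranked_snoc)
  qed
qed

lemma card_residues:
  assumes "finite A" "1 \<le> Q"
  shows "card {r. r < m \<and> r mod Q \<in> A} \<le> card A * (m div Q + 1)"
proof -
  have "{r. r < m \<and> r mod Q \<in> A} \<subseteq> (\<lambda>(a, k). k * Q + a) ` (A \<times> {..m div Q})"
  proof
    fix r assume "r \<in> {r. r < m \<and> r mod Q \<in> A}"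
    then have "r mod Q \<in> A" "r div Q \<le> m div Q" by (auto intro: div_le_mono)
    moreover have "r = (\<lambda>(a, k). k * Q + a) (r mod Q, r div Q)" by simp
    ultimately show "r \<in> (\<lambda>(a, k). k * Q + a) ` (A \<times> {..m div Q})" by blast
  qed
  then have "card {r. r < m \<and> r mod Q \<in> A} \<le> card ((\<lambda>(a, k). k * Q + a) ` (A \<times> {..m div Q}))"
    using assms by (intro card_mono) auto
  also have "\<dots> \<le> card (A \<times> {..m div Q})" using assms by (intro card_image_le) auto
  finally show ?thesis by (simp add: card_cartesian_product)
qed

lemma card_vars_home:
  assumes "finite H" "1 \<le> W"
  shows "card {v. v < N \<and> v mod W \<in> H} \<le> card H * (N div W + 1)"
  using card_residues[OF assms] .

definition types :: "nat \<Rightarrow> nat list set" where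
  "types W = {xs. set xs \<subseteq> {..<W} \<and> length xs \<le> 3}"

lemma finite_types: "finite (types W)"
  unfolding types_def using finite_lists_length_le[of "{..<W}" 3] by simp

definition degree_le :: "nat \<Rightarrow> nat \<Rightarrow> lit list list \<Rightarrow> bool" where
  "degree_le D N F \<longleftrightarrow> (\<forall>v < N. length (filter (\<lambda>C. v \<in> fst ` set C) F) \<le> D)"

lemma length_filter_sum: "finite T \<Longrightarrow> (\<And>C. C \<in> set F \<Longrightarrow> P C \<Longrightarrow> f C \<in> T) \<Longrightarrow>
   length (filter P F) = (\<Sum>\<tau>\<in>T. length (filter (\<lambda>C. P C \<and> f C = \<tau>) F))"
proof (induction F)
  case (Cons C F)
  have IH: "length (filter P F) = (\<Sum>\<tau>\<in>T. length (filter (\<lambda>C. P C \<and> f C = \<tau>) F))" using Cons by auto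
  show ?case
  proof (cases "P C")
    case True
    have "(\<Sum>\<tau>\<in>T. length (filter (\<lambda>C. P C \<and> f C = \<tau>) (C # F))) =
        (\<Sum>\<tau>\<in>T. length (filter (\<lambda>C. P C \<and> f C = \<tau>) F) + (if f C = \<tau> then 1 else 0))"
      using True by (intro sum.cong) auto
    also have "\<dots> = length (filter P F) + 1"
      using Cons.prems True by (simp add: sum.distrib IH sum.delta)
    finally show ?thesis using True by simp
  next
    case False
    then show ?thesis using IH by simp
  qed
qed simp

lemma length_filter_mono': "(\<And>x. P x \<Longrightarrow> Q x) \<Longrightarrow> length (filter P xs) \<le> length (filter Q xs)"
  by (induction xs) auto

text \<open>At most |H| (N div W + 1) D clauses have a variable with home in H. Dealing in turn
  sends the fraction |A|/Q of each type to A, up to a rounding error of |A| per type. With |H| |A|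
  \<le> Q the main term no longer depends on H and A.\<close>

lemma load_count:
  assumes F: "\<And>C. C \<in> set F \<Longrightarrow> length C \<le> 3 \<and> fst ` set C \<subseteq> {..<N}"
    and deg: "degree_le D N F" and W: "1 \<le> W" and Q: "1 \<le> Q"
    and HA: "finite H" "finite A" "card H * card A \<le> Q"
  shows "length (filter (\<lambda>x. (\<exists>v \<in> fst ` set (fst x). v mod W \<in> H) \<and> snd x mod Q \<in> A) (ranked W F))
    \<le> D * (N div W + 1) + Q * card (types W)"
proof -
  let ?P = "\<lambda>x. (\<exists>v \<in> fst ` set (fst x). v mod W \<in> H) \<and> snd x mod Q \<in> A"
  let ?T = "{\<tau> \<in> types W. set \<tau> \<inter> H \<noteq> {}}"
  let ?m = "\<lambda>\<tau>. length (filter (\<lambda>C. ctype W C = \<tau>) F)"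
  have sF: "fst x \<in> set F" if "x \<in> set (ranked W F)" for x
    using that arg_cong[OF map_fst_ranked[of W F], of set] by auto
  have ty: "ctype W C \<in> types W" if "C \<in> set F" for C
    using F[OF that] W by (auto simp: ctype_def types_def)
  have "length (filter ?P (ranked W F)) = (\<Sum>\<tau>\<in>?T. length (filter (\<lambda>x. ?P x \<and> ctype W (fst x) = \<tau>) (ranked W F)))"
  proof (rule length_filter_sum)
    fix x assume x: "x \<in> set (ranked W F)" "?P x"
    then have "set (ctype W (fst x)) \<inter> H \<noteq> {}" by (auto simp: ctype_def)
    then show "ctype W (fst x) \<in> ?T" using ty[OF sF[OF x(1)]] by blast
  qed (use finite_types in simp)
  also have "\<dots> \<le> (\<Sum>\<tau>\<in>?T. card A * (?m \<tau> div Q + 1))"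
  proof (rule sum_mono)
    fix \<tau>
    have "length (filter (\<lambda>x. ?P x \<and> ctype W (fst x) = \<tau>) (ranked W F)) \<le>
        length (filter (\<lambda>x. snd x mod Q \<in> A) (filter (\<lambda>x. ctype W (fst x) = \<tau>) (ranked W F)))"
      unfolding filter_filter by (rule length_filter_mono') auto
    also have "\<dots> = length (filter (\<lambda>r. r mod Q \<in> A) (map snd (filter (\<lambda>x. ctype W (fst x) = \<tau>) (ranked W F))))"
      by (simp add: filter_map o_def)
    also have "\<dots> = length (filter (\<lambda>r. r mod Q \<in> A) [0..<?m \<tau>])"
      unfolding ranked_rank by (simp add: rev_filter[symmetric])
    also have "\<dots> = card {r. r < ?m \<tau> \<and> r mod Q \<in> A}"
      by (subst distinct_card[symmetric]) (auto intro: arg_cong[of _ _ card])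
    also have "\<dots> \<le> card A * (?m \<tau> div Q + 1)" by (rule card_residues[OF HA(2) Q])
    finally show "length (filter (\<lambda>x. ?P x \<and> ctype W (fst x) = \<tau>) (ranked W F)) \<le> card A * (?m \<tau> div Q + 1)" .
  qed
  also have "\<dots> = card A * (\<Sum>\<tau>\<in>?T. ?m \<tau> div Q) + card A * card ?T"
    by (simp add: sum_distrib_left[symmetric] sum.distrib algebra_simps)
  also have "\<dots> \<le> D * (N div W + 1) + Q * card (types W)"
  proof (cases "card H = 0")
    case True
    then have "?T = {}" using HA(1) by auto
    then show ?thesis by (simp only: sum.empty card.empty)
  next
    case False
    then have "1 * card A \<le> card H * card A" by (intro mult_right_mono) auto
    then have AQ: "card A \<le> Q" using HA(3) by linarith
    have "(\<Sum>\<tau>\<in>?T. ?m \<tau>) \<le> card H * (N div W + 1) * D"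
    proof -
      let ?V = "{v. v < N \<and> v mod W \<in> H}"
      have "(\<Sum>\<tau>\<in>?T. ?m \<tau>) = length (filter (\<lambda>C. ctype W C \<in> ?T) F)"
        by (subst length_filter_sum[where f = "ctype W" and T = ?T])
          (auto simp: finite_types intro!: sum.cong arg_cong[of _ _ length] filter_cong)
      also have "\<dots> \<le> (\<Sum>v\<in>?V. length (filter (\<lambda>C. v \<in> fst ` set C) F))"
      proof -
        have "length (filter (\<lambda>C. ctype W C \<in> ?T) G) \<le> (\<Sum>v\<in>?V. length (filter (\<lambda>C. v \<in> fst ` set C) G))"
          if "set G \<subseteq> set F" for G using that
        proof (induction G)
          case (Cons C G)
          have "(if ctype W C \<in> ?T then 1 else 0) \<le> (\<Sum>v\<in>?V. if v \<in> fst ` set C then 1 else (0::nat))"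
          proof (cases "ctype W C \<in> ?T")
            case True
            then obtain v where v: "v \<in> fst ` set C" "v mod W \<in> H" by (auto simp: ctype_def)
            then have "v \<in> ?V" using F[of C] Cons.prems by auto
            then have "(if v \<in> fst ` set C then 1 else (0::nat)) \<le> (\<Sum>v\<in>?V. if v \<in> fst ` set C then 1 else 0)"
              by (intro member_le_sum) auto
            then show ?thesis using v True by simp
          qed auto
          moreover have "length (filter (\<lambda>C. ctype W C \<in> ?T) G) \<le> (\<Sum>v\<in>?V. length (filter (\<lambda>C. v \<in> fst ` set C) G))"
            using Cons by simp
          ultimately have "(if ctype W C \<in> ?T then 1 else 0) + length (filter (\<lambda>C. ctype W C \<in> ?T) G) \<le>
             (\<Sum>v\<in>?V. (if v \<in> fst ` set C then 1 else 0) + length (filter (\<lambda>C. v \<in> fst ` set C) G))"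
            unfolding sum.distrib by (rule add_mono)
          also have "\<dots> = (\<Sum>v\<in>?V. length (filter (\<lambda>C. v \<in> fst ` set C) (C # G)))"
            by (intro sum.cong) auto
          finally have "(if ctype W C \<in> ?T then 1 else 0) + length (filter (\<lambda>C. ctype W C \<in> ?T) G) \<le>
              (\<Sum>v\<in>?V. length (filter (\<lambda>C. v \<in> fst ` set C) (C # G)))" .
          moreover have "length (filter (\<lambda>C. ctype W C \<in> ?T) (C # G)) =
              (if ctype W C \<in> ?T then 1 else 0) + length (filter (\<lambda>C. ctype W C \<in> ?T) G)"
            by (cases "ctype W C \<in> ?T") simp_all
          ultimately show ?case by (simp only:)
        qed simp
        then show ?thesis by simp
      qed
      also have "\<dots> \<le> (\<Sum>v\<in>?V. D)" using deg by (intro sum_mono) (auto simp: degree_le_def)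
      also have "\<dots> \<le> card H * (N div W + 1) * D"
        using card_vars_home[OF HA(1) W, of N] by simp
      finally show ?thesis .
    qed
    moreover have "Q * (\<Sum>\<tau>\<in>?T. ?m \<tau> div Q) \<le> (\<Sum>\<tau>\<in>?T. ?m \<tau>)"
      unfolding sum_distrib_left by (intro sum_mono) simp
    ultimately have "Q * (\<Sum>\<tau>\<in>?T. ?m \<tau> div Q) \<le> card H * (N div W + 1) * D" by linarith
    then have "card A * (Q * (\<Sum>\<tau>\<in>?T. ?m \<tau> div Q)) \<le> card A * (card H * (N div W + 1) * D)"
      by (rule mult_left_mono) simp
    also have "\<dots> = (card H * card A) * (D * (N div W + 1))" by (simp only: mult_ac)
    also have "\<dots> \<le> Q * (D * (N div W + 1))" using HA(3) by (rule mult_right_mono) simp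
    finally have "Q * (card A * (\<Sum>\<tau>\<in>?T. ?m \<tau> div Q)) \<le> Q * (D * (N div W + 1))" by (simp only: mult_ac)
    then have "card A * (\<Sum>\<tau>\<in>?T. ?m \<tau> div Q) \<le> D * (N div W + 1)" using Q by simp
    moreover have "card A * card ?T \<le> Q * card (types W)"
      using AQ finite_types by (intro mult_le_mono card_mono) auto
    ultimately show ?thesis by (rule add_mono)
  qed
  finally show ?thesis .
qed

text \<open>The last condition bounds congestion: the pairs of home and node whose path uses a given
  line at a given step fit into a combinatorial rectangle of area at most \<open>Q\<close>.\<close>

definition path_system :: "nat list list list \<Rightarrow> nat \<Rightarrow> nat \<Rightarrow> nat \<Rightarrow> bool" where
  "path_system PT W Q d \<longleftrightarrow> 1 \<le> W \<and> 1 \<le> Q \<and> length PT = W \<and> (\<forall>h < W. length (PT ! h) = Q) \<and>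
     (\<forall>h < W. \<forall>q < Q. length (PT ! h ! q) = d + 1) \<and>
     (\<forall>l. \<forall>i \<le> d. \<exists>H A. finite H \<and> finite A \<and> card H * card A \<le> Q \<and>
        (\<forall>h < W. \<forall>q < Q. PT ! h ! q ! i = l \<longrightarrow> h \<in> H \<and> q \<in> A))"

lemma through_nth:
  assumes ps: "path_system PT W Q d" and q: "q < Q"
  shows "through PT W v q = PT ! (v mod W) ! q"
proof -
  have "v mod W < W" using ps by (auto simp: path_system_def)
  then have "v mod W < length PT" "q < length (PT ! (v mod W))" using ps q by (auto simp: path_system_def)
  then show ?thesis by (simp add: through_def nthd_nth)
qed

text \<open>The factor 3 accounts for the variables of a clause and d + 1 for the steps of a path.
  All that does not scale with N/W is a constant of the grid.\<close>

definition capacity :: "nat \<Rightarrow> nat \<Rightarrow> nat \<Rightarrow> nat \<Rightarrow> nat \<Rightarrow> nat" where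
  "capacity d D W Q N = 3 * (d + 1) * D * (N div W) + 3 * (d + 1) * (D + Q * card (types W))"

lemma mem_lvars: "v \<in> set (lvars PT W N R l) \<longleftrightarrow>
    v < N \<and> (\<exists>x \<in> set R. v \<in> fst ` set (fst x) \<and> l \<in> set (through PT W v (snd x)))"
  by (auto simp: lvars_def list_ex_iff)

lemma distinct_lvars: "distinct (lvars PT W N R l)"
  by (simp add: lvars_def)

theorem length_lvars:
  assumes ps: "path_system PT W Q d" and deg: "degree_le D N F"
    and F: "\<And>C. C \<in> set F \<Longrightarrow> length C \<le> 3 \<and> fst ` set C \<subseteq> {..<N}"
  shows "length (lvars PT W N (placed W Q F) l) \<le> capacity d D W Q N"
proof -
  have WQ: "1 \<le> W" "1 \<le> Q" using ps by (auto simp: path_system_def)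
  let ?b = "D * (N div W + 1) + Q * card (types W)"
  let ?V = "\<lambda>i. {v. \<exists>x \<in> set (ranked W F). v \<in> fst ` set (fst x) \<and> PT ! (v mod W) ! (snd x mod Q) ! i = l}"
  have Vi: "finite (?V i) \<and> card (?V i) \<le> 3 * ?b" if i: "i \<le> d" for i
  proof -
    from ps i obtain H A where HA: "finite H" "finite A" "card H * card A \<le> Q"
      "\<And>h q. h < W \<Longrightarrow> q < Q \<Longrightarrow> PT ! h ! q ! i = l \<Longrightarrow> h \<in> H \<and> q \<in> A"
      unfolding path_system_def by metis
    let ?L = "filter (\<lambda>x. (\<exists>v \<in> fst ` set (fst x). v mod W \<in> H) \<and> snd x mod Q \<in> A) (ranked W F)"
    have sub: "?V i \<subseteq> (\<Union>x \<in> set ?L. fst ` set (fst x))"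
    proof
      fix v assume "v \<in> ?V i"
      then obtain x where x: "x \<in> set (ranked W F)" "v \<in> fst ` set (fst x)" "PT ! (v mod W) ! (snd x mod Q) ! i = l"
        by blast
      then have "v mod W \<in> H \<and> snd x mod Q \<in> A" using WQ by (intro HA(4)) auto
      then have "x \<in> set ?L" using x by auto
      then show "v \<in> (\<Union>x \<in> set ?L. fst ` set (fst x))" using x(2) by blast
    qed
    have "card (?V i) \<le> card (\<Union>x \<in> set ?L. fst ` set (fst x))" by (intro card_mono[OF _ sub]) auto
    also have "\<dots> \<le> (\<Sum>x\<in>set ?L. card (fst ` set (fst x)))" by (rule card_UN_le) simp
    also have "\<dots> \<le> (\<Sum>x\<in>set ?L. 3)"
    proof (rule sum_mono)
      fix x assume "x \<in> set ?L"
      then have "fst x \<in> set F" using arg_cong[OF map_fst_ranked[of W F], of set] by auto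
      then have "length (fst x) \<le> 3" using F by blast
      then show "card (fst ` set (fst x)) \<le> 3"
        using card_image_le[of "set (fst x)" fst] card_length[of "fst x"] by simp
    qed
    also have "\<dots> \<le> 3 * length ?L" using card_length[of ?L] by simp
    also have "\<dots> \<le> 3 * ?b" using load_count[OF F deg WQ HA(1-3)] by (intro mult_left_mono) auto
    finally show ?thesis using finite_subset[OF sub] by auto
  qed
  have "set (lvars PT W N (placed W Q F) l) \<subseteq> (\<Union>i \<in> {..d}. ?V i)"
  proof
    fix v assume "v \<in> set (lvars PT W N (placed W Q F) l)"
    then obtain x where x: "x \<in> set (ranked W F)" "v \<in> fst ` set (fst x)" "l \<in> set (through PT W v (snd x mod Q))"
      by (auto simp: mem_lvars placed_def)
    have q: "snd x mod Q < Q" "v mod W < W" using WQ by auto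
    have "l \<in> set (PT ! (v mod W) ! (snd x mod Q))" using x(3) through_nth[OF ps q(1)] by simp
    moreover have "length (PT ! (v mod W) ! (snd x mod Q)) = d + 1" using ps q by (auto simp: path_system_def)
    ultimately obtain i where "i \<le> d" "PT ! (v mod W) ! (snd x mod Q) ! i = l"
      by (metis in_set_conv_nth Suc_eq_plus1 less_Suc_eq_le)
    then show "v \<in> (\<Union>i \<in> {..d}. ?V i)" using x by blast
  qed
  then have "card (set (lvars PT W N (placed W Q F) l)) \<le> card (\<Union>i \<in> {..d}. ?V i)"
    using Vi by (intro card_mono) auto
  also have "\<dots> \<le> (\<Sum>i\<in>{..d}. card (?V i))" by (rule card_UN_le) simp
  also have "\<dots> \<le> (\<Sum>i\<in>{..d}. 3 * ?b)" using Vi by (intro sum_mono) auto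
  also have "\<dots> = capacity d D W Q N" by (simp add: capacity_def algebra_simps)
  finally show ?thesis using distinct_card[OF distinct_lvars] by simp
qed

fun bool_lists :: "nat \<Rightarrow> bool list list" where
  "bool_lists 0 = [[]]"
| "bool_lists (Suc n) = map ((#) False) (bool_lists n) @ map ((#) True) (bool_lists n)"

lemma length_bool_lists: "length (bool_lists n) = 2 ^ n"
  by (induction n) auto

lemma set_bool_lists: "set (bool_lists n) = {xs. length xs = n}"
proof (induction n)
  case (Suc n)
  show ?case
  proof (intro set_eqI iffI)
    fix xs assume "xs \<in> set (bool_lists (Suc n))"
    then show "xs \<in> {xs. length xs = Suc n}" using Suc by auto
  next
    fix xs :: "bool list" assume "xs \<in> {xs. length xs = Suc n}"
    then obtain b ys where "xs = b # ys" "length ys = n" by (auto simp: length_Suc_conv)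
    then show "xs \<in> set (bool_lists (Suc n))" using Suc by (cases b) auto
  qed
qed simp

text \<open>The requirement for equal lines is the hypothesis that makes values constant along a
  loop; agreement on common variables transports truth values from line to line.\<close>

definition line_cons :: "(lit list \<times> nat) list \<Rightarrow> (nat \<Rightarrow> nat list) \<Rightarrow> bool list list \<Rightarrow> nat \<Rightarrow> nat \<Rightarrow> nat \<Rightarrow> nat \<Rightarrow> bool" where
  "line_cons R S Bs l v l' v' \<longleftrightarrow> okline R (S l) (nthd [] Bs v) \<and> (l = l' \<longrightarrow> v = v') \<and>
     agree (S l) (nthd [] Bs v) (S l') (nthd [] Bs v')"

lemma truths_map: "set (truths S (map \<alpha> S @ xs)) = {v \<in> set S. \<alpha> v}"
  by (induction S) (auto simp: truths_def)

text \<open>\<open>linked l l'\<close> means that some cell lies on both lines.\<close>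

theorem routing_correct:
  assumes ps: "path_system PT W Q d" and F: "\<And>C. C \<in> set F \<Longrightarrow> fst ` set C \<subseteq> {..<N}"
    and R: "R = placed W Q F" and S: "S = lvars PT W N R" and B: "\<And>l. length (S l) \<le> B"
    and range: "\<And>h q i. h < W \<Longrightarrow> q < Q \<Longrightarrow> i \<le> d \<Longrightarrow> PT ! h ! q ! i \<in> Ls"
    and refl: "\<And>l. l \<in> Ls \<Longrightarrow> linked l l"
    and linked_path: "\<And>h q i. h < W \<Longrightarrow> q < Q \<Longrightarrow> i < d \<Longrightarrow> linked (PT ! h ! q ! i) (PT ! h ! q ! Suc i)"
    and first: "\<And>h q. h < W \<Longrightarrow> q < Q \<Longrightarrow> PT ! h ! q ! 0 = src h"
    and last: "\<And>h q. h < W \<Longrightarrow> q < Q \<Longrightarrow> PT ! h ! q ! d = tgt q"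
  shows "(\<exists>val. (\<forall>l \<in> Ls. val l < 2 ^ B) \<and> (\<forall>l \<in> Ls. \<forall>l' \<in> Ls. linked l l' \<longrightarrow>
      line_cons R S (bool_lists B) l (val l) l' (val l'))) \<longleftrightarrow> (\<exists>\<alpha>. models \<alpha> F)"
proof
  have WQ: "1 \<le> W" "1 \<le> Q" using ps by (auto simp: path_system_def)
  have len: "length (PT ! h ! q) = d + 1" if "h < W" "q < Q" for h q using ps that by (auto simp: path_system_def)
  have RF: "fst ` set R = set F"
    using arg_cong[OF map_fst_ranked[of W F], of set] by (simp add: R placed_def image_image)
  have Rq: "snd x < Q" if "x \<in> set R" for x using that WQ by (auto simp: R placed_def)
  {
    assume "\<exists>val. (\<forall>l \<in> Ls. val l < 2 ^ B) \<and> (\<forall>l \<in> Ls. \<forall>l' \<in> Ls. linked l l' \<longrightarrow>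
      line_cons R S (bool_lists B) l (val l) l' (val l'))"
    then obtain val where val: "\<And>l l'. l \<in> Ls \<Longrightarrow> l' \<in> Ls \<Longrightarrow> linked l l' \<Longrightarrow>
      line_cons R S (bool_lists B) l (val l) l' (val l')" by blast
    define tr where "tr l = set (truths (S l) (nthd [] (bool_lists B) (val l)))" for l
    \<comment> \<open>The truth value is read off at the home line; agreement along the paths
      carries it to every clause of the variable.\<close>
    define \<alpha> where "\<alpha> v \<longleftrightarrow> v \<in> tr (src (v mod W))" for v
    have on_path: "v \<in> set (S (PT ! (v mod W) ! snd x ! i))" if x: "x \<in> set R" "v \<in> fst ` set (fst x)" and i: "i \<le> d" for x v i
    proof -
      have q: "snd x < Q" "v mod W < W" using Rq[OF x(1)] WQ by auto
      have "v < N" using F[of "fst x"] RF x by auto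
      moreover have "PT ! (v mod W) ! snd x ! i \<in> set (through PT W v (snd x))"
        unfolding through_nth[OF ps q(1)] using len[OF q(2,1)] i by (intro nth_mem) simp
      ultimately show ?thesis using x unfolding S mem_lvars by blast
    qed
    have same: "v \<in> tr (PT ! (v mod W) ! snd x ! i) \<longleftrightarrow> \<alpha> v"
      if x: "x \<in> set R" "v \<in> fst ` set (fst x)" and "i \<le> d" for x v i
      using that(3)
    proof (induction i)
      case 0
      have q: "snd x < Q" "v mod W < W" using Rq[OF x(1)] WQ by auto
      show ?case using first[OF q(2,1)] by (simp add: \<alpha>_def)
    next
      case (Suc i)
      have q: "snd x < Q" "v mod W < W" using Rq[OF x(1)] WQ by auto
      let ?l = "PT ! (v mod W) ! snd x ! i" and ?l' = "PT ! (v mod W) ! snd x ! Suc i"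
      have "line_cons R S (bool_lists B) ?l (val ?l) ?l' (val ?l')"
        using Suc.prems q by (intro val range linked_path) auto
      then have "v \<in> tr ?l \<longleftrightarrow> v \<in> tr ?l'"
        using on_path[OF x, of i] on_path[OF x, of "Suc i"] Suc.prems
        by (auto simp: line_cons_def agree_def list_all_iff tr_def)
      then show ?case using Suc by simp
    qed
    have "models \<alpha> F"
      unfolding models_def
    proof
      fix C assume "C \<in> set F"
      then have "C \<in> fst ` set R" using RF by simp
      then obtain x where x: "x \<in> set R" "fst x = C" by blast
      have q: "snd x < Q" using Rq[OF x(1)] .
      let ?l = "tgt (snd x)"
      have tl: "PT ! (v mod W) ! snd x ! d = ?l" for v using WQ q by (intro last) auto
      have "?l \<in> Ls" using range[of 0 "snd x" d] last[of 0 "snd x"] WQ q by simp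
      then have "okline R (S ?l) (nthd [] (bool_lists B) (val ?l))"
        using val refl by (auto simp: line_cons_def)
      moreover have "v \<in> set (S ?l)" if "v \<in> fst ` set C" for v
        using on_path[OF x(1), of v d] that x(2) tl[of v] by simp
      ultimately have "\<exists>y\<in>set C. (fst y \<in> tr ?l) = snd y"
        using x unfolding okline_def list_all_iff list_ex_iff tr_def by (metis image_eqI)
      then obtain y where y: "y \<in> set C" "(fst y \<in> tr ?l) = snd y" by blast
      have "fst y \<in> tr ?l \<longleftrightarrow> \<alpha> (fst y)"
        using same[OF x(1), of "fst y" d] y(1) x(2) tl[of "fst y"] by simp
      then show "\<exists>l\<in>set C. lit_true \<alpha> l" using y by (auto simp: lit_true_def)
    qed
    then show "\<exists>\<alpha>. models \<alpha> F" by blast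
  }
  {
    assume "\<exists>\<alpha>. models \<alpha> F"
    then obtain \<alpha> where \<alpha>: "models \<alpha> F" ..
    \<comment> \<open>Bits in excess of the variables on the line are filled with
      \<open>False\<close>; \<open>truths\<close> ignores them.\<close>
    define vec where "vec l = map \<alpha> (S l) @ replicate (B - length (S l)) False" for l
    have "\<exists>v. v < 2 ^ B \<and> bool_lists B ! v = vec l" for l
    proof -
      have "length (vec l) = B" using B[of l] by (simp add: vec_def)
      then have "vec l \<in> set (bool_lists B)" by (simp add: set_bool_lists)
      then show ?thesis using length_bool_lists[of B] by (metis in_set_conv_nth)
    qed
    then obtain val where val: "\<And>l. val l < 2 ^ B \<and> bool_lists B ! val l = vec l" by metis
    have nv: "nthd [] (bool_lists B) (val l) = vec l" for l
      using val[of l] by (simp add: nthd_nth length_bool_lists)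
    have tr: "set (truths (S l) (vec l)) = {v \<in> set (S l). \<alpha> v}" for l
      unfolding vec_def by (rule truths_map)
    have "okline R (S l) (vec l)" for l
      unfolding okline_def list_all_iff list_ex_iff
    proof (intro ballI impI)
      fix x assume x: "x \<in> set R" "\<forall>y\<in>set (fst x). fst y \<in> set (S l)"
      then have "fst x \<in> set F" using RF by blast
      then obtain y where "y \<in> set (fst x)" "lit_true \<alpha> y" using \<alpha> unfolding models_def by blast
      then show "\<exists>y\<in>set (fst x). (fst y \<in> set (truths (S l) (vec l))) = snd y"
        using x(2) unfolding tr lit_true_def by blast
    qed
    moreover have "agree (S l) (vec l) (S l') (vec l')" for l l'
      unfolding agree_def list_all_iff tr by blast
    ultimately have "line_cons R S (bool_lists B) l (val l) l' (val l')" for l l'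
      unfolding line_cons_def nv by blast
    then show "\<exists>val. (\<forall>l \<in> Ls. val l < 2 ^ B) \<and> (\<forall>l \<in> Ls. \<forall>l' \<in> Ls. linked l l' \<longrightarrow>
      line_cons R S (bool_lists B) l (val l) l' (val l'))" using val by blast
  }
qed

section \<open>Coordinate-by-coordinate routing in the grid\<close>

lemma digits_mod:
  fixes M :: nat
  shows "(\<And>j. j < i \<Longrightarrow> q div M ^ j mod M = q' div M ^ j mod M) \<Longrightarrow> q mod M ^ i = q' mod M ^ i"
proof (induction i)
  case (Suc i)
  have e: "x mod M ^ Suc i = M ^ i * (x div M ^ i mod M) + x mod M ^ i" for x
    using mod_mult2_eq[of x "M ^ i" M] by (simp add: mult.commute)
  show ?case unfolding e using Suc.IH Suc.prems by simp
qed simp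

lemma digits_div:
  fixes M :: nat
  assumes "h < M ^ n" "h' < M ^ n" "i \<le> n"
    and "\<And>j. i \<le> j \<Longrightarrow> j < n \<Longrightarrow> h div M ^ j mod M = h' div M ^ j mod M"
  shows "h div M ^ i = h' div M ^ i"
proof -
  have M: "M ^ n = M ^ i * M ^ (n - i)" using assms(3) by (simp add: power_add[symmetric])
  have "h div M ^ i < M ^ (n - i)" "h' div M ^ i < M ^ (n - i)"
    using assms(1,2) unfolding M by (auto simp: mult.commute intro!: less_mult_imp_div_less)
  moreover have "(h div M ^ i) mod M ^ (n - i) = (h' div M ^ i) mod M ^ (n - i)"
  proof (rule digits_mod)
    fix j assume "j < n - i"
    then show "h div M ^ i div M ^ j mod M = h' div M ^ i div M ^ j mod M"
      using assms(4)[of "i + j"] by (simp add: div_mult2_eq[symmetric] power_add)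
  qed
  ultimately show ?thesis by simp
qed

lemma card_same_div: "finite {h. h < (m::nat) \<and> h div P = c} \<and> card {h. h < m \<and> h div P = c} \<le> P" if "1 \<le> P"
proof -
  have "{h. h < m \<and> h div P = c} \<subseteq> (\<lambda>r. c * P + r) ` {..<P}"
  proof
    fix h assume "h \<in> {h. h < m \<and> h div P = c}"
    then have "h = c * P + h mod P" "h mod P < P" using that by (auto simp: div_mult_mod_eq)
    then show "h \<in> (\<lambda>r. c * P + r) ` {..<P}" by blast
  qed
  from card_mono[OF _ this] show ?thesis using card_image_le[of "{..<P}" "\<lambda>r. c * P + r"] by simp
qed

lemma card_same_mod: "finite {q. q < P * k \<and> q mod P = c} \<and> card {q. q < P * k \<and> q mod P = c} \<le> (k::nat)" if "1 \<le> P"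
proof -
  have "{q. q < P * k \<and> q mod P = c} \<subseteq> (\<lambda>r. r * P + c) ` {..<k}"
  proof
    fix q assume "q \<in> {q. q < P * k \<and> q mod P = c}"
    then have "q = q div P * P + c" "q div P < k" by (auto simp: less_mult_imp_div_less mult.commute)
    then show "q \<in> (\<lambda>r. r * P + c) ` {..<k}" by blast
  qed
  from card_mono[OF _ this] show ?thesis using card_image_le[of "{..<k}" "\<lambda>r. r * P + c"] by simp
qed

context network
begin

definition idx :: "'d \<Rightarrow> nat" where "idx = to_nat_on UNIV"

definition ax :: "nat \<Rightarrow> 'd" where "ax = from_nat_into UNIV"

lemma idx_ax: "k < CARD('d) \<Longrightarrow> idx (ax k) = k"
  using to_nat_on_from_nat_into[of k "UNIV :: 'd set"] to_nat_on_finite[of "UNIV :: 'd set"]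
  by (auto simp: idx_def ax_def bij_betw_def)

lemma ax_idx: "ax (idx i) = i"
  by (simp add: idx_def ax_def)

lemma idx_less: "idx i < CARD('d)"
  using to_nat_on_finite[of "UNIV :: 'd set"] by (auto simp: idx_def bij_betw_def)

text \<open>Homes are the nodes whose coordinate with index 0 equals 1; the other coordinates are
  the base-M digits of h, shifted by one.\<close>

definition hf :: "nat \<Rightarrow> 'd \<Rightarrow> nat" where
  "hf h j = (if idx j = 0 then 1 else h div M ^ (idx j - 1) mod M + 1)"

definition qf :: "nat \<Rightarrow> 'd \<Rightarrow> nat" where
  "qf q j = q div M ^ idx j mod M + 1"

definition mix :: "nat \<Rightarrow> nat \<Rightarrow> nat \<Rightarrow> 'd \<Rightarrow> nat" where
  "mix i h q j = (if idx j < i then qf q j else hf h j)"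

text \<open>After all coordinates have been adjusted, one more line through the node, in direction
  \<open>ax 0\<close>, is the meeting place of the variables of its clauses.\<close>

definition dir :: "nat \<Rightarrow> 'd" where
  "dir i = (if i < CARD('d) then ax i else ax 0)"

text \<open>From its home \<open>h\<close> a variable reaches node \<open>q\<close> by adjusting one coordinate after the other.\<close>

definition pline :: "nat \<Rightarrow> nat \<Rightarrow> nat \<Rightarrow> 'd \<times> ('d \<Rightarrow> nat)" where
  "pline h q i = (dir i, (mix i h q)(dir i := 0))"

lemma mix_range: "mix i h q j \<in> {1..M}"
  using M1 by (auto simp: mix_def hf_def qf_def Suc_le_eq)

lemma pline_Lines: "pline h q i \<in> Lines"
  using mix_range by (auto simp: pline_def Lines_def simp del: atLeastAtMost_iff)

definition linked :: "'d \<times> ('d \<Rightarrow> nat) \<Rightarrow> 'd \<times> ('d \<Rightarrow> nat) \<Rightarrow> bool" where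
  "linked l l' \<longleftrightarrow> (\<exists>x \<in> Cells. \<exists>i j fl fl'. desc x i = Some (l, fl) \<and> desc x j = Some (l', fl'))"

lemma linked_refl: "l \<in> Lines \<Longrightarrow> linked l l"
proof -
  assume l: "l \<in> Lines"
  have "1 \<in> {1..E}" using E2 by auto
  then show ?thesis using strand_cells[OF l] desc_strand(1)[OF l] unfolding linked_def by blast
qed

text \<open>Consecutive lines of a path cross at the node whose coordinates up to index i already
  agree with q.\<close>

lemma linked_pline: "i < CARD('d) \<Longrightarrow> linked (pline h q i) (pline h q (Suc i))"
proof -
  assume i: "i < CARD('d)"
  let ?p = "mix (Suc i) h q"
  have "mix i h q j = ?p j" if "j \<noteq> ax i" for j
  proof -
    have "idx j \<noteq> i" using that ax_idx[of j] by auto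
    then show ?thesis by (auto simp: mix_def)
  qed
  then have e: "pline h q i = (ax i, ?p(ax i := 0))"
    using i by (auto simp: pline_def dir_def fun_eq_iff)
  have e': "pline h q (Suc i) = (dir (Suc i), ?p(dir (Suc i) := 0))" by (simp add: pline_def)
  show ?thesis unfolding linked_def e e'
    using node_cell[of ?p, OF mix_range] by blast
qed

lemma pline_src: "pline h q 0 = pline h 0 0"
  by (simp add: pline_def mix_def[abs_def])

lemma pline_tgt: "pline h q CARD('d) = pline 0 q CARD('d)"
  using idx_less by (simp add: pline_def mix_def[abs_def])

lemma pline_eq_mix: "pline h q i = pline h' q' i \<Longrightarrow> j \<noteq> dir i \<Longrightarrow> mix i h q j = mix i h' q' j"
  by (auto simp: pline_def dest: fun_cong[of _ _ j])

text \<open>A line used at step i reveals the coordinates of q below i and those of h above i. This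
  leaves M^i choices for h and M^(d-i) for q. On the final line h is arbitrary and one coordinate of
  q is open, M^(d-1) times M choices.\<close>

lemma pline_fibre:
  assumes i: "i \<le> CARD('d)"
  shows "\<exists>H A. finite H \<and> finite A \<and> card H * card A \<le> M ^ CARD('d) \<and>
    (\<forall>h < M ^ (CARD('d) - 1). \<forall>q < M ^ CARD('d). pline h q i = l \<longrightarrow> h \<in> H \<and> q \<in> A)"
proof (cases "\<exists>h < M ^ (CARD('d) - 1). \<exists>q < M ^ CARD('d). pline h q i = l")
  case False
  then show ?thesis by (intro exI[of _ "{}"]) auto
next
  case True
  then obtain h0 q0 where 0: "h0 < M ^ (CARD('d) - 1)" "q0 < M ^ CARD('d)" "pline h0 q0 i = l" by blast
  have MP: "1 \<le> M ^ k" for k using M1 by simp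
  show ?thesis
  proof (cases "i < CARD('d)")
    case True
    let ?H = "{h. h < M ^ (CARD('d) - 1) \<and> h div M ^ i = h0 div M ^ i}"
    let ?A = "{q. q < M ^ i * M ^ (CARD('d) - i) \<and> q mod M ^ i = q0 mod M ^ i}"
    have P: "M ^ i * M ^ (CARD('d) - i) = M ^ CARD('d)" using True by (simp add: power_add[symmetric])
    have "card ?H * card ?A \<le> M ^ i * M ^ (CARD('d) - i)"
      using card_same_div[OF MP] card_same_mod[OF MP] by (intro mult_le_mono) auto
    moreover have "h \<in> ?H \<and> q \<in> ?A" if h: "h < M ^ (CARD('d) - 1)" and q: "q < M ^ CARD('d)" and e: "pline h q i = l" for h q
    proof
      note eq = pline_eq_mix[OF trans[OF e 0(3)[symmetric]]]
      have di: "dir i = ax i" using True by (simp add: dir_def)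
      have "h div M ^ i = h0 div M ^ i"
      proof (rule digits_div[OF h 0(1)])
        show "i \<le> CARD('d) - 1" using True by simp
        fix j assume j: "i \<le> j" "j < CARD('d) - 1"
        then have a: "idx (ax (Suc j)) = Suc j" by (intro idx_ax) simp
        have "ax (Suc j) \<noteq> dir i" using a idx_ax[OF True] j unfolding di by (metis Suc_n_not_le_n)
        from eq[OF this] show "h div M ^ j mod M = h0 div M ^ j mod M" using a j by (simp add: mix_def hf_def)
      qed
      then show "h \<in> ?H" using h by simp
      have "q mod M ^ i = q0 mod M ^ i"
      proof (rule digits_mod)
        fix j assume j: "j < i"
        then have a: "idx (ax j) = j" using True by (intro idx_ax) simp
        have "ax j \<noteq> dir i" using a idx_ax[OF True] j unfolding di by auto
        from eq[OF this] show "q div M ^ j mod M = q0 div M ^ j mod M" using a j by (simp add: mix_def qf_def)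
      qed
      then show "q \<in> ?A" using q P by simp
    qed
    ultimately show ?thesis
      using card_same_div[OF MP] card_same_mod[OF MP] P by (intro exI[of _ ?H] exI[of _ ?A]) auto
  next
    case False
    then have id: "i = CARD('d)" using i by simp
    have d0: "0 < CARD('d)" by simp
    let ?H = "{..<M ^ (CARD('d) - 1)}" and ?A = "{q. q < M ^ CARD('d) \<and> q div M ^ 1 = q0 div M ^ 1}"
    have "card ?H * card ?A \<le> M ^ (CARD('d) - 1) * M ^ 1"
      using card_same_div[OF MP[of 1]] by (intro mult_le_mono) simp_all
    also have "\<dots> = M ^ CARD('d)" using d0 by (metis Suc_diff_1 power_Suc2 power_one_right)
    finally have c: "card ?H * card ?A \<le> M ^ CARD('d)" .
    have "q \<in> ?A" if q: "q < M ^ CARD('d)" and e: "pline h q i = l" for h q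
    proof -
      note eq = pline_eq_mix[OF trans[OF e 0(3)[symmetric]]]
      have "q div M ^ 1 = q0 div M ^ 1"
      proof (rule digits_div[OF q 0(2)])
        show "1 \<le> CARD('d)" using d0 by simp
        fix j assume j: "1 \<le> j" "j < CARD('d)"
        have a: "idx (ax j) = j" using j by (intro idx_ax) simp
        have "ax j \<noteq> dir i" using a idx_ax[OF d0] j unfolding dir_def id by auto
        from eq[OF this] show "q div M ^ j mod M = q0 div M ^ j mod M" using a j by (simp add: mix_def qf_def id)
      qed
      then show ?thesis using q by simp
    qed
    then show ?thesis
      using c card_same_div[OF MP[of 1]] by (intro exI[of _ ?H] exI[of _ ?A]) auto
  qed
qed

definition path_table :: "('d \<times> ('d \<Rightarrow> nat) \<Rightarrow> nat) \<Rightarrow> nat list list list" where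
  "path_table li = map (\<lambda>h. map (\<lambda>q. map (\<lambda>i. li (pline h q i)) [0..<CARD('d) + 1]) [0..<M ^ CARD('d)]) [0..<M ^ (CARD('d) - 1)]"

lemma path_table_nth:
  "h < M ^ (CARD('d) - 1) \<Longrightarrow> q < M ^ CARD('d) \<Longrightarrow> i \<le> CARD('d) \<Longrightarrow> path_table li ! h ! q ! i = li (pline h q i)"
  unfolding path_table_def by (simp add: nth_append del: upt_Suc)

lemma path_system_table:
  assumes inj: "inj_on li Lines"
  shows "path_system (path_table li) (M ^ (CARD('d) - 1)) (M ^ CARD('d)) CARD('d)"
  unfolding path_system_def
proof (intro conjI allI impI)
  show "1 \<le> M ^ (CARD('d) - 1)" "1 \<le> M ^ CARD('d)" using M1 by simp_all
  show "length (path_table li) = M ^ (CARD('d) - 1)" by (simp add: path_table_def)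
  show "\<And>h. h < M ^ (CARD('d) - 1) \<Longrightarrow> length (path_table li ! h) = M ^ CARD('d)" by (simp add: path_table_def)
  show "\<And>h q. h < M ^ (CARD('d) - 1) \<Longrightarrow> q < M ^ CARD('d) \<Longrightarrow> length (path_table li ! h ! q) = CARD('d) + 1"
    by (simp add: path_table_def)
  fix l i assume i: "i \<le> CARD('d)"
  show "\<exists>H A. finite H \<and> finite A \<and> card H * card A \<le> M ^ CARD('d) \<and>
    (\<forall>h < M ^ (CARD('d) - 1). \<forall>q < M ^ CARD('d). path_table li ! h ! q ! i = l \<longrightarrow> h \<in> H \<and> q \<in> A)"
  proof (cases "\<exists>l' \<in> Lines. li l' = l")
    case True
    then obtain l' where l': "l' \<in> Lines" "li l' = l" by blast
    have "pline h q i = l'" if "h < M ^ (CARD('d) - 1)" "q < M ^ CARD('d)" "path_table li ! h ! q ! i = l" for h q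
      using that inj pline_Lines l' unfolding path_table_nth[OF that(1,2) i] by (auto simp: inj_on_def)
    then show ?thesis using pline_fibre[OF i, of l'] by meson
  next
    case False
    then have "path_table li ! h ! q ! i \<noteq> l" if "h < M ^ (CARD('d) - 1)" "q < M ^ CARD('d)" for h q
      using pline_Lines path_table_nth[OF that i] by metis
    then show ?thesis by (intro exI[of _ "{}"]) auto
  qed
qed

text \<open>\<open>li\<close> numbers the lines, so that the constraints can be evaluated on coded
  data; injectivity keeps lines apart.\<close>

theorem network_routing:
  assumes inj: "inj_on li Lines"
    and F: "\<And>C. C \<in> set F \<Longrightarrow> length C \<le> 3 \<and> fst ` set C \<subseteq> {..<N}" and deg: "degree_le Dg N F"
    and R: "R = placed (M ^ (CARD('d) - 1)) (M ^ CARD('d)) F"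
    and S: "S = lvars (path_table li) (M ^ (CARD('d) - 1)) N R"
    and B: "B = capacity CARD('d) Dg (M ^ (CARD('d) - 1)) (M ^ CARD('d)) N"
  shows "(\<exists>\<tau>. solution (2 ^ B) (\<lambda>l v l' v'. line_cons R S (bool_lists B) (li l) v (li l') v') \<tau>) \<longleftrightarrow> (\<exists>\<alpha>. models \<alpha> F)"
proof -
  let ?PT = "path_table li" and ?W = "M ^ (CARD('d) - 1)" and ?Q = "M ^ CARD('d)"
  let ?cons = "\<lambda>l v l' v'. line_cons R S (bool_lists B) (li l) v (li l') v'"
  let ?link = "\<lambda>a b. \<exists>l \<in> Lines. \<exists>l' \<in> Lines. a = li l \<and> b = li l' \<and> linked l l'"
  note ps = path_system_table[OF inj]
  have nth: "?PT ! h ! q ! i = li (pline h q i)" if "h < ?W" "q < ?Q" "i \<le> CARD('d)" for h q i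
    using path_table_nth[OF that] .
  have "(\<exists>\<tau>. solution (2 ^ B) ?cons \<tau>) \<longleftrightarrow>
    (\<exists>val. (\<forall>l \<in> Lines. val l < 2 ^ B) \<and> (\<forall>x \<in> Cells. \<forall>i j l fl l' fl'. desc x i = Some (l, fl) \<longrightarrow>
       desc x j = Some (l', fl') \<longrightarrow> ?cons l (val l) l' (val l')))"
    by (rule solution_iff) (auto simp: line_cons_def)
  also have "\<dots> \<longleftrightarrow> (\<exists>val. (\<forall>a \<in> li ` Lines. val a < 2 ^ B) \<and> (\<forall>a \<in> li ` Lines. \<forall>b \<in> li ` Lines. ?link a b \<longrightarrow>
      line_cons R S (bool_lists B) a (val a) b (val b)))"
  proof
    assume "\<exists>val. (\<forall>l \<in> Lines. val l < 2 ^ B) \<and> (\<forall>x \<in> Cells. \<forall>i j l fl l' fl'. desc x i = Some (l, fl) \<longrightarrow>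
       desc x j = Some (l', fl') \<longrightarrow> ?cons l (val l) l' (val l'))"
    then obtain val where val: "\<And>l. l \<in> Lines \<Longrightarrow> val l < 2 ^ B"
      "\<And>x i j l fl l' fl'. x \<in> Cells \<Longrightarrow> desc x i = Some (l, fl) \<Longrightarrow> desc x j = Some (l', fl') \<Longrightarrow> ?cons l (val l) l' (val l')"
      by blast
    define val' where "val' a = val (inv_into Lines li a)" for a
    have v: "val' (li l) = val l" if "l \<in> Lines" for l using inj that by (simp add: val'_def)
    have "\<forall>a \<in> li ` Lines. val' a < 2 ^ B" using val(1) v by auto
    moreover have "line_cons R S (bool_lists B) a (val' a) b (val' b)" if link: "?link a b" for a b
    proof -
      obtain l l' where l: "l \<in> Lines" "l' \<in> Lines" "a = li l" "b = li l'" "linked l l'" using link by blast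
      then obtain x i j fl fl' where "x \<in> Cells" "desc x i = Some (l, fl)" "desc x j = Some (l', fl')"
        unfolding linked_def by blast
      then show ?thesis using val(2) l v by metis
    qed
    ultimately show "\<exists>val. (\<forall>a \<in> li ` Lines. val a < 2 ^ B) \<and> (\<forall>a \<in> li ` Lines. \<forall>b \<in> li ` Lines. ?link a b \<longrightarrow>
      line_cons R S (bool_lists B) a (val a) b (val b))" by blast
  next
    assume "\<exists>val. (\<forall>a \<in> li ` Lines. val a < 2 ^ B) \<and> (\<forall>a \<in> li ` Lines. \<forall>b \<in> li ` Lines. ?link a b \<longrightarrow>
      line_cons R S (bool_lists B) a (val a) b (val b))"
    then obtain val where val: "\<And>l. l \<in> Lines \<Longrightarrow> val (li l) < 2 ^ B"
      "\<And>l l'. l \<in> Lines \<Longrightarrow> l' \<in> Lines \<Longrightarrow> linked l l' \<Longrightarrow> line_cons R S (bool_lists B) (li l) (val (li l)) (li l') (val (li l'))"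
      by (metis image_eqI)
    have "?cons l (val (li l)) l' (val (li l'))"
      if "x \<in> Cells" "desc x i = Some (l, fl)" "desc x j = Some (l', fl')" for x i j l fl l' fl'
    proof (rule val(2))
      show "l \<in> Lines" "l' \<in> Lines" using that desc_iff D_strand by blast+
      show "linked l l'" using that unfolding linked_def by blast
    qed
    then show "\<exists>val. (\<forall>l \<in> Lines. val l < 2 ^ B) \<and> (\<forall>x \<in> Cells. \<forall>i j l fl l' fl'. desc x i = Some (l, fl) \<longrightarrow>
       desc x j = Some (l', fl') \<longrightarrow> ?cons l (val l) l' (val l'))" using val(1) by (intro exI[of _ "\<lambda>l. val (li l)"]) blast
  qed
  also have "\<dots> \<longleftrightarrow> (\<exists>\<alpha>. models \<alpha> F)"
  proof (rule routing_correct[OF ps _ R S])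
    show "fst ` set C \<subseteq> {..<N}" if "C \<in> set F" for C using F[OF that] by blast
    show "length (S l) \<le> B" for l unfolding S R B by (rule length_lvars[OF ps deg F])
    show "?PT ! h ! q ! i \<in> li ` Lines" if "h < ?W" "q < ?Q" "i \<le> CARD('d)" for h q i
      unfolding nth[OF that] using pline_Lines by blast
    show "?link a a" if "a \<in> li ` Lines" for a using that linked_refl by blast
    show "?link (?PT ! h ! q ! i) (?PT ! h ! q ! Suc i)" if hq: "h < ?W" "q < ?Q" and i: "i < CARD('d)" for h q i
    proof -
      have "?PT ! h ! q ! i = li (pline h q i)" "?PT ! h ! q ! Suc i = li (pline h q (Suc i))"
        using i by (intro nth hq; simp)+
      then show ?thesis using pline_Lines linked_pline[OF i] by blast
    qed
    show "?PT ! h ! q ! 0 = li (pline h 0 0)" if "h < ?W" "q < ?Q" for h q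
      using nth[OF that, of 0] pline_src[of h q] by simp
    show "?PT ! h ! q ! CARD('d) = li (pline 0 q CARD('d))" if "h < ?W" "q < ?Q" for h q
      using nth[OF that, of "CARD('d)"] pline_tgt[of h q] by simp
  qed
  finally show ?thesis .
qed

end

section \<open>The decision procedure and its polynomial running time\<close>

lemma FP_lift3:
  assumes "FP (\<lambda>p. h (fst p) (fst (snd p)) (snd (snd p)))" "FP f" "FP g" "FP k"
  shows "FP (\<lambda>x. h (f x) (g x) (k x))"
  using FP_comp[OF FP_Pair[OF assms(2) FP_Pair[OF assms(3,4)]] assms(1)] by simp

lemma FP_lift4:
  assumes "FP (\<lambda>p. h (fst p) (fst (snd p)) (fst (snd (snd p))) (snd (snd (snd p))))" "FP f" "FP g" "FP k" "FP l"
  shows "FP (\<lambda>x. h (f x) (g x) (k x) (l x))"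
  using FP_comp[OF FP_Pair[OF assms(2) FP_Pair[OF assms(3) FP_Pair[OF assms(4,5)]]] assms(1)] by simp

lemma FP_lift5:
  assumes "FP (\<lambda>p. h (fst p) (fst (snd p)) (fst (snd (snd p))) (fst (snd (snd (snd p)))) (snd (snd (snd (snd p)))))"
    "FP f" "FP g" "FP k" "FP l" "FP m"
  shows "FP (\<lambda>x. h (f x) (g x) (k x) (l x) (m x))"
  using FP_comp[OF FP_Pair[OF assms(2) FP_Pair[OF assms(3) FP_Pair[OF assms(4) FP_Pair[OF assms(5,6)]]]] assms(1)] by simp

lemma FP_sub': "FP (\<lambda>p. sub (fst p) (snd p :: 'b::coded list))"
  unfolding sub_def by (intro fp)

lemmas FP_sub [fp] = FP_comp2[where h = sub, OF _ _ FP_sub']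

lemma FP_active': "FP (\<lambda>p. active (fst p) (snd p :: 'b::coded list))"
  unfolding active_def by (intro fp)

lemmas FP_active [fp] = FP_comp2[where h = active, OF _ _ FP_active']

lemma FP_petals': "FP (\<lambda>p. petals (fst p) (fst (snd p) :: 'b::coded list) (snd (snd p)))"
  unfolding petals_def by (intro fp)

lemmas FP_petals [fp] = FP_lift3[where h = petals, OF FP_petals']

lemma FP_flowers': "FP (\<lambda>p. flowers (fst p) (snd p :: 'b::coded list list))"
  unfolding flowers_def by (intro fp)

lemmas FP_flowers [fp] = FP_comp2[where h = flowers, OF _ _ FP_flowers']

lemma FP_large_flowers': "FP (\<lambda>p. large_flowers (fst p) (snd p :: 'b::coded list list))"
  unfolding large_flowers_def by (intro fp)

lemmas FP_large_flowers [fp] = FP_comp2[where h = large_flowers, OF _ _ FP_large_flowers']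

lemma FP_open_petals': "FP (\<lambda>p. open_petals (fst p) (fst (snd p) :: 'b::coded list) (snd (snd p)))"
  unfolding open_petals_def by (intro fp)

lemmas FP_open_petals [fp] = FP_lift3[where h = open_petals, OF FP_open_petals']

lemma FP_branch': "FP (\<lambda>p. branch (fst p) (snd p :: 'b::coded list list \<times> nat))"
  unfolding branch_def by (intro fp)

lemmas FP_branch [fp] = FP_comp2[where h = branch, OF _ _ FP_branch']

lemma FP_spread': "FP (\<lambda>p. spread (fst p) (snd p :: ('b::coded list list \<times> nat) list))"
  unfolding spread_def by (intro fp)

lemmas FP_spread [fp] = FP_comp2[where h = spread, OF _ _ FP_spread']

text \<open>The frontier is exponentially long in N, but with the cut-off its computation is
  polynomial in the unary number p.\<close>

definition cut_leaves :: "nat \<Rightarrow> nat \<Rightarrow> nat \<Rightarrow> lit list list \<Rightarrow> (lit list list \<times> nat) list" where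
  "cut_leaves p \<theta> N K = tfold p [] (\<lambda>y. spread \<theta>) (replicate (N * (4 * \<theta> + 1) + 1) ()) [(K, 2 * N div \<theta>)]"

lemma FP_cut_leaves': "FP (\<lambda>p. cut_leaves (fst p) (fst (snd p)) (fst (snd (snd p))) (snd (snd (snd p))))"
  unfolding cut_leaves_def by (intro fp)

lemmas FP_cut_leaves [fp] = FP_lift4[where h = cut_leaves, OF FP_cut_leaves']

definition cut_bool_lists :: "nat \<Rightarrow> nat \<Rightarrow> bool list list" where
  "cut_bool_lists p B = tfold p [] (\<lambda>y acc. map ((#) False) acc @ map ((#) True) acc) (replicate B ()) [[]]"

lemma FP_cut_bool_lists': "FP (\<lambda>p. cut_bool_lists (fst p) (snd p))"
  unfolding cut_bool_lists_def by (intro fp)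

lemmas FP_cut_bool_lists [fp] = FP_comp2[where h = cut_bool_lists, OF _ _ FP_cut_bool_lists']

lemma FP_ctype': "FP (\<lambda>p. ctype (fst p) (snd p))"
  unfolding ctype_def by (intro fp)

lemmas FP_ctype [fp] = FP_comp2[where h = ctype, OF _ _ FP_ctype']

lemma ranked_bound: "x \<in> set (ranked W F) \<Longrightarrow> fst x \<in> set F \<and> snd x \<le> length F"
proof (induction F rule: rev_induct)
  case (snoc C F)
  have "length (ranked W F) = length F" using arg_cong[OF map_fst_ranked[of W F], of length] by simp
  then have "length (filter P (ranked W F)) \<le> length F" for P by (metis length_filter_le)
  then show ?case using snoc by (auto simp: ranked_snoc intro: le_SucI)
qed (simp add: ranked_def)

lemma FP_ranked [fp]:
  assumes f: "FP f" and g: "FP g"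
  shows "FP (\<lambda>x. ranked (f x) (g x))"
proof (rule FP_comp2[OF f g])
  show "FP (\<lambda>p. ranked (fst p) (snd p))"
    unfolding ranked_def
  proof (rule FP_fold[where k = 3 and b = 3])
    fix x :: "nat \<times> lit list list" and us vs
    assume "snd x = us @ vs"
    then have "sz us \<le> sz (snd x)" using sz_append[of us vs] tsize_pos[of "code vs"] by simp
    also have "\<dots> \<le> sz x" by (cases x) simp
    finally have us: "sz us \<le> sz x" .
    have len: "2 * length us + 1 \<le> sz us" by (rule length_le_sz)
    have "sz y \<le> 2 * sz x + 2" if "y \<in> set (ranked (fst x) us)" for y
    proof -
      have "fst y \<in> set us" "snd y \<le> length us" using ranked_bound[OF that] by auto
      moreover have "sz (fst y) \<le> sz us" using sz_mem[OF calculation(1)] by simp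
      ultimately show ?thesis using us len by (cases y) simp
    qed
    have len': "length (ranked (fst x) us) = length us"
      using arg_cong[OF map_fst_ranked[of "fst x" us], of length] by simp
    have "sz (ranked (fst x) us) \<le> 1 + length us * (2 * sz x + 3)"
      using sz_list_le[of "ranked (fst x) us" "2 * sz x + 2", OF \<open>\<And>y. y \<in> set (ranked (fst x) us) \<Longrightarrow> sz y \<le> 2 * sz x + 2\<close>]
      unfolding len' by (simp add: algebra_simps)
    also have "\<dots> \<le> 1 + sz x * (2 * sz x + 3)" using us len by (intro add_mono mult_right_mono) auto
    also have "\<dots> \<le> (sz x + 3) ^ 3" by (simp add: power3_eq_cube algebra_simps)
    finally show "sz (fold (\<lambda>C acc. (C, length (filter (\<lambda>xa. ctype (fst x) (fst xa) = ctype (fst x) C) acc)) # acc) us [])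
      \<le> (sz x + 3) ^ 3" by (simp add: ranked_def)
  qed (intro fp)+
qed

lemma FP_placed': "FP (\<lambda>p. placed (fst p) (fst (snd p)) (snd (snd p)))"
  unfolding placed_def by (intro fp)

lemmas FP_placed [fp] = FP_lift3[where h = placed, OF FP_placed']

lemma FP_through': "FP (\<lambda>p. through (fst p) (fst (snd p)) (fst (snd (snd p))) (snd (snd (snd p))))"
  unfolding through_def by (intro fp)

lemmas FP_through [fp] = FP_lift4[where h = through, OF FP_through']

lemma FP_lvars': "FP (\<lambda>p. lvars (fst p) (fst (snd p)) (fst (snd (snd p))) (fst (snd (snd (snd p)))) (snd (snd (snd (snd p)))))"
  unfolding lvars_def by (intro fp)

lemmas FP_lvars [fp] = FP_lift5[where h = lvars, OF FP_lvars']

lemma FP_truths': "FP (\<lambda>p. truths (fst p) (snd p))"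
  unfolding truths_def by (intro fp)

lemmas FP_truths [fp] = FP_comp2[where h = truths, OF _ _ FP_truths']

lemma FP_okline': "FP (\<lambda>p. okline (fst p) (fst (snd p)) (snd (snd p)))"
  unfolding okline_def by (intro fp)

lemmas FP_okline [fp] = FP_lift3[where h = okline, OF FP_okline']

lemma FP_agree': "FP (\<lambda>p. agree (fst p) (fst (snd p)) (fst (snd (snd p))) (snd (snd (snd p))))"
  unfolding agree_def by (intro fp)

lemmas FP_agree [fp] = FP_lift4[where h = agree, OF FP_agree']

subsection \<open>The list of balls\<close>

text \<open>A cell is given by the binary coordinates and, for each direction, the line that is shown there (if
  any) together with the orientation.\<close>

type_synonym cell = "(sym list \<times> (nat \<times> bool) list) list"

definition line_ok :: "nat list list list \<times> nat \<times> nat \<times> (lit list \<times> nat) list \<Rightarrow> bool list list \<Rightarrow>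
    nat \<times> nat \<Rightarrow> nat \<times> nat \<Rightarrow> bool" where
  "line_ok net Bs a b = line_cons (snd (snd (snd net)))
     (lvars (fst net) (fst (snd net)) (fst (snd (snd net))) (snd (snd (snd net)))) Bs (fst a) (snd a) (fst b) (snd b)"

lemma FP_line_ok': "FP (\<lambda>p. line_ok (fst p) (fst (snd p)) (fst (snd (snd p))) (snd (snd (snd p))))"
  unfolding line_ok_def line_cons_def by (intro fp)

lemmas FP_line_ok [fp] = FP_lift4[where h = line_ok, OF FP_line_ok']

definition cell_ok :: "nat list list list \<times> nat \<times> nat \<times> (lit list \<times> nat) list \<Rightarrow> bool list list \<Rightarrow>
    cell \<Rightarrow> nat list \<Rightarrow> bool" where
  "cell_ok net Bs cl t = list_all (\<lambda>z. case snd (fst z) of [] \<Rightarrow> snd z = 0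
     | y # ys \<Rightarrow> list_all (\<lambda>z'. case snd (fst z') of [] \<Rightarrow> True
         | y' # ys' \<Rightarrow> line_ok net Bs (fst y, snd z) (fst y', snd z')) (zip cl t)) (zip cl t)"

lemma FP_cell_ok': "FP (\<lambda>p. cell_ok (fst p) (fst (snd p)) (fst (snd (snd p))) (snd (snd (snd p))))"
  unfolding cell_ok_def by (intro fp)

lemmas FP_cell_ok [fp] = FP_lift4[where h = cell_ok, OF FP_cell_ok']

definition coord_exp :: "nat \<Rightarrow> nat \<Rightarrow> nat \<Rightarrow> (nat \<times> bool) list \<Rightarrow> nat \<Rightarrow> nat" where
  "coord_exp q Y n ys t = q * (Y + n - (case ys of [] \<Rightarrow> t | y # ys \<Rightarrow> if snd y then n - 1 - t else t))"

lemma FP_coord_exp': "FP (\<lambda>p. coord_exp (fst p) (fst (snd p)) (fst (snd (snd p))) (fst (snd (snd (snd p)))) (snd (snd (snd (snd p)))))"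
  unfolding coord_exp_def by (intro fp)

lemmas FP_coord_exp [fp] = FP_lift5[where h = coord_exp, OF FP_coord_exp']

text \<open>In lowest terms, 2 (x + 2^(-e)) is (2^e x + 1) / 2^(e-1). Binary words start with the
  least significant digit, so the numerator is a \<open>One\<close>, then e - 1 times
  \<open>Zero\<close>, then the digits of x.\<close>

definition coord_string :: "sym list \<Rightarrow> nat \<Rightarrow> sym list" where
  "coord_string xs e = LPar # (LPar # Zero # One # replicate (e - 1) Zero @ xs @ [RPar]) @
     (LPar # Zero # replicate (e - 1) Zero @ [One] @ [RPar]) @ [RPar]"

lemma FP_coord_string': "FP (\<lambda>p. coord_string (fst p) (snd p))"
  unfolding coord_string_def by (intro fp)

lemmas FP_coord_string [fp] = FP_comp2[where h = coord_string, OF _ _ FP_coord_string']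

definition ball_string :: "nat \<times> nat \<times> nat \<Rightarrow> cell \<Rightarrow> nat list \<Rightarrow> sym list" where
  "ball_string s cl t = LPar # concat (map (\<lambda>z. coord_string (fst (fst z))
     (coord_exp (fst s) (fst (snd s)) (snd (snd s)) (snd (fst z)) (snd z))) (zip cl t)) @ [RPar]"

lemma FP_ball_string': "FP (\<lambda>p. ball_string (fst p) (fst (snd p)) (snd (snd p)))"
  unfolding ball_string_def by (intro fp)

lemmas FP_ball_string [fp] = FP_lift3[where h = ball_string, OF FP_ball_string']

fun tuples :: "nat \<Rightarrow> nat \<Rightarrow> nat list list" where
  "tuples 0 n = [[]]"
| "tuples (Suc d) n = concat (map (\<lambda>t. map (\<lambda>v. v # t) [0..<n]) (tuples d n))"

text \<open>The dimension is not part of the input, so the exponent of the polynomial may depend on it.\<close>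

lemma FP_tuples': "FP (tuples d)"
proof (induction d)
  case 0
  show ?case by (simp add: FP_const)
next
  case (Suc d)
  show ?case unfolding tuples.simps by (intro fp Suc)
qed

lemmas FP_tuples = FP_comp[OF _ FP_tuples']

definition balls_string :: "nat \<Rightarrow> nat \<times> nat \<times> nat \<Rightarrow> nat list list list \<times> nat \<times> nat \<times> (lit list \<times> nat) list \<Rightarrow>
    bool list list \<Rightarrow> cell list \<Rightarrow> sym list" where
  "balls_string d s net Bs cells = LPar # concat (map (\<lambda>cl. concat (map (ball_string s cl)
     (filter (cell_ok net Bs cl) (tuples d (snd (snd s)))))) cells) @ [RPar]"

lemma FP_balls_string': "FP (\<lambda>p. balls_string d (fst p) (fst (snd p)) (fst (snd (snd p))) (snd (snd (snd p))))"
  unfolding balls_string_def by (intro fp FP_tuples)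

lemmas FP_balls_string = FP_lift4[where h = "balls_string d" for d, OF FP_balls_string']

subsection \<open>Simulation of a given machine\<close>

text \<open>A zipper: the symbols left of the head, nearest first, and those from the head on.
  Beyond the ends of the lists the tape is blank.\<close>

type_synonym ztape = "sym list \<times> sym list"

type_synonym table = "((nat \<times> sym list) \<times> (nat \<times> (sym \<times> move) list)) list"

definition zread :: "ztape \<Rightarrow> sym" where
  "zread z = (case snd z of [] \<Rightarrow> Blank | x # xs \<Rightarrow> x)"

definition zact :: "(sym \<times> move) \<times> ztape \<Rightarrow> ztape" where
  "zact a = (if snd (fst a) = Stay then (fst (snd a), fst (fst a) # tl (snd (snd a)))
     else if snd (fst a) = MoveRight then (fst (fst a) # fst (snd a), tl (snd (snd a)))
     else (case fst (snd a) of [] \<Rightarrow> ([], Blank # fst (fst a) # tl (snd (snd a)))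
       | x # xs \<Rightarrow> (xs, x # fst (fst a) # tl (snd (snd a)))))"

definition zstep :: "table \<times> nat \<Rightarrow> nat \<times> ztape list \<Rightarrow> nat \<times> ztape list" where
  "zstep m c = (if fst c = snd m then c else
     case filter (\<lambda>e. fst e = (fst c, map zread (snd c))) (fst m) of [] \<Rightarrow> c
     | e # es \<Rightarrow> (fst (snd e), map zact (zip (snd (snd e)) (snd c))))"

text \<open>A positive answer is an encoded list and contains \<open>LPar\<close>; the negative one
  is the single symbol \<open>Zero\<close>. Searching the output tape therefore decides.\<close>

definition zaccept :: "nat \<times> ztape list \<Rightarrow> bool" where
  "zaccept c = (case rev (snd c) of [] \<Rightarrow> False | z # zs \<Rightarrow> LPar \<in> set (fst z) \<or> LPar \<in> set (snd z))"

definition simulate :: "table \<times> nat \<times> nat \<Rightarrow> nat \<Rightarrow> sym list \<Rightarrow> bool" where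
  "simulate m p w = zaccept ((zstep (fst m, fst (snd m)) ^^ p) (0, ([], w) # replicate (snd (snd m) - 1) ([], [])))"

lemma FP_zread': "FP (\<lambda>x. zread x)"
  unfolding zread_def by (intro fp)

lemmas FP_zread [fp] = FP_comp[OF _ FP_zread']

lemma FP_tl': "FP (\<lambda>x. tl (x :: 'b::coded list))"
  unfolding tl_def by (intro fp)

lemmas FP_tl [fp] = FP_comp[OF _ FP_tl']

lemma FP_zact': "FP (\<lambda>x. zact x)"
  unfolding zact_def by (intro fp)

lemmas FP_zact [fp] = FP_comp[OF _ FP_zact']

lemma FP_zstep': "FP (\<lambda>p. zstep (fst p) (snd p))"
  unfolding zstep_def by (intro fp)

lemmas FP_zstep [fp] = FP_comp2[where h = zstep, OF _ _ FP_zstep']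

lemma FP_zaccept': "FP (\<lambda>x. zaccept x)"
  unfolding zaccept_def by (intro fp)

lemmas FP_zaccept [fp] = FP_comp[OF _ FP_zaccept']

lemma sz_tl: "sz (tl xs) \<le> sz (xs :: 'a::coded list)"
  by (cases xs) (auto simp: tl_def)

lemma sz_zact: "sz (zact a) \<le> sz (snd a) + 12"
proof -
  obtain s m l r where a: "a = ((s, m), (l, r))" by (metis surj_pair)
  have "sz s \<le> 9" "sz (tl r) \<le> sz r" by (rule sz_sym_le, rule sz_tl)
  then show ?thesis by (cases l) (auto simp: a zact_def code_sym_def)
qed

text \<open>The growth per step is bounded by the table alone, so p simulated steps remain
  polynomial in p.\<close>

lemma sz_zstep: "sz (zstep m c) \<le> sz c + 14 * sz m"
proof (cases "filter (\<lambda>e. fst e = (fst c, map zread (snd c))) (fst m)")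
  case Nil
  then show ?thesis by (simp add: zstep_def)
next
  case (Cons e es)
  then have "e \<in> set (filter (\<lambda>e. fst e = (fst c, map zread (snd c))) (fst m))" by simp
  then have "e \<in> set (fst m)" by simp
  then have "sz e \<le> sz (fst m)" using sz_mem[of e "fst m"] by simp
  then have e: "sz e \<le> sz m" by (cases m) simp
  have z: "sz (map zact (zip as ts)) \<le> sz ts + 12 * length as" for as ts
  proof (induction as arbitrary: ts)
    case Nil
    then show ?case using tsize_pos[of "code ts"] by (simp add: Suc_le_eq)
  next
    case (Cons a as)
    show ?case
    proof (cases ts)
      case Nil
      then show ?thesis by simp
    next
      case (Cons t ts')
      then show ?thesis using Cons.IH[of ts'] sz_zact[of "(a, t)"] by simp
    qed
  qed
  obtain k q as where e': "e = (k, q, as)" by (metis surj_pair)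
  have "2 * length as + 1 \<le> sz as" by (rule length_le_sz)
  moreover have "sz q + sz as \<le> sz m" using e by (simp add: e')
  ultimately have "sz (q, map zact (zip as (snd c))) \<le> sz (snd c) + 1 + 14 * sz m"
    using z[of as "snd c"] by simp
  then show ?thesis using Cons by (cases c) (simp add: zstep_def e')
qed

lemma FP_simulate [fp]:
  assumes "FP f" "FP g" "FP k"
  shows "FP (\<lambda>x. simulate (f x) (g x) (k x))"
proof (rule FP_lift3[OF _ assms])
  show "FP (\<lambda>p. simulate (fst p) (fst (snd p)) (snd (snd p)))"
    unfolding simulate_def
  proof (intro FP_zaccept, rule FP_iter_inc[where k = 14 and b = 2])
    fix x :: "(table \<times> nat \<times> nat) \<times> nat \<times> sym list" and acc
    have "sz (zstep (fst (fst x), fst (snd (fst x))) acc) \<le> sz acc + 14 * sz (fst (fst x), fst (snd (fst x)))"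
      by (rule sz_zstep)
    also have "sz (fst (fst x), fst (snd (fst x))) \<le> sz x"
      by (cases x, cases "fst x", cases "snd (fst x)") simp
    also have "14 * sz x \<le> (sz x + 14) ^ 2" by (simp add: power2_eq_square algebra_simps)
    finally show "sz (zstep (fst (fst x), fst (snd (fst x))) acc) \<le> sz acc + (sz x + 14) ^ 2" by simp
  qed (intro fp)+
qed

subsection \<open>Parsing and normalizing a formula\<close>

text \<open>Variables keep their binary names while parsing: converting an arbitrary binary word
  into a unary number could be exponentially long.\<close>

type_synonym nlit = "sym list \<times> bool"

definition dedup :: "'a list \<Rightarrow> 'a list" where
  "dedup xs = fold (\<lambda>x acc. if x \<in> set acc then acc else x # acc) xs []"

lemma dedup_fold:
  fixes xs acc :: "'a list"
  defines "ys \<equiv> fold (\<lambda>x acc. if x \<in> set acc then acc else x # acc) xs acc"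
  shows "set ys = set xs \<union> set acc \<and> (distinct acc \<longrightarrow> distinct ys) \<and> length ys \<le> length xs + length acc"
  unfolding ys_def
proof (induction xs arbitrary: acc)
  case (Cons x xs)
  show ?case
  proof (cases "x \<in> set acc")
    case True
    then show ?thesis using Cons.IH[of acc] by (auto simp: insert_absorb)
  next
    case False
    then show ?thesis using Cons.IH[of "x # acc"] by auto
  qed
qed simp

lemma set_dedup [simp]: "set (dedup xs) = set xs" and distinct_dedup: "distinct (dedup xs)"
  and length_dedup: "length (dedup xs) \<le> length xs"
  using dedup_fold[of xs "[]"] by (simp_all add: dedup_def)

definition merge_clauses :: "'a list list \<Rightarrow> 'a list list" where
  "merge_clauses K = fold (\<lambda>C acc. if list_ex (\<lambda>C'. sub C C' \<and> sub C' C) acc then acc else C # acc) K []"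

lemma merge_clauses: "csets (merge_clauses K) = csets K" "distinct (map set (merge_clauses K))"
    "set (merge_clauses K) \<subseteq> set K"
proof -
  have ex: "list_ex (\<lambda>C'. sub C C' \<and> sub C' C) acc \<longleftrightarrow> set C \<in> csets acc" for C :: "'a list" and acc
    by (auto simp: list_ex_iff sub_iff)
  have "csets (fold (\<lambda>C acc. if list_ex (\<lambda>C'. sub C C' \<and> sub C' C) acc then acc else C # acc) K acc) = csets K \<union> csets acc
    \<and> (distinct (map set acc) \<longrightarrow>
        distinct (map set (fold (\<lambda>C acc. if list_ex (\<lambda>C'. sub C C' \<and> sub C' C) acc then acc else C # acc) K acc)))
    \<and> set (fold (\<lambda>C acc. if list_ex (\<lambda>C'. sub C C' \<and> sub C' C) acc then acc else C # acc) K acc) \<subseteq> set K \<union> set acc" for acc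
    unfolding ex
  proof (induction K arbitrary: acc)
    case (Cons C K)
    show ?case
    proof (cases "set C \<in> csets acc")
      case True
      then show ?thesis using Cons.IH[of acc] by auto
    next
      case False
      then show ?thesis using Cons.IH[of "C # acc"] by auto
    qed
  qed simp
  from this[of "[]"] show "csets (merge_clauses K) = csets K" "distinct (map set (merge_clauses K))"
    "set (merge_clauses K) \<subseteq> set K" unfolding merge_clauses_def by simp_all
qed

text \<open>The bracket depth tells formula, clause and literal apart. Within a literal the first
  symbol is the sign and the rest the name of the variable.\<close>

definition pstep :: "sym \<Rightarrow> nat \<times> sym list \<times> nlit list \<times> nlit list list \<Rightarrow> nat \<times> sym list \<times> nlit list \<times> nlit list list" where
  "pstep y s = (case s of (dep, cur, cl, cls) \<Rightarrow>
     if y = LPar then (Suc dep, [], cl, cls)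
     else if y = RPar then
       if dep = 3 then (2, [], (tl (rev cur), zread ([], rev cur) = One) # cl, cls)
       else if dep = 2 then (1, [], [], cl # cls)
       else (0, [], [], cls)
     else (dep, y # cur, cl, cls))"

definition parse :: "sym list \<Rightarrow> nlit list list" where
  "parse w = snd (snd (snd (fold pstep w (0, [], [], []))))"

definition nl :: "nat \<times> bool \<Rightarrow> nlit" where
  "nl l = (binary (fst l), snd l)"

lemma set_binary: "set (binary n) \<subseteq> {Zero, One}"
  by (induction n rule: binary.induct) (subst binary.simps, auto)

fun bval :: "sym list \<Rightarrow> nat" where
  "bval [] = 0"
| "bval (x # xs) = (if x = One then 1 else 0) + 2 * bval xs"

lemma bval_binary [simp]: "bval (binary n) = n"
proof (induction n rule: binary.induct)
  case (1 n)
  then show ?case by (subst binary.simps) (auto elim: oddE)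
qed

lemma binary_inj [simp]: "binary m = binary n \<longleftrightarrow> m = n"
  by (metis bval_binary)

lemma fold_pstep_bits:
  "set xs \<subseteq> {Zero, One} \<Longrightarrow> fold pstep xs (dep, cur, cl, cls) = (dep, rev xs @ cur, cl, cls)"
  by (induction xs arbitrary: cur) (auto simp: pstep_def)

lemma pstep_literal: "fold pstep (enc_literal l) (2, [], cl, cls) = (2, [], nl l # cl, cls)"
  using set_binary[of "fst l"]
  by (auto simp: enc_literal_def pstep_def[of LPar] pstep_def[of RPar] pstep_def[of One] pstep_def[of Zero]
      fold_pstep_bits nl_def tl_def zread_def)

lemma pstep_literals: "fold pstep (concat (map enc_literal C)) (2, [], cl, cls) = (2, [], rev (map nl C) @ cl, cls)"
  by (induction C arbitrary: cl) (simp_all add: pstep_literal)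

lemma pstep_clauses: "fold pstep (concat (map (enc_list enc_literal) \<phi>)) (1, [], [], cls) =
   (1, [], [], rev (map (\<lambda>C. rev (map nl C)) \<phi>) @ cls)"
proof (induction \<phi> arbitrary: cls)
  case (Cons C \<phi>)
  have "fold pstep (enc_list enc_literal C) (1, [], [], cls) = (1, [], [], rev (map nl C) # cls)"
    using pstep_literals[of C "[]" cls]
    by (simp add: enc_list_def pstep_def[of LPar] pstep_def[of RPar] numeral_2_eq_2)
  then show ?case using Cons.IH by simp
qed simp

lemma parse_cnf: "parse (enc_cnf \<phi>) = rev (map (\<lambda>C. rev (map nl C)) \<phi>)"
  unfolding parse_def enc_cnf_def enc_list_def[of "enc_list enc_literal"]
  using pstep_clauses[of \<phi> "[]"] by (simp add: pstep_def[of LPar] pstep_def[of RPar])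

definition names :: "nlit list list \<Rightarrow> sym list list" where
  "names K = dedup (map fst (concat K))"

definition lookup :: "sym list list \<Rightarrow> sym list \<Rightarrow> nat" where
  "lookup V v = (case filter (\<lambda>z. fst z = v) (zip V [0..<length V]) of [] \<Rightarrow> 0 | z # zs \<Rightarrow> snd z)"

lemma lookup_nth:
  assumes "distinct V" "i < length V"
  shows "lookup V (V ! i) = i"
proof -
  let ?F = "filter (\<lambda>z. fst z = V ! i) (zip V [0..<length V])"
  have "(V ! i, i) \<in> set ?F" using assms(2) by (auto simp: in_set_zip intro!: exI[of _ i])
  then obtain z zs where F: "?F = z # zs" by (cases ?F) auto
  then have "z \<in> set ?F" by simp
  then have "V ! snd z = V ! i" "snd z < length V" by (auto simp: in_set_zip)
  then show ?thesis using F assms by (simp add: lookup_def nth_eq_iff_index_eq)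
qed

text \<open>Renumbering by the position among the occurring names keeps the unary numbers
  small.\<close>

definition normalized :: "nlit list list \<Rightarrow> lit list list" where
  "normalized K = merge_clauses (map (\<lambda>C. dedup (map (\<lambda>l. (lookup (names K) (fst l), snd l)) C)) K)"

text \<open>The input does not state N. The number of occurring variables is computable, at most N,
  and takes its place from here on.\<close>

theorem normalized_cnf:
  assumes \<phi>: "three_cnf N \<phi>"
  defines "K \<equiv> parse (enc_cnf \<phi>)"
  shows "well (vlits (length (names K))) (normalized K)" "length (names K) \<le> N"
    "satisfiable \<phi> \<longleftrightarrow> (\<exists>\<alpha>. models \<alpha> (normalized K))"
proof -
  let ?V = "names K"
  have V: "distinct ?V" "set ?V = {binary (fst l) | l C. C \<in> set \<phi> \<and> l \<in> set C}"
    unfolding names_def set_dedup K_def parse_cnf by (rule distinct_dedup) (auto simp: nl_def image_iff; force)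
  have lk: "lookup ?V x < length ?V \<and> ?V ! lookup ?V x = x" if "x \<in> set ?V" for x
    using that lookup_nth[OF V(1)] by (metis in_set_conv_nth)
  let ?c = "\<lambda>C. (\<lambda>l. (lookup ?V (binary (fst l)), snd l)) ` set C"
  let ?K' = "map (\<lambda>C. dedup (map (\<lambda>l. (lookup ?V (fst l), snd l)) C)) K"
  have cs: "csets (normalized K) = ?c ` set \<phi>"
    unfolding normalized_def merge_clauses(1) by (simp add: K_def parse_cnf image_image nl_def)
  show "well (vlits (length ?V)) (normalized K)"
    unfolding well_def
  proof (intro conjI ballI)
    show "distinct (map set (normalized K))" unfolding normalized_def by (rule merge_clauses)
  next
    fix C assume C: "C \<in> set (normalized K)"
    then have "C \<in> set ?K'" using merge_clauses(3) unfolding normalized_def by blast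
    then obtain C0 where C0: "C0 \<in> set \<phi>" "C = dedup (map (\<lambda>l. (lookup ?V (fst l), snd l)) (rev (map nl C0)))"
      by (auto simp: K_def parse_cnf)
    show "distinct C" unfolding C0(2) by (rule distinct_dedup)
    have "length C \<le> length C0" unfolding C0(2) using length_dedup by (metis length_map length_rev)
    then show "length C \<le> 3" using \<phi> C0(1) unfolding three_cnf_def by (meson le_trans)
    have "binary (fst l) \<in> set ?V" if "l \<in> set C0" for l using that C0(1) unfolding V(2) by blast
    then have "lookup ?V (binary (fst l)) < length ?V" if "l \<in> set C0" for l using lk that by blast
    then show "set C \<subseteq> vlits (length ?V)" by (auto simp: C0(2) vlits_def nl_def)
  qed
  have "set ?V \<subseteq> binary ` {..<N}" using \<phi> unfolding V(2) three_cnf_def by fastforce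
  then have "card (set ?V) \<le> N" using surj_card_le[of "{..<N}" "set ?V" binary] by simp
  then show "length ?V \<le> N" using distinct_card[OF V(1)] by simp
  have mod: "models \<alpha> (normalized K) \<longleftrightarrow> (\<forall>C \<in> set \<phi>. \<exists>l \<in> set C. \<alpha> (lookup ?V (binary (fst l))) = snd l)" for \<alpha>
  proof -
    have "models \<alpha> (normalized K) \<longleftrightarrow> (\<forall>c \<in> csets (normalized K). \<exists>l \<in> c. lit_true \<alpha> l)"
      by (simp add: models_def)
    then show ?thesis unfolding cs by (simp add: lit_true_def)
  qed
  show "satisfiable \<phi> \<longleftrightarrow> (\<exists>\<alpha>. models \<alpha> (normalized K))"
  proof
    assume "satisfiable \<phi>"
    then obtain \<beta> where \<beta>: "models \<beta> \<phi>" unfolding satisfiable_models by blast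
    have "models (\<lambda>i. \<beta> (bval (?V ! i))) (normalized K)"
      unfolding mod
    proof
      fix C assume C: "C \<in> set \<phi>"
      then obtain l where l: "l \<in> set C" "\<beta> (fst l) = snd l" using \<beta> unfolding models_def lit_true_def by blast
      then have "binary (fst l) \<in> set ?V" using C V(2) by blast
      from lk[OF this] show "\<exists>l \<in> set C. \<beta> (bval (?V ! lookup ?V (binary (fst l)))) = snd l"
        using l by (intro bexI[of _ l]) auto
    qed
    then show "\<exists>\<alpha>. models \<alpha> (normalized K)" by blast
  next
    assume "\<exists>\<alpha>. models \<alpha> (normalized K)"
    then obtain \<alpha> where "models \<alpha> (normalized K)" by blast
    then have "models (\<lambda>v. \<alpha> (lookup ?V (binary v))) \<phi>" using mod[of \<alpha>] by (simp add: models_def[of _ \<phi>] lit_true_def)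
    then show "satisfiable \<phi>" unfolding satisfiable_models by blast
  qed
qed

lemma FP_dedup': "FP (\<lambda>x. dedup (x :: 'b::coded list))"
  unfolding dedup_def
  by (rule FP_fold_inc[where k = 1 and b = 1]) (intro fp | simp)+

lemmas FP_dedup [fp] = FP_comp[OF _ FP_dedup']

lemma FP_merge_clauses': "FP (\<lambda>x. merge_clauses (x :: 'b::coded list list))"
  unfolding merge_clauses_def
  by (rule FP_fold_inc[where k = 1 and b = 1]) (intro fp | simp)+

lemmas FP_merge_clauses [fp] = FP_comp[OF _ FP_merge_clauses']

lemma FP_pstep': "FP (\<lambda>p. pstep (fst p) (snd p))"
  unfolding pstep_def by (intro fp)

lemma sz_pstep: "sz (pstep y s) \<le> sz s + 20"
proof -
  obtain dep cur cl cls where s: "s = (dep, cur, cl, cls)" by (metis surj_pair)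
  have "sz (tl (rev cur)) \<le> sz cur" using sz_tl[of "rev cur"] by (simp add: sz_rev)
  moreover have "sz y \<le> 9" by (rule sz_sym_le)
  moreover have "sz (zread ([], rev cur) = One) \<le> 3" by (simp add: code_bool_def)
  moreover have "1 \<le> sz cur" "1 \<le> sz cl" "1 \<le> sz cls" using tsize_pos by (auto simp: Suc_le_eq)
  ultimately show ?thesis by (auto simp: s pstep_def)
qed

lemma FP_parse': "FP (\<lambda>w. parse w)"
  unfolding parse_def
proof (intro fp, rule FP_fold_inc[where k = 20 and b = 1])
  show "FP (\<lambda>p. pstep (fst (snd p)) (snd (snd p)))"
    by (intro fp FP_comp2[where h = pstep, OF _ _ FP_pstep'])
  show "sz (pstep y acc) \<le> sz acc + (sz x + sz y + 20) ^ 1" for x :: "sym list" and y acc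
    using sz_pstep[of y acc] by simp
qed (intro fp)+

lemmas FP_parse [fp] = FP_comp[OF _ FP_parse']

lemma FP_names': "FP (\<lambda>K. names K)"
  unfolding names_def by (intro fp)

lemmas FP_names [fp] = FP_comp[OF _ FP_names']

lemma FP_lookup': "FP (\<lambda>p. lookup (fst p) (snd p))"
  unfolding lookup_def by (intro fp)

lemmas FP_lookup [fp] = FP_comp2[where h = lookup, OF _ _ FP_lookup']

lemma FP_normalized': "FP (\<lambda>K. normalized K)"
  unfolding normalized_def by (intro fp)

lemmas FP_normalized [fp] = FP_comp[OF _ FP_normalized']

subsection \<open>The decision procedure\<close>

type_synonym reduction = "(nat \<times> nat) \<times> (nat \<times> nat) \<times> nat \<times> nat list list list \<times> cell list"

definition leaf_string :: "nat \<Rightarrow> reduction \<Rightarrow> nat \<Rightarrow> nat \<Rightarrow> lit list list \<Rightarrow> sym list" where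
  "leaf_string d r p N K = (case r of ((\<beta>, \<gamma>), (W, Q), q, PT, cells) \<Rightarrow>
     let Bs = cut_bool_lists p (\<beta> * (N div W) + \<gamma>) in
     balls_string d (q, length Bs + d, length Bs) (PT, W, N, placed W Q (filter (active K) K)) Bs cells)"

lemma FP_leaf_string': "FP (\<lambda>p. leaf_string d (fst p) (fst (snd p)) (fst (snd (snd p))) (snd (snd (snd p))))"
  unfolding leaf_string_def by (intro fp FP_balls_string)

lemmas FP_leaf_string = FP_lift4[where h = "leaf_string d" for d, OF FP_leaf_string']

text \<open>Leaves with large flowers are rejected. So are leaves without any ball, because the
  simulated machine promises nothing on the empty collection.\<close>

definition decide :: "nat \<Rightarrow> (nat \<times> reduction \<times> table \<times> nat \<times> nat) \<times> nat \<times> sym list \<Rightarrow> bool" where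
  "decide d z = (case z of ((\<theta>, r, m), p, w) \<Rightarrow>
     list_ex (\<lambda>s. large_flowers \<theta> (fst s) = [] \<and>
       leaf_string d r p (length (names (parse w))) (fst s) \<noteq> [LPar, RPar] \<and>
       simulate m p (leaf_string d r p (length (names (parse w))) (fst s)))
     (cut_leaves p \<theta> (length (names (parse w))) (normalized (parse w))))"

lemma FP_decide: "FP (decide d)"
  unfolding decide_def by (intro fp FP_leaf_string)

subsection \<open>Correctness of the simulation\<close>

definition znth :: "sym list \<Rightarrow> nat \<Rightarrow> sym" where
  "znth xs i = (if i < length xs then xs ! i else Blank)"

lemma znth_simps [simp]: "znth [] i = Blank" "znth (x # xs) 0 = x" "znth (x # xs) (Suc i) = znth xs i"
  "znth (tl xs) i = znth xs (Suc i)"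
  by (simp_all add: znth_def tl_def split: list.split)

definition zrel :: "ztape \<Rightarrow> tape \<Rightarrow> bool" where
  "zrel z t \<longleftrightarrow> (\<forall>i. fst t (snd t + int i) = znth (snd z) i) \<and> (\<forall>i. fst t (snd t - 1 - int i) = znth (fst z) i)"

lemma zread_zrel: "zrel z t \<Longrightarrow> zread z = fst t (snd t)"
  unfolding zrel_def by (drule conjunct1, drule spec[of _ 0]) (simp add: zread_def split: list.split)

lemma zrel_init: "zrel ([], w) (tape_of w, 0)"
  by (auto simp: zrel_def tape_of_def znth_def)

lemma zrel_act:
  assumes "zrel z t"
  shows "zrel (zact (a, z)) (act a t)"
proof -
  obtain s m u p l r where [simp]: "a = (s, m)" "t = (u, p)" "z = (l, r)" by (metis surj_pair)
  have R: "u (p + int i) = znth r i" and L: "u (p - 1 - int i) = znth l i" for i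
    using assms by (auto simp: zrel_def)
  have R1: "u (p + (1 + int i)) = znth r (Suc i)" for i using R[of "Suc i"] by simp
  have L1: "u (p - 2 - int i) = znth l (Suc i)" for i using L[of "Suc i"] by (simp add: algebra_simps)
  show ?thesis
  proof (cases m)
    case Stay
    have "(u(p := s)) (p + int i) = znth (s # tl r) i" for i using R1[of "i - 1"] by (cases i) auto
    moreover have "(u(p := s)) (p - 1 - int i) = znth l i" for i using L[of i] by simp
    ultimately show ?thesis using Stay by (simp add: zact_def zrel_def)
  next
    case MoveRight
    have "(u(p := s)) (p + 1 + int i) = znth (tl r) i" for i using R1[of i] by (simp add: add.assoc)
    moreover have "(u(p := s)) (p + 1 - 1 - int i) = znth (s # l) i" for i
      using L[of "i - 1"] by (cases i) (auto simp: algebra_simps)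
    ultimately show ?thesis using MoveRight by (simp add: zact_def zrel_def)
  next
    case MoveLeft
    have l: "zact (a, z) = (tl l, znth l 0 # s # tl r)"
      using MoveLeft by (simp add: zact_def tl_def split: list.split)
    have "(u(p := s)) (p - 1 + int i) = znth (znth l 0 # s # tl r) i" for i
    proof (cases i)
      case 0
      then show ?thesis using L[of 0] by simp
    next
      case (Suc j)
      then show ?thesis using R1[of "j - 1"] by (cases j) (auto simp: algebra_simps)
    qed
    moreover have "(u(p := s)) (p - 1 - 1 - int i) = znth (tl l) i" for i using L1[of i] by simp
    ultimately show ?thesis using MoveLeft unfolding l by (simp add: zrel_def)
  qed
qed

text \<open>A machine acts through finitely many states and combinations of read symbols, so a
  finite constant captures an arbitrary \<open>trans_fun\<close>.\<close>

definition table_of :: "tm \<Rightarrow> table" where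
  "table_of M = concat (map (\<lambda>q. map (\<lambda>ss. ((q, ss), trans_fun M q ss))
     (List.n_lists (tapes M) [Blank, Zero, One, LPar, RPar])) [0..<states M])"

lemma set_table_of: "e \<in> set (table_of M) \<longleftrightarrow>
   (\<exists>q < states M. \<exists>ss. length ss = tapes M \<and> e = ((q, ss), trans_fun M q ss))"
proof -
  have "set ss \<subseteq> {Blank, Zero, One, LPar, RPar}" for ss :: "sym list"
    using sym.exhaust by blast
  then show ?thesis by (auto simp: table_of_def set_n_lists)
qed

definition zconf :: "tm \<Rightarrow> nat \<times> ztape list \<Rightarrow> nat \<times> tape list \<Rightarrow> bool" where
  "zconf M c k \<longleftrightarrow> fst c = fst k \<and> fst k \<le> states M \<and> length (snd k) = tapes M \<and> list_all2 zrel (snd c) (snd k)"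

lemma zconf_step:
  assumes M: "turing_machine M" and c: "zconf M c k"
  shows "zconf M (zstep (table_of M, states M) c) (tm_step M k)"
proof -
  obtain q zs us where [simp]: "c = (q, zs)" "k = (q, us)" and q: "q \<le> states M" and len: "length us = tapes M"
    and rel: "list_all2 zrel zs us" using c by (cases c; cases k) (auto simp: zconf_def)
  show ?thesis
  proof (cases "q = states M")
    case True
    then show ?thesis using c by (simp add: zstep_def)
  next
    case False
    let ?ss = "map zread zs"
    have ss: "map (\<lambda>(u, p). u p) us = ?ss"
      using rel by (auto simp: list_all2_conv_all_nth zread_zrel split_beta intro!: nth_equalityI)
    have lss: "length ?ss = tapes M" using rel len by (simp add: list_all2_lengthD)
    have qs: "q < states M" using q False by simp
    let ?F = "filter (\<lambda>e. fst e = (q, ?ss)) (table_of M)"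
    have "((q, ?ss), trans_fun M q ?ss) \<in> set ?F" using qs lss by (auto simp: set_table_of)
    then obtain e es where F: "?F = e # es" by (cases ?F) auto
    then have "e \<in> set ?F" by simp
    then have e: "snd e = trans_fun M q ?ss" by (auto simp: set_table_of)
    obtain q' as where tr: "trans_fun M q ?ss = (q', as)" by (metis surj_pair)
    have tm: "q' \<le> states M" "length as = tapes M"
      using M qs lss tr unfolding turing_machine_def by (metis fst_conv, metis snd_conv)
    have "list_all2 zrel (map zact (zip as zs)) (map2 act as us)"
      using rel by (auto simp: list_all2_conv_all_nth intro!: zrel_act)
    then show ?thesis using False tm e F tr ss len by (simp add: zconf_def zstep_def)
  qed
qed

lemma zconf_init:
  assumes "turing_machine M"
  shows "zconf M (0, ([], w) # replicate (tapes M - 1) ([], [])) (tm_init M w)"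
proof -
  have "list_all2 zrel (replicate n ([], [])) (replicate n (tape_of [], 0))" for n
    by (induction n) (simp_all add: zrel_init)
  then show ?thesis using assms by (simp add: zconf_def tm_init_def zrel_init turing_machine_def)
qed

lemma zrel_LPar: "zrel z t \<Longrightarrow> LPar \<in> set (fst z) \<or> LPar \<in> set (snd z) \<longleftrightarrow> (\<exists>i. fst t i = LPar)"
proof -
  assume z: "zrel z t"
  have n: "LPar \<in> set xs \<longleftrightarrow> (\<exists>i. znth xs i = LPar)" for xs
    by (auto simp: znth_def in_set_conv_nth)
  have "(\<exists>i. znth (fst z) i = LPar \<or> znth (snd z) i = LPar)" if i: "fst t i = LPar" for i
  proof (cases "snd t \<le> i")
    case True
    then have "i = snd t + int (nat (i - snd t))" by simp
    then show ?thesis using i z unfolding zrel_def by metis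
  next
    case False
    then have "i = snd t - 1 - int (nat (snd t - 1 - i))" by simp
    then show ?thesis using i z unfolding zrel_def by metis
  qed
  then show ?thesis using z unfolding n zrel_def by metis
qed

text \<open>A halting configuration is stationary, so simulating more steps than necessary is
  harmless.\<close>

theorem simulate_correct:
  assumes M: "turing_machine M" and h: "halts_with M w t y" and p: "t \<le> p"
  shows "simulate (table_of M, states M, tapes M) p w \<longleftrightarrow> LPar \<in> set y"
proof -
  let ?c = "\<lambda>i. (zstep (table_of M, states M) ^^ i) (0, ([], w) # replicate (tapes M - 1) ([], []))"
  let ?k = "\<lambda>i. (tm_step M ^^ i) (tm_init M w)"
  have conf: "zconf M (?c i) (?k i)" for i
    by (induction i) (simp_all add: zconf_init[OF M, simplified] zconf_step[OF M])
  obtain us where us: "?k t = (states M, us)" "fst (last us) = tape_of y"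
    using h unfolding halts_with_def by (cases "?k t") auto
  have "?k (t + i) = (states M, us)" for i
    by (induction i) (simp_all add: us)
  from this[of "p - t"] have k: "?k p = (states M, us)" using p by simp
  obtain q zs where c: "?c p = (q, zs)" by (cases "?c p")
  have rel: "list_all2 zrel zs us" "length us = tapes M" using conf[of p] unfolding zconf_def k c by simp_all
  then have "us \<noteq> []" using M by (auto simp: turing_machine_def)
  then obtain us' u where u: "us = us' @ [u]" by (cases us rule: rev_cases) auto
  then obtain zs' z where z: "zs = zs' @ [z]" "zrel z u" using rel(1) by (auto simp: list_all2_append2 list_all2_Cons2)
  have "simulate (table_of M, states M, tapes M) p w \<longleftrightarrow> (\<exists>i. tape_of y i = LPar)"
    using zrel_LPar[OF z(2)] us(2) by (simp add: simulate_def zaccept_def c z(1) u del: One_nat_def)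
  also have "\<dots> \<longleftrightarrow> LPar \<in> set y"
  proof
    assume "LPar \<in> set y"
    then obtain i where "i < length y" "y ! i = LPar" by (auto simp: in_set_conv_nth)
    then show "\<exists>i. tape_of y i = LPar" by (intro exI[of _ "int i"]) (simp add: tape_of_def)
  next
    assume "\<exists>i. tape_of y i = LPar"
    then obtain i where "tape_of y i = LPar" by blast
    then have "0 \<le> i" "nat i < length y" "y ! nat i = LPar" by (auto simp: tape_of_def split: if_splits)
    then show "LPar \<in> set y" by (metis nth_mem)
  qed
  finally show ?thesis .
qed

subsection \<open>Correctness of the list of balls\<close>

lemma binary_double: "1 \<le> x \<Longrightarrow> binary (2 ^ k * x) = replicate k Zero @ binary x"
proof (induction k)
  case (Suc k)
  have "binary (2 ^ Suc k * x) = Zero # binary (2 ^ k * x)"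
    by (subst binary.simps) (use Suc.prems in \<open>simp add: mult.assoc\<close>)
  then show ?case using Suc by simp
qed simp

lemma binary_1: "binary 1 = [One]"
  by (subst binary.simps) (simp, subst binary.simps, simp)

text \<open>For e \<ge> 1 the numerator is odd and the denominator a power of two, so the fraction
  is already reduced.\<close>

lemma enc_rat_coord:
  assumes "1 \<le> x" "1 \<le> e"
  shows "enc_rat (2 * (of_nat x + 1 / 2 ^ e)) = coord_string (binary x) e"
proof -
  obtain e' where e: "e = Suc e'" using assms(2) by (cases e) auto
  let ?p = "2 ^ e * int x + 1" and ?q = "2 ^ e' :: int"
  have "2 * (of_nat x + 1 / 2 ^ e :: rat) = Fract ?p ?q"
    by (simp add: e Fract_of_int_quotient field_simps)
  moreover have "coprime ?p ?q"
  proof -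
    have "coprime ?p 2" by (simp add: e)
    then show ?thesis by simp
  qed
  ultimately have quo: "quotient_of (2 * (of_nat x + 1 / 2 ^ e :: rat)) = (?p, ?q)"
    by (simp add: quotient_of_Fract normalize_stable)
  have p: "nat \<bar>?p\<bar> = 2 ^ e * x + 1" by (simp add: nat_add_distrib nat_mult_distrib nat_power_eq)
  have q: "nat \<bar>?q\<bar> = 2 ^ e' * 1" by (simp add: nat_power_eq)
  have "binary (2 ^ e * x + 1) = One # binary (2 ^ e' * x)"
    by (subst binary.simps) (simp add: e)
  then have bp: "binary (nat \<bar>?p\<bar>) = One # replicate e' Zero @ binary x" unfolding p using binary_double[OF assms(1)] by simp
  have bq: "binary (nat \<bar>?q\<bar>) = replicate e' Zero @ [One]" unfolding q using binary_double[of 1 e'] binary_1 by simp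
  have pos: "\<not> ?p < 0" "\<not> ?q < 0" by (simp_all add: not_less)
  show ?thesis
    unfolding enc_rat_def quo prod.case enc_list_def enc_int_def list.map concat.simps bp bq coord_string_def if_not_P[OF pos(1)] if_not_P[OF pos(2)]
    by (simp add: e)
qed

lemma set_tuples: "set (tuples d n) = {t. length t = d \<and> set t \<subseteq> {..<n}}"
proof (induction d)
  case (Suc d)
  show ?case
  proof (intro set_eqI iffI)
    fix t assume "t \<in> {t. length t = Suc d \<and> set t \<subseteq> {..<n}}"
    then obtain v t' where "t = v # t'" "v < n" "t' \<in> set (tuples d n)" unfolding Suc by (cases t) auto
    then show "t \<in> set (tuples (Suc d) n)" by (auto simp: image_iff)
  qed (use Suc in auto)
qed auto

lemma distinct_tuples: "distinct (tuples d n)"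
proof (induction d)
  case (Suc d)
  have "distinct (concat (map (\<lambda>t. map (\<lambda>v. v # t) [0..<n]) ts))" if "distinct ts" for ts
    using that by (induction ts) (auto simp: distinct_map inj_on_def)
  then show ?case using Suc by simp
qed simp

context network
begin

definition cell_row :: "('d \<times> ('d \<Rightarrow> nat) \<Rightarrow> nat) \<Rightarrow> ('d \<Rightarrow> nat) \<Rightarrow> cell" where
  "cell_row li x = map (\<lambda>i. (binary (x (ax i)),
     case desc x (ax i) of None \<Rightarrow> [] | Some y \<Rightarrow> [(li (fst y), snd y)])) [0..<CARD('d)]"

definition vect :: "nat list \<Rightarrow> 'd \<Rightarrow> nat" where
  "vect t i = t ! idx i"

lemma all_ax: "(\<forall>i. P i) \<longleftrightarrow> (\<forall>i < CARD('d). P (ax i))"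
  by (metis ax_idx idx_less)

lemma vect_ax: "i < CARD('d) \<Longrightarrow> vect t (ax i) = t ! i"
  by (simp add: vect_def idx_ax)

lemma zip_cell_row:
  assumes "length t = CARD('d)"
  shows "zip (cell_row li x) t = map (\<lambda>i. ((binary (x (ax i)),
     case desc x (ax i) of None \<Rightarrow> [] | Some y \<Rightarrow> [(li (fst y), snd y)]), vect t (ax i))) [0..<CARD('d)]"
  using assms by (intro nth_equalityI) (auto simp: cell_row_def vect_ax)

lemma cell_ok_valid:
  assumes t: "t \<in> set (tuples CARD('d) n)"
    and cons: "\<And>l v l' v'. cons l v l' v' \<longleftrightarrow> line_ok net Bs (li l, v) (li l', v')"
  shows "cell_ok net Bs (cell_row li x) t \<longleftrightarrow> valid n cons x (vect t)"
proof -
  have len: "length t = CARD('d)" and "set t \<subseteq> {..<n}" using t by (auto simp: set_tuples)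
  then have less: "vect t (ax i) < n" if "i < CARD('d)" for i
    using that len \<open>set t \<subseteq> {..<n}\<close> nth_mem[of i t] by (auto simp: vect_ax simp del: nth_mem)
  have "cell_ok net Bs (cell_row li x) t \<longleftrightarrow> (\<forall>i < CARD('d). case desc x (ax i) of None \<Rightarrow> vect t (ax i) = 0
     | Some y \<Rightarrow> \<forall>j < CARD('d). case desc x (ax j) of None \<Rightarrow> True
         | Some y' \<Rightarrow> cons (fst y) (vect t (ax i)) (fst y') (vect t (ax j)))"
  proof -
    have la: "list_all P (map f [0..<k]) \<longleftrightarrow> (\<forall>i < k. P (f i))" for P :: "'x \<Rightarrow> bool" and f k
      by (auto simp: list_all_iff)
    have c: "(case (case o' of None \<Rightarrow> [] | Some y \<Rightarrow> [g y]) of [] \<Rightarrow> a | z # zs \<Rightarrow> h z) \<longleftrightarrow>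
        (case o' of None \<Rightarrow> a | Some y \<Rightarrow> h (g y))" for o' :: "'x option" and g :: "'x \<Rightarrow> 'y" and a h
      by (cases o') auto
    show ?thesis unfolding cell_ok_def zip_cell_row[OF len] la fst_conv snd_conv c cons by simp
  qed
  also have "\<dots> \<longleftrightarrow> (\<forall>i. case desc x i of None \<Rightarrow> vect t i = 0
     | Some y \<Rightarrow> \<forall>j. case desc x j of None \<Rightarrow> True
         | Some y' \<Rightarrow> cons (fst y) (vect t i) (fst y') (vect t j))"
    unfolding all_ax[of "\<lambda>j. case desc x j of None \<Rightarrow> True | Some y' \<Rightarrow> cons (fst _) (vect t _) (fst y') (vect t j)"] by (rule all_ax[symmetric])
  also have "\<dots> \<longleftrightarrow> valid n cons x (vect t)"
  proof -
    have "vect t i < n" for i using less[OF idx_less[of i]] by (simp add: ax_idx)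
    then show ?thesis unfolding valid_def by (auto split: option.splits)
  qed
  finally show ?thesis .
qed

lemma ball_string_center:
  assumes t: "t \<in> set (tuples CARD('d) n)" and v: "valid n cons x (vect t)" and q: "1 \<le> q"
    and x: "\<And>i. 1 \<le> x i"
  shows "ball_string (q, Y, n) (cell_row li x) t = enc_point (ball_center q Y n x (vect t))"
proof -
  have len: "length t = CARD('d)" using t by (auto simp: set_tuples)
  have "coord_string (binary (x (ax i))) (coord_exp q Y n
      (case desc x (ax i) of None \<Rightarrow> [] | Some y \<Rightarrow> [(li (fst y), snd y)]) (vect t (ax i)))
    = enc_rat (ball_center q Y n x (vect t) $ ax i)" for i
  proof -
    have e: "coord_exp q Y n (case desc x (ax i) of None \<Rightarrow> [] | Some y \<Rightarrow> [(li (fst y), snd y)]) (vect t (ax i))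
        = q * expo Y n x (vect t) (ax i)"
      by (auto simp: coord_exp_def expo_def shown_def split: option.split)
    have "1 \<le> expo Y n x (vect t) (ax i)" using shown_less[OF v, of "ax i"] unfolding expo_def by linarith
    then have "1 \<le> q * expo Y n x (vect t) (ax i)" using q by (simp add: Suc_le_eq)
    from enc_rat_coord[OF x this] show ?thesis unfolding e by (simp add: ball_center_def center_def)
  qed
  then show ?thesis
    unfolding ball_string_def zip_cell_row[OF len] enc_point_def enc_list_def by (simp add: comp_def ax_def)
qed

definition centers :: "nat \<Rightarrow> nat \<Rightarrow> nat \<Rightarrow> ('d \<times> ('d \<Rightarrow> nat) \<Rightarrow> nat \<Rightarrow> 'd \<times> ('d \<Rightarrow> nat) \<Rightarrow> nat \<Rightarrow> bool) \<Rightarrow>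
    ('d \<Rightarrow> nat) list \<Rightarrow> (rat ^ 'd) list" where
  "centers q Y n cons xs = concat (map (\<lambda>x. map (\<lambda>t. ball_center q Y n x (vect t))
     (filter (\<lambda>t. valid n cons x (vect t)) (tuples CARD('d) n))) xs)"

theorem balls_string_centers:
  assumes cons: "\<And>l v l' v'. cons l v l' v' \<longleftrightarrow> line_ok net Bs (li l, v) (li l', v')" and q: "1 \<le> q"
    and xs: "set xs = Cells"
  shows "balls_string CARD('d) (q, Y, n) net Bs (map (cell_row li) xs) = enc_list enc_point (centers q Y n cons xs)"
proof -
  have f: "filter (cell_ok net Bs (cell_row li x)) (tuples CARD('d) n) =
      filter (\<lambda>t. valid n cons x (vect t)) (tuples CARD('d) n)" for x
    using cell_ok_valid[OF _ cons] by (intro filter_cong) auto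
  have ball: "map (ball_string (q, Y, n) (cell_row li x)) (filter (\<lambda>t. valid n cons x (vect t)) (tuples CARD('d) n)) =
      map (\<lambda>t. enc_point (ball_center q Y n x (vect t))) (filter (\<lambda>t. valid n cons x (vect t)) (tuples CARD('d) n))"
    if "x \<in> Cells" for x
  proof (intro map_cong refl)
    fix t assume "t \<in> set (filter (\<lambda>t. valid n cons x (vect t)) (tuples CARD('d) n))"
    then have t: "t \<in> set (tuples CARD('d) n)" "valid n cons x (vect t)" by auto
    have "1 \<le> x i" for i using Cells_bounds[OF that, of i] by simp
    from ball_string_center[OF t q this] show "ball_string (q, Y, n) (cell_row li x) t =
      enc_point (ball_center q Y n x (vect t))" .
  qed
  have "concat (map (\<lambda>cl. concat (map (ball_string (q, Y, n) cl)
     (filter (cell_ok net Bs cl) (tuples CARD('d) n)))) (map (cell_row li) ys)) =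
     concat (map enc_point (centers q Y n cons ys))" if "set ys \<subseteq> Cells" for ys
    using that
  proof (induction ys)
    case (Cons x ys)
    then have "x \<in> Cells" "set ys \<subseteq> Cells" by auto
    with Cons.IH ball[of x] show ?case by (simp add: centers_def f comp_def del: map_eq_conv)
  qed (simp add: centers_def)
  then show ?thesis using xs by (simp add: balls_string_def enc_list_def)
qed

lemma vect_surj:
  assumes "valid n cons x t"
  shows "\<exists>u \<in> set (tuples CARD('d) n). vect u = t"
proof
  let ?u = "map (\<lambda>i. t (ax i)) [0..<CARD('d)]"
  show "?u \<in> set (tuples CARD('d) n)" using assms by (auto simp: set_tuples valid_def)
  show "vect ?u = t" using idx_less ax_idx by (auto simp: vect_def)
qed

lemma set_centers:
  assumes "set xs = Cells"
  shows "set (centers q Y n cons xs) = {ball_center q Y n x t | x t. x \<in> Cells \<and> valid n cons x t}"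
proof (intro set_eqI iffI)
  fix c assume "c \<in> set (centers q Y n cons xs)"
  then show "c \<in> {ball_center q Y n x t | x t. x \<in> Cells \<and> valid n cons x t}"
    using assms by (auto simp: centers_def)
next
  fix c assume "c \<in> {ball_center q Y n x t | x t. x \<in> Cells \<and> valid n cons x t}"
  then obtain x t where c: "c = ball_center q Y n x t" "x \<in> Cells" "valid n cons x t" by blast
  from vect_surj[OF c(3)] obtain u where "u \<in> set (tuples CARD('d) n)" "vect u = t" by blast
  then show "c \<in> set (centers q Y n cons xs)" using c assms by (force simp: centers_def)
qed

text \<open>\<open>finds_balls\<close> speaks only about lists without repetitions; different tuples
  and different cells yield different centers.\<close>

lemma distinct_centers:
  assumes sc: "ball_scale q n Y CARD('d)" and xs: "distinct xs"
  shows "distinct (centers q Y n cons xs)"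
  using xs
proof (induction xs)
  case (Cons x xs)
  let ?ts = "filter (\<lambda>t. valid n cons x (vect t)) (tuples CARD('d) n)"
  have "u = u'" if "u \<in> set ?ts" "u' \<in> set ?ts" "ball_center q Y n x (vect u) = ball_center q Y n x (vect u')" for u u'
  proof -
    have v: "vect u = vect u'" using ball_center_inj[OF sc _ _ that(3)] that(1,2) by auto
    have "length u = CARD('d)" "length u' = CARD('d)" using that(1,2) by (auto simp: set_tuples)
    then show ?thesis using v vect_ax by (intro nth_equalityI) (auto, metis)
  qed
  then have 1: "distinct (map (\<lambda>t. ball_center q Y n x (vect t)) ?ts)"
    unfolding distinct_map using distinct_tuples by (auto intro: inj_onI)
  have 2: "distinct (centers q Y n cons xs)" using Cons by simp
  have 3: "set (map (\<lambda>t. ball_center q Y n x (vect t)) ?ts) \<inter> set (centers q Y n cons xs) = {}"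
  proof -
    have "x = y" if "valid n cons x (vect u)" "valid n cons y (vect u')"
      "ball_center q Y n x (vect u) = ball_center q Y n y (vect u')" for y u u'
      using ball_center_inj[OF sc that] by simp
    moreover have "x \<notin> set xs" using Cons.prems by simp
    ultimately show ?thesis by (auto simp: centers_def)
  qed
  show ?case using 1 2 3 by (simp add: centers_def)
qed (simp add: centers_def)

lemma length_centers: "length (centers q Y n cons xs) \<le> length xs * n ^ CARD('d)"
proof -
  have len: "length (tuples d n) = n ^ d" for d
  proof (induction d)
    case (Suc d)
    have "length (concat (map (\<lambda>t. map (\<lambda>v. v # t) [0..<n]) ts)) = n * length ts" for ts :: "nat list list"
      by (induction ts) auto
    then show ?case using Suc by simp
  qed simp
  have "length (filter P (tuples CARD('d) n)) \<le> n ^ CARD('d)" for P using length_filter_le len by metis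
  then show ?thesis by (induction xs) (auto simp: centers_def add_mono)
qed

end

subsection \<open>Correctness of the decision procedure\<close>

lemma cut_leaves_eq:
  assumes "\<And>i. i \<le> N * (4 * \<theta> + 1) + 1 \<Longrightarrow> sz ((spread \<theta> ^^ i) [(K, 2 * N div \<theta>)]) \<le> p"
  shows "cut_leaves p \<theta> N K = leaves \<theta> N K"
proof -
  have u: "us = replicate (length us) ()" for us by (induction us) auto
  have f: "fold (\<lambda>y. spread \<theta>) us z = (spread \<theta> ^^ length us) z" for us :: "unit list" and z :: "(lit list list \<times> nat) list"
    by (subst u[of us]) (rule fold_replicate)
  have "cut_leaves p \<theta> N K = fold (\<lambda>y. spread \<theta>) (replicate (N * (4 * \<theta> + 1) + 1) ()) [(K, 2 * N div \<theta>)]"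
    unfolding cut_leaves_def
  proof (rule tfold_eq_fold)
    fix us vs assume "replicate (N * (4 * \<theta> + 1) + 1) () = us @ vs"
    then have "N * (4 * \<theta> + 1) + 1 = length us + length vs" by (metis length_append length_replicate)
    then have "length us \<le> N * (4 * \<theta> + 1) + 1" by linarith
    then show "sz (fold (\<lambda>y. spread \<theta>) us [(K, 2 * N div \<theta>)]) \<le> p" unfolding f by (rule assms)
  qed
  then show ?thesis unfolding leaves_def f by (simp del: replicate_Suc replicate.simps)
qed

lemma cut_bool_lists_eq:
  assumes "\<And>i. i \<le> B \<Longrightarrow> sz (bool_lists i) \<le> p"
  shows "cut_bool_lists p B = bool_lists B"
proof -
  let ?g = "\<lambda>acc. map ((#) False) acc @ map ((#) True) acc"
  have f: "fold (\<lambda>y. ?g) us [[]] = bool_lists (length us)" for us :: "unit list"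
    by (induction us rule: rev_induct) simp_all
  have "cut_bool_lists p B = fold (\<lambda>y. ?g) (replicate B ()) [[]]"
    unfolding cut_bool_lists_def
  proof (rule tfold_eq_fold)
    fix us vs assume "replicate B () = us @ vs"
    then have "B = length us + length vs" by (metis length_append length_replicate)
    then show "sz (fold (\<lambda>y. ?g) us [[]]) \<le> p" unfolding f using assms by simp
  qed
  then show ?thesis unfolding f by simp
qed

lemma sz_bool: "sz (b :: bool) \<le> 3"
  by (simp add: code_bool_def)

lemma sz_bool_lists: "sz (bool_lists i) \<le> 2 ^ i * (4 * i + 2) + 1"
proof -
  have "sz xs \<le> 4 * i + 1" if "xs \<in> set (bool_lists i)" for xs
  proof -
    have "length xs = i" using that by (simp add: set_bool_lists)
    then show ?thesis using sz_list_le[of xs 3, OF sz_bool] by simp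
  qed
  from sz_list_le[of "bool_lists i", OF this] show ?thesis by (simp add: length_bool_lists)
qed

lemma finite_card_vlits: "finite (vlits N) \<and> card (vlits N) = 2 * N"
proof -
  have "vlits N = {..<N} \<times> UNIV" by (auto simp: vlits_def)
  then show ?thesis by (simp add: card_cartesian_product)
qed

lemma card_short_clauses:
  "finite {xs. set xs \<subseteq> vlits N \<and> length xs \<le> 3} \<and> card {xs. set xs \<subseteq> vlits N \<and> length xs \<le> 3} \<le> (2 * N + 1) ^ 3"
proof -
  have "(\<Sum>i\<le>3. (2 * N) ^ i) \<le> (2 * N + 1) ^ 3" by (simp add: eval_nat_numeral algebra_simps)
  then show ?thesis
    using card_lists_length_le[of "vlits N" 3] finite_lists_length_le[of "vlits N" 3] finite_card_vlits[of N] by simp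
qed

lemma well_length:
  assumes "well (vlits N) K"
  shows "length K \<le> (2 * N + 1) ^ 3"
proof -
  have "length K = card (csets K)" using assms by (metis well_def distinct_card length_map set_map)
  also have "\<dots> \<le> card {xs. set xs \<subseteq> vlits N \<and> length xs \<le> 3}"
    using assms card_short_clauses by (intro surj_card_le) (auto simp: well_def)
  also have "\<dots> \<le> (2 * N + 1) ^ 3" using card_short_clauses by blast
  finally show ?thesis .
qed

lemma sz_well:
  assumes w: "well (vlits N) K"
  shows "sz K \<le> (2 * N + 1) ^ 3 * (6 * N + 20) + 1"
proof -
  have l: "sz l \<le> 2 * N + 5" if "l \<in> vlits N" for l :: lit
    using that sz_bool[of "snd l"] by (cases l) (auto simp: vlits_def sz_nat)
  have "sz C \<le> 6 * N + 19" if "C \<in> set K" for C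
  proof -
    have C: "length C \<le> 3" "set C \<subseteq> vlits N" using w that by (auto simp: well_def)
    have "sz C \<le> 1 + length C * (2 * N + 5 + 1)" by (rule sz_list_le) (use l C in blast)
    also have "\<dots> \<le> 1 + 3 * (2 * N + 5 + 1)" using C(1) by (intro add_mono mult_right_mono) auto
    finally show ?thesis by simp
  qed
  from sz_list_le[of K, OF this] have "sz K \<le> 1 + length K * (6 * N + 20)" by (simp add: algebra_simps)
  also have "\<dots> \<le> 1 + (2 * N + 1) ^ 3 * (6 * N + 20)" using well_length[OF w] by (intro add_mono mult_right_mono) auto
  finally show ?thesis by simp
qed

lemma sz_frontier:
  assumes w: "well (vlits N) K" and \<theta>: "1 \<le> \<theta>"
  shows "sz ((spread \<theta> ^^ i) [(K, 2 * N div \<theta>)]) \<le>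
    1 + length ((spread \<theta> ^^ i) [(K, 2 * N div \<theta>)]) * ((2 * N + 1) ^ 3 * (6 * N + 20) + 4 * N + 4)"
proof -
  have "sz s \<le> (2 * N + 1) ^ 3 * (6 * N + 20) + 4 * N + 3" if "s \<in> set ((spread \<theta> ^^ i) [(K, 2 * N div \<theta>)])" for s
  proof -
    have s: "well (vlits N) (fst s)" "snd s \<le> 2 * N div \<theta>" using spread_iter_well[OF w \<theta> that] by auto
    have "2 * N div \<theta> \<le> 2 * N" by simp
    with s(2) have "snd s \<le> 2 * N" by linarith
    then show ?thesis using sz_well[OF s(1)] by (cases s) (simp add: sz_nat)
  qed
  from sz_list_le[of "(spread \<theta> ^^ i) [(K, 2 * N div \<theta>)]", OF this] show ?thesis by (simp add: ac_simps)
qed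

text \<open>A variable has two literals, and each lies in at most one active unit, fewer than
  \<theta> active pairs and fewer than 4\<theta>^2 active triples.\<close>

lemma leaf_degree_le:
  assumes w: "well (vlits N) K" and lf: "large_flowers \<theta> K = []" and \<theta>: "1 \<le> \<theta>"
  shows "degree_le (2 * (\<theta> + 4 * \<theta> * \<theta>)) N (filter (active K) K)"
  unfolding degree_le_def
proof (intro allI impI)
  fix v assume "v < N"
  let ?A = "\<lambda>j l. {C \<in> set K. active K C \<and> length C = j \<and> l \<in> set C}"
  have dist: "distinct K" using w by (metis well_def distinct_map)
  have one: "?A 1 l \<subseteq> {[l]}" for l by (auto simp: length_Suc_conv)
  have c1: "card (?A 1 l) \<le> 1" for l using card_mono[OF _ one[of l]] by simp
  have len: "length C \<in> {1, 2, 3}" if "C \<in> set K" "l \<in> set C" for C and l :: lit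
  proof -
    have "length C \<le> 3" "C \<noteq> []" using w that by (auto simp: well_def)
    then show ?thesis by (cases "length C") auto
  qed
  have "length (filter (\<lambda>C. v \<in> fst ` set C) (filter (active K) K)) =
      card {C \<in> set K. active K C \<and> v \<in> fst ` set C}"
    using distinct_card[of "filter (\<lambda>C. v \<in> fst ` set C) (filter (active K) K)"] dist by (simp add: conj_commute)
  also have "{C \<in> set K. active K C \<and> v \<in> fst ` set C} \<subseteq>
      (?A 1 (v, True) \<union> ?A 2 (v, True) \<union> ?A 3 (v, True)) \<union> (?A 1 (v, False) \<union> ?A 2 (v, False) \<union> ?A 3 (v, False))"
  proof
    fix C assume C: "C \<in> {C \<in> set K. active K C \<and> v \<in> fst ` set C}"
    then obtain b where "(v, b) \<in> set C" by force
    then show "C \<in> (?A 1 (v, True) \<union> ?A 2 (v, True) \<union> ?A 3 (v, True)) \<union> (?A 1 (v, False) \<union> ?A 2 (v, False) \<union> ?A 3 (v, False))"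
      using C len[of C "(v, b)"] by (cases b) auto
  qed
  then have "card {C \<in> set K. active K C \<and> v \<in> fst ` set C} \<le>
      card ((?A 1 (v, True) \<union> ?A 2 (v, True) \<union> ?A 3 (v, True)) \<union> (?A 1 (v, False) \<union> ?A 2 (v, False) \<union> ?A 3 (v, False)))"
    by (intro card_mono) auto
  also have "\<dots> \<le> (card (?A 1 (v, True)) + card (?A 2 (v, True)) + card (?A 3 (v, True))) +
      (card (?A 1 (v, False)) + card (?A 2 (v, False)) + card (?A 3 (v, False)))"
    by (intro order_trans[OF card_Un_le] add_mono) auto
  also have "\<dots> \<le> 2 * (\<theta> + 4 * \<theta> * \<theta>)"
  proof -
    have sum: "a + b + c \<le> \<theta> + 4 * \<theta> * \<theta>" if "a \<le> 1" "b < \<theta>" "c < 4 * \<theta> * \<theta>" for a b c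
    proof -
      have "a + Suc b + Suc c \<le> 1 + \<theta> + 4 * \<theta> * \<theta>" using that by (intro add_mono) auto
      then show ?thesis by simp
    qed
    have "card (?A 1 l) + card (?A 2 l) + card (?A 3 l) \<le> \<theta> + 4 * \<theta> * \<theta>" for l
      by (rule sum[OF c1 leaf_degree[OF w lf \<theta>]])
    from add_mono[OF this this] show ?thesis by (simp only: mult_2)
  qed
  finally show "length (filter (\<lambda>C. v \<in> fst ` set C) (filter (active K) K)) \<le> 2 * (\<theta> + 4 * \<theta> * \<theta>)" .
qed

lemma length_binary: "length (binary n) \<le> n"
proof (induction n rule: binary.induct)
  case (1 n)
  show ?case
  proof (cases "n = 0")
    case False
    then have "length (binary n) = Suc (length (binary (n div 2)))" by (subst binary.simps) simp
    also have "\<dots> \<le> Suc (n div 2)" using 1 False by simp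
    also have "\<dots> \<le> n" using False by linarith
    finally show ?thesis .
  qed (simp add: binary.simps)
qed

lemma length_concat_le: "(\<And>x. x \<in> set xs \<Longrightarrow> length (f x) \<le> k) \<Longrightarrow> length (concat (map f xs)) \<le> length xs * k"
proof (induction xs)
  case (Cons x xs)
  have "length (f x) \<le> k" "length (concat (map f xs)) \<le> length xs * k" using Cons by auto
  then show ?case by simp
qed simp

context network
begin

text \<open>The first two numbers are slope and intercept of \<open>capacity\<close> in terms of
  \<open>N div W\<close>; they depend on the grid and the degree only and are supplied as
  data.\<close>

definition reduct :: "nat \<Rightarrow> nat \<Rightarrow> ('d \<times> ('d \<Rightarrow> nat) \<Rightarrow> nat) \<Rightarrow> ('d \<Rightarrow> nat) list \<Rightarrow> reduction" where
  "reduct q Dg li xs = ((3 * (CARD('d) + 1) * Dg,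
      3 * (CARD('d) + 1) * (Dg + M ^ CARD('d) * card (types (M ^ (CARD('d) - 1))))),
    (M ^ (CARD('d) - 1), M ^ CARD('d)), q, path_table li, map (cell_row li) xs)"

theorem leaf_centers:
  assumes li: "inj_on li Lines" and xs: "set xs = Cells" and q: "1 \<le> q" and d: "2 \<le> CARD('d)"
    and w: "well (vlits N) K" and deg: "degree_le Dg N (filter (active K) K)"
    and B: "B = capacity CARD('d) Dg (M ^ (CARD('d) - 1)) (M ^ CARD('d)) N"
    and cut: "cut_bool_lists p B = bool_lists B"
  shows "\<exists>cons. leaf_string CARD('d) (reduct q Dg li xs) p N K =
      enc_list enc_point (centers q (2 ^ B + CARD('d)) (2 ^ B) cons xs) \<and>
    ((\<exists>js. nonintersecting_balls (card Cells) (centers q (2 ^ B + CARD('d)) (2 ^ B) cons xs) js) \<longleftrightarrow> (\<exists>\<alpha>. models \<alpha> K))"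
proof -
  define F R where "F = filter (active K) K" and "R = placed (M ^ (CARD('d) - 1)) (M ^ CARD('d)) F"
  define S where "S = lvars (path_table li) (M ^ (CARD('d) - 1)) N R"
  define cons where "cons = (\<lambda>l v l' v'. line_cons R S (bool_lists B) (li l) v (li l') v')"
  let ?cs = "centers q (2 ^ B + CARD('d)) (2 ^ B) cons xs"
  have F: "length C \<le> 3 \<and> fst ` set C \<subseteq> {..<N}" if "C \<in> set F" for C
    using w that by (auto simp: F_def well_def vlits_def)
  have c: "cons l v l' v' \<longleftrightarrow>
      line_ok (path_table li, M ^ (CARD('d) - 1), N, R) (bool_lists B) (li l, v) (li l', v')" for l v l' v'
    by (simp add: cons_def line_ok_def S_def)
  have "leaf_string CARD('d) (reduct q Dg li xs) p N K =
      balls_string CARD('d) (q, 2 ^ B + CARD('d), 2 ^ B) (path_table li, M ^ (CARD('d) - 1), N, R) (bool_lists B) (map (cell_row li) xs)"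
    using cut unfolding leaf_string_def reduct_def B capacity_def
    by (simp add: R_def F_def length_bool_lists Let_def)
  also have "\<dots> = enc_list enc_point ?cs" by (rule balls_string_centers[OF c q xs])
  finally have 1: "leaf_string CARD('d) (reduct q Dg li xs) p N K = enc_list enc_point ?cs" .
  have sc: "ball_scale q (2 ^ B) (2 ^ B + CARD('d)) CARD('d)" using q d by unfold_locales auto
  have "(\<exists>js. nonintersecting_balls (card Cells) ?cs js) \<longleftrightarrow> (\<exists>\<tau>. solution (2 ^ B) cons \<tau>)"
    by (rule balls_iff_solution[OF sc set_centers[OF xs]])
  also have "\<dots> \<longleftrightarrow> (\<exists>\<alpha>. models \<alpha> F)"
    unfolding cons_def by (rule network_routing[OF li F deg[folded F_def] R_def S_def B])
  also have "\<dots> \<longleftrightarrow> (\<exists>\<alpha>. models \<alpha> K)"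
  proof -
    have "models \<alpha> F \<longleftrightarrow> models \<alpha> K" for \<alpha>
      using models_active[of \<alpha> K] unfolding F_def by (auto simp: models_def)
    then show ?thesis by simp
  qed
  finally show ?thesis using 1 by blast
qed

text \<open>Exponents are at most q (2n + d), so each coordinate takes a number of symbols linear in
  n.\<close>

lemma length_centers_string:
  assumes sc: "ball_scale q n (n + CARD('d)) CARD('d)" and xs: "set xs = Cells"
  shows "length (enc_list enc_point (centers q (n + CARD('d)) n cons xs)) \<le>
    length (centers q (n + CARD('d)) n cons xs) * (CARD('d) * (2 * (q * (2 * n + CARD('d))) + E + 10) + 2) + 2"
proof -
  interpret ball_scale q n "n + CARD('d)" "CARD('d)" by (rule sc)
  have "length (enc_point c) \<le> CARD('d) * (2 * (q * (2 * n + CARD('d))) + E + 10) + 2"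
    if cs: "c \<in> set (centers q (n + CARD('d)) n cons xs)" for c
  proof -
    obtain x t where c: "c = ball_center q (n + CARD('d)) n x t" "x \<in> Cells" "valid n cons x t"
      using cs unfolding set_centers[OF xs] by blast
    have "length (enc_rat (c $ i)) \<le> 2 * (q * (2 * n + CARD('d))) + E + 10" for i
    proof -
      let ?e = "expo (n + CARD('d)) n x t i"
      have e: "1 \<le> ?e" "?e \<le> 2 * n + CARD('d)" using shown_less[OF c(3), of i] unfolding expo_def by linarith+
      then have qe: "1 \<le> q * ?e" "q * ?e \<le> q * (2 * n + CARD('d))" using q by (simp_all add: Suc_le_eq)
      have x: "1 \<le> x i" "x i \<le> E" using Cells_bounds[OF c(2), of i] by auto
      have "enc_rat (c $ i) = coord_string (binary (x i)) (q * ?e)"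
        using enc_rat_coord[OF x(1) qe(1)] by (simp add: c(1) ball_center_def center_def)
      then have "length (enc_rat (c $ i)) \<le> 2 * (q * ?e) + length (binary (x i)) + 10"
        by (simp add: coord_string_def)
      also have "\<dots> \<le> 2 * (q * (2 * n + CARD('d))) + E + 10"
        using order_trans[OF length_binary x(2)] by (intro add_mono mult_left_mono[OF qe(2)]) auto
      finally show ?thesis .
    qed
    then have "length (concat (map enc_rat (map (\<lambda>i. c $ from_nat_into UNIV i) [0..<CARD('d)]))) \<le>
      length (map (\<lambda>i. c $ from_nat_into UNIV i) [0..<CARD('d)]) * (2 * (q * (2 * n + CARD('d))) + E + 10)"
      by (intro length_concat_le) auto
    then show ?thesis by (simp add: enc_point_def enc_list_def)
  qed
  from length_concat_le[OF this] show ?thesis by (simp add: enc_list_def)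
qed

end

context network
begin

text \<open>A single strand already has \<open>E\<close> cells. This is the lower bound that makes k
  large enough for a little-o estimate.\<close>

lemma card_Cells_ge: "E \<le> card Cells"
proof -
  obtain i :: 'd where True by blast
  let ?l = "(i, \<lambda>j. if j = i then 0 else 1 :: nat)"
  have l: "?l \<in> Lines" using M1 by (auto simp: Lines_def)
  have "inj_on (fwd ?l) {1..E}" by (auto simp: inj_on_def fwd_def fun_eq_iff split: if_splits)
  then have "card (fwd ?l ` {1..E}) = E" by (simp add: card_image)
  moreover have "fwd ?l ` {1..E} \<subseteq> Cells" using strand_cells[OF l] by blast
  ultimately show ?thesis using card_mono[OF finite_Cells, of "fwd ?l ` {1..E}"] by simp
qed

text \<open>\<open>p1\<close> and \<open>p2\<close> keep the cut-offs from taking effect, and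
  \<open>p3\<close> lets each simulated run finish. Soundness holds because branching only adds
  clauses, completeness because the branch of a model ends in a leaf without large flowers.\<close>

theorem decide_correct:
  assumes li: "inj_on li Lines" and xs: "set xs = Cells" "distinct xs" and q: "1 \<le> q" and d: "2 \<le> CARD('d)"
    and \<theta>: "1 \<le> \<theta>" and Dg: "Dg = 2 * (\<theta> + 4 * \<theta> * \<theta>)"
    and \<phi>: "three_cnf N0 \<phi>"
    and N: "N = length (names (parse (enc_cnf \<phi>)))"
    and B: "B = capacity CARD('d) Dg (M ^ (CARD('d) - 1)) (M ^ CARD('d)) N"
    and P: "\<And>cons. real_point ` set (centers q (2 ^ B + CARD('d)) (2 ^ B) cons xs) \<in> P"
    and Mx: "finds_balls Mx (card Cells) P T"
    and p1: "\<And>i K. well (vlits N) K \<Longrightarrow> i \<le> N * (4 * \<theta> + 1) + 1 \<Longrightarrow> sz ((spread \<theta> ^^ i) [(K, 2 * N div \<theta>)]) \<le> p"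
    and p2: "\<And>i. i \<le> B \<Longrightarrow> sz (bool_lists i) \<le> p"
    and p3: "\<And>nb len. 1 \<le> nb \<Longrightarrow> nb \<le> card Cells * (2 ^ B) ^ CARD('d) \<Longrightarrow>
      len \<le> nb * (CARD('d) * (2 * (q * (2 * 2 ^ B + CARD('d))) + E + 10) + 2) + 2 \<Longrightarrow> T nb len \<le> real p"
  shows "decide CARD('d) ((\<theta>, reduct q Dg li xs, (table_of Mx, states Mx, tapes Mx)), p, enc_cnf \<phi>) \<longleftrightarrow> satisfiable \<phi>"
proof -
  let ?w = "enc_cnf \<phi>" and ?m = "(table_of Mx, states Mx, tapes Mx)"
  let ?K = "normalized (parse ?w)" and ?s = "leaf_string CARD('d) (reduct q Dg li xs) p N"
  note norm = normalized_cnf[OF \<phi>, folded N]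
  have TM: "turing_machine Mx" using Mx by (simp add: finds_balls_def)
  have sc: "ball_scale q (2 ^ B) (2 ^ B + CARD('d)) CARD('d)" using q d by unfold_locales auto
  have leaf: "?s K \<noteq> [LPar, RPar] \<and> simulate ?m p (?s K) \<longleftrightarrow> (\<exists>\<alpha>. models \<alpha> K)"
    if K: "well (vlits N) K" "large_flowers \<theta> K = []" for K
  proof -
    have deg: "degree_le Dg N (filter (active K) K)" unfolding Dg by (rule leaf_degree_le[OF K \<theta>])
    obtain cons where c: "?s K = enc_list enc_point (centers q (2 ^ B + CARD('d)) (2 ^ B) cons xs)"
      "(\<exists>js. nonintersecting_balls (card Cells) (centers q (2 ^ B + CARD('d)) (2 ^ B) cons xs) js) \<longleftrightarrow> (\<exists>\<alpha>. models \<alpha> K)"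
      using leaf_centers[OF li xs(1) q d K(1) deg B cut_bool_lists_eq[OF p2]] by blast
    let ?cs = "centers q (2 ^ B + CARD('d)) (2 ^ B) cons xs"
    show ?thesis
    proof (cases "?cs = []")
      case True
      have "1 \<le> card Cells" using card_Cells_ge pos_M by linarith
      then have "\<not> nonintersecting_balls (card Cells) ?cs js" for js
        unfolding True nonintersecting_balls_def by auto
      then show ?thesis using c True by (simp add: enc_list_def)
    next
      case False
      have nb: "1 \<le> length ?cs" using False by (simp add: Suc_le_eq)
      have "length ?cs \<le> length xs * (2 ^ B) ^ CARD('d)" by (rule length_centers)
      also have "length xs = card Cells" using distinct_card[OF xs(2)] xs(1) by simp
      finally have le: "length ?cs \<le> card Cells * (2 ^ B) ^ CARD('d)" .
      have "T (length ?cs) (length (enc_list enc_point ?cs)) \<le> real p"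
        by (rule p3[OF nb le length_centers_string[OF sc xs(1)]])
      moreover obtain t y where t: "real t \<le> T (length ?cs) (length (enc_list enc_point ?cs))"
        "halts_with Mx (enc_list enc_point ?cs) t y"
        "if \<exists>js. nonintersecting_balls (card Cells) ?cs js
          then \<exists>js. nonintersecting_balls (card Cells) ?cs js \<and> y = enc_list enc_nat js else y = [Zero]"
        using Mx False distinct_centers[OF sc xs(2), of cons] P[of cons] unfolding finds_balls_def by blast
      ultimately have "t \<le> p" by linarith
      from simulate_correct[OF TM t(2) this] have "simulate ?m p (?s K) \<longleftrightarrow> LPar \<in> set y" by (simp add: c(1))
      also have "\<dots> \<longleftrightarrow> (\<exists>\<alpha>. models \<alpha> K)"
        using t(3) unfolding c(2) by (cases "\<exists>\<alpha>. models \<alpha> K") (auto simp: enc_list_def)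
      finally have sim: "simulate ?m p (?s K) \<longleftrightarrow> (\<exists>\<alpha>. models \<alpha> K)" .
      obtain c0 cs' where "?cs = c0 # cs'" using False by (cases ?cs) auto
      then have "?s K \<noteq> [LPar, RPar]" unfolding c(1) by (simp add: enc_list_def enc_point_def)
      then show ?thesis using sim by simp
    qed
  qed
  have cut: "cut_leaves p \<theta> N ?K = leaves \<theta> N ?K" by (rule cut_leaves_eq[OF p1[OF norm(1)]])
  have D: "decide CARD('d) ((\<theta>, reduct q Dg li xs, ?m), p, ?w) \<longleftrightarrow>
    (\<exists>s \<in> set (leaves \<theta> N ?K). large_flowers \<theta> (fst s) = [] \<and> ?s (fst s) \<noteq> [LPar, RPar] \<and> simulate ?m p (?s (fst s)))"
    unfolding decide_def by (simp add: N[symmetric] cut list_ex_iff)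
  have wl: "well (vlits N) (fst s) \<and> set ?K \<subseteq> set (fst s)" if "s \<in> set (leaves \<theta> N ?K)" for s
    using spread_iter_well[OF norm(1) \<theta>] that unfolding leaves_def by blast
  show ?thesis
  proof
    assume "decide CARD('d) ((\<theta>, reduct q Dg li xs, ?m), p, ?w)"
    then obtain s where s: "s \<in> set (leaves \<theta> N ?K)" "large_flowers \<theta> (fst s) = []"
      "?s (fst s) \<noteq> [LPar, RPar]" "simulate ?m p (?s (fst s))" unfolding D by blast
    then obtain \<alpha> where "models \<alpha> (fst s)" using leaf wl by blast
    then have "models \<alpha> ?K" using wl[OF s(1)] unfolding models_def by blast
    then show "satisfiable \<phi>" using norm(3) by blast
  next
    assume "satisfiable \<phi>"
    then obtain \<alpha> where "models \<alpha> ?K" using norm(3) by blast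
    from leaves_complete[OF norm(1) this \<theta>] obtain K' r' where K': "(K', r') \<in> set (leaves \<theta> N ?K)" "models \<alpha> K'"
      "large_flowers \<theta> K' = []" by blast
    then show "decide CARD('d) ((\<theta>, reduct q Dg li xs, ?m), p, ?w)"
      using leaf[of K'] wl[OF K'(1)] unfolding D by (intro bexI[OF _ K'(1)]) auto
  qed
qed

end

section \<open>The reduction on a Cantor grid\<close>

context cantor
begin

text \<open>k is determined by the grid, and \<open>prm\<close> by grid, machine and \<theta>;
  neither depends on the formula, so both are constants of the final 3-SAT machine.\<close>

theorem reduction_exists:
  fixes m :: nat
  assumes d: "2 \<le> CARD('d::finite)"
  defines "E \<equiv> B ^ Suc m + 2"
  shows "\<exists>k. E \<le> k \<and> k \<le> 2 * CARD('d) * (A ^ m) ^ (CARD('d) - 1) * E \<and>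
    (\<forall>Mx T \<theta>. finds_balls Mx k (Pow cross :: (real ^ 'd) set set) T \<longrightarrow> 1 \<le> \<theta> \<longrightarrow> (\<exists>prm. \<forall>N0 \<phi> N b p.
      three_cnf N0 \<phi> \<longrightarrow> N = length (names (parse (enc_cnf \<phi>))) \<longrightarrow>
      b = capacity CARD('d) (2 * (\<theta> + 4 * \<theta> * \<theta>)) ((A ^ m) ^ (CARD('d) - 1)) ((A ^ m) ^ CARD('d)) N \<longrightarrow>
      (\<forall>i K. well (vlits N) K \<longrightarrow> i \<le> N * (4 * \<theta> + 1) + 1 \<longrightarrow> sz ((spread \<theta> ^^ i) [(K, 2 * N div \<theta>)]) \<le> p) \<longrightarrow>
      (\<forall>i \<le> b. sz (bool_lists i) \<le> p) \<longrightarrow>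
      (\<forall>nb len. 1 \<le> nb \<longrightarrow> nb \<le> k * (2 ^ b) ^ CARD('d) \<longrightarrow>
        len \<le> nb * (CARD('d) * (2 * (q * (2 * 2 ^ b + CARD('d))) + E + 10) + 2) + 2 \<longrightarrow> T nb len \<le> real p) \<longrightarrow>
      (decide CARD('d) (prm, p, enc_cnf \<phi>) \<longleftrightarrow> satisfiable \<phi>)))"
proof -
  \<comment> \<open>The backward strand is shifted in a second direction, which d \<ge> 2
    provides.\<close>
  define nx :: "'d \<Rightarrow> 'd" where "nx = (\<lambda>i. SOME j. j \<noteq> i)"
  have "\<exists>j. j \<noteq> i" for i :: 'd
  proof (rule ccontr)
    assume "\<not> (\<exists>j. j \<noteq> i)"
    then have "UNIV = {i}" by auto
    then have "CARD('d) = 1" by (metis card.empty card_insert_disjoint empty_iff finite.emptyI One_nat_def)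
    then show False using d by simp
  qed
  then have nx: "nx i \<noteq> i" for i unfolding nx_def by (rule someI_ex)
  \<comment> \<open>Beyond the backward strands at \<open>grid_pos (A ^ m) + 1\<close> there must be
    one free coordinate for the ends of the loops.\<close>
  have E: "E = grid_pos (A ^ m) + 2" by (simp add: E_def grid_pos_def cant_power)
  have A1: "1 \<le> A ^ m" using A2 by simp
  interpret network grid_pos "A ^ m" E nx
    by unfold_locales (use grid_pos_gap grid_pos_1 nx A1 E in auto)
  have q: "1 \<le> q" using pq by simp
  obtain xs where xs: "set xs = Cells" "distinct xs" using finite_distinct_list[OF finite_Cells] by blast
  have li: "inj_on (to_nat_on Lines) Lines" by (rule inj_on_to_nat_on[OF countable_finite[OF finite_Lines]])
  have P: "real_point ` set (centers q (2 ^ b + CARD('d)) (2 ^ b) cons xs) \<in> Pow cross" for b cons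
  proof -
    have "real_point (ball_center q (2 ^ b + CARD('d)) (2 ^ b) x t) \<in> cross"
      if x: "x \<in> Cells" and v: "valid (2 ^ b) cons x t" for x t
    proof -
      obtain l where l: "l \<in> Lines" "x \<in> fwd l ` {1..E} \<union> bwd l ` {1..E}" using x by (auto simp: Cells_iff)
      have "real_point (ball_center q (2 ^ b + CARD('d)) (2 ^ b) x t) $ j / 2 \<in> dust" if "j \<noteq> fst l" for j
      proof -
        let ?u = "expo (2 ^ b + CARD('d)) (2 ^ b) x t j"
        have u: "1 \<le> ?u" using shown_less[OF v, of j] unfolding expo_def by linarith
        have "x j \<in> digs" using strand_coord[OF l(2) that] grid_pos_digs[of "snd l j"] by auto
        from digs_dust[OF this u] show ?thesis
          by (simp add: ball_center_def real_point_center eps_def local.B_def power_mult add_divide_distrib)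
      qed
      then show ?thesis unfolding cross_def by blast
    qed
    then show ?thesis unfolding set_centers[OF xs(1)] by blast
  qed
  show ?thesis
  proof (intro exI[of _ "card Cells"] conjI allI impI)
    show "E \<le> card Cells" by (rule card_Cells_ge)
    show "card Cells \<le> 2 * CARD('d) * (A ^ m) ^ (CARD('d) - 1) * E" by (rule card_Cells)
  next
    fix Mx T and \<theta> :: nat
    assume Mx: "finds_balls Mx (card Cells) (Pow cross :: (real ^ 'd) set set) T" and \<theta>: "1 \<le> \<theta>"
    show "\<exists>prm. \<forall>N0 \<phi> N b p.
      three_cnf N0 \<phi> \<longrightarrow> N = length (names (parse (enc_cnf \<phi>))) \<longrightarrow>
      b = capacity CARD('d) (2 * (\<theta> + 4 * \<theta> * \<theta>)) ((A ^ m) ^ (CARD('d) - 1)) ((A ^ m) ^ CARD('d)) N \<longrightarrow>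
      (\<forall>i K. well (vlits N) K \<longrightarrow> i \<le> N * (4 * \<theta> + 1) + 1 \<longrightarrow> sz ((spread \<theta> ^^ i) [(K, 2 * N div \<theta>)]) \<le> p) \<longrightarrow>
      (\<forall>i \<le> b. sz (bool_lists i) \<le> p) \<longrightarrow>
      (\<forall>nb len. 1 \<le> nb \<longrightarrow> nb \<le> card Cells * (2 ^ b) ^ CARD('d) \<longrightarrow>
        len \<le> nb * (CARD('d) * (2 * (q * (2 * 2 ^ b + CARD('d))) + E + 10) + 2) + 2 \<longrightarrow> T nb len \<le> real p) \<longrightarrow>
      (decide CARD('d) (prm, p, enc_cnf \<phi>) \<longleftrightarrow> satisfiable \<phi>)"
      by (intro exI allI impI, rule decide_correct[OF li xs q d \<theta> refl _ _ _ P Mx]) blast+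
  qed
qed

end

subsection \<open>Running times\<close>

lemma poly_le_exp:
  assumes "0 < \<epsilon>"
  shows "\<exists>C > 0. \<forall>N. real (N + 2) ^ a \<le> C * 2 powr (\<epsilon> * real N)"
proof -
  have "(\<lambda>N. real (N + 2) ^ a) \<in> O(\<lambda>N. 2 powr (\<epsilon> * real N))" using assms by real_asymp
  then obtain c where c: "c > 0" "eventually (\<lambda>N. norm (real (N + 2) ^ a) \<le> c * norm (2 powr (\<epsilon> * real N))) at_top"
    by (elim landau_o.bigE)
  then obtain N0 where N0: "\<And>N. N \<ge> N0 \<Longrightarrow> real (N + 2) ^ a \<le> c * 2 powr (\<epsilon> * real N)"
    by (auto simp: eventually_at_top_linorder)
  show ?thesis
  proof (intro exI[of _ "c + real (N0 + 2) ^ a"] conjI allI)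
    fix N
    have one: "1 \<le> 2 powr (\<epsilon> * real N)" using assms by (intro ge_one_powr_ge_zero) auto
    show "real (N + 2) ^ a \<le> (c + real (N0 + 2) ^ a) * 2 powr (\<epsilon> * real N)"
    proof (cases "N0 \<le> N")
      case True
      then show ?thesis using N0[OF True] by (simp add: distrib_right add_increasing2)
    next
      case False
      then have "real (N + 2) ^ a \<le> real (N0 + 2) ^ a" by (intro power_mono) auto
      also have "\<dots> \<le> (c + real (N0 + 2) ^ a) * 1" using c(1) by simp
      also have "\<dots> \<le> (c + real (N0 + 2) ^ a) * 2 powr (\<epsilon> * real N)" using one c(1) by (intro mult_left_mono) auto
      finally show ?thesis .
    qed
  qed (use c(1) in \<open>simp add: add_pos_nonneg\<close>)
qed

lemma powr_div_le:
  assumes "1 \<le> qq"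
  shows "2 powr (real N / real qq) \<le> 2 * 2 ^ (N div qq)"
proof -
  have "N < (N div qq + 1) * qq" using dividend_less_times_div[of qq N] assms by (simp add: algebra_simps)
  then have "real N < real (N div qq + 1) * real qq" by (metis of_nat_less_iff of_nat_mult)
  then have "real N / real qq \<le> real (N div qq + 1)" using assms by (simp add: divide_le_eq)
  then have "2 powr (real N / real qq) \<le> 2 powr real (N div qq + 1)" by (intro powr_mono) auto
  also have "\<dots> = 2 * 2 ^ (N div qq)" by (subst powr_realpow) auto
  finally show ?thesis .
qed

lemma cube_times: "(2 * x) ^ 3 * (20 * x) = 160 * x ^ 4" "(2 * x) ^ 3 * (6 * x) = 48 * x ^ 4" for x :: nat
  by (simp_all add: power3_eq_cube power4_eq_xxxx)

text \<open>With weight x = 1/\<theta>^2, about 4\<theta>N rounds and budget 2N/\<theta>, the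
  frontier has at most exp(1 + N ((4\<theta> + 1)/\<theta>^2 + 4 ln \<theta>/\<theta>)) entries. The
  coefficient of N tends to 0, so a suitable \<theta> achieves any rate; half of the rate is
  reserved for the polynomial size of the entries.\<close>

lemma frontier_bound:
  assumes qq: "1 \<le> qq"
  shows "\<exists>\<theta> \<ge> 1. \<exists>C. \<forall>N K i. well (vlits N) K \<longrightarrow> i \<le> N * (4 * \<theta> + 1) + 1 \<longrightarrow>
    real (sz ((spread \<theta> ^^ i) [(K, 2 * N div \<theta>)])) \<le> C * 2 powr (real N / real qq)"
proof -
  let ?a = "\<lambda>\<theta>. (4 * real \<theta> + 1) / real \<theta> ^ 2 + 4 * ln (real \<theta>) / real \<theta>"
  let ?\<epsilon> = "1 / (2 * real qq)"
  have \<epsilon>: "0 < ?\<epsilon>" using qq by simp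
  have "(?a \<longlongrightarrow> 0) at_top" by real_asymp
  moreover have "0 < ln 2 * ?\<epsilon>" using \<epsilon> by (intro mult_pos_pos) auto
  ultimately have "eventually (\<lambda>\<theta>. ?a \<theta> < ln 2 * ?\<epsilon>) at_top" by (rule order_tendstoD)
  then have "eventually (\<lambda>\<theta>. ?a \<theta> < ln 2 * ?\<epsilon> \<and> 1 \<le> \<theta>) at_top"
    using eventually_ge_at_top[of "1 :: nat"] by (rule eventually_conj)
  then obtain \<theta> where \<theta>: "?a \<theta> < ln 2 * ?\<epsilon>" "1 \<le> \<theta>" by (auto simp: eventually_at_top_linorder)
  obtain C where C: "C > 0" "\<And>N. real (N + 2) ^ 4 \<le> C * 2 powr (?\<epsilon> * real N)" using poly_le_exp[OF \<epsilon>, of 4] by blast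
  let ?x = "1 / real \<theta> ^ 2"
  have x: "0 < ?x" "?x \<le> 1" using \<theta>(2) by auto
  have main: "real (sz ((spread \<theta> ^^ i) [(K, 2 * N div \<theta>)])) \<le> 193 * exp 1 * C * 2 powr (real N / real qq)"
    if w: "well (vlits N) K" and i: "i \<le> N * (4 * \<theta> + 1) + 1" for N K i
  proof -
    let ?L = "(spread \<theta> ^^ i) [(K, 2 * N div \<theta>)]"
    have "real (length ?L) \<le> (1 + ?x) ^ i * (1 / ?x) ^ (2 * N div \<theta>)" by (rule spread_iter_count[OF x])
    also have "\<dots> \<le> exp (?x * real i) * exp (2 * ln (real \<theta>) * real (2 * N div \<theta>))"
    proof (intro mult_mono)
      have "(1 + ?x) ^ i \<le> exp ?x ^ i" using x exp_ge_add_one_self[of ?x] by (intro power_mono) auto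
      then show "(1 + ?x) ^ i \<le> exp (?x * real i)" by (simp add: exp_of_nat_mult[symmetric] mult.commute)
      have "1 / ?x = exp (2 * ln (real \<theta>))" using \<theta>(2) by (simp add: exp_double[of "ln (real \<theta>)"])
      then have "(1 / ?x) ^ (2 * N div \<theta>) = exp (2 * ln (real \<theta>)) ^ (2 * N div \<theta>)" by simp
      then show "(1 / ?x) ^ (2 * N div \<theta>) \<le> exp (2 * ln (real \<theta>) * real (2 * N div \<theta>))"
        by (simp add: exp_of_nat_mult[symmetric] mult.commute)
    qed (use x in auto)
    also have "\<dots> = exp (?x * real i + 2 * ln (real \<theta>) * real (2 * N div \<theta>))" by (simp add: exp_add)
    also have "\<dots> \<le> exp (1 + real N * ?a \<theta>)"
    proof -
      have "real i \<le> real N * (4 * real \<theta> + 1) + 1" using of_nat_mono[OF i, where 'a = real] by (simp add: algebra_simps)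
      then have "?x * real i \<le> ?x * (real N * (4 * real \<theta> + 1) + 1)" using x by (intro mult_left_mono) auto
      also have "\<dots> = real N * ((4 * real \<theta> + 1) / real \<theta> ^ 2) + ?x" by (simp add: algebra_simps add_divide_distrib)
      also have "\<dots> \<le> real N * ((4 * real \<theta> + 1) / real \<theta> ^ 2) + 1" using x(2) by simp
      finally have 1: "?x * real i \<le> real N * ((4 * real \<theta> + 1) / real \<theta> ^ 2) + 1" .
      have "real (2 * N div \<theta>) \<le> real (2 * N) / real \<theta>" by (rule of_nat_div_le_of_nat)
      then have "2 * ln (real \<theta>) * real (2 * N div \<theta>) \<le> 2 * ln (real \<theta>) * (real (2 * N) / real \<theta>)"
        using \<theta>(2) by (intro mult_left_mono) auto
      also have "\<dots> = real N * (4 * ln (real \<theta>) / real \<theta>)" by simp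
      finally show ?thesis using 1 by (simp add: distrib_left)
    qed
    also have "\<dots> \<le> exp (1 + real N * (ln 2 * ?\<epsilon>))" using mult_left_mono[OF less_imp_le[OF \<theta>(1)], of "real N"] by simp
    also have "\<dots> = exp 1 * 2 powr (?\<epsilon> * real N)" by (simp add: exp_add powr_def mult_ac)
    finally have cnt: "real (length ?L) \<le> exp 1 * 2 powr (?\<epsilon> * real N)" .
    have "(2 * N + 1) ^ 3 \<le> (2 * (N + 2)) ^ 3" by (intro power_mono) auto
    then have "(2 * N + 1) ^ 3 * (6 * N + 20) \<le> (2 * (N + 2)) ^ 3 * (20 * (N + 2))" by (intro mult_mono) auto
    also have "\<dots> = 160 * (N + 2) ^ 4" by (rule cube_times)
    finally have "(2 * N + 1) ^ 3 * (6 * N + 20) \<le> 160 * (N + 2) ^ 4" .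
    moreover have "N + 2 \<le> (N + 2) ^ 4" by (rule self_le_power) auto
    moreover have "P + 4 * N + 4 \<le> 192 * y" if "P \<le> 160 * y" "N + 2 \<le> y" for P y using that by linarith
    ultimately have pol: "(2 * N + 1) ^ 3 * (6 * N + 20) + 4 * N + 4 \<le> 192 * (N + 2) ^ 4" by blast
    have "sz ?L \<le> 1 + length ?L * ((2 * N + 1) ^ 3 * (6 * N + 20) + 4 * N + 4)" by (rule sz_frontier[OF w \<theta>(2)])
    also have "\<dots> \<le> 1 + length ?L * (192 * (N + 2) ^ 4)" using pol by (intro add_mono mult_left_mono) auto
    finally have "real (sz ?L) \<le> real (1 + length ?L * (192 * (N + 2) ^ 4))" by (rule of_nat_mono)
    also have "\<dots> = 1 + real (length ?L) * (192 * real (N + 2) ^ 4)" by simp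
    also have "\<dots> \<le> 1 + (exp 1 * 2 powr (?\<epsilon> * real N)) * (192 * (C * 2 powr (?\<epsilon> * real N)))"
      using cnt C by (intro add_mono mult_mono) auto
    also have "\<dots> = 1 + 192 * exp 1 * C * (2 powr (?\<epsilon> * real N) * 2 powr (?\<epsilon> * real N))" by simp
    also have "2 powr (?\<epsilon> * real N) * 2 powr (?\<epsilon> * real N) = 2 powr (real N / real qq)"
      using qq by (simp add: powr_add[symmetric])
    finally have "real (sz ?L) \<le> 1 + 192 * exp 1 * C * 2 powr (real N / real qq)" .
    moreover have "1 \<le> exp 1 * C * 2 powr (real N / real qq)"
    proof -
      have "1 \<le> C * 2 powr (?\<epsilon> * real 0)" using C(2)[of 0] by simp
      then have "1 \<le> C" by simp
      moreover have "1 \<le> 2 powr (real N / real qq)" by (intro ge_one_powr_ge_zero) auto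
      moreover have "1 \<le> exp (1 :: real)" by simp
      ultimately show ?thesis by (metis mult_le_one mult_mono' mult_1 zero_le_one)
    qed
    ultimately show ?thesis by linarith
  qed
  show ?thesis using \<theta>(2) main by blast
qed

text \<open>Clauses are distinct, so there are O(N^3) of them, each of length O(N).\<close>

lemma length_enc_cnf:
  assumes "three_cnf N \<phi>"
  shows "length (enc_cnf \<phi>) + 2 \<le> 52 * (N + 2) ^ 4"
proof -
  have three: "length C \<le> 3 \<and> (\<forall>l \<in> set C. fst l < N)" if "C \<in> set \<phi>" for C
    using assms that unfolding three_cnf_def by (simp add: split_beta)
  have lit: "length (enc_literal l) \<le> N + 3" if "fst l < N" for l
    using that length_binary[of "fst l"] by (simp add: enc_literal_def)
  have cl: "length (enc_list enc_literal C) \<le> 3 * N + 11" if "C \<in> set \<phi>" for C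
  proof -
    have C: "length C \<le> 3" "\<And>l. l \<in> set C \<Longrightarrow> fst l < N" using three[OF that] by auto
    have "length (concat (map enc_literal C)) \<le> length C * (N + 3)" by (rule length_concat_le) (use lit C(2) in blast)
    also have "\<dots> \<le> 3 * (N + 3)" using C(1) by (rule mult_right_mono) simp
    finally show ?thesis by (simp add: enc_list_def)
  qed
  have "length (concat (map (enc_list enc_literal) \<phi>)) \<le> length \<phi> * (3 * N + 11)" by (rule length_concat_le[OF cl])
  also have "length \<phi> = card (set \<phi>)" using assms by (simp add: three_cnf_def distinct_card)
  also have "card (set \<phi>) \<le> card {xs. set xs \<subseteq> vlits N \<and> length xs \<le> 3}"
    using three card_short_clauses[of N] by (intro card_mono) (auto simp: vlits_def)
  also have "\<dots> \<le> (2 * N + 1) ^ 3" using card_short_clauses by blast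
  also have "(2 * N + 1) ^ 3 \<le> (2 * (N + 2)) ^ 3" by (intro power_mono) auto
  also have "(2 * (N + 2)) ^ 3 * (3 * N + 11) \<le> (2 * (N + 2)) ^ 3 * (6 * (N + 2))" by (intro mult_left_mono) auto
  also have "\<dots> = 48 * (N + 2) ^ 4" by (rule cube_times)
  finally have "length (concat (map (enc_list enc_literal) \<phi>)) \<le> 48 * (N + 2) ^ 4" by simp
  moreover have "1 \<le> (N + 2) ^ 4" by (rule one_le_power) simp
  moreover have "length (enc_cnf \<phi>) = length (concat (map (enc_list enc_literal) \<phi>)) + 2"
    by (simp add: enc_cnf_def enc_list_def)
  ultimately show ?thesis by linarith
qed

lemma Blank_enc_cnf: "Blank \<notin> set (enc_cnf \<phi>)"
  using set_binary by (auto simp: enc_cnf_def enc_list_def enc_literal_def)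

text \<open>With n = 2^b there are at most k n^d balls, written with O(n^(d+1)) symbols for fixed k.
  The sign of g is unknown, hence the absolute value.\<close>

lemma ball_time_bound:
  fixes k d c f E q b nb len :: nat and g :: real
  assumes nb: "1 \<le> nb" "nb \<le> k * (2 ^ b) ^ d"
    and len: "len \<le> nb * (d * (2 * (q * (2 * 2 ^ b + d)) + E + 10) + 2) + 2"
  shows "real f * real nb powr g * real len ^ c \<le>
    real f * real k powr \<bar>g\<bar> * real (k * (d * (2 * (q * (2 + d)) + E + 10) + 4)) ^ c *
      2 powr (real b * (real d * \<bar>g\<bar> + real (d + 1) * real c))"
proof -
  define n :: nat where "n = 2 ^ b"
  define L where "L = d * (2 * (q * (2 + d)) + E + 10) + 2"
  have n: "1 \<le> n" by (simp add: n_def)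
  have nr: "real n = 2 powr real b" by (simp add: n_def powr_realpow)
  have nb': "nb \<le> k * n ^ d" using nb(2) by (simp add: n_def)
  then have k: "1 \<le> k * n ^ d" using nb(1) by linarith
  have m: "x \<le> x * n" for x using n by simp
  have "2 * n + d \<le> (2 + d) * n" using m[of d] by (simp add: algebra_simps)
  from mult_le_mono2[OF this, of q] have "q * (2 * n + d) \<le> q * (2 + d) * n" by (simp only: mult.assoc)
  then have "2 * (q * (2 * n + d)) + (E + 10) \<le> 2 * (q * (2 + d) * n) + (E + 10) * n"
    using m[of "E + 10"] by (intro add_mono mult_le_mono2)
  then have "2 * (q * (2 * n + d)) + E + 10 \<le> (2 * (q * (2 + d)) + E + 10) * n" by (simp add: algebra_simps)
  from mult_le_mono2[OF this, of d]
  have "d * (2 * (q * (2 * n + d)) + E + 10) \<le> d * (2 * (q * (2 + d)) + E + 10) * n" by (simp only: mult.assoc)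
  from add_mono[OF this m[of 2]] have L: "d * (2 * (q * (2 * n + d)) + E + 10) + 2 \<le> L * n"
    unfolding L_def by (simp only: distrib_right)
  have "len \<le> nb * (d * (2 * (q * (2 * n + d)) + E + 10) + 2) + 2" using len by (simp add: n_def)
  also have "\<dots> \<le> (k * n ^ d) * (L * n) + 2 * ((k * n ^ d) * n)"
    using nb' L k n by (intro add_mono mult_le_mono) (auto simp: Suc_le_eq)
  also have "\<dots> = k * (L + 2) * n ^ (d + 1)" by (simp add: algebra_simps)
  finally have len': "len \<le> k * (L + 2) * n ^ (d + 1)" .
  have 1: "real nb powr g \<le> real k powr \<bar>g\<bar> * 2 powr (real b * (real d * \<bar>g\<bar>))"
  proof -
    have "real nb powr g \<le> real nb powr \<bar>g\<bar>" using nb(1) by (intro powr_mono) auto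
    also have "\<dots> \<le> real (k * n ^ d) powr \<bar>g\<bar>" using nb' by (intro powr_mono2) (auto simp del: of_nat_mult of_nat_power)
    also have "\<dots> = real k powr \<bar>g\<bar> * (real n ^ d) powr \<bar>g\<bar>" by (simp add: powr_mult)
    also have "real n ^ d = 2 powr (real b * real d)" unfolding nr by (simp add: powr_power mult.commute)
    finally show ?thesis by (simp add: powr_powr mult.assoc)
  qed
  have 2: "real len ^ c \<le> real (k * (L + 2)) ^ c * 2 powr (real b * (real (d + 1) * real c))"
  proof -
    have "real len ^ c \<le> real (k * (L + 2) * n ^ (d + 1)) ^ c" using len' by (intro power_mono) (auto simp del: of_nat_mult of_nat_power)
    also have "\<dots> = real (k * (L + 2)) ^ c * (real n ^ (d + 1)) ^ c" by (simp only: of_nat_mult of_nat_power power_mult_distrib)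
    also have "(real n ^ (d + 1)) ^ c = 2 powr (real b * (real (d + 1) * real c))"
      unfolding nr power_mult[symmetric] by (simp only: powr_power of_nat_mult mult_ac)
    finally show ?thesis .
  qed
  have "real f * real nb powr g * real len ^ c \<le> real f * (real k powr \<bar>g\<bar> * 2 powr (real b * (real d * \<bar>g\<bar>))) *
    (real (k * (L + 2)) ^ c * 2 powr (real b * (real (d + 1) * real c)))"
    by (intro mult_mono 1 2 mult_left_mono) auto
  also have "\<dots> = real f * real k powr \<bar>g\<bar> * real (k * (L + 2)) ^ c *
    (2 powr (real b * (real d * \<bar>g\<bar>)) * 2 powr (real b * (real (d + 1) * real c)))" by (simp only: mult_ac)
  also have "2 powr (real b * (real d * \<bar>g\<bar>)) * 2 powr (real b * (real (d + 1) * real c)) =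
     2 powr (real b * (real d * \<bar>g\<bar> + real (d + 1) * real c))" by (simp only: powr_add[symmetric] distrib_left)
  finally have "real f * real nb powr g * real len ^ c \<le> real f * real k powr \<bar>g\<bar> * real (k * (L + 2)) ^ c *
    2 powr (real b * (real d * \<bar>g\<bar> + real (d + 1) * real c))" .
  moreover have "L + 2 = d * (2 * (q * (2 + d)) + E + 10) + 4" by (simp add: L_def)
  ultimately show ?thesis by (simp only:)
qed

lemma sz_bool_lists_le: "i \<le> b \<Longrightarrow> real (sz (bool_lists i)) \<le> 7 * 2 powr (real b * 2)"
proof -
  assume "i \<le> b"
  then have i: "(2::nat) ^ i \<le> 2 ^ b" by (intro power_increasing) auto
  have "i < 2 ^ i" by (rule less_exp)
  moreover have "1 \<le> (2::nat) ^ i" by simp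
  ultimately have "4 * i + 2 \<le> 6 * 2 ^ i" by linarith
  then have "2 ^ i * (4 * i + 2) + 1 \<le> 2 ^ i * (6 * 2 ^ i) + 1" by (intro add_mono mult_le_mono2) auto
  with sz_bool_lists[of i] have "sz (bool_lists i) \<le> 2 ^ i * (6 * 2 ^ i) + 1" by (rule order_trans)
  also have "\<dots> \<le> 2 ^ b * (6 * 2 ^ b) + 1" using i by (intro add_mono mult_le_mono) auto
  also have "\<dots> \<le> 7 * (2 ^ b * 2 ^ b)" by simp
  finally have "real (sz (bool_lists i)) \<le> real (7 * (2 ^ b * 2 ^ b))" by (rule of_nat_mono)
  also have "\<dots> = 7 * (2 powr real b * 2 powr real b)" by (simp add: powr_realpow)
  finally show ?thesis by (simp add: powr_add[symmetric] mult.commute)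
qed

section \<open>Choice of the dimension and of the grid size\<close>

lemma rational_exponent:
  fixes a b :: real
  assumes "0 \<le> a" "a < b" "b \<le> 1"
  shows "\<exists>p q :: nat. 1 \<le> p \<and> p < q \<and> a < real p / real q \<and> real p / real q < b"
proof -
  obtain r where r: "r \<in> \<rat>" "a < r" "r < b" using Rats_dense_in_real[OF assms(2)] by blast
  obtain p q :: nat where pq: "q \<noteq> 0" "\<bar>r\<bar> = real p / real q" using Rats_abs_nat_div_natE[OF r(1)] by metis
  have e: "real p / real q = r" using pq r assms by simp
  have "0 < real p / real q" "real p / real q < 1" using e r assms by auto
  then have "1 \<le> p" "p < q" using pq by (auto simp: zero_less_divide_iff divide_less_eq)
  then show ?thesis using r e by blast
qed

text \<open>Let X = B^m, W = (A^m)^(d-1) = X^((d-1) alpha) and s = 1 + (d-1) alpha \<ge> \<delta>.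
  Then k = O(W X) = O(X^s), so k^(1 - 1/\<delta>) = O(X^(s - s/\<delta>)) = O(X^(s-1)) = O(W), and
  little-o makes |g k| an arbitrarily small multiple of W.\<close>

lemma (in cantor) choose_scale:
  fixes g :: "nat \<Rightarrow> real" and \<delta> b0 e0 :: real
  assumes g: "g \<in> o(\<lambda>k. real k powr (1 - 1 / \<delta>))" and \<delta>: "1 < \<delta>" "\<delta> \<le> 1 + real (d - 1) * alpha"
    and d: "2 \<le> d" and b0: "0 < b0"
  shows "\<exists>m. \<forall>k. B ^ Suc m + 2 \<le> k \<longrightarrow> k \<le> 2 * d * (A ^ m) ^ (d - 1) * (B ^ Suc m + 2) \<longrightarrow>
    b0 * (real d * \<bar>g k\<bar> + e0) \<le> real ((A ^ m) ^ (d - 1))"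
proof -
  let ?\<delta>0 = "1 + real (d - 1) * alpha"
  define C where "C = (6 * real d * real B) powr (1 - 1 / \<delta>)"
  have B2: "2 \<le> B" using AB A2 by linarith
  have C: "0 < C" using d B2 by (simp add: C_def)
  \<comment> \<open>The factor 2 leaves half of W for each of the two summands.\<close>
  define \<eta> where "\<eta> = 1 / (2 * b0 * real d * C)"
  have \<eta>: "0 < \<eta>" using b0 d C by (simp add: \<eta>_def)
  from landau_o.smallD[OF g \<eta>] obtain k0 where k0: "\<And>k. k0 \<le> k \<Longrightarrow> \<bar>g k\<bar> \<le> \<eta> * real k powr (1 - 1 / \<delta>)"
    by (auto simp: eventually_at_top_linorder)
  obtain m where m: "real k0 < 2 ^ m" "2 * b0 * e0 < 2 ^ m"
  proof -
    obtain m1 where m1: "real k0 < 2 ^ m1" using real_arch_pow[of 2 "real k0"] by auto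
    obtain m2 where m2: "2 * b0 * e0 < 2 ^ m2" using real_arch_pow[of 2 "2 * b0 * e0"] by auto
    have "(2::real) ^ m1 \<le> 2 ^ max m1 m2" "(2::real) ^ m2 \<le> 2 ^ max m1 m2" by (intro power_increasing; simp)+
    then show ?thesis using that[of "max m1 m2"] m1 m2 by linarith
  qed
  let ?W = "real ((A ^ m) ^ (d - 1))" and ?X = "real (B ^ m)"
  have X: "1 \<le> ?X" using B2 by simp
  have W: "?W = ?X powr (real (d - 1) * alpha)"
  proof -
    have "?W = (?X powr alpha) ^ (d - 1)" using A_powr[of m] by simp
    also have "\<dots> = (?X powr alpha) powr real (d - 1)" using X B2 by (subst powr_realpow) auto
    also have "\<dots> = ?X powr (real (d - 1) * alpha)" by (simp only: powr_powr mult.commute)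
    finally show ?thesis .
  qed
  have W2: "2 ^ m \<le> ?W"
  proof -
    have "(2::nat) ^ m \<le> A ^ m" using A2 by (intro power_mono) auto
    also have "\<dots> \<le> (A ^ m) ^ (d - 1)" using A2 d by (intro self_le_power) auto
    finally have "real (2 ^ m) \<le> ?W" by (rule of_nat_mono)
    then show ?thesis by simp
  qed
  show ?thesis
  proof (intro exI[of _ m] allI impI)
    fix k assume k: "B ^ Suc m + 2 \<le> k" "k \<le> 2 * d * (A ^ m) ^ (d - 1) * (B ^ Suc m + 2)"
    have "(2::nat) ^ m \<le> B ^ Suc m"
    proof -
      have "(2::nat) ^ m \<le> 2 ^ Suc m" by simp
      also have "\<dots> \<le> B ^ Suc m" using B2 by (intro power_mono) auto
      finally show ?thesis .
    qed
    then have "real (2 ^ m) \<le> real k" using k(1) by (intro of_nat_mono) linarith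
    then have "k0 \<le> k" using m(1) by simp
    from k0[OF this] have gk: "\<bar>g k\<bar> \<le> \<eta> * real k powr (1 - 1 / \<delta>)" .
    have "1 \<le> B ^ Suc m" using B2 by simp
    then have "B ^ Suc m + 2 \<le> 3 * (B * B ^ m)" by simp
    then have "k \<le> 2 * d * (A ^ m) ^ (d - 1) * (3 * (B * B ^ m))" using k(2) by (meson le_trans mult_le_mono2)
    then have "real k \<le> real (2 * d * (A ^ m) ^ (d - 1) * (3 * (B * B ^ m)))" by (rule of_nat_mono)
    also have "\<dots> = 6 * real d * real B * (?W * ?X)" by simp
    also have "?W * ?X = ?X powr ?\<delta>0" unfolding W using X by (simp add: powr_add)
    finally have "real k powr (1 - 1 / \<delta>) \<le> (6 * real d * real B * ?X powr ?\<delta>0) powr (1 - 1 / \<delta>)"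
      using \<delta> by (intro powr_mono2) auto
    also have "\<dots> = C * ?X powr (?\<delta>0 * (1 - 1 / \<delta>))" using d by (simp add: powr_mult powr_powr C_def)
    also have "\<dots> \<le> C * ?X powr (real (d - 1) * alpha)"
    proof -
      have "0 < \<delta>" using \<delta>(1) by simp
      then have "1 \<le> ?\<delta>0 / \<delta>" using \<delta>(2) by (simp only: le_divide_eq_1_pos)
      then have "?\<delta>0 * (1 - 1 / \<delta>) \<le> real (d - 1) * alpha" by (simp add: right_diff_distrib)
      then show ?thesis using X C by (intro mult_left_mono powr_mono) auto
    qed
    finally have "real k powr (1 - 1 / \<delta>) \<le> C * ?W" unfolding W .
    then have "\<bar>g k\<bar> \<le> \<eta> * (C * ?W)" using gk \<eta> by (meson mult_left_mono order_trans less_imp_le)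
    then have "b0 * (real d * \<bar>g k\<bar>) \<le> b0 * (real d * (\<eta> * (C * ?W)))"
      using b0 by (intro mult_left_mono) auto
    also have "\<dots> = ?W / 2" using b0 d C by (simp add: \<eta>_def)
    finally have "b0 * (real d * \<bar>g k\<bar>) \<le> ?W / 2" .
    moreover have "b0 * e0 \<le> ?W / 2" using m(2) W2 by linarith
    ultimately show "b0 * (real d * \<bar>g k\<bar> + e0) \<le> ?W" by (simp add: distrib_left)
  qed
qed

theorem theorem1p2:
  fixes \<delta> \<delta>' :: real
  assumes "CARD('d::finite) \<ge> 2"
    and "1 < \<delta>'" and "\<delta>' < \<delta>" and "\<delta> < real CARD('d)"
    and "\<forall>\<P> :: (real ^ 'd) set set. fractal_dim \<P> \<le> ereal \<delta> \<longrightarrow>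
      (\<exists>(f :: nat \<Rightarrow> nat) (g :: nat \<Rightarrow> real) (c :: nat).
         computable f \<and> g \<in> o(\<lambda>k. real k powr (1 - 1 / \<delta>')) \<and>
         (\<forall>k. \<exists>M. finds_balls M k \<P>
            (\<lambda>n len. real (f k) * real n powr g k * real len ^ c)))"
  shows "\<not> ETH"
proof
  assume ETH
  then obtain \<sigma> :: real where \<sigma>: "0 < \<sigma>"
    "\<not> (\<exists>M T. (\<lambda>N. real (T N)) \<in> O(\<lambda>N. 2 powr (\<sigma> * real N)) \<and> solves_3sat M T)"
    unfolding ETH_def by blast
  let ?d = "CARD('d)"
  have d: "2 \<le> ?d" and d1: "0 < real (?d - 1)" using assms(1) by auto
  \<comment> \<open>alpha is chosen such that 1 + (d-1) alpha lies between \<delta>' and \<delta>: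
    above \<delta>' for the running time, below \<delta> for the dimension of the inputs.\<close>
  have "(\<delta> - 1) / real (?d - 1) \<le> 1" using assms(1,4) d1 by (simp add: divide_le_eq of_nat_diff)
  with rational_exponent[of "(\<delta>' - 1) / real (?d - 1)" "(\<delta> - 1) / real (?d - 1)"]
  obtain p q where frac: "1 \<le> p" "p < q" "(\<delta>' - 1) / real (?d - 1) < real p / real q"
    "real p / real q < (\<delta> - 1) / real (?d - 1)"
    using assms(2,3) d1 by (auto simp: divide_strict_right_mono)
  interpret cantor p q using frac(1,2) by unfold_locales
  have \<delta>0: "\<delta>' \<le> 1 + real (?d - 1) * alpha" "1 + real (?d - 1) * alpha \<le> \<delta>"
    using frac(3,4) d1 unfolding alpha_def[symmetric] by (simp_all add: field_simps)
  have "fractal_dim (Pow (cross :: (real ^ 'd) set)) \<le> ereal \<delta>"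
    using fractal_dim_cross \<delta>0(2) by (meson ereal_less_eq(3) order_trans)
  with assms(5) obtain f :: "nat \<Rightarrow> nat" and g c where
    g: "g \<in> o(\<lambda>k. real k powr (1 - 1 / \<delta>'))" and
    alg: "\<And>k. \<exists>M. finds_balls M k (Pow (cross :: (real ^ 'd) set)) (\<lambda>n len. real (f k) * real n powr g k * real len ^ c)"
    by blast
  obtain E' where E': "\<And>prm c h. FP h \<Longrightarrow> \<exists>M K. turing_machine M \<and> (\<forall>w. Blank \<notin> set w \<longrightarrow>
      (\<exists>t \<le> K * (length w + 2) ^ K * 2 ^ (h w * E').
         halts_with M w t [if decide ?d (prm, c * 2 ^ h w, w) then One else Zero]))"
    using padded_machine[OF FP_decide] by blast
  \<comment> \<open>Padding of order 2^(N/qq) costs time 2^(E' N/qq) up to polynomial factors, which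
    has to stay below 2^(\<sigma> N).\<close>
  obtain qq :: nat where qq: "real E' / \<sigma> < real qq" using reals_Archimedean2 by blast
  then have qq1: "1 \<le> qq" using \<sigma>(1) by (cases qq) (auto simp: divide_less_0_iff)
  obtain \<theta> Cf where \<theta>: "1 \<le> \<theta>" and Cf: "\<And>N K i. well (vlits N) K \<Longrightarrow> i \<le> N * (4 * \<theta> + 1) + 1 \<Longrightarrow>
    real (sz ((spread \<theta> ^^ i) [(K, 2 * N div \<theta>)])) \<le> Cf * 2 powr (real N / real qq)"
    using frontier_bound[OF qq1] by blast
  define Dg where "Dg = 2 * (\<theta> + 4 * \<theta> * \<theta>)"
  define \<beta> where "\<beta> = real (3 * (?d + 1) * Dg)"
  have "0 < 3 * (?d + 1) * Dg" using \<theta> by (simp add: Dg_def)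
  then have \<beta>: "0 < \<beta>" unfolding \<beta>_def by (simp only: of_nat_0_less_iff)
  \<comment> \<open>A line carries about \<beta> N/W bits. The grid must be so large that this
    number, times the exponent of the running time in 2^bits, is at most N/qq.\<close>
  have "0 < \<beta> * real qq" using \<beta> qq1 by simp
  from choose_scale[OF g assms(2) \<delta>0(1) d this, of "real (?d + 1) * real c + 2"]
  obtain m where m: "\<And>k. B ^ Suc m + 2 \<le> k \<Longrightarrow> k \<le> 2 * ?d * (A ^ m) ^ (?d - 1) * (B ^ Suc m + 2) \<Longrightarrow>
    \<beta> * real qq * (real ?d * \<bar>g k\<bar> + (real (?d + 1) * real c + 2)) \<le> real ((A ^ m) ^ (?d - 1))" by blast
  define E where "E = B ^ Suc m + 2"
  define W where "W = (A ^ m) ^ (?d - 1)"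
  define \<gamma> where "\<gamma> = real (3 * (?d + 1) * (Dg + (A ^ m) ^ ?d * card (types W)))"
  define cap where "cap = (\<lambda>N. capacity ?d Dg W ((A ^ m) ^ ?d) N)"
  obtain k where k: "E \<le> k" "k \<le> 2 * ?d * W * E" and red: "\<And>Mx T \<theta>. finds_balls Mx k (Pow cross :: (real ^ 'd) set set) T \<Longrightarrow> 1 \<le> \<theta> \<Longrightarrow> (\<exists>prm. \<forall>N0 \<phi> N b p.
      three_cnf N0 \<phi> \<longrightarrow> N = length (names (parse (enc_cnf \<phi>))) \<longrightarrow>
      b = capacity ?d (2 * (\<theta> + 4 * \<theta> * \<theta>)) W ((A ^ m) ^ ?d) N \<longrightarrow>
      (\<forall>i K. well (vlits N) K \<longrightarrow> i \<le> N * (4 * \<theta> + 1) + 1 \<longrightarrow> sz ((spread \<theta> ^^ i) [(K, 2 * N div \<theta>)]) \<le> p) \<longrightarrow>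
      (\<forall>i \<le> b. sz (bool_lists i) \<le> p) \<longrightarrow>
      (\<forall>nb len. 1 \<le> nb \<longrightarrow> nb \<le> k * (2 ^ b) ^ ?d \<longrightarrow>
        len \<le> nb * (?d * (2 * (q * (2 * 2 ^ b + ?d)) + E + 10) + 2) + 2 \<longrightarrow> T nb len \<le> real p) \<longrightarrow>
      (decide ?d (prm, p, enc_cnf \<phi>) \<longleftrightarrow> satisfiable \<phi>))"
    using reduction_exists[OF d, of m] unfolding E_def[symmetric] W_def[symmetric] by blast
  \<comment> \<open>The exponent with which 2^(bits per line) enters the costs; the summand 2 covers
    the list of all bit vectors, of size O((2^bits)^2).\<close>
  define e where "e = real ?d * \<bar>g k\<bar> + (real (?d + 1) * real c + 2)"
  have e: "2 \<le> e" "real ?d * \<bar>g k\<bar> + real (?d + 1) * real c \<le> e" by (simp_all add: e_def)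
  have W1: "1 \<le> W" using A2 by (simp add: W_def)
  have We: "\<beta> * real qq * e \<le> real W" using m[of k] k unfolding e_def E_def W_def by blast
  have cap: "real (cap N) * e \<le> real N / real qq + \<gamma> * e" for N
  proof -
    have "real (cap N) = \<beta> * real (N div W) + \<gamma>" by (simp add: cap_def capacity_def \<beta>_def \<gamma>_def)
    also have "\<dots> \<le> \<beta> * (real N / real W) + \<gamma>"
      using \<beta> of_nat_div_le_of_nat[of N W, where 'a = real] by (intro add_mono mult_left_mono) auto
    finally have "real (cap N) * e \<le> (\<beta> * (real N / real W) + \<gamma>) * e" using e(1) by (intro mult_right_mono) auto
    also have "\<dots> = real N * (\<beta> * e / real W) + \<gamma> * e" by (simp add: distrib_right)
    also have "\<beta> * e / real W \<le> 1 / real qq" using We W1 qq1 by (simp add: field_simps)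
    finally show ?thesis by (simp add: mult_left_mono)
  qed
  obtain Mx where Mx: "finds_balls Mx k (Pow (cross :: (real ^ 'd) set)) (\<lambda>n len. real (f k) * real n powr g k * real len ^ c)"
    using alg by blast
  from red[OF Mx \<theta>, folded Dg_def] obtain prm where prm: "\<And>N0 \<phi> N p. three_cnf N0 \<phi> \<Longrightarrow>
      N = length (names (parse (enc_cnf \<phi>))) \<Longrightarrow>
      (\<And>i K. well (vlits N) K \<Longrightarrow> i \<le> N * (4 * \<theta> + 1) + 1 \<Longrightarrow> sz ((spread \<theta> ^^ i) [(K, 2 * N div \<theta>)]) \<le> p) \<Longrightarrow>
      (\<And>i. i \<le> cap N \<Longrightarrow> sz (bool_lists i) \<le> p) \<Longrightarrow>
      (\<And>nb len. 1 \<le> nb \<Longrightarrow> nb \<le> k * (2 ^ cap N) ^ ?d \<Longrightarrow>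
        len \<le> nb * (?d * (2 * (q * (2 * 2 ^ cap N + ?d)) + E + 10) + 2) + 2 \<Longrightarrow>
        real (f k) * real nb powr g k * real len ^ c \<le> real p) \<Longrightarrow>
      decide ?d (prm, p, enc_cnf \<phi>) \<longleftrightarrow> satisfiable \<phi>"
    unfolding cap_def by blast
  define Ct where "Ct = real (f k) * real k powr \<bar>g k\<bar> * real (k * (?d * (2 * (q * (2 + ?d)) + E + 10) + 4)) ^ c"
  \<comment> \<open>One constant dominates the three demands on the padding: the frontier, the list
    of bit vectors and the simulated running time.\<close>
  define C where "C = \<bar>Cf\<bar> + (7 + Ct) * 2 powr (\<gamma> * e)"
  define c0 where "c0 = nat \<lceil>2 * C\<rceil>"
  have Ct: "0 \<le> Ct" by (simp add: Ct_def)
  have C: "Cf \<le> C" "7 * 2 powr (\<gamma> * e) \<le> C" "Ct * 2 powr (\<gamma> * e) \<le> C" "0 \<le> C"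
  proof -
    have "0 \<le> Ct * 2 powr (\<gamma> * e)" "0 \<le> 2 powr (\<gamma> * e)" using Ct by auto
    then show "Cf \<le> C" "7 * 2 powr (\<gamma> * e) \<le> C" "Ct * 2 powr (\<gamma> * e) \<le> C" "0 \<le> C"
      unfolding C_def distrib_right by linarith+
  qed
  have pad: "C * 2 powr (real N / real qq) \<le> real (c0 * 2 ^ (N div qq))" for N
  proof -
    have "C * 2 powr (real N / real qq) \<le> C * (2 * 2 ^ (N div qq))" using powr_div_le[OF qq1] C(4) by (rule mult_left_mono)
    also have "\<dots> = 2 * C * 2 ^ (N div qq)" by simp
    also have "2 * C \<le> real c0" unfolding c0_def using C(4) by (simp add: of_nat_ceiling)
    finally show ?thesis by simp
  qed
  have exp: "2 powr (real (cap N) * x) \<le> 2 powr (\<gamma> * e) * 2 powr (real N / real qq)" if "x \<le> e" for x N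
  proof -
    have "real (cap N) * x \<le> real (cap N) * e" using that by (intro mult_left_mono) auto
    also have "\<dots> \<le> \<gamma> * e + real N / real qq" using cap[of N] by simp
    finally show ?thesis by (simp add: powr_add[symmetric])
  qed
  \<comment> \<open>The padding is computed from the number of occurring variables, which the
    machine can determine from its input.\<close>
  define h where "h = (\<lambda>w. length (names (parse w)) div qq)"
  have correct: "decide ?d (prm, c0 * 2 ^ h (enc_cnf \<phi>), enc_cnf \<phi>) \<longleftrightarrow> satisfiable \<phi>" if \<phi>: "three_cnf N0 \<phi>" for N0 \<phi>
  proof -
    define N where "N = length (names (parse (enc_cnf \<phi>)))"
    have le: "x \<le> real (c0 * 2 ^ h (enc_cnf \<phi>))" if "x \<le> C' * 2 powr (real N / real qq)" "C' \<le> C" for x C'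
    proof -
      have "C' * 2 powr (real N / real qq) \<le> C * 2 powr (real N / real qq)" using that(2) by (rule mult_right_mono) simp
      then show ?thesis using that(1) pad[of N] unfolding h_def N_def by linarith
    qed
    show ?thesis
    proof (rule prm[OF \<phi> N_def])
      fix i K assume "well (vlits N) K" "i \<le> N * (4 * \<theta> + 1) + 1"
      from le[OF Cf[OF this] C(1)] show "sz ((spread \<theta> ^^ i) [(K, 2 * N div \<theta>)]) \<le> c0 * 2 ^ h (enc_cnf \<phi>)"
        by (simp only: of_nat_le_iff)
    next
      fix i assume "i \<le> cap N"
      from sz_bool_lists_le[OF this] have "real (sz (bool_lists i)) \<le> 7 * 2 powr (real (cap N) * 2)" .
      also have "\<dots> \<le> 7 * 2 powr (\<gamma> * e) * 2 powr (real N / real qq)" using exp[OF e(1)] by simp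
      finally have "real (sz (bool_lists i)) \<le> 7 * 2 powr (\<gamma> * e) * 2 powr (real N / real qq)" .
      from le[OF this C(2)] show "sz (bool_lists i) \<le> c0 * 2 ^ h (enc_cnf \<phi>)" by (simp only: of_nat_le_iff)
    next
      fix nb len :: nat
      assume "1 \<le> nb" "nb \<le> k * (2 ^ cap N) ^ ?d"
        "len \<le> nb * (?d * (2 * (q * (2 * 2 ^ cap N + ?d)) + E + 10) + 2) + 2"
      from ball_time_bound[OF this, of "f k" "g k" c]
      have "real (f k) * real nb powr g k * real len ^ c \<le>
        Ct * 2 powr (real (cap N) * (real ?d * \<bar>g k\<bar> + real (?d + 1) * real c))" by (simp only: Ct_def)
      also have "\<dots> \<le> Ct * (2 powr (\<gamma> * e) * 2 powr (real N / real qq))" using exp[OF e(2)] Ct by (rule mult_left_mono)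
      also have "\<dots> = Ct * 2 powr (\<gamma> * e) * 2 powr (real N / real qq)" by simp
      finally have "real (f k) * real nb powr g k * real len ^ c \<le> Ct * 2 powr (\<gamma> * e) * 2 powr (real N / real qq)" .
      from le[OF this C(3)] show "real (f k) * real nb powr g k * real len ^ c \<le> real (c0 * 2 ^ h (enc_cnf \<phi>))" .
    qed
  qed
  have "FP h" unfolding h_def by (intro fp)
  from E'[OF this, of prm c0] obtain M K where M: "turing_machine M"
    "\<And>w. Blank \<notin> set w \<Longrightarrow> \<exists>t \<le> K * (length w + 2) ^ K * 2 ^ (h w * E').
         halts_with M w t [if decide ?d (prm, c0 * 2 ^ h w, w) then One else Zero]" by blast
  define T where "T = (\<lambda>N. K * (52 * (N + 2) ^ 4) ^ K * 2 ^ (N div qq * E'))"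
  have "solves_3sat M T"
    unfolding solves_3sat_def
  proof (intro conjI allI impI)
    fix N \<phi> assume \<phi>: "three_cnf N \<phi>"
    obtain t where t: "t \<le> K * (length (enc_cnf \<phi>) + 2) ^ K * 2 ^ (h (enc_cnf \<phi>) * E')"
      "halts_with M (enc_cnf \<phi>) t [if decide ?d (prm, c0 * 2 ^ h (enc_cnf \<phi>), enc_cnf \<phi>) then One else Zero]"
      using M(2)[OF Blank_enc_cnf] by blast
    have hN: "h (enc_cnf \<phi>) * E' \<le> N div qq * E'" unfolding h_def by (intro mult_right_mono div_le_mono normalized_cnf(2)[OF \<phi>]) simp
    have "K * (length (enc_cnf \<phi>) + 2) ^ K * 2 ^ (h (enc_cnf \<phi>) * E') \<le> T N"
      unfolding T_def by (intro mult_le_mono power_mono power_increasing hN length_enc_cnf[OF \<phi>]) auto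
    then show "\<exists>t \<le> T N. halts_with M (enc_cnf \<phi>) t [if satisfiable \<phi> then One else Zero]"
      using t correct[OF \<phi>] by (intro exI[of _ t]) simp
  qed (rule M(1))
  moreover have "(\<lambda>N. real (T N)) \<in> O(\<lambda>N. 2 powr (\<sigma> * real N))"
  proof -
    \<comment> \<open>The strict inequality leaves an exponential factor that absorbs the polynomial
      one.\<close>
    have "real E' / real qq < \<sigma>" using qq \<sigma>(1) qq1 by (simp add: field_simps)
    then have "0 < \<sigma> - real E' / real qq" by simp
    from poly_le_exp[OF this, of "4 * K"] obtain C' where C': "C' > 0"
      "\<And>N. real (N + 2) ^ (4 * K) \<le> C' * 2 powr ((\<sigma> - real E' / real qq) * real N)" by blast
    show ?thesis
    proof (rule bigoI[of _ "real K * 52 ^ K * C'"], rule always_eventually, rule allI)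
      fix N
      have "real (2 ^ (N div qq * E')) = 2 powr (real (N div qq) * real E')" by (simp add: powr_realpow[symmetric])
      also have "\<dots> \<le> 2 powr (real N / real qq * real E')"
        by (intro powr_mono mult_right_mono of_nat_div_le_of_nat) auto
      finally have 1: "real (2 ^ (N div qq * E')) \<le> 2 powr (real N / real qq * real E')" .
      have "real (T N) = real K * 52 ^ K * real (N + 2) ^ (4 * K) * real (2 ^ (N div qq * E'))"
        by (simp add: T_def power_mult_distrib power_mult)
      also have "\<dots> \<le> real K * 52 ^ K * (C' * 2 powr ((\<sigma> - real E' / real qq) * real N)) * 2 powr (real N / real qq * real E')"
        using 1 C' by (intro mult_mono mult_left_mono) auto
      also have "\<dots> = real K * 52 ^ K * C' * (2 powr ((\<sigma> - real E' / real qq) * real N) * 2 powr (real N / real qq * real E'))"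
        by simp
      also have "2 powr ((\<sigma> - real E' / real qq) * real N) * 2 powr (real N / real qq * real E') = 2 powr (\<sigma> * real N)"
        by (simp add: powr_add[symmetric] algebra_simps)
      finally show "norm (real (T N)) \<le> real K * 52 ^ K * C' * norm (2 powr (\<sigma> * real N))" by simp
    qed
  qed
  ultimately show False using \<sigma>(2) by blast
qed

end
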